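(* The cubic lattice stick index of the link $4_1^2$ is $13$; that is, $s_{CL}[4_1^2]=13$.
   Context: The cubic lattice is the subset $(\mathbb{R}\times\mathbb{Z}\times\mathbb{Z})\cup(\mathbb{Z}\times\mathbb{R}\times\mathbb{Z})\cup(\mathbb{Z}\times\mathbb{Z}\times\mathbb{R})$ of $\mathbb{R}^3$. A lattice stick conformation is a polygonal link $L$ contained in the cubic lattice (with vertices at points of $\mathbb{Z}^3$); $[L]$ denotes its link type. A stick of $L$ is a maximal line segment contained in $L$ (of any length). $s_{CL}(L)$ is the number of sticks of $L$, and the cubic lattice stick index $s_{CL}[L]$ is the minimum of $s_{CL}(L')$ over all lattice stick conformations $L'$ of the link type $[L]$. $4_1^2$ (Rolfsen table notation) is the two-component two-braid link with four crossings, i.e. the $(2,4)$-torus link, of linking number $2$. *)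

theory Defs
  imports "HOL-Analysis.Analysis"
begin

definition integer_points :: "(real ^ 3) set" where
  "integer_points = {x. \<forall>i. x $ i \<in> \<int>}"

(* The coordinate i is the unrestricted one. *)
definition cubic_lattice :: "(real ^ 3) set" where
  "cubic_lattice = {x. \<exists>i. \<forall>j. j \<noteq> i \<longrightarrow> x $ j \<in> \<int>}"

(* A polygon is given by its cyclic list of vertices. *)
definition edge :: "(real ^ 3) list \<Rightarrow> nat \<Rightarrow> (real ^ 3) set" where
  "edge vs i = closed_segment (vs ! i) (vs ! (Suc i mod length vs))"

definition edge_ends :: "(real ^ 3) list \<Rightarrow> nat \<Rightarrow> (real ^ 3) set" where
  "edge_ends vs i = {vs ! i, vs ! (Suc i mod length vs)}"

definition polygon :: "(real ^ 3) list \<Rightarrow> (real ^ 3) set" where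
  "polygon vs = (\<Union>i<length vs. edge vs i)"

(* Two distinct edges meet at most in a common endpoint. A straight angle at a
   vertex is allowed; sticks are defined below without reference to the vertices. *)
definition simple_polygon :: "(real ^ 3) list \<Rightarrow> bool" where
  "simple_polygon vs \<longleftrightarrow> length vs \<ge> 3 \<and> distinct vs \<and>
     (\<forall>i<length vs. \<forall>j<length vs. i \<noteq> j \<longrightarrow>
        edge vs i \<inter> edge vs j = edge_ends vs i \<inter> edge_ends vs j)"

definition polygonal_link :: "(real ^ 3) list set \<Rightarrow> bool" where
  "polygonal_link P \<longleftrightarrow> finite P \<and> P \<noteq> {} \<and> (\<forall>vs\<in>P. simple_polygon vs) \<and>
     pairwise (\<lambda>vs ws. disjnt (polygon vs) (polygon ws)) P"

definition lattice_stick_conformation :: "(real ^ 3) set \<Rightarrow> bool" where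
  "lattice_stick_conformation L \<longleftrightarrow>
     (\<exists>P. polygonal_link P \<and> (\<forall>vs\<in>P. set vs \<subseteq> integer_points) \<and>
          L = (\<Union>vs\<in>P. polygon vs)) \<and>
     L \<subseteq> cubic_lattice"

definition line_segment :: "(real ^ 3) set \<Rightarrow> bool" where
  "line_segment S \<longleftrightarrow> (\<exists>a b. a \<noteq> b \<and> S = closed_segment a b)"

definition sticks :: "(real ^ 3) set \<Rightarrow> (real ^ 3) set set" where
  "sticks L = {S. line_segment S \<and> S \<subseteq> L \<and>
     (\<forall>T. line_segment T \<and> S \<subseteq> T \<and> T \<subseteq> L \<longrightarrow> T = S)}"

definition stick_number :: "(real ^ 3) set \<Rightarrow> nat" where
  "stick_number L = card (sticks L)"

(* There is a homotopy through self-homeomorphisms of the space from the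
   identity to a homeomorphism taking A onto B. *)
definition ambient_isotopic :: "(real ^ 3) set \<Rightarrow> (real ^ 3) set \<Rightarrow> bool" where
  "ambient_isotopic A B \<longleftrightarrow>
     (\<exists>f. homotopic_with_canon (\<lambda>h. \<exists>g. homeomorphism UNIV UNIV h g) UNIV UNIV id f \<and>
          f ` A = B)"

(* Link types are unoriented. *)
definition link_type :: "(real ^ 3) set \<Rightarrow> (real ^ 3) set set" where
  "link_type L = {L'. ambient_isotopic L L'}"

(* The infimum is taken in enat: it is infinite if T contains no lattice stick
   conformation, and a finite value is attained, so that it is a minimum. *)
definition cubic_lattice_stick_index :: "(real ^ 3) set set \<Rightarrow> enat" where
  "cubic_lattice_stick_index T =
     (INF L\<in>{L \<in> T. lattice_stick_conformation L}. enat (stick_number L))"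

(* Point of the standard torus with longitude angle u and meridian angle v. *)
definition torus_point :: "real \<Rightarrow> real \<Rightarrow> real ^ 3" where
  "torus_point u v = vector [(2 + cos v) * cos u, (2 + cos v) * sin u, - sin v]"

(* The (p,q)-torus link: the closed p-strand braid around the vertical axis which
   winds q times in the meridian direction. It has gcd p q components. The sign of
   the third coordinate in torus_point makes it right-handed for p, q > 0, so that
   the two components of torus_link 2 4, oriented by increasing u, have linking
   number +2. *)
definition torus_link :: "nat \<Rightarrow> nat \<Rightarrow> (real ^ 3) set" where
  "torus_link p q =
     {torus_point u v | u v. \<exists>k::int. real p * v - real q * u = 2 * pi * of_int k}"

definition link_4_1_2 :: "(real ^ 3) set" where
  "link_4_1_2 = torus_link 2 4"

end

theory Submission
  imports Defs "HOL-Complex_Analysis.Complex_Analysis"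
begin

text \<open>
  Lower bound. Each point \<open>w\<close> of space has a spinor, and the trace of the product of the Hermitian rank one matrices
  belonging to \<open>v - b\<close>, where \<open>v\<close> runs through the vertices of a closed polygon, is nonzero unless \<open>b\<close> lies on the
  polygon. Its winding number as \<open>b\<close> runs through a second loop is the linking number. Inserting points on the edges of
  the polygon multiplies the trace by positive numbers, so the absolute value is invariant under ambient isotopy; it is
  \<open>2\<close> for \<open>4_1^2\<close>, for both orders of the components, because a quarter turn exchanges them. The sticks of a
  two-component conformation are the edges of its reduced polygons. If there are at most \<open>12\<close>, then one component has
  four edges or both have six. The trace of a rectangle counts the crossings of the second component through it, and
  a hexagon is a product of two or three rectangles; counting the edges of the second component that can cross bounds
  the linking number by \<open>1\<close> for one of the orders.

  Upper bound. Shears make an explicit conformation star-shaped about the vertical axis. Then a move in the radial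
  direction followed by a move in the vertical direction takes the torus link to it: along each line the move is
  affine (in the logarithm of the radius, respectively the height), with coefficients supplied by Tietze's theorem.
\<close>

section \<open>Spinor chains\<close>

text \<open>The argument of the trace is, up to sign, half the solid angle under which the polygon
  is seen from \<open>b\<close>: the cyclic product of inner products of spinors carries the phase
  of a spherical polygon. The total solid angle is 4 \<pi>, so each passage through the polygon
  turns the trace once. This gives a linking number without a spanning surface or a projection,
  continuous in all vertices at once. An isotopy does not keep polygons polygonal, so invariance is
  proved for fine polygons inscribed in the moving curve.

  The obstacle to the bound is that counting alone gives, for a rectangle, only that four times the
  linking number is at most the number of edges. The splittings 4 + 8 and 6 + 6 of twelve sticks
  just escape this: eight edges could cross twice, and several rectangles with bound 1 each could
  add up. The former is excluded because the second polygon would meet itself. The latter is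
  excluded because a hexagon on a box cannot pass in the same sense through two adjacent faces, or,
  for a planar hexagon, because its two rectangles act as a single window. The value 13 is attained
  as 4 + 9.\<close>

text \<open>\<open>spin_act w\<close> is the positive semidefinite Hermitian matrix \<open>|w| I + w \<cdot> \<sigma>\<close> of rank at most one,
  with the Pauli matrices \<open>\<sigma>\<close>; it is \<open>s s\<^sup>*\<close> for the vector \<open>s = spinor w\<close>. The trace of a product of such
  matrices vanishes only if two cyclically consecutive vectors are antiparallel or one of them is zero.\<close>

definition spin_act :: "real^3 \<Rightarrow> complex \<times> complex \<Rightarrow> complex \<times> complex" where
  "spin_act w v =
    (of_real (norm w + w$3) * fst v + Complex (w$1) (- (w$2)) * snd v,
     Complex (w$1) (w$2) * fst v + of_real (norm w - w$3) * snd v)"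

definition spin_trace :: "(real^3) list \<Rightarrow> complex" where
  "spin_trace ws = fst (foldr spin_act ws (1,0)) + snd (foldr spin_act ws (0,1))"

definition spinor :: "real^3 \<Rightarrow> complex \<times> complex" where
  "spinor w = (if norm w + w$3 = 0 then (0, of_real (sqrt (2 * norm w)))
     else (of_real (sqrt (norm w + w$3)), Complex (w$1) (w$2) / of_real (sqrt (norm w + w$3))))"

definition herm :: "complex \<times> complex \<Rightarrow> complex \<times> complex \<Rightarrow> complex" where
  "herm u v = cnj (fst u) * fst v + cnj (snd u) * snd v"

fun hchain :: "(real^3) list \<Rightarrow> complex" where
  "hchain (u # v # ws) = herm (spinor u) (spinor v) * hchain (v # ws)"
| "hchain ws = 1"

lemma norm_sq_3: "(norm (w::real^3))\<^sup>2 = (w$1)\<^sup>2 + (w$2)\<^sup>2 + (w$3)\<^sup>2"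
  unfolding power2_norm_eq_inner by (simp add: inner_vec_def sum_3 power2_eq_square)

lemma inner_3: "(v::real^3) \<bullet> w = v$1 * w$1 + v$2 * w$2 + v$3 * w$3"
  by (simp add: inner_vec_def sum_3)

lemma norm_ge_3: "norm (w::real^3) + w$3 \<ge> 0"
  using component_le_norm_cart[of w 3] by linarith

lemma spin_act_spinor:
  "spin_act w v = (fst (spinor w) * herm (spinor w) v, snd (spinor w) * herm (spinor w) v)"
proof (cases "norm w + w$3 = 0")
  case True
  then have z: "w$3 = - norm w" by simp
  then have "(w$1)\<^sup>2 + (w$2)\<^sup>2 = 0" using norm_sq_3[of w] by simp
  then have xy: "w$1 = 0" "w$2 = 0" by (simp_all add: sum_power2_eq_zero_iff)
  have "complex_of_real (sqrt (2 * norm w)) * complex_of_real (sqrt (2 * norm w)) = of_real (2 * norm w)"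
    by (metis mult_nonneg_nonneg norm_ge_zero of_real_mult real_sqrt_mult_self abs_of_nonneg zero_le_numeral)
  then show ?thesis using z xy
    by (simp add: spin_act_def spinor_def herm_def complex_eq_iff algebra_simps)
next
  case False
  define s where "s = sqrt (norm w + w$3)"
  have s: "s > 0" "s\<^sup>2 = norm w + w$3" using False norm_ge_3[of w] by (auto simp: s_def)
  \<comment> \<open>This is the vanishing determinant of the matrix; it allows the second diagonal
    entry to be written as a quotient by \<open>s\<^sup>2\<close>.\<close>
  have xy: "(w$1)\<^sup>2 + (w$2)\<^sup>2 = s\<^sup>2 * (norm w - w$3)"
    unfolding s using norm_sq_3[of w] by (simp add: algebra_simps power2_eq_square)
  have sp: "spinor w = (of_real s, Complex (w$1) (w$2) / of_real s)"
    using False by (simp add: spinor_def s_def)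
  have m: "norm w + w$3 = s\<^sup>2" using s by simp
  have n: "of_real (norm w - w$3) = (Complex (w$1) (w$2) * cnj (Complex (w$1) (w$2)) / (of_real s)\<^sup>2)"
  proof -
    have "Complex (w$1) (w$2) * cnj (Complex (w$1) (w$2)) = of_real (s\<^sup>2 * (norm w - w$3))"
      unfolding xy[symmetric] by (simp add: complex_eq_iff power2_eq_square)
    then show ?thesis using s(1) by simp
  qed
  have c: "Complex (w$1) (- (w$2)) = cnj (Complex (w$1) (w$2))" by (simp add: complex_eq_iff)
  show ?thesis
    unfolding spin_act_def sp herm_def m n c using s(1)
    by (simp add: field_simps power2_eq_square)
qed

lemma herm_commute: "herm v u = cnj (herm u v)"
  by (simp add: herm_def algebra_simps)

lemma hchain_append: "hchain (xs @ u # ys) = hchain (xs @ [u]) * hchain (u # ys)"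
proof (induction xs)
  case (Cons a xs) then show ?case by (cases xs) auto
qed simp

text \<open>A product of rank one matrices is the outer product of its first and last vectors,
  scaled by the inner products in between.\<close>

lemma foldr_spin_act:
  "foldr spin_act (u # ws) v = (let c = hchain (u # ws) * herm (spinor (last (u # ws))) v in
      (fst (spinor u) * c, snd (spinor u) * c))"
proof (induction ws arbitrary: u)
  case Nil then show ?case by (simp add: spin_act_spinor Let_def)
next
  case (Cons a ws)
  define c where "c = hchain (a # ws) * herm (spinor (last (a # ws))) v"
  have "foldr spin_act (u # a # ws) v = spin_act u (foldr spin_act (a # ws) v)" by simp
  also have "\<dots> = spin_act u (fst (spinor a) * c, snd (spinor a) * c)"
    by (simp only: Cons.IH[of a] Let_def c_def)
  also have "\<dots> = (fst (spinor u) * (herm (spinor u) (spinor a) * c), snd (spinor u) * (herm (spinor u) (spinor a) * c))"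
    by (simp add: spin_act_spinor herm_def algebra_simps)
  finally show ?case by (simp add: c_def Let_def mult.assoc)
qed

text \<open>The trace of an outer product is the one missing inner product, from the last vector
  back to the first; repeating \<open>u\<close> at the end of the chain supplies it.\<close>

lemma spin_trace_hchain: "spin_trace (u # ws) = hchain (u # ws @ [u])"
proof -
  have e: "u # ws = butlast (u # ws) @ [last (u # ws)]" by simp
  have "hchain (u # ws @ [u]) = hchain ((u # ws) @ [u])" by simp
  also have "\<dots> = hchain (butlast (u # ws) @ last (u # ws) # [u])"
    by (metis append.assoc append_Cons append_Nil e)
  also have "\<dots> = hchain (u # ws) * herm (spinor (last (u # ws))) (spinor u)"
    by (subst hchain_append) (simp flip: e)
  finally have 1: "hchain (u # ws @ [u]) = hchain (u # ws) * herm (spinor (last (u # ws))) (spinor u)" .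
  show ?thesis unfolding 1 spin_trace_def foldr_spin_act Let_def
    by (simp add: herm_def algebra_simps)
qed

text \<open>The squared modulus is the trace of the product of the two matrices, which
  \<open>spin_act\<close> computes without the case distinction in \<open>spinor\<close>.\<close>

lemma herm_spinor_sq: "(cmod (herm (spinor v) (spinor w)))\<^sup>2 = 2 * (norm v * norm w + v \<bullet> w)"
proof -
  have "complex_of_real ((cmod (herm (spinor v) (spinor w)))\<^sup>2) = spin_trace [v, w]"
    by (simp add: spin_trace_hchain herm_commute[of "spinor w" "spinor v"] del: of_real_power)
       (rule complex_norm_square)
  also have "\<dots> = of_real (2 * (norm v * norm w + v \<bullet> w))"
    by (simp add: spin_trace_def spin_act_def inner_3 complex_eq_iff algebra_simps)
  finally show ?thesis using of_real_eq_iff by blast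
qed

text \<open>A zero means equality in the Cauchy-Schwarz inequality for \<open>v\<close> and
  \<open>- w\<close>. Then the segment passes through the origin, at the parameter \<open>t\<close>
  that divides it in the ratio of the norms.\<close>

lemma herm_spinor_nonzero:
  assumes "0 \<notin> closed_segment v w"
  shows "herm (spinor v) (spinor w) \<noteq> 0"
proof
  assume "herm (spinor v) (spinor w) = 0"
  then have 0: "norm v * norm w + v \<bullet> w = 0" using herm_spinor_sq[of v w] by simp
  have nz: "v \<noteq> 0" "w \<noteq> 0" using assms by auto
  have "v \<bullet> (-w) = norm v * norm (-w)" using 0 by simp
  then have eq: "norm v *\<^sub>R (-w) = norm w *\<^sub>R v" using norm_cauchy_schwarz_eq[of v "-w"] by simp
  define t where "t = norm v / (norm v + norm w)"
  have p: "norm v + norm w > 0" using nz by (simp add: add_pos_pos)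
  have t: "0 \<le> t" "t \<le> 1" using p by (auto simp: t_def)
  have s1: "1 - t = norm w / (norm v + norm w)" using p by (simp add: t_def field_simps)
  have "(1 - t) *\<^sub>R v + t *\<^sub>R w = (1 / (norm v + norm w)) *\<^sub>R (norm w *\<^sub>R v + norm v *\<^sub>R w)"
    by (simp only: s1) (simp add: t_def scaleR_add_right)
  also have "\<dots> = 0" using eq by (metis add.commute neg_eq_iff_add_eq_0 scaleR_minus_right scaleR_zero_right)
  finally show False using assms t by (force simp: closed_segment_def)
qed

section \<open>Positive factors and the subdivision of edges\<close>

definition pos_mult :: "complex \<Rightarrow> complex \<Rightarrow> bool" where
  "pos_mult x y \<longleftrightarrow> (\<exists>k>0. x = of_real k * y)"

lemma pos_mult_refl [simp]: "pos_mult x x"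
  unfolding pos_mult_def by (rule exI[of _ 1]) simp

lemma pos_mult_trans: "pos_mult x y \<Longrightarrow> pos_mult y z \<Longrightarrow> pos_mult x z"
  unfolding pos_mult_def by (metis mult.assoc mult_pos_pos of_real_mult)

lemma pos_mult_sym: "pos_mult x y \<Longrightarrow> pos_mult y x"
  unfolding pos_mult_def
proof clarify
  fix k :: real assume "0 < k"
  then show "\<exists>k'>0. y = of_real k' * (of_real k * y)" by (intro exI[of _ "1/k"]) simp
qed

lemma pos_mult_mult: "pos_mult a b \<Longrightarrow> pos_mult c d \<Longrightarrow> pos_mult (a * c) (b * d)"
  unfolding pos_mult_def
proof clarify
  fix k l :: real assume "0 < k" "0 < l"
  then show "\<exists>m>0. of_real k * b * (of_real l * d) = of_real m * (b * d)"
    by (intro exI[of _ "k*l"]) simp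
qed

text \<open>Apart from the term with \<open>norm w\<close>, the matrix of \<open>w\<close> is linear
  in \<open>w\<close>. So for a point of the segment it is the corresponding combination of the
  matrices of \<open>u\<close> and \<open>v\<close> plus a multiple of the identity. The spinors of
  \<open>u\<close> and \<open>v\<close> are eigenvectors of their own matrices with eigenvalues
  \<open>2 * norm u\<close> and \<open>2 * norm v\<close>, which leaves the positive factor
  \<open>?k\<close>.\<close>

lemma hchain_subdivide:
  assumes "w \<in> closed_segment u v" "0 \<notin> closed_segment u v"
  shows "pos_mult (herm (spinor u) (spinor w) * herm (spinor w) (spinor v)) (herm (spinor u) (spinor v))"
proof -
  obtain t where t: "0 \<le> t" "t \<le> 1" "w = (1 - t) *\<^sub>R u + t *\<^sub>R v"
    using assms(1) by (auto simp: closed_segment_def)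
  let ?k = "norm w + (1 - t) * norm u + t * norm v"
  have w: "w \<noteq> 0" using assms by auto
  then have k: "?k > 0" using t by (simp add: add_pos_nonneg)
  have aff: "spin_act w x = (let p = spin_act u x; q = spin_act v x; c = norm w - (1-t) * norm u - t * norm v in
      (of_real (1-t) * fst p + of_real t * fst q + of_real c * fst x,
       of_real (1-t) * snd p + of_real t * snd q + of_real c * snd x))" for x
    unfolding spin_act_def Let_def t(3) by (simp add: complex_eq_iff algebra_simps)
  have self: "herm (spinor x) (spinor x) = of_real (2 * norm x)" for x
  proof -
    have "herm (spinor x) (spinor x) = spin_trace [x]" by (simp add: spin_trace_hchain)
    also have "\<dots> = of_real (2 * norm x)" by (simp add: spin_trace_def spin_act_def complex_eq_iff)
    finally show ?thesis .
  qed
  have h1: "herm (spinor u) (spin_act w x) = herm (spinor u) (spinor w) * herm (spinor w) x" for x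
    by (simp add: spin_act_spinor herm_def algebra_simps)
  have h2: "herm (spinor u) (spin_act u x) = of_real (2 * norm u) * herm (spinor u) x" for x
    unfolding self[symmetric] by (simp add: spin_act_spinor herm_def algebra_simps)
  have h3: "spin_act v (spinor v) = (of_real (2 * norm v) * fst (spinor v), of_real (2 * norm v) * snd (spinor v))"
    unfolding self[symmetric] by (simp add: spin_act_spinor herm_def algebra_simps)
  let ?c = "norm w - (1-t) * norm u - t * norm v"
  have "herm (spinor u) (spinor w) * herm (spinor w) (spinor v) = herm (spinor u) (spin_act w (spinor v))"
    by (simp add: h1)
  also have "\<dots> = of_real (1-t) * herm (spinor u) (spin_act u (spinor v))
        + of_real t * herm (spinor u) (spin_act v (spinor v)) + of_real ?c * herm (spinor u) (spinor v)"
    unfolding aff Let_def herm_def fst_conv snd_conv by (simp only: algebra_simps)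
  also have "\<dots> = of_real ?k * herm (spinor u) (spinor v)"
    unfolding h2 h3 by (simp add: herm_def algebra_simps)
  finally show ?thesis using k by (auto simp: pos_mult_def)
qed

fun csegs :: "(real^3) list \<Rightarrow> (real^3) set" where
  "csegs (u # v # ws) = closed_segment u v \<union> csegs (v # ws)"
| "csegs ws = {}"

lemma hchain_nonzero: "0 \<notin> csegs ws \<Longrightarrow> hchain ws \<noteq> 0"
  by (induction ws rule: hchain.induct) (auto simp: herm_spinor_nonzero)

lemma continuous_on_spin_trace:
  assumes "\<And>v. v \<in> set vs \<Longrightarrow> continuous_on S (\<lambda>x. f v x)"
  shows "continuous_on S (\<lambda>x. spin_trace (map (\<lambda>v. f v x) vs))"
proof -
  have cC: "continuous_on S (\<lambda>x. Complex (g x) (h x))" if "continuous_on S g" "continuous_on S h" for g h :: "_ \<Rightarrow> real"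
    unfolding Complex_eq using that by (intro continuous_intros)
  have "continuous_on S (\<lambda>x. fst (foldr spin_act (map (\<lambda>v. f v x) vs) p)) \<and>
        continuous_on S (\<lambda>x. snd (foldr spin_act (map (\<lambda>v. f v x) vs) p))" for p
    using assms
  proof (induction vs)
    case (Cons a vs)
    have a: "continuous_on S (f a)" using Cons.prems by simp
    show ?case using Cons a
      by (auto simp: spin_act_def intro!: continuous_intros cC)
  qed auto
  note * = this
  show ?thesis unfolding spin_trace_def
    by (intro continuous_on_add conjunct1[OF *] conjunct2[OF *])
qed

section \<open>The linking invariant of a polygon and a loop\<close>

text \<open>Up to sign, this is the linking number of the closed polygon with vertices \<open>vs\<close> and the loop \<open>b\<close>.\<close>

definition spin_link :: "(real^3) list \<Rightarrow> (real \<Rightarrow> real^3) \<Rightarrow> complex" where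
  "spin_link vs b = winding_number (\<lambda>s. spin_trace (map (\<lambda>v. v - b s) vs)) 0"

text \<open>The points k / 2^M of the unit interval in increasing order, the inner ones twice. The
  recursion follows \<open>+++\<close>, so that a sample of a joined path is the concatenation of
  samples of its two halves; a repeated point only contributes a positive factor to the
  trace.\<close>

fun dyad :: "nat \<Rightarrow> real list" where
  "dyad 0 = [0, 1]"
| "dyad (Suc M) = map (\<lambda>s. s / 2) (dyad M) @ map (\<lambda>s. (1 + s) / 2) (dyad M)"

fun ppath :: "(real^3) list \<Rightarrow> real \<Rightarrow> real^3" where
  "ppath (u # v # w # ws) = linepath u v +++ ppath (v # w # ws)"
| "ppath [u, v] = linepath u v"
| "ppath [u] = linepath u u"
| "ppath [] = linepath 0 0"

lemma dyad_nonempty [simp]: "dyad M \<noteq> []"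
  by (induction M) auto

lemma hd_dyad [simp]: "hd (dyad M) = 0"
  by (induction M) (auto simp: hd_map)

lemma last_dyad [simp]: "last (dyad M) = 1"
  by (induction M) (auto simp: last_map)

lemma set_dyad: "set (dyad M) \<subseteq> {0..1}"
  by (induction M) (auto simp: subset_iff)

lemma dyad_step: "successively (\<lambda>s t. s \<le> t \<and> t \<le> s + 1 / 2^M) (dyad M)"
proof (induction M)
  case (Suc M)
  have 1: "successively (\<lambda>s t. s \<le> t \<and> t \<le> s + 1 / 2^Suc M) (map (\<lambda>s. s / 2) (dyad M))"
    unfolding successively_map using Suc by (rule successively_mono) (auto simp: field_simps)
  have 2: "successively (\<lambda>s t. s \<le> t \<and> t \<le> s + 1 / 2^Suc M) (map (\<lambda>s. (1 + s) / 2) (dyad M))"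
    unfolding successively_map using Suc by (rule successively_mono) (auto simp: field_simps)
  show ?case using 1 2 by (simp add: successively_append_iff last_map hd_map)
qed simp

lemma rev_dyad: "rev (dyad M) = map (\<lambda>s. 1 - s) (dyad M)"
proof (induction M)
  case (Suc M)
  then show ?case by (simp add: rev_map o_def field_simps)
qed simp

lemma csegs_shift: "0 \<in> csegs (map (\<lambda>v. v - p) xs) \<longleftrightarrow> p \<in> csegs xs"
proof (induction xs rule: csegs.induct)
  case (1 u v ws)
  have "0 \<in> closed_segment (u - p) (v - p) \<longleftrightarrow> p \<in> closed_segment u v"
    using closed_segment_translation_eq[of "-p" p u v] by simp
  then show ?case using 1 by simp
qed auto

lemma hchain_join:
  "xs \<noteq> [] \<Longrightarrow> ys \<noteq> [] \<Longrightarrow>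
   hchain (xs @ ys) = hchain xs * herm (spinor (last xs)) (spinor (hd ys)) * hchain ys"
proof (induction xs rule: hchain.induct)
  case ("2_2" v) then show ?case by (cases ys) auto
qed auto

lemma spin_trace_alt: "ws \<noteq> [] \<Longrightarrow> spin_trace ws = hchain ws * herm (spinor (last ws)) (spinor (hd ws))"
  by (cases ws) (auto simp: spin_trace_hchain hchain_join[of "_ # _" "[_]", simplified])

lemma spin_trace_nonzero:
  assumes "vs \<noteq> []" "p \<notin> csegs (vs @ [hd vs])"
  shows "spin_trace (map (\<lambda>v. v - p) vs) \<noteq> 0"
proof -
  obtain u us where [simp]: "vs = u # us" using assms(1) by (cases vs) auto
  have "spin_trace (map (\<lambda>v. v - p) vs) = hchain (map (\<lambda>v. v - p) (vs @ [hd vs]))"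
    by (simp add: spin_trace_hchain)
  then show ?thesis using hchain_nonzero csegs_shift assms(2) by metis
qed

lemma hchain_rev: "hchain (rev ws) = cnj (hchain ws)"
proof (induction ws rule: hchain.induct)
  case (1 u v ws)
  have "hchain (rev (u # v # ws)) = hchain (rev (v # ws) @ [u])" by simp
  also have "\<dots> = hchain (rev (v # ws)) * herm (spinor v) (spinor u)"
    by (subst hchain_join) (auto simp: last_rev)
  finally show ?case using 1 by (simp add: herm_commute[of "spinor v" "spinor u"])
qed auto

lemma spin_trace_rev: "spin_trace (rev ws) = cnj (spin_trace ws)"
proof (cases "ws = []")
  case False
  then show ?thesis
    by (simp add: spin_trace_alt hchain_rev last_rev hd_rev herm_commute[of "spinor (hd ws)" "spinor (last ws)"])
qed (simp add: spin_trace_def)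

lemma herm_self: "herm (spinor x) (spinor x) = of_real (2 * norm x)"
proof -
  have "herm (spinor x) (spinor x) = spin_trace [x]" by (simp add: spin_trace_hchain)
  also have "\<dots> = of_real (2 * norm x)" by (simp add: spin_trace_def spin_act_def complex_eq_iff)
  finally show ?thesis .
qed

lemma pos_mult_herm_self: "x \<noteq> 0 \<Longrightarrow> pos_mult (herm (spinor x) (spinor x)) 1"
  unfolding herm_self pos_mult_def by (intro exI[of _ "2 * norm x"]) auto

text \<open>Values in a positive ratio lie on one ray from 0, so the straight homotopy avoids 0.
  Hence positive factors of a trace do not change \<open>spin_link\<close>.\<close>

lemma winding_number_pos_mult:
  assumes "path f" "path g" "pathfinish f = pathstart f" "pathfinish g = pathstart g"
    and "\<And>t. t \<in> {0..1} \<Longrightarrow> pos_mult (f t) (g t)" "\<And>t. t \<in> {0..1} \<Longrightarrow> g t \<noteq> 0"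
  shows "winding_number f 0 = winding_number g 0"
proof (rule winding_number_loops_linear_eq[OF assms(2,1,4,3)])
  fix t :: real assume t: "t \<in> {0..1}"
  obtain k where k: "k > 0" "f t = of_real k * g t" using assms(5)[OF t] by (auto simp: pos_mult_def)
  show "0 \<notin> closed_segment (g t) (f t)"
  proof
    assume "0 \<in> closed_segment (g t) (f t)"
    then obtain u where u: "0 \<le> u" "u \<le> 1" "(1 - u) *\<^sub>R g t + u *\<^sub>R f t = 0"
      by (auto simp: closed_segment_def)
    have "of_real ((1 - u) + u * k) * g t = 0"
      using u(3) unfolding k(2) by (simp add: scaleR_conv_of_real algebra_simps)
    then have "(1 - u) + u * k = 0" using assms(6)[OF t] by (metis mult_eq_0_iff of_real_eq_0_iff)
    moreover have "(1 - u) + u * k > 0"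
      using u(1,2) k(1) by (cases "u = 0") (auto intro: add_nonneg_pos)
    ultimately show False by simp
  qed
qed

section \<open>Homotopy invariance for inscribed polygons\<close>

lemma csegs_avoid:
  "successively (\<lambda>u v. norm (v - u) < norm (u - p)) xs \<Longrightarrow> p \<notin> csegs xs"
proof (induction xs rule: csegs.induct)
  case (1 u v ws)
  have "p \<notin> closed_segment u v"
    using 1(2) segment_bound(1)[of p u v] by (auto simp: norm_minus_commute)
  then show ?case using 1 by simp
qed auto

text \<open>By compactness the two moving loops keep a distance of at least \<open>\<delta>\<close>,
  and for large \<open>M\<close> consecutive samples of \<open>a\<close> are closer than
  \<open>\<delta>\<close>, uniformly in time. The inscribed polygons then miss \<open>b\<close>
  throughout, so the trace moves in the punctured plane.\<close>

lemma spin_link_homotopy: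
  fixes a b :: "real \<Rightarrow> real \<Rightarrow> real^3"
  assumes ca: "continuous_on ({0..1} \<times> {0..1}) (\<lambda>x. a (fst x) (snd x))"
    and cb: "continuous_on ({0..1} \<times> {0..1}) (\<lambda>x. b (fst x) (snd x))"
    and disj: "\<And>t s x. t \<in> {0..1} \<Longrightarrow> s \<in> {0..1} \<Longrightarrow> x \<in> {0..1} \<Longrightarrow> a t s \<noteq> b t x"
    and la: "\<And>t. t \<in> {0..1} \<Longrightarrow> a t 0 = a t 1"
    and lb: "\<And>t. t \<in> {0..1} \<Longrightarrow> b t 0 = b t 1"
  shows "\<exists>M0. \<forall>M\<ge>M0. spin_link (map (a 0) (dyad M)) (b 0) = spin_link (map (a 1) (dyad M)) (b 1)"
proof -
  let ?I = "{0..1::real}"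
  have ca': "continuous_on S (\<lambda>x. a (f x) (g x))"
    if "continuous_on S f" "continuous_on S g" "f ` S \<subseteq> ?I" "g ` S \<subseteq> ?I" for S :: "(real\<times>real\<times>real) set" and f g
    using continuous_on_compose2[OF ca, of S "\<lambda>x. (f x, g x)"] that by (auto intro: continuous_intros)
  have cb': "continuous_on S (\<lambda>x. b (f x) (g x))"
    if "continuous_on S f" "continuous_on S g" "f ` S \<subseteq> ?I" "g ` S \<subseteq> ?I" for S :: "(real\<times>real\<times>real) set" and f g
    using continuous_on_compose2[OF cb, of S "\<lambda>x. (f x, g x)"] that by (auto intro: continuous_intros)
  let ?d = "\<lambda>y::real\<times>real\<times>real. dist (a (fst y) (fst (snd y))) (b (fst y) (snd (snd y)))"
  have "\<exists>y\<in>?I \<times> ?I \<times> ?I. \<forall>z\<in>?I \<times> ?I \<times> ?I. ?d y \<le> ?d z"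
    by (intro continuous_attains_inf compact_Times compact_Icc continuous_on_dist ca' cb' continuous_intros) auto
  then obtain y where y: "y \<in> ?I \<times> ?I \<times> ?I" "\<And>z. z \<in> ?I \<times> ?I \<times> ?I \<Longrightarrow> ?d y \<le> ?d z" by blast
  define \<delta> where "\<delta> = ?d y"
  have \<delta>0: "\<delta> > 0" using y(1) disj unfolding \<delta>_def by auto
  have \<delta>: "\<delta> \<le> dist (a t s) (b t x)" if "t \<in> ?I" "s \<in> ?I" "x \<in> ?I" for t s x
    using y(2)[of "(t,s,x)"] that by (auto simp: \<delta>_def)
  have "uniformly_continuous_on (?I \<times> ?I) (\<lambda>x. a (fst x) (snd x))"
    by (intro compact_uniformly_continuous ca compact_Times compact_Icc)
  then obtain e where e: "e > 0" "\<And>t s s'. t \<in> ?I \<Longrightarrow> s \<in> ?I \<Longrightarrow> s' \<in> ?I \<Longrightarrow> \<bar>s' - s\<bar> < e \<Longrightarrow> dist (a t s') (a t s) < \<delta>"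
    using \<delta>0 unfolding uniformly_continuous_on_def by (force simp: dist_Pair_Pair dist_real_def)
  obtain M0 where M0: "(1/2::real) ^ M0 < e" using e(1) real_arch_pow_inv[of e "1/2"] by auto
  have main: "spin_link (map (a 0) (dyad M)) (b 0) = spin_link (map (a 1) (dyad M)) (b 1)" if M: "M \<ge> M0" for M
  proof -
    have eM: "1 / 2 ^ M < e"
    proof -
      have "(1/2::real) ^ M \<le> (1/2) ^ M0" using M by (intro power_decreasing) auto
      then show ?thesis using M0 by (simp add: power_one_over)
    qed
    have avoid: "b t x \<notin> csegs (map (a t) (dyad M) @ [hd (map (a t) (dyad M))])" if t: "t \<in> ?I" and x: "x \<in> ?I" for t x
    proof (rule csegs_avoid)
      have 1: "successively (\<lambda>s s'. norm (a t s' - a t s) < norm (a t s - b t x)) (dyad M)"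
      proof (rule successively_mono[OF dyad_step])
        fix s s' assume s: "s \<in> set (dyad M)" "s' \<in> set (dyad M)" "s \<le> s' \<and> s' \<le> s + 1 / 2 ^ M"
        then have I: "s \<in> ?I" "s' \<in> ?I" using set_dyad by blast+
        have "dist (a t s') (a t s) < \<delta>" using s eM by (intro e(2) t I) auto
        also have "\<delta> \<le> dist (a t s) (b t x)" by (intro \<delta> t x I)
        finally show "norm (a t s' - a t s) < norm (a t s - b t x)" by (simp add: dist_norm)
      qed
      \<comment> \<open>The edge that closes the sample has length 0, so for it the step condition
        only asks that its end differs from \<open>b t x\<close>.\<close>
      have 2: "a t 1 \<noteq> b t x" using disj t x by simp
      show "successively (\<lambda>u v. norm (v - u) < norm (u - b t x)) (map (a t) (dyad M) @ [hd (map (a t) (dyad M))])"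
        using 1 2 la[OF t] by (simp add: successively_append_iff successively_map last_map hd_map)
    qed
    have nz: "spin_trace (map (\<lambda>s. a t s - b t x) (dyad M)) \<noteq> 0" if "t \<in> ?I" "x \<in> ?I" for t x
      using spin_trace_nonzero[OF _ avoid[OF that]] by (simp add: o_def)
    have "homotopic_loops (-{0}) (\<lambda>x. spin_trace (map (\<lambda>s. a 0 s - b 0 x) (dyad M)))
        (\<lambda>x. spin_trace (map (\<lambda>s. a 1 s - b 1 x) (dyad M)))"
    proof -
      let ?h = "\<lambda>y. spin_trace (map (\<lambda>s. a (fst y) s - b (fst y) (snd y)) (dyad M))"
      have c2: "continuous_on (?I \<times> ?I) (\<lambda>y. a (fst y) s)" if "s \<in> ?I" for s
        using that by (intro continuous_on_compose2[OF ca, of _ "\<lambda>y. (fst y, s)", simplified] continuous_intros) auto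
      have "continuous_on (?I \<times> ?I) ?h"
        by (rule continuous_on_spin_trace) (use set_dyad in \<open>auto intro!: continuous_intros c2 cb\<close>)
      then show ?thesis
        unfolding homotopic_loops using nz lb
        by (intro exI[of _ ?h]) (auto simp: pathstart_def pathfinish_def)
    qed
    then show ?thesis
      unfolding spin_link_def map_map o_def by (rule winding_number_homotopic_loops)
  qed
  then show ?thesis by blast
qed

text \<open>Induction by halving the segment. The midpoint occurs twice in the sample, which
  contributes a positive factor, and \<open>hchain_subdivide\<close> removes it.\<close>

lemma hchain_linepath:
  assumes "p \<notin> closed_segment a b"
  shows "pos_mult (hchain (map (\<lambda>s. linepath a b s - p) (dyad M))) (herm (spinor (a - p)) (spinor (b - p)))"
  using assms
proof (induction M arbitrary: a b)
  case 0 then show ?case by (simp add: linepath_def)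
next
  case (Suc M)
  let ?m = "midpoint a b"
  have m: "?m \<in> closed_segment a b" by (simp add: midpoint_in_closed_segment)
  have sub: "closed_segment a ?m \<subseteq> closed_segment a b" "closed_segment ?m b \<subseteq> closed_segment a b"
    using m by (auto simp: subset_closed_segment)
  have np: "p \<notin> closed_segment a ?m" "p \<notin> closed_segment ?m b" "?m - p \<noteq> 0"
    using Suc.prems sub m by auto
  have e: "map (\<lambda>s. linepath a b s - p) (dyad (Suc M)) =
      map (\<lambda>s. linepath a ?m s - p) (dyad M) @ map (\<lambda>s. linepath ?m b s - p) (dyad M)"
  proof -
    have 1: "linepath a b (s / 2) = linepath a ?m s" for s
      by (simp add: linepath_def midpoint_def vec_eq_iff field_simps)
    have 2: "linepath a b ((1 + s) / 2) = linepath ?m b s" for s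
      by (simp add: linepath_def midpoint_def vec_eq_iff field_simps)
    show ?thesis by (simp only: dyad.simps map_append map_map o_def 2) (simp only: 1)
  qed
  have seg: "?m - p \<in> closed_segment (a - p) (b - p)" "0 \<notin> closed_segment (a - p) (b - p)"
    using closed_segment_translation_eq[of "-p" ?m a b] closed_segment_translation_eq[of "-p" p a b] m Suc.prems
    by auto
  have "pos_mult (hchain (map (\<lambda>s. linepath a b s - p) (dyad (Suc M))))
     (herm (spinor (a - p)) (spinor (?m - p)) * 1 * herm (spinor (?m - p)) (spinor (b - p)))"
    unfolding e
  proof (subst hchain_join)
    have l: "last (map (\<lambda>s. linepath a ?m s - p) (dyad M)) = ?m - p" "hd (map (\<lambda>s. linepath ?m b s - p) (dyad M)) = ?m - p"
      by (simp_all add: last_map hd_map linepath_def)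
    show "pos_mult (hchain (map (\<lambda>s. linepath a ?m s - p) (dyad M)) *
        herm (spinor (last (map (\<lambda>s. linepath a ?m s - p) (dyad M)))) (spinor (hd (map (\<lambda>s. linepath ?m b s - p) (dyad M)))) *
        hchain (map (\<lambda>s. linepath ?m b s - p) (dyad M)))
      (herm (spinor (a - p)) (spinor (?m - p)) * 1 * herm (spinor (?m - p)) (spinor (b - p)))"
      unfolding l by (intro pos_mult_mult Suc.IH np pos_mult_herm_self)
  qed auto
  then show ?case using hchain_subdivide[OF seg] pos_mult_trans by simp
qed

section \<open>Samples of a polygonal path\<close>

lemma pathstart_ppath [simp]: "xs \<noteq> [] \<Longrightarrow> pathstart (ppath xs) = hd xs"
  by (induction xs rule: ppath.induct) auto

lemma pathfinish_ppath [simp]: "xs \<noteq> [] \<Longrightarrow> pathfinish (ppath xs) = last xs"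
  by (induction xs rule: ppath.induct) auto

lemma path_ppath [simp]: "path (ppath xs)"
proof -
  have "path (\<lambda>_. c)" for c :: "real^3" by (simp add: path_def)
  then show ?thesis by (induction xs rule: ppath.induct) auto
qed

lemma path_image_ppath: "length xs \<ge> 2 \<Longrightarrow> path_image (ppath xs) = csegs xs"
  by (induction xs rule: ppath.induct) (auto simp: path_image_join)

text \<open>Every join in \<open>ppath\<close> uses up one level of \<open>dyad\<close>, hence the
  bound on \<open>M\<close>. On each edge the sample collapses by \<open>hchain_linepath\<close>,
  and each inner vertex is sampled twice.\<close>

lemma hchain_ppath:
  assumes "length xs \<ge> 2" "M \<ge> length xs" "p \<notin> csegs xs"
  shows "pos_mult (hchain (map (\<lambda>s. ppath xs s - p) (dyad M))) (hchain (map (\<lambda>v. v - p) xs))"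
  using assms
proof (induction xs arbitrary: M rule: ppath.induct)
  case (1 u v w ws)
  obtain N where N: "M = Suc N" using 1(3) by (cases M) auto
  let ?g = "ppath (v # w # ws)"
  have g0: "?g 0 = v" using pathstart_ppath[of "v # w # ws"] by (simp add: pathstart_def)
  have g1: "?g 1 = last (w # ws)" using pathfinish_ppath[of "v # w # ws"] by (simp add: pathfinish_def)
  have e: "map (\<lambda>s. ppath (u # v # w # ws) s - p) (dyad M) =
      map (\<lambda>s. linepath u v s - p) (dyad N) @ map (\<lambda>s. ?g s - p) (dyad N)"
  proof -
    have 1: "(linepath u v +++ ?g) (s / 2) = linepath u v s" if "s \<in> set (dyad N)" for s
      using set_dyad[of N] that by (auto simp: joinpaths_def)
    have 2: "(linepath u v +++ ?g) ((1 + s) / 2) = ?g s" if "s \<in> set (dyad N)" for s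
    proof -
      have "0 \<le> s" "s \<le> 1" using set_dyad[of N] that by auto
      \<comment> \<open>The parameter 1/2 belongs to the first path of a join, so the case
        \<open>s = 0\<close> needs that \<open>?g\<close> starts at \<open>v\<close>.\<close>
      then show ?thesis using g0 by (cases "s = 0") (auto simp: joinpaths_def linepath_def add_divide_distrib)
    qed
    show ?thesis unfolding N using 1 2 by auto
  qed
  have nz: "v - p \<noteq> 0" using 1(4) by auto
  have "pos_mult (hchain (map (\<lambda>s. ppath (u # v # w # ws) s - p) (dyad M)))
     (herm (spinor (u - p)) (spinor (v - p)) * 1 * hchain (map (\<lambda>v. v - p) (v # w # ws)))"
    unfolding e
  proof (subst hchain_join)
    have l: "last (map (\<lambda>s. linepath u v s - p) (dyad N)) = v - p" "hd (map (\<lambda>s. ?g s - p) (dyad N)) = v - p"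
      using g0 by (simp_all add: last_map hd_map linepath_1' del: ppath.simps)
    show "pos_mult (hchain (map (\<lambda>s. linepath u v s - p) (dyad N)) *
        herm (spinor (last (map (\<lambda>s. linepath u v s - p) (dyad N)))) (spinor (hd (map (\<lambda>s. ?g s - p) (dyad N)))) *
        hchain (map (\<lambda>s. ?g s - p) (dyad N)))
      (herm (spinor (u - p)) (spinor (v - p)) * 1 * hchain (map (\<lambda>v. v - p) (v # w # ws)))"
      unfolding l
      by (intro pos_mult_mult hchain_linepath pos_mult_herm_self 1 nz) (use 1(3,4) N in auto)
  qed auto
  then show ?case by simp
next
  case (2 u v)
  then show ?case using hchain_linepath by simp
qed auto

lemma path_spin_trace:
  assumes "path b"
  shows "path (\<lambda>s. spin_trace (map (\<lambda>v. v - b s) vs))"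
  using assms unfolding path_def by (intro continuous_on_spin_trace continuous_intros) auto

abbreviation "cyc vs \<equiv> vs @ [hd vs]"

text \<open>The sample passes through all vertices, and its further points lie on edges, where they
  contribute positive factors. The bound on \<open>M\<close> is strict because the cyclic list has
  one vertex more than \<open>vs\<close>.\<close>

lemma spin_link_samples:
  assumes vs: "vs \<noteq> []" and M: "M > length vs" and b: "path b" "pathfinish b = pathstart b"
    and av: "path_image b \<inter> csegs (cyc vs) = {}"
  shows "spin_link (map (ppath (cyc vs)) (dyad M)) b = spin_link vs b"
  unfolding spin_link_def
proof (rule winding_number_pos_mult)
  fix t :: real assume t: "t \<in> {0..1}"
  let ?p = "b t"
  have "?p \<in> path_image b" using t by (auto simp: path_image_def)
  then have np: "?p \<notin> csegs (cyc vs)" using av by blast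
  have v0: "hd vs - ?p \<noteq> 0"
  proof -
    have "hd vs \<in> csegs (cyc vs)" using vs by (cases vs; cases "tl vs") auto
    then show ?thesis using np by auto
  qed
  let ?xs = "map (\<lambda>v. v - ?p) (map (ppath (cyc vs)) (dyad M))"
  have "hd ?xs = hd vs - ?p" "last ?xs = hd vs - ?p"
    using vs pathstart_ppath[of "cyc vs"] pathfinish_ppath[of "cyc vs"]
    by (auto simp: hd_map last_map pathstart_def pathfinish_def simp del: pathstart_ppath pathfinish_ppath)
  then have "spin_trace ?xs = hchain ?xs * herm (spinor (hd vs - ?p)) (spinor (hd vs - ?p))"
    by (simp add: spin_trace_alt)
  moreover have "pos_mult (hchain ?xs) (hchain (map (\<lambda>v. v - ?p) (cyc vs)))"
    using hchain_ppath[of "cyc vs" M ?p] vs M np by (cases vs) (auto simp: o_def)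
  ultimately have "pos_mult (spin_trace ?xs) (hchain (map (\<lambda>v. v - ?p) (cyc vs)) * 1)"
    using pos_mult_mult pos_mult_herm_self[OF v0] by metis
  moreover have "hchain (map (\<lambda>v. v - ?p) (cyc vs)) = spin_trace (map (\<lambda>v. v - ?p) vs)"
    using vs by (cases vs) (auto simp: spin_trace_hchain)
  ultimately show "pos_mult (spin_trace ?xs) (spin_trace (map (\<lambda>v. v - ?p) vs))" by simp
  show "spin_trace (map (\<lambda>v. v - ?p) vs) \<noteq> 0" using spin_trace_nonzero[OF vs np] .
qed (use b in \<open>auto intro!: path_spin_trace simp: pathstart_def pathfinish_def simp del: map_map\<close>)

text \<open>Reversing the order of the factors conjugates the trace, since the matrices are
  Hermitian.\<close>

lemma cmod_lam_reversepath:
  assumes "path b" "\<And>s. s \<in> {0..1} \<Longrightarrow> spin_trace (map (\<lambda>v. v - b s) (map c (dyad M))) \<noteq> 0"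
  shows "cmod (spin_link (map (reversepath c) (dyad M)) b) = cmod (spin_link (map c (dyad M)) b)"
proof -
  let ?F = "\<lambda>s. spin_trace (map (\<lambda>v. v - b s) (map c (dyad M)))"
  have "map (reversepath c) (dyad M) = map c (map (\<lambda>s. 1 - s) (dyad M))" by (simp add: reversepath_def)
  also have "\<dots> = rev (map c (dyad M))" by (simp only: rev_dyad[symmetric] rev_map)
  finally have "spin_link (map (reversepath c) (dyad M)) b = winding_number (cnj \<circ> ?F) (cnj 0)"
    unfolding spin_link_def by (simp add: rev_map[symmetric] spin_trace_rev o_def del: map_map)
  also have "\<dots> = - cnj (winding_number ?F 0)"
    by (rule winding_number_cnj[OF path_spin_trace[OF assms(1)]])
       (use assms(2) in \<open>auto simp: path_image_def simp del: map_map dest: sym\<close>)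
  finally show ?thesis by (simp add: spin_link_def)
qed

text \<open>An isotopy between links only determines image sets, so parametrizations of one curve
  have to be compared. Carried over to the unit circle, simple loops wind 1 or -1 times about 0.
  Equal winding numbers give a homotopy in the punctured plane, and \<open>sgn\<close> retracts it
  to the circle.\<close>

lemma simple_loops_same_image:
  fixes p q :: "real \<Rightarrow> real^3"
  assumes p: "simple_path p" "pathfinish p = pathstart p" and q: "simple_path q" "pathfinish q = pathstart q"
    and im: "path_image q = path_image p"
  shows "homotopic_loops (path_image p) p q \<or> homotopic_loops (path_image p) p (reversepath q)"
proof -
  let ?S = "sphere (0::complex) 1"
  have "path_image p homeomorphic ?S" using homeomorphic_simple_path_image_circle[OF p] by simp
  then obtain h k where hk: "homeomorphism (path_image p) ?S h k" by (auto simp: homeomorphic_def)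
  have ch: "continuous_on (path_image p) h" and ck: "continuous_on ?S k" and
    kh: "\<And>x. x \<in> path_image p \<Longrightarrow> k (h x) = x" and hS: "h ` path_image p = ?S" and kS: "k ` ?S = path_image p"
    using hk by (auto simp: homeomorphism_def)
  have inj: "inj_on h (path_image p)" using kh by (metis inj_onI)
  have wn: "winding_number (h \<circ> r) 0 \<in> {1,-1}" "path_image (h \<circ> r) = ?S" "simple_path (h \<circ> r)"
    "pathfinish (h \<circ> r) = pathstart (h \<circ> r)"
    if r: "simple_path r" "pathfinish r = pathstart r" "path_image r = path_image p" for r
  proof -
    show s: "simple_path (h \<circ> r)"
      using r ch inj by (intro simple_path_continuous_image) (auto simp: inj_on_def)
    show i: "path_image (h \<circ> r) = ?S" using r hS by (simp add: path_image_compose)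
    have 0: "0 \<in> inside (path_image (h \<circ> r))" unfolding i
      using inside_frontier_eq_interior[of "cball (0::complex) 1"] by simp
    show "pathfinish (h \<circ> r) = pathstart (h \<circ> r)"
      using r(2) by (simp add: pathfinish_compose pathstart_compose)
    show "winding_number (h \<circ> r) 0 \<in> {1,-1}"
      using simple_closed_path_winding_number_inside[OF s] 0 by blast
  qed
  have main: "homotopic_loops (path_image p) p r"
    if r: "simple_path r" "pathfinish r = pathstart r" "path_image r = path_image p"
      and eq: "winding_number (h \<circ> p) 0 = winding_number (h \<circ> r) 0" for r
  proof -
    have "homotopic_loops (-{0}) (h \<circ> p) (h \<circ> r)"
      using winding_number_homotopic_loops_eq[of "h \<circ> p" 0 "h \<circ> r"] wn[OF p refl] wn[OF r] eq
      by (simp add: simple_path_imp_path)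
    then have "homotopic_loops (path_image p) ((\<lambda>z. k (sgn z)) \<circ> (h \<circ> p)) ((\<lambda>z. k (sgn z)) \<circ> (h \<circ> r))"
    proof (rule homotopic_loops_continuous_image)
      show "continuous_on (-{0}) (\<lambda>z. k (sgn z))"
        by (intro continuous_on_compose2[OF ck] continuous_intros) (auto simp: norm_sgn split: if_splits)
      show "(\<lambda>z. k (sgn z)) \<in> (-{0}) \<rightarrow> path_image p"
      proof (rule Pi_I)
        fix x :: complex assume "x \<in> -{0}"
        then have "sgn x \<in> ?S" by (simp add: norm_sgn)
        then show "k (sgn x) \<in> path_image p" using kS by blast
      qed
    qed
    note h1 = this
    have e: "((\<lambda>z. k (sgn z)) \<circ> (h \<circ> r')) t = r' t" if "t \<in> {0..1}" "path_image r' = path_image p" for t r'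
    proof -
      have "r' t \<in> path_image p" using that by (auto simp: path_image_def)
      moreover then have "norm (h (r' t)) = 1" using hS by force
      ultimately show ?thesis using kh by (simp add: sgn_div_norm)
    qed
    have h2: "homotopic_loops (path_image p) r' ((\<lambda>z. k (sgn z)) \<circ> (h \<circ> r'))"
      if "simple_path r'" "pathfinish r' = pathstart r'" "path_image r' = path_image p" for r'
      using that by (intro homotopic_loops_eq) (use e[symmetric] in \<open>simp_all add: simple_path_imp_path\<close>)
    show ?thesis
      by (rule homotopic_loops_trans[OF h2[OF p refl] homotopic_loops_trans[OF h1 homotopic_loops_sym[OF h2[OF r]]]])
  qed
  have rq: "simple_path (reversepath q)" "pathfinish (reversepath q) = pathstart (reversepath q)"
    "path_image (reversepath q) = path_image p" using q im by (auto simp: simple_path_reversepath)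
  have "h \<circ> reversepath q = reversepath (h \<circ> q)" by (auto simp: reversepath_def)
  then have "winding_number (h \<circ> reversepath q) 0 = - winding_number (h \<circ> q) 0"
    using wn[OF q im] by (simp add: winding_number_reversepath simple_path_imp_path)
  then show ?thesis using main[OF q im] main[OF rq] wn(1)[OF p refl] wn(1)[OF q im] by auto
qed

section \<open>Isotopy invariance of the absolute value\<close>

lemma path_image_cyc: "vs \<noteq> [] \<Longrightarrow> path_image (ppath (cyc vs)) = csegs (cyc vs)"
  by (rule path_image_ppath) (cases vs; simp)

lemma pathfinish_cyc: "vs \<noteq> [] \<Longrightarrow> pathfinish (ppath (cyc vs)) = pathstart (ppath (cyc vs))"
  by simp

lemma spin_link_sample_homotopic:
  assumes h: "homotopic_loops C a a'" and b: "path b" "pathfinish b = pathstart b" and d: "C \<inter> path_image b = {}"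
  shows "\<exists>M0. \<forall>M\<ge>M0. spin_link (map a (dyad M)) b = spin_link (map a' (dyad M)) b"
proof -
  obtain h :: "real \<times> real \<Rightarrow> real^3" where h: "continuous_on ({0..1} \<times> {0..1}) h" "h \<in> ({0..1} \<times> {0..1}) \<rightarrow> C"
    "\<And>x. x \<in> {0..1} \<Longrightarrow> h (0, x) = a x" "\<And>x. x \<in> {0..1} \<Longrightarrow> h (1, x) = a' x"
    "\<And>t. t \<in> {0..1} \<Longrightarrow> pathfinish (h \<circ> Pair t) = pathstart (h \<circ> Pair t)"
    using h unfolding homotopic_loops by metis
  have "\<exists>M0. \<forall>M\<ge>M0. spin_link (map (\<lambda>s. h (0, s)) (dyad M)) b = spin_link (map (\<lambda>s. h (1, s)) (dyad M)) b"
  proof (rule spin_link_homotopy[where a = "\<lambda>t s. h (t, s)" and b = "\<lambda>t. b"])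
    show "continuous_on ({0..1} \<times> {0..1}) (\<lambda>x. b (snd x))"
      by (rule continuous_on_compose2[OF b(1)[unfolded path_def]]) (auto intro: continuous_intros)
    show "h (t, s) \<noteq> b x" if "t \<in> {0..1}" "s \<in> {0..1}" "x \<in> {0..1}" for t s x
    proof -
      have "h (t, s) \<in> C" by (rule Pi_mem[OF h(2)]) (use that in simp)
      moreover have "b x \<in> path_image b" using that by (simp add: path_image_def)
      ultimately show ?thesis using d by (metis disjoint_iff)
    qed
    show "h (t, 0) = h (t, 1)" if "t \<in> {0..1}" for t using h(5)[OF that] by (simp add: pathfinish_def pathstart_def)
  qed (use h(1) b in \<open>simp_all add: pathfinish_def pathstart_def\<close>)
  moreover have "map (\<lambda>s. h (0, s)) (dyad M) = map a (dyad M)" "map (\<lambda>s. h (1, s)) (dyad M) = map a' (dyad M)" for M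
    using h(3,4) set_dyad by (auto intro!: map_cong simp del: atLeastAtMost_iff)
  ultimately show ?thesis by simp
qed

lemma spin_link_loop_homotopic:
  assumes vs: "vs \<noteq> []" and h: "homotopic_loops C b b'" and d: "csegs (cyc vs) \<inter> C = {}"
  shows "spin_link vs b = spin_link vs b'"
proof -
  have "homotopic_loops (-{0}) ((\<lambda>p. spin_trace (map (\<lambda>v. v - p) vs)) \<circ> b) ((\<lambda>p. spin_trace (map (\<lambda>v. v - p) vs)) \<circ> b')"
  proof (rule homotopic_loops_continuous_image[OF h])
    show "continuous_on C (\<lambda>p. spin_trace (map (\<lambda>v. v - p) vs))"
      by (intro continuous_on_spin_trace continuous_intros)
    show "(\<lambda>p. spin_trace (map (\<lambda>v. v - p) vs)) \<in> C \<rightarrow> - {0}"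
      using spin_trace_nonzero[OF vs] d by blast
  qed
  then show ?thesis unfolding spin_link_def o_def by (rule winding_number_homotopic_loops)
qed

lemma cmod_lam_reverse_loop:
  assumes vs: "vs \<noteq> []" and b: "path b" and d: "csegs (cyc vs) \<inter> path_image b = {}"
  shows "cmod (spin_link vs (reversepath b)) = cmod (spin_link vs b)"
proof -
  let ?F = "\<lambda>s. spin_trace (map (\<lambda>v. v - b s) vs)"
  have "spin_trace (map (\<lambda>v. v - b s) vs) \<noteq> 0" if "s \<in> {0..1}" for s
  proof -
    have "b s \<in> path_image b" using that by (simp add: path_image_def)
    then show ?thesis using spin_trace_nonzero[OF vs] d by blast
  qed
  then have "0 \<notin> path_image ?F" by (force simp: path_image_def)
  moreover have "spin_link vs (reversepath b) = winding_number (reversepath ?F) 0"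
    unfolding spin_link_def reversepath_def ..
  ultimately have "spin_link vs (reversepath b) = - spin_link vs b"
    using winding_number_reversepath[OF path_spin_trace[OF b]] by (simp add: spin_link_def)
  then show ?thesis by simp
qed

text \<open>The final map of the isotopy takes \<open>ppath (cyc vs)\<close> to a loop with the
  image of \<open>ppath (cyc vs')\<close>, but parametrized in another way, and likewise for the
  second polygons. The first loop is exchanged at the level of its samples, the second one directly;
  the absolute value absorbs the two unknown orientations.\<close>

theorem spin_link_isotopy_invariant:
  fixes H :: "real \<times> (real^3) \<Rightarrow> real^3"
  assumes cH: "continuous_on ({0..1} \<times> UNIV) H" and H0: "\<And>x. H (0, x) = x"
    and inj: "\<And>t. t \<in> {0..1} \<Longrightarrow> inj (\<lambda>x. H (t, x))"
    and ne: "vs \<noteq> []" "ws \<noteq> []" "vs' \<noteq> []" "ws' \<noteq> []"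
    and simple: "simple_path (ppath (cyc vs))" "simple_path (ppath (cyc ws))"
      "simple_path (ppath (cyc vs'))" "simple_path (ppath (cyc ws'))"
    and disj: "csegs (cyc vs) \<inter> csegs (cyc ws) = {}"
    and im: "(\<lambda>x. H (1, x)) ` csegs (cyc vs) = csegs (cyc vs')"
      "(\<lambda>x. H (1, x)) ` csegs (cyc ws) = csegs (cyc ws')"
  shows "cmod (spin_link vs' (ppath (cyc ws'))) = cmod (spin_link vs (ppath (cyc ws)))"
proof -
  let ?a = "ppath (cyc vs)" and ?b = "ppath (cyc ws)" and ?c = "ppath (cyc vs')" and ?d = "ppath (cyc ws')"
  let ?f = "\<lambda>x. H (1, x)"
  let ?a1 = "?f \<circ> ?a" and ?b1 = "?f \<circ> ?b"
  note pI = path_image_cyc[OF ne(1)] path_image_cyc[OF ne(2)] path_image_cyc[OF ne(3)] path_image_cyc[OF ne(4)]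
  note pF = pathfinish_cyc[OF ne(1)] pathfinish_cyc[OF ne(2)] pathfinish_cyc[OF ne(3)] pathfinish_cyc[OF ne(4)]
  have cf: "continuous_on S ?f" for S
    by (intro continuous_on_compose2[OF cH] continuous_intros) auto
  have injf: "inj_on ?f S" for S by (rule inj_on_subset[OF inj[of 1] subset_UNIV]) simp
  have s1: "simple_path ?a1" "simple_path ?b1"
    by (rule simple_path_continuous_image[OF simple(1) cf injf], rule simple_path_continuous_image[OF simple(2) cf injf])
  have i1: "path_image ?a1 = csegs (cyc vs')" "path_image ?b1 = csegs (cyc ws')"
    using im pI by (simp_all add: path_image_compose)
  have f1: "pathfinish ?a1 = pathstart ?a1" "pathfinish ?b1 = pathstart ?b1"
    using pF by (simp_all add: pathfinish_compose pathstart_compose)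
  have disj': "csegs (cyc vs') \<inter> csegs (cyc ws') = {}"
    unfolding im[symmetric] using disj inj[of 1] by (auto dest: injD)
  have cp: "continuous_on ({0..1} \<times> {0..1}) (\<lambda>x. H (fst x, p (snd x)))" if "path p" for p
  proof -
    have 1: "continuous_on ({0..1} \<times> {0..1}) (\<lambda>x::real\<times>real. p (snd x))"
      by (rule continuous_on_compose2[OF that[unfolded path_def]]) (auto intro: continuous_intros)
    have 2: "continuous_on ({0..1} \<times> {0..1}) (\<lambda>x::real\<times>real. (fst x, p (snd x)))"
      by (intro continuous_on_Pair continuous_on_fst continuous_on_id 1)
    show ?thesis by (rule continuous_on_compose2[OF cH 2]) auto
  qed
  have "\<exists>M0. \<forall>M\<ge>M0. spin_link (map (\<lambda>s. H (0, ?a s)) (dyad M)) (\<lambda>s. H (0, ?b s)) = spin_link (map (\<lambda>s. H (1, ?a s)) (dyad M)) (\<lambda>s. H (1, ?b s))"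
  proof (rule spin_link_homotopy[where a = "\<lambda>t s. H (t, ?a s)" and b = "\<lambda>t s. H (t, ?b s)"])
    show "H (t, ?a s) \<noteq> H (t, ?b x)" if "t \<in> {0..1}" "s \<in> {0..1}" "x \<in> {0..1}" for t s x
    proof -
      have "?a s \<in> csegs (cyc vs)" "?b x \<in> csegs (cyc ws)"
        unfolding pI(1,2)[symmetric] using that by (auto simp: path_image_def)
      then have "?a s \<noteq> ?b x" using disj by (metis IntI empty_iff)
      then show ?thesis using inj[OF that(1)] by (auto dest: injD)
    qed
  qed (use cp pF(1,2) in \<open>auto simp: pathfinish_def pathstart_def\<close>)
  then obtain M1 where M1: "\<And>M. M \<ge> M1 \<Longrightarrow> spin_link (map ?a (dyad M)) ?b = spin_link (map ?a1 (dyad M)) ?b1"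
    unfolding H0 o_def by auto
  have b1: "path ?b1" using s1 simple_path_imp_path by blast
  obtain c' where c': "c' = ?c \<or> c' = reversepath ?c" "homotopic_loops (csegs (cyc vs')) ?a1 c'"
    using simple_loops_same_image[OF s1(1) f1(1) simple(3) pF(3)] i1 pI by auto
  obtain M2 where M2: "\<And>M. M \<ge> M2 \<Longrightarrow> spin_link (map ?a1 (dyad M)) ?b1 = spin_link (map c' (dyad M)) ?b1"
    using spin_link_sample_homotopic[OF c'(2) b1 f1(2)] disj' i1 by auto
  \<comment> \<open>Fine enough for both homotopies and for the samples of both \<open>vs\<close>
    and \<open>vs'\<close>.\<close>
  define M where "M = M1 + M2 + length vs + length vs' + 1"
  have "spin_link vs ?b = spin_link (map ?a (dyad M)) ?b"
    by (rule spin_link_samples[symmetric]) (use ne disj pI pF in \<open>auto simp: M_def\<close>)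
  also have "\<dots> = spin_link (map c' (dyad M)) ?b1" using M1[of M] M2[of M] by (simp add: M_def)
  finally have 1: "spin_link vs ?b = spin_link (map c' (dyad M)) ?b1" .
  have nz: "spin_trace (map (\<lambda>v. v - ?b1 s) (map ?c (dyad M))) \<noteq> 0" if s: "s \<in> {0..1}" for s
  proof -
    have "?b1 s \<in> path_image ?b1" using s by (simp add: path_image_def)
    then have np: "?b1 s \<notin> csegs (cyc vs')" using disj' i1 by blast
    let ?xs = "map (\<lambda>v. v - ?b1 s) (map ?c (dyad M))"
    have v0: "hd vs' - ?b1 s \<noteq> 0"
    proof -
      have "hd vs' \<in> csegs (cyc vs')" using ne(3) by (cases vs'; cases "tl vs'") auto
      then show ?thesis using np by auto
    qed
    have e: "hd ?xs = hd vs' - ?b1 s" "last ?xs = hd vs' - ?b1 s"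
      using ne(3) pathstart_ppath[of "cyc vs'"] pathfinish_ppath[of "cyc vs'"]
      by (auto simp: hd_map last_map pathstart_def pathfinish_def simp del: pathstart_ppath pathfinish_ppath)
    have "pos_mult (hchain ?xs) (hchain (map (\<lambda>v. v - ?b1 s) (cyc vs')))"
      using hchain_ppath[of "cyc vs'" M "?b1 s"] ne(3) np
      by (cases vs') (auto simp: o_def M_def)
    moreover have "hchain (map (\<lambda>v. v - ?b1 s) (cyc vs')) \<noteq> 0"
      by (rule hchain_nonzero) (use np csegs_shift in blast)
    ultimately have "hchain ?xs \<noteq> 0" by (auto simp: pos_mult_def)
    moreover have "spin_trace ?xs = hchain ?xs * of_real (2 * norm (hd vs' - ?b1 s))"
      using e herm_self by (subst spin_trace_alt) (simp_all del: map_map)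
    ultimately show ?thesis using v0 by (simp del: map_map)
  qed
  have 2: "cmod (spin_link (map c' (dyad M)) ?b1) = cmod (spin_link (map ?c (dyad M)) ?b1)"
    using c'(1) cmod_lam_reversepath[OF b1 nz] by (metis (no_types, lifting))
  have 3: "spin_link (map ?c (dyad M)) ?b1 = spin_link vs' ?b1"
    by (rule spin_link_samples) (use ne disj' i1 f1 b1 in \<open>auto simp: M_def\<close>)
  obtain d' where d': "d' = ?d \<or> d' = reversepath ?d" "homotopic_loops (csegs (cyc ws')) ?b1 d'"
    using simple_loops_same_image[OF s1(2) f1(2) simple(4) pF(4)] i1 pI by auto
  have "spin_link vs' ?b1 = spin_link vs' d'" by (rule spin_link_loop_homotopic[OF ne(3) d'(2) disj'])
  moreover have "cmod (spin_link vs' d') = cmod (spin_link vs' ?d)"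
    using d'(1) cmod_lam_reverse_loop[OF ne(3) path_ppath, of "cyc ws'"] disj' pI by auto
  ultimately show ?thesis using 1 2 3 by simp
qed

section \<open>Sticks of a pair of polygons\<close>

lemma csegs_UN: "csegs xs = (\<Union>i<length xs - 1. closed_segment (xs ! i) (xs ! Suc i))"
proof (induction xs rule: csegs.induct)
  case (1 u v ws)
  have "{..<length (u # v # ws) - 1} = insert 0 (Suc ` {..<length (v # ws) - 1})"
    by (auto simp: image_iff less_Suc_eq_0_disj)
  then show ?case using 1 by simp
qed auto

lemma polygon_csegs: "vs \<noteq> [] \<Longrightarrow> polygon vs = csegs (cyc vs)"
  unfolding polygon_def edge_def csegs_UN
proof (intro SUP_cong)
  fix i assume "vs \<noteq> []" "i \<in> {..<length (cyc vs) - 1}"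
  then have i: "i < length vs" by simp
  show "closed_segment (vs ! i) (vs ! (Suc i mod length vs)) = closed_segment (cyc vs ! i) (cyc vs ! Suc i)"
  proof (cases "Suc i = length vs")
    case True
    have "vs \<noteq> []" using i by auto
    then have "vs ! 0 = hd vs" by (simp add: hd_conv_nth)
    then show ?thesis using True i by (simp add: nth_append)
  next
    case False
    then show ?thesis using i by (simp add: nth_append)
  qed
qed auto

lemma arc_ppath:
  assumes "length xs \<ge> 2" "\<And>i. Suc i < length xs \<Longrightarrow> xs ! i \<noteq> xs ! Suc i"
    and "\<And>i j. i < j \<Longrightarrow> Suc j < length xs \<Longrightarrow>
      closed_segment (xs ! i) (xs ! Suc i) \<inter> closed_segment (xs ! j) (xs ! Suc j) \<subseteq> {xs ! Suc i}"
  shows "arc (ppath xs)"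
  using assms
proof (induction xs rule: ppath.induct)
  case (1 u v w ws)
  let ?ys = "v # w # ws"
  have a: "arc (ppath ?ys)"
  proof (rule 1(1))
    show "?ys ! i \<noteq> ?ys ! Suc i" if "Suc i < length ?ys" for i using 1(3)[of "Suc i"] that by simp
    show "closed_segment (?ys ! i) (?ys ! Suc i) \<inter> closed_segment (?ys ! j) (?ys ! Suc j) \<subseteq> {?ys ! Suc i}"
      if "i < j" "Suc j < length ?ys" for i j using 1(4)[of "Suc i" "Suc j"] that by simp
  qed simp
  have "closed_segment u v \<inter> csegs ?ys \<subseteq> {v}"
    unfolding csegs_UN
  proof
    fix x assume "x \<in> closed_segment u v \<inter> (\<Union>i<length ?ys - 1. closed_segment (?ys ! i) (?ys ! Suc i))"
    then obtain j where j: "j < length ?ys - 1" "x \<in> closed_segment u v" "x \<in> closed_segment (?ys ! j) (?ys ! Suc j)" by blast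
    then show "x \<in> {v}" using 1(4)[of 0 "Suc j"] by auto
  qed
  moreover have "u \<noteq> v" using 1(3)[of 0] by simp
  ultimately show ?case using a
    by (auto intro!: arc_join arc_linepath simp: path_image_ppath simp del: csegs.simps)
next
  case (2 u v) then show ?case using 2(2)[of 0] by (auto intro: arc_linepath)
qed auto

lemma simple_path_cyc:
  assumes "simple_polygon vs"
  shows "simple_path (ppath (cyc vs))"
proof -
  let ?n = "length vs"
  have n: "?n \<ge> 3" and d: "distinct vs" and
    e: "\<And>i j. i < ?n \<Longrightarrow> j < ?n \<Longrightarrow> i \<noteq> j \<Longrightarrow> edge vs i \<inter> edge vs j = edge_ends vs i \<inter> edge_ends vs j"
    using assms by (auto simp: simple_polygon_def)
  have vs0: "vs \<noteq> []" using n by auto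
  obtain u v w ws where vs: "vs = u # v # w # ws"
    using n by (cases vs; cases "tl vs"; cases "tl (tl vs)") auto
  let ?xs = "v # w # ws @ [u]"
  have nth: "?xs ! i = vs ! (Suc i mod ?n)" if "i < ?n" for i
  proof (cases "Suc i = ?n")
    case True
    then have "i = Suc (Suc (length ws))" using vs by simp
    then show ?thesis using True vs by (simp add: nth_append)
  next
    case False
    then have "i < length (v # w # ws)" using that vs by simp
    then have "?xs ! i = (v # w # ws) ! i" by (metis append_Cons nth_append)
    then show ?thesis using False that vs by simp
  qed
  have seg: "closed_segment (?xs ! i) (?xs ! Suc i) = edge vs (Suc i)" if "Suc i < ?n" for i
    unfolding edge_def using nth[of i] nth[of "Suc i"] that by simp
  have lx: "length ?xs = ?n" using vs by simp
  have a: "arc (ppath ?xs)"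
  proof (rule arc_ppath)
    show "2 \<le> length ?xs" by simp
    show "?xs ! i \<noteq> ?xs ! Suc i" if "Suc i < length ?xs" for i
    proof -
      have i: "Suc i < ?n" using that lx by simp
      show ?thesis
        using nth[of i] nth[of "Suc i"] i n vs0 nth_eq_iff_index_eq[OF d, of "Suc i" "Suc (Suc i) mod ?n"]
        by (cases "Suc (Suc i) = ?n") auto
    qed
    show "closed_segment (?xs ! i) (?xs ! Suc i) \<inter> closed_segment (?xs ! j) (?xs ! Suc j) \<subseteq> {?xs ! Suc i}"
      if ij: "i < j" "Suc j < length ?xs" for i j
    proof -
      have j: "Suc j < ?n" using ij lx by simp
      have "closed_segment (?xs ! i) (?xs ! Suc i) \<inter> closed_segment (?xs ! j) (?xs ! Suc j) =
          edge_ends vs (Suc i) \<inter> edge_ends vs (Suc j)"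
        using seg[of i] seg[of j] e[of "Suc i" "Suc j"] ij j by simp
      also have "\<dots> \<subseteq> {vs ! Suc (Suc i)}"
      proof -
        have 1: "vs ! Suc i \<noteq> vs ! Suc j" using d ij j by (simp add: nth_eq_iff_index_eq)
        have 2: "vs ! Suc i \<noteq> vs ! (Suc (Suc j) mod ?n)"
          using ij j n vs0 nth_eq_iff_index_eq[OF d, of "Suc i" "Suc (Suc j) mod ?n"]
          by (cases "Suc (Suc j) = ?n") auto
        show ?thesis using 1 2 ij j by (auto simp: edge_ends_def)
      qed
      also have "vs ! Suc (Suc i) = ?xs ! Suc i" using nth[of "Suc i"] ij j by simp
      finally show ?thesis .
    qed
  qed
  have uv: "u \<noteq> v" using d vs by simp
  have e0: "closed_segment u v = edge vs 0" "edge_ends vs 0 = {u, v}" using vs by (auto simp: edge_def edge_ends_def)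
  have "closed_segment u v \<inter> csegs ?xs \<subseteq> {u, v}"
    unfolding csegs_UN
  proof
    fix x assume "x \<in> closed_segment u v \<inter> (\<Union>i<length ?xs - 1. closed_segment (?xs ! i) (?xs ! Suc i))"
    then obtain i where i: "i < length ?xs - 1" "x \<in> closed_segment u v" "x \<in> closed_segment (?xs ! i) (?xs ! Suc i)" by blast
    then have "Suc i < ?n" using lx by linarith
    then have "x \<in> edge vs 0 \<inter> edge vs (Suc i)" using i seg[of i] e0 by (metis IntI)
    moreover have "edge vs 0 \<inter> edge vs (Suc i) = edge_ends vs 0 \<inter> edge_ends vs (Suc i)"
      by (rule e) (use \<open>Suc i < ?n\<close> in linarith)+
    ultimately show "x \<in> {u, v}" unfolding e0(2) by (metis IntD1)
  qed
  then have "simple_path (linepath u v +++ ppath ?xs)"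
    using a uv
    by (intro simple_path_join_loop arc_linepath) (auto simp: path_image_ppath simp del: csegs.simps ppath.simps)
  then show ?thesis unfolding vs by simp
qed

section \<open>Rotating the vertex list and removing straight vertices\<close>

lemma edge_rotate1:
  assumes "i < length vs"
  shows "edge (rotate1 vs) i = edge vs (Suc i mod length vs)"
    and "edge_ends (rotate1 vs) i = edge_ends vs (Suc i mod length vs)"
proof -
  have m: "Suc i mod length vs < length vs" using assms by (intro mod_less_divisor) auto
  show "edge (rotate1 vs) i = edge vs (Suc i mod length vs)"
    "edge_ends (rotate1 vs) i = edge_ends vs (Suc i mod length vs)"
    using assms m by (simp_all add: edge_def edge_ends_def nth_rotate1)
qed

lemma bij_Suc_mod: "n > 0 \<Longrightarrow> bij_betw (\<lambda>i. Suc i mod n) {..<n} {..<n}"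
proof -
  assume n: "n > 0"
  have "inj_on (\<lambda>i. Suc i mod n) {..<n}"
    by (auto simp: inj_on_def mod_Suc split: if_splits)
  moreover have "(\<lambda>i. Suc i mod n) ` {..<n} \<subseteq> {..<n}" using n by auto
  ultimately show ?thesis by (simp add: bij_betw_def endo_inj_surj)
qed

lemma simple_polygon_rotate1:
  assumes "simple_polygon vs"
  shows "simple_polygon (rotate1 vs)" "polygon (rotate1 vs) = polygon vs"
proof -
  let ?n = "length vs"
  have n: "?n \<ge> 3" and e: "\<And>i j. i < ?n \<Longrightarrow> j < ?n \<Longrightarrow> i \<noteq> j \<Longrightarrow> edge vs i \<inter> edge vs j = edge_ends vs i \<inter> edge_ends vs j"
    using assms by (auto simp: simple_polygon_def)
  then have b: "bij_betw (\<lambda>i. Suc i mod ?n) {..<?n} {..<?n}" by (intro bij_Suc_mod) linarith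
  show "simple_polygon (rotate1 vs)"
    unfolding simple_polygon_def
  proof (intro conjI allI impI)
    fix i j assume ij: "i < length (rotate1 vs)" "j < length (rotate1 vs)" "i \<noteq> j"
    then have "Suc i mod ?n \<noteq> Suc j mod ?n" using b by (auto simp: bij_betw_def inj_on_def)
    then show "edge (rotate1 vs) i \<inter> edge (rotate1 vs) j = edge_ends (rotate1 vs) i \<inter> edge_ends (rotate1 vs) j"
      using ij e[of "Suc i mod ?n" "Suc j mod ?n", OF mod_less_divisor mod_less_divisor] n
      by (simp add: edge_rotate1, metis gr_zeroI less_zeroE list.size(3) not_numeral_le_zero)
  qed (use assms in \<open>auto simp: simple_polygon_def\<close>)
  have "polygon (rotate1 vs) = (\<Union>i\<in>(\<lambda>i. Suc i mod ?n) ` {..<?n}. edge vs i)"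
    by (simp add: polygon_def edge_rotate1)
  moreover have "(\<lambda>i. Suc i mod ?n) ` {..<?n} = {..<?n}" using b by (simp add: bij_betw_def)
  ultimately show "polygon (rotate1 vs) = polygon vs" by (simp only: polygon_def)
qed

lemma simple_polygon_rotate:
  "simple_polygon vs \<Longrightarrow> simple_polygon (rotate k vs) \<and> polygon (rotate k vs) = polygon vs"
  by (induction k) (auto simp: simple_polygon_rotate1)

lemma simple_polygon_merge:
  assumes s: "simple_polygon (a # b # c # xs)" and b: "b \<in> closed_segment a c"
  shows "simple_polygon (a # c # xs)" "polygon (a # c # xs) = polygon (a # b # c # xs)"
proof -
  let ?vs = "a # b # c # xs" and ?ws = "a # c # xs"
  let ?n = "length ?ws"
  have e: "\<And>i j. i < Suc ?n \<Longrightarrow> j < Suc ?n \<Longrightarrow> i \<noteq> j \<Longrightarrow> edge ?vs i \<inter> edge ?vs j = edge_ends ?vs i \<inter> edge_ends ?vs j"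
    and d: "distinct ?vs" using s by (auto simp: simple_polygon_def)
  have e0: "edge ?ws 0 = edge ?vs 0 \<union> edge ?vs 1"
    using b Un_closed_segment[of b a c] by (simp add: edge_def)
  have ends0: "edge_ends ?ws 0 = {a, c}" "edge_ends ?vs 0 = {a, b}" "edge_ends ?vs 1 = {b, c}"
    by (auto simp: edge_ends_def)
  have wrap: "?ws ! (Suc i mod ?n) = ?vs ! (Suc (Suc i) mod Suc ?n)" if "0 < i" "i < ?n" for i
    using that by (cases "Suc i = ?n") (auto simp: nth_Cons split: nat.splits)
  have nth: "?ws ! i = ?vs ! Suc i" if "0 < i" for i
    using that by (cases i) auto
  have ei: "edge ?ws i = edge ?vs (Suc i)" "edge_ends ?ws i = edge_ends ?vs (Suc i)" if "0 < i" "i < ?n" for i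
    using wrap[OF that] nth[OF that(1)] by (simp_all add: edge_def edge_ends_def)
  \<comment> \<open>In a triangle a vertex between the other two would lie on the opposite edge,
    against simplicity; so three vertices remain.\<close>
  have xs: "xs \<noteq> []"
  proof
    assume [simp]: "xs = []"
    have 1: "edge ?vs 0 \<inter> edge ?vs 2 = edge_ends ?vs 0 \<inter> edge_ends ?vs 2" by (rule e) auto
    have 2: "edge ?vs 2 = closed_segment c a" "edge_ends ?vs 2 = {c, a}" "edge ?vs 0 = closed_segment a b"
      by (simp_all add: edge_def edge_ends_def)
    have "b \<in> edge ?vs 0 \<inter> edge ?vs 2" unfolding 2 using b by (simp add: closed_segment_commute)
    then show False unfolding 1 using d 2 ends0 by auto
  qed
  have bnot: "b \<notin> edge_ends ?vs (Suc i)" if "0 < i" "i < ?n" for i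
  proof -
    have "?vs ! Suc i \<noteq> ?vs ! 1" using d that by (subst nth_eq_iff_index_eq) auto
    moreover have "?vs ! (Suc (Suc i) mod Suc ?n) \<noteq> ?vs ! 1"
      using d that by (subst nth_eq_iff_index_eq) (auto simp: mod_Suc)
    ultimately show ?thesis by (auto simp: edge_ends_def)
  qed
  have case0: "edge ?ws 0 \<inter> edge ?ws j = edge_ends ?ws 0 \<inter> edge_ends ?ws j" if j: "0 < j" "j < ?n" for j
  proof -
    have "edge ?ws 0 \<inter> edge ?ws j = (edge ?vs 0 \<inter> edge ?vs (Suc j)) \<union> (edge ?vs 1 \<inter> edge ?vs (Suc j))"
      unfolding e0 ei[OF j] by blast
    also have "\<dots> = ({a, b} \<union> {b, c}) \<inter> edge_ends ?vs (Suc j)"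
      using e[of 0 "Suc j"] e[of 1 "Suc j"] j ends0 by auto
    also have "\<dots> = {a, c} \<inter> edge_ends ?vs (Suc j)" using bnot[OF j] by auto
    finally show ?thesis using ends0 ei[OF j] by simp
  qed
  show "simple_polygon ?ws" unfolding simple_polygon_def
  proof (intro conjI allI impI)
    show "3 \<le> length ?ws" using xs by (cases xs) auto
    show "distinct ?ws" using d by auto
    fix i j assume ij: "i < ?n" "j < ?n" "i \<noteq> j"
    consider "i = 0" | "j = 0" | "0 < i" "0 < j" by linarith
    then show "edge ?ws i \<inter> edge ?ws j = edge_ends ?ws i \<inter> edge_ends ?ws j"
    proof cases
      case 1 then show ?thesis using case0[of j] ij by simp
    next
      case 2 then show ?thesis using case0[of i] ij by (simp add: Int_commute)
    next
      case 3 then show ?thesis using ei[of i] ei[of j] e[of "Suc i" "Suc j"] ij by simp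
    qed
  qed
  have "{..<?n} = insert 0 {i. 0 < i \<and> i < ?n}" "{..<Suc ?n} = insert 0 (insert 1 (Suc ` {i. 0 < i \<and> i < ?n}))"
    by (auto simp: less_Suc_eq_0_disj)
  then show "polygon ?ws = polygon ?vs" unfolding polygon_def using e0 ei by auto
qed

text \<open>No straight angles. Simplicity excludes that an edge folds back on the previous one, so
  the edges of a simple reduced polygon are maximal segments.\<close>

definition reduced :: "(real^3) list \<Rightarrow> bool" where
  "reduced vs \<longleftrightarrow> (\<forall>i<length vs. vs ! (Suc i mod length vs) \<notin>
     closed_segment (vs ! i) (vs ! (Suc (Suc i) mod length vs)))"

text \<open>A shortest vertex list with the given point set is reduced, since a straight vertex
  could be dropped from it.\<close>

lemma obtain_reduced:
  assumes "simple_polygon vs"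
  obtains ws where "simple_polygon ws" "reduced ws" "polygon ws = polygon vs" "set ws \<subseteq> set vs"
proof -
  let ?P = "\<lambda>ws. simple_polygon ws \<and> polygon ws = polygon vs \<and> set ws \<subseteq> set vs"
  obtain ws where ws: "?P ws" "\<And>ys. ?P ys \<Longrightarrow> length ws \<le> length ys"
    using ex_has_least_nat[of ?P vs length] assms by auto
  have "reduced ws" unfolding reduced_def
  proof (intro allI impI notI)
    let ?n = "length ws"
    fix i assume i: "i < ?n" and b: "ws ! (Suc i mod ?n) \<in> closed_segment (ws ! i) (ws ! (Suc (Suc i) mod ?n))"
    have n: "?n \<ge> 3" using ws(1) by (simp add: simple_polygon_def)
    \<comment> \<open>Rotated so that the straight vertex stands in the second place.\<close>
    let ?r = "rotate i ws"
    have r: "simple_polygon ?r" "polygon ?r = polygon vs" using simple_polygon_rotate ws(1) by auto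
    obtain a b' c xs where abc: "?r = a # b' # c # xs"
      using n by (cases ?r; cases "tl ?r"; cases "tl (tl ?r)") (auto dest: arg_cong[where f = length])
    have "a = ws ! i" "b' = ws ! (Suc i mod ?n)" "c = ws ! (Suc (Suc i) mod ?n)"
      using nth_rotate[of 0 ws i] nth_rotate[of 1 ws i] nth_rotate[of 2 ws i] n i abc
      by (simp_all, metis gr_zeroI less_zeroE list.size(3) not_numeral_le_zero)
    moreover have "set (a # c # xs) \<subseteq> set vs"
      using ws(1) arg_cong[OF abc, of set] by auto
    ultimately have "?P (a # c # xs)"
      using simple_polygon_merge[of a b' c xs] b r abc by auto
    then have "length ws \<le> length (a # c # xs)" by (rule ws(2))
    then show False using arg_cong[OF abc, of length] by simp
  qed
  then show ?thesis using that ws(1) by blast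
qed

section \<open>Maximal segments in a union of segments\<close>

lemma segment_start_in_union:
  fixes b q :: "'a::real_normed_vector"
  assumes "finite F" "\<And>f. f \<in> F \<Longrightarrow> closed f \<and> convex f" "closed_segment b q \<subseteq> \<Union>F" "b \<noteq> q"
  shows "\<exists>f\<in>F. \<exists>x\<in>closed_segment b q. x \<noteq> b \<and> closed_segment b x \<subseteq> f"
proof -
  \<comment> \<open>The finitely many closed members that miss \<open>b\<close> leave a ball about
    \<open>b\<close> free. A short initial piece therefore ends in a member that contains
    \<open>b\<close>, and convexity puts the whole piece into it.\<close>
  let ?U = "\<Union>{f \<in> F. b \<notin> f}"
  have "closed ?U" using assms(1,2) by (intro closed_Union) auto
  moreover have "b \<notin> ?U" by auto
  ultimately obtain e where e: "e > 0" "ball b e \<subseteq> - ?U"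
    by (meson ComplI openE open_Compl)
  define t where "t = min 1 (e / (2 * norm (q - b)))"
  have nq: "norm (q - b) > 0" using assms(4) by simp
  have t: "0 < t" "t \<le> 1" "t * norm (q - b) < e"
  proof -
    show "0 < t" "t \<le> 1" using e nq by (auto simp: t_def)
    have "t * norm (q - b) \<le> e / (2 * norm (q - b)) * norm (q - b)"
      using nq by (intro mult_right_mono) (auto simp: t_def)
    also have "\<dots> < e" using nq e by simp
    finally show "t * norm (q - b) < e" .
  qed
  define x where "x = b + t *\<^sub>R (q - b)"
  have "dist b x = t * norm (q - b)" using t by (simp add: x_def dist_norm)
  then have x: "x \<in> closed_segment b q" "x \<noteq> b" "x \<in> ball b e"
    using t nq assms(4) by (auto simp: x_def closed_segment_def algebra_simps intro!: exI[of _ t])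
  obtain f where f: "f \<in> F" "x \<in> f" using x assms(3) by blast
  then have "b \<in> f" using e x by blast
  then have "closed_segment b x \<subseteq> f" using f assms(2) by (simp add: closed_segment_subset)
  then show ?thesis using f x by blast
qed

lemma between_extend:
  fixes a b c x :: "'a::real_vector"
  assumes "b \<in> closed_segment a x" "x \<in> closed_segment b c" "x \<noteq> b"
  shows "b \<in> closed_segment a c"
proof -
  obtain t where t: "0 \<le> t" "t \<le> 1" "b = (1 - t) *\<^sub>R a + t *\<^sub>R x" using assms(1) by (auto simp: closed_segment_def)
  obtain s where s: "0 \<le> s" "s \<le> 1" "x = (1 - s) *\<^sub>R b + s *\<^sub>R c" using assms(2) by (auto simp: closed_segment_def)
  have s0: "s > 0" using s assms(3) by (cases "s = 0") auto
  let ?d = "1 - t * (1 - s)"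
  have d: "?d > 0"
  proof -
    have "t * (1 - s) \<le> 1 * (1 - s)" using t s by (intro mult_right_mono) auto
    then show ?thesis using s0 by simp
  qed
  have "b = (1 - t) *\<^sub>R a + (t * (1 - s)) *\<^sub>R b + (t * s) *\<^sub>R c"
    using t(3) unfolding s(3) by (simp add: algebra_simps)
  then have "?d *\<^sub>R b = (1 - t) *\<^sub>R a + (t * s) *\<^sub>R c" by (simp add: algebra_simps)
  then have "b = (1 / ?d) *\<^sub>R ((1 - t) *\<^sub>R a + (t * s) *\<^sub>R c)" using d by (metis divide_self_if less_irrefl scaleR_one scaleR_scaleR times_divide_eq_left mult_1)
  also have "\<dots> = (1 - t * s / ?d) *\<^sub>R a + (t * s / ?d) *\<^sub>R c"
  proof -
    have "(1 - t) / ?d = 1 - t * s / ?d" using d by (simp add: field_simps)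
    then show ?thesis by (simp add: scaleR_add_right)
  qed
  finally have "b = (1 - t * s / ?d) *\<^sub>R a + (t * s / ?d) *\<^sub>R c" .
  moreover have "0 \<le> t * s / ?d" "t * s / ?d \<le> 1" using t s d by (auto simp: field_simps)
  ultimately show ?thesis unfolding closed_segment_def by blast
qed

lemma between_shrink:
  fixes a b y z :: "'a::real_vector"
  assumes "b \<in> closed_segment a y" "z \<in> closed_segment b y"
  shows "b \<in> closed_segment a z"
proof -
  obtain t where t: "0 \<le> t" "t \<le> 1" "b = a + t *\<^sub>R (y - a)"
    using assms(1) by (auto simp: closed_segment_def algebra_simps)
  obtain s where s: "0 \<le> s" "s \<le> 1" "z = b + s *\<^sub>R (y - b)"
    using assms(2) by (auto simp: closed_segment_def algebra_simps)
  show ?thesis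
  proof (cases "t = 0")
    case True then show ?thesis using t by simp
  next
    case False
    let ?d = "t + s * (1 - t)"
    have d: "?d > 0" using False t s by (simp add: add_pos_nonneg)
    have z: "z = a + ?d *\<^sub>R (y - a)" unfolding s(3) t(3) by (simp add: algebra_simps)
    have "b = a + (t / ?d) *\<^sub>R (z - a)" unfolding z t(3) using d by simp
    then have "b = (1 - t / ?d) *\<^sub>R a + (t / ?d) *\<^sub>R z" by (simp add: algebra_simps)
    moreover have "0 \<le> s * (1 - t)" using t s by simp
    then have "0 \<le> t / ?d" "t / ?d \<le> 1" using t(1) d by (simp_all add: divide_le_eq)
    ultimately show ?thesis unfolding closed_segment_def by blast
  qed
qed

lemma in_segment_line:
  fixes u v p x y :: "'a::real_vector"
  assumes "p \<in> closed_segment u v" "x \<in> closed_segment u v" "y \<in> closed_segment u v" "p \<noteq> x"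
  obtains r where "y = p + r *\<^sub>R (x - p)"
proof -
  obtain s1 s2 s3 where s: "p = u + s1 *\<^sub>R (v - u)" "x = u + s2 *\<^sub>R (v - u)" "y = u + s3 *\<^sub>R (v - u)"
    using assms by (auto simp: closed_segment_def algebra_simps)
  have "s1 \<noteq> s2" using s assms(4) by auto
  have "y = p + ((s3 - s1) / (s2 - s1)) *\<^sub>R (x - p)"
  proof -
    have "x - p = (s2 - s1) *\<^sub>R (v - u)" "y - p = (s3 - s1) *\<^sub>R (v - u)" unfolding s by (simp_all add: algebra_simps)
    then have "y - p = ((s3 - s1) / (s2 - s1)) *\<^sub>R (x - p)" using \<open>s1 \<noteq> s2\<close> by simp
    then show ?thesis by (simp add: algebra_simps)
  qed
  then show ?thesis by (rule that)
qed

lemma between_end: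
  fixes a b p y :: "'a::real_vector"
  assumes "p \<in> closed_segment a b" "y = a + m *\<^sub>R (b - a)" "m > 1"
  shows "b \<in> closed_segment p y" "b \<in> closed_segment a y"
proof -
  obtain s where s: "0 \<le> s" "s \<le> 1" "p = a + s *\<^sub>R (b - a)"
    using assms(1) by (auto simp: closed_segment_def algebra_simps)
  have gen: "b \<in> closed_segment (a + s *\<^sub>R (b - a)) y" if "0 \<le> s" "s \<le> 1" for s
  proof -
    let ?t = "(1 - s) / (m - s)"
    have ms: "m - s > 0" using that assms(3) by simp
    have "(1 - r) * s + r * m = s + r * (m - s)" for r by (simp add: algebra_simps)
    then have "(1 - ?t) * s + ?t * m = s + ?t * (m - s)" .
    moreover have "?t * (m - s) = 1 - s" using ms by simp
    ultimately have "(1 - ?t) * s + ?t * m = 1" by linarith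
    have "(1 - r) *\<^sub>R (a + s *\<^sub>R (b - a)) + r *\<^sub>R y = a + ((1 - r) * s + r * m) *\<^sub>R (b - a)" for r
      unfolding assms(2) by (simp add: algebra_simps)
    then have "(1 - ?t) *\<^sub>R (a + s *\<^sub>R (b - a)) + ?t *\<^sub>R y = a + ((1 - ?t) * s + ?t * m) *\<^sub>R (b - a)" .
    also have "\<dots> = b" unfolding \<open>(1 - ?t) * s + ?t * m = 1\<close> by simp
    finally have "b = (1 - ?t) *\<^sub>R (a + s *\<^sub>R (b - a)) + ?t *\<^sub>R y" by simp
    moreover have "0 \<le> ?t" "?t \<le> 1" using that ms assms(3) by (auto simp: field_simps)
    ultimately show ?thesis unfolding closed_segment_def by blast
  qed
  show "b \<in> closed_segment p y" using gen[of s] s by simp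
  show "b \<in> closed_segment a y" using gen[of 0] by simp
qed

text \<open>Abstracts the edges of a reduced link: different segments meet only in a common end, and
  there they do not continue each other in a straight line.\<close>

definition unbent :: "(real^3) set set \<Rightarrow> bool" where
  "unbent E \<longleftrightarrow> finite E \<and> (\<forall>e\<in>E. line_segment e) \<and>
    (\<forall>e\<in>E. \<forall>f\<in>E. \<forall>b. e \<noteq> f \<and> b \<in> e \<and> b \<in> f \<longrightarrow>
       (\<exists>a c. e = closed_segment b a \<and> f = closed_segment b c \<and> b \<notin> closed_segment a c))"

text \<open>Two common points put \<open>T\<close> on the line of \<open>e\<close>. If
  \<open>T\<close> left \<open>e\<close> at an end \<open>b\<close>, then just beyond
  \<open>b\<close> it would run in another member \<open>f\<close>, which continues \<open>e\<close>
  in a straight line; \<open>unbent\<close> forbids this.\<close>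

lemma segment_absorbed:
  assumes E: "unbent E" and T: "T = closed_segment u v" "T \<subseteq> \<Union>E" and e: "e \<in> E"
    and px: "p \<in> T" "x \<in> T" "p \<in> e" "x \<in> e" "p \<noteq> x"
  shows "T \<subseteq> e"
proof
  fix y assume y: "y \<in> T"
  have conv: "closed f \<and> convex f" if "f \<in> E" for f
    using E that by (auto simp: unbent_def line_segment_def)
  have key: False if ab: "e = closed_segment a b" and m: "y = a + m *\<^sub>R (b - a)" "m > 1" for a b m
  proof -
    have b1: "b \<in> closed_segment p y" "b \<in> closed_segment a y" using between_end m px(3) ab by blast+
    have "b \<in> T" using b1(1) px(1) y T(1) by (meson convex_closed_segment convex_contains_segment subsetD)
    then have sub: "closed_segment b y \<subseteq> T" using y T(1) by (simp add: subset_closed_segment)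
    have bny: "b \<noteq> y"
    proof
      assume "b = y"
      then have "m *\<^sub>R (b - a) = b - a" using m(1) by (metis add_diff_cancel_left')
      then have "(m - 1) *\<^sub>R (b - a) = 0" unfolding scaleR_diff_left by simp
      then have "a = b" using m(2) by auto
      then show False using px ab by auto
    qed
    obtain f z where f: "f \<in> E" "z \<in> closed_segment b y" "z \<noteq> b" "closed_segment b z \<subseteq> f"
      using segment_start_in_union[of E b y] E conv sub T(2) bny by (auto simp: unbent_def) blast
    have bz: "b \<in> closed_segment a z"
      by (rule between_shrink[OF b1(2) f(2)])
    have ne: "z \<notin> e"
    proof
      assume "z \<in> e"
      then have "z \<in> closed_segment a b" using ab by simp
      then have "dist a b = dist a z + dist z b" "dist a z = dist a b + dist b z"
        using bz by (simp_all add: between_mem_segment[symmetric] between)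
      then show False using f(3) by (simp add: dist_commute)
    qed
    then have "e \<noteq> f" using f(4) by auto
    moreover have "b \<in> e" "b \<in> f" using ab f(4) by auto
    ultimately obtain a' c where ac: "e = closed_segment b a'" "f = closed_segment b c" "b \<notin> closed_segment a' c"
      using E e f(1) unfolding unbent_def by metis
    have "a' = a" using ab ac(1) by (metis closed_segment_eq doubleton_eq_iff)
    moreover have "b \<in> closed_segment a c"
      by (rule between_extend[OF bz _ f(3)]) (use f(4) ac(2) in auto)
    ultimately show False using ac(3) by simp
  qed
  obtain a b where ab: "e = closed_segment a b" using E e by (auto simp: unbent_def line_segment_def)
  obtain r where r: "y = p + r *\<^sub>R (x - p)" using in_segment_line px y T(1) by metis
  obtain s1 s2 where s: "p = a + s1 *\<^sub>R (b - a)" "x = a + s2 *\<^sub>R (b - a)"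
    using px(3,4) unfolding ab by (auto simp: closed_segment_def algebra_simps)
  define m where "m = s1 + r * (s2 - s1)"
  have m: "y = a + m *\<^sub>R (b - a)" unfolding r s m_def by (simp add: algebra_simps)
  have m': "y = b + (1 - m) *\<^sub>R (a - b)" unfolding m by (simp add: algebra_simps)
  show "y \<in> e"
  proof (rule ccontr)
    assume "y \<notin> e"
    moreover have "y \<in> e" if "0 \<le> m" "m \<le> 1"
      unfolding ab closed_segment_def using that m by (auto simp: algebra_simps intro!: exI[of _ m])
    ultimately have "m > 1 \<or> 1 - m > 1" by linarith
    then show False using key[OF ab m] key[OF _ m'] ab by (metis closed_segment_commute)
  qed
qed

lemma sticks_unbent:
  assumes E: "unbent E"
  shows "sticks (\<Union>E) = E"
proof (intro equalityI subsetI)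
  fix e assume e: "e \<in> E"
  obtain a b where ab: "e = closed_segment a b" "a \<noteq> b" using E e by (auto simp: unbent_def line_segment_def)
  show "e \<in> sticks (\<Union>E)" unfolding sticks_def
  proof (intro CollectI conjI allI impI)
    show "line_segment e" using E e by (simp add: unbent_def)
    show "e \<subseteq> \<Union>E" using e by blast
    fix T assume T: "line_segment T \<and> e \<subseteq> T \<and> T \<subseteq> \<Union>E"
    then obtain u v where uv: "T = closed_segment u v" by (auto simp: line_segment_def)
    have "T \<subseteq> e" using segment_absorbed[OF E uv _ e, of a b] T ab by auto
    then show "T = e" using T by blast
  qed
next
  fix S assume S: "S \<in> sticks (\<Union>E)"
  then have "line_segment S" and SE: "S \<subseteq> \<Union>E"
    and mx: "\<And>T. line_segment T \<Longrightarrow> S \<subseteq> T \<Longrightarrow> T \<subseteq> \<Union>E \<Longrightarrow> T = S"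
    unfolding sticks_def by simp_all
  then obtain p q where "S = closed_segment p q" "p \<noteq> q" unfolding line_segment_def by metis
  note pq = this SE
  have conv: "closed f \<and> convex f" if "f \<in> E" for f
    using E that by (auto simp: unbent_def line_segment_def)
  obtain f x where f: "f \<in> E" "x \<in> closed_segment p q" "x \<noteq> p" "closed_segment p x \<subseteq> f"
    using segment_start_in_union[of E p q] E conv pq by (auto simp: unbent_def)
  have "S \<subseteq> f" using segment_absorbed[OF E pq(1,3) f(1), of p x] f pq by auto
  then have "f = S" using mx[of f] f(1) E by (auto simp: unbent_def)
  then show "S \<in> E" using f by simp
qed

lemma edge_line_segment:
  assumes "simple_polygon vs" "i < length vs"
  shows "line_segment (edge vs i)" "vs ! i \<noteq> vs ! (Suc i mod length vs)"
proof -
  have dl: "distinct vs" "length vs \<ge> 3" using assms(1) by (auto simp: simple_polygon_def)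
  moreover have "i \<noteq> Suc i mod length vs" using assms(2) dl by (cases "Suc i = length vs") auto
  moreover have "Suc i mod length vs < length vs" using dl by (intro mod_less_divisor) linarith
  ultimately show "vs ! i \<noteq> vs ! (Suc i mod length vs)" using assms(2) by (simp add: nth_eq_iff_index_eq)
  then show "line_segment (edge vs i)" by (auto simp: line_segment_def edge_def)
qed

lemma inj_edge:
  assumes "simple_polygon vs"
  shows "inj_on (edge vs) {..<length vs}"
proof (rule inj_onI, rule ccontr)
  fix i j assume ij: "i \<in> {..<length vs}" "j \<in> {..<length vs}" "edge vs i = edge vs j" "i \<noteq> j"
  then have "edge vs i = edge_ends vs i \<inter> edge_ends vs j" using assms by (auto simp: simple_polygon_def)
  then have "finite (edge vs i)" by (simp add: edge_ends_def)
  then show False using edge_line_segment[OF assms] ij by (auto simp: edge_def)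
qed

theorem stick_number_reduced:
  assumes vs: "simple_polygon vs" "reduced vs" and ws: "simple_polygon ws" "reduced ws"
    and d: "polygon vs \<inter> polygon ws = {}"
  shows "stick_number (polygon vs \<union> polygon ws) = length vs + length ws"
proof -
  let ?A = "edge vs ` {..<length vs}" and ?B = "edge ws ` {..<length ws}"
  have corner: "\<exists>a c. edge us i = closed_segment b a \<and> edge us j = closed_segment b c \<and> b \<notin> closed_segment a c"
    if us: "simple_polygon us" "reduced us" and ij: "i < length us" "j < length us" "i \<noteq> j"
      and b: "b \<in> edge us i" "b \<in> edge us j" for us i j b
  proof -
    let ?n = "length us"
    have n: "?n \<ge> 3" and dis: "distinct us" using us(1) by (auto simp: simple_polygon_def)
    have "b \<in> edge_ends us i \<inter> edge_ends us j" using b us(1) ij by (auto simp: simple_polygon_def)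
    moreover have "us ! i \<noteq> us ! j" using dis ij by (simp add: nth_eq_iff_index_eq)
    moreover have n0: "?n > 0" using n by linarith
    then have lt: "Suc k mod ?n < ?n" for k by (rule mod_less_divisor)
    have "Suc i mod ?n \<noteq> Suc j mod ?n"
      using ij bij_Suc_mod[OF n0] unfolding bij_betw_def inj_on_def by blast
    then have "us ! (Suc i mod ?n) \<noteq> us ! (Suc j mod ?n)"
      using dis lt by (simp add: nth_eq_iff_index_eq)
    ultimately have "b = us ! i \<and> us ! i = us ! (Suc j mod ?n) \<or> b = us ! j \<and> us ! j = us ! (Suc i mod ?n)"
      by (auto simp: edge_ends_def)
    then show ?thesis
    proof (elim disjE conjE)
      assume b: "b = us ! i" "us ! i = us ! (Suc j mod ?n)"
      then have i: "i = Suc j mod ?n" using dis ij lt by (simp add: nth_eq_iff_index_eq)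
      have "us ! (Suc j mod ?n) \<notin> closed_segment (us ! j) (us ! (Suc (Suc j) mod ?n))"
        using us(2) ij by (simp add: reduced_def)
      moreover have "Suc i mod ?n = Suc (Suc j) mod ?n" unfolding i by (simp add: mod_Suc_eq)
      ultimately show ?thesis unfolding edge_def b(1) using b(2)
        by (metis closed_segment_commute i)
    next
      assume b: "b = us ! j" "us ! j = us ! (Suc i mod ?n)"
      then have j: "j = Suc i mod ?n" using dis ij lt by (simp add: nth_eq_iff_index_eq)
      have "us ! (Suc i mod ?n) \<notin> closed_segment (us ! i) (us ! (Suc (Suc i) mod ?n))"
        using us(2) ij by (simp add: reduced_def)
      moreover have "Suc j mod ?n = Suc (Suc i) mod ?n" unfolding j by (simp add: mod_Suc_eq)
      ultimately show ?thesis unfolding edge_def b(1) using b(2)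
        by (metis closed_segment_commute j)
    qed
  qed
  have sub: "e \<subseteq> polygon vs" if "e \<in> ?A" for e using that by (auto simp: polygon_def)
  have sub': "e \<subseteq> polygon ws" if "e \<in> ?B" for e using that by (auto simp: polygon_def)
  have "unbent (?A \<union> ?B)" unfolding unbent_def
  proof (intro conjI ballI allI impI)
    show "line_segment e" if "e \<in> ?A \<union> ?B" for e
      using that edge_line_segment(1)[OF vs(1)] edge_line_segment(1)[OF ws(1)] by auto
    fix e f b assume e: "e \<in> ?A \<union> ?B" and f: "f \<in> ?A \<union> ?B" and b: "e \<noteq> f \<and> b \<in> e \<and> b \<in> f"
    consider "e \<in> ?A" "f \<in> ?A" | "e \<in> ?B" "f \<in> ?B"
      using e f b sub sub' d by blast
    then show "\<exists>a c. e = closed_segment b a \<and> f = closed_segment b c \<and> b \<notin> closed_segment a c"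
    proof cases
      case 1 then show ?thesis using corner[OF vs] b by auto
    next
      case 2 then show ?thesis using corner[OF ws] b by auto
    qed
  qed simp
  moreover have "polygon vs \<union> polygon ws = \<Union>(?A \<union> ?B)" by (auto simp: polygon_def)
  ultimately have "sticks (polygon vs \<union> polygon ws) = ?A \<union> ?B" using sticks_unbent by metis
  moreover have "?A \<inter> ?B = {}"
  proof (rule ccontr)
    assume "?A \<inter> ?B \<noteq> {}"
    then obtain e where "e \<in> ?A" "e \<in> ?B" by blast
    then have "e \<subseteq> {}" using sub sub' d by blast
    then show False using \<open>e \<in> ?A\<close> by (auto simp: edge_def)
  qed
  moreover have "card ?A = length vs" "card ?B = length ws"
    using inj_edge[OF vs(1)] inj_edge[OF ws(1)] by (simp_all add: card_image)
  ultimately show ?thesis unfolding stick_number_def by (simp add: card_Un_disjoint)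
qed

section \<open>Crossings with a rectangle\<close>

definition rect :: "real^3 \<Rightarrow> real^3 \<Rightarrow> real^3 \<Rightarrow> (real^3) list" where
  "rect v a b = [v, v + a, v + a + b, v + b]"

definition rtrace :: "real^3 \<Rightarrow> real^3 \<Rightarrow> real^3 \<Rightarrow> real^3 \<Rightarrow> complex" where
  "rtrace v a b p = spin_trace (map (\<lambda>u. u - p) (rect v a b))"

definition height :: "real^3 \<Rightarrow> real^3 \<Rightarrow> real^3 \<Rightarrow> real^3 \<Rightarrow> real" where
  "height v a b p = (p - v) \<bullet> cross3 a b"

definition inside_rect :: "real^3 \<Rightarrow> real^3 \<Rightarrow> real^3 \<Rightarrow> real^3 \<Rightarrow> bool" where
  "inside_rect v a b p \<longleftrightarrow> 0 < (p - v) \<bullet> a \<and> (p - v) \<bullet> a < a \<bullet> a \<and> 0 < (p - v) \<bullet> b \<and> (p - v) \<bullet> b < b \<bullet> b"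

definition outside_rect :: "real^3 \<Rightarrow> real^3 \<Rightarrow> real^3 \<Rightarrow> real^3 \<Rightarrow> bool" where
  "outside_rect v a b p \<longleftrightarrow> (p - v) \<bullet> a < 0 \<or> a \<bullet> a < (p - v) \<bullet> a \<or> (p - v) \<bullet> b < 0 \<or> b \<bullet> b < (p - v) \<bullet> b"

lemma spin_trace_4_Im:
  "Im (spin_trace [w1, w2, w3, w4]) = 2 * (norm w1 * (w2 \<bullet> cross3 w3 w4) + norm w2 * (w1 \<bullet> cross3 w3 w4)
     + norm w3 * (w1 \<bullet> cross3 w2 w4) + norm w4 * (w1 \<bullet> cross3 w2 w3))"
  by (simp add: spin_trace_def spin_act_def inner_3 cross3_def algebra_simps)

lemma spin_trace_4_Re:
  "Re (spin_trace [w1, w2, w3, w4]) = 2 * (norm w1 * norm w2 * norm w3 * norm w4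
     + norm w3 * norm w4 * (w1 \<bullet> w2) + norm w2 * norm w4 * (w1 \<bullet> w3) + norm w2 * norm w3 * (w1 \<bullet> w4)
     + norm w1 * norm w4 * (w2 \<bullet> w3) + norm w1 * norm w3 * (w2 \<bullet> w4) + norm w1 * norm w2 * (w3 \<bullet> w4)
     + (w1 \<bullet> w2) * (w3 \<bullet> w4) - (w1 \<bullet> w3) * (w2 \<bullet> w4) + (w1 \<bullet> w4) * (w2 \<bullet> w3))"
  by (simp add: spin_trace_def spin_act_def inner_3 algebra_simps)

text \<open>Seen from \<open>p\<close>, all four triples of vertices of a parallelogram have the
  same triple product, so in the plane of the rectangle the trace is real, and elsewhere its
  imaginary part tells the side.\<close>

lemma rtrace_Im:
  "Im (rtrace v a b p) = - 2 * (norm (v - p) + norm (v + a - p) + norm (v + a + b - p) + norm (v + b - p)) * height v a b p"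
proof -
  define w where "w = v - p"
  have w: "v + a - p = w + a" "v + a + b - p = w + a + b" "v + b - p = w + b" by (simp_all add: w_def algebra_simps)
  have d: "(w + a) \<bullet> cross3 (w + a + b) (w + b) = w \<bullet> cross3 a b"
    "w \<bullet> cross3 (w + a + b) (w + b) = w \<bullet> cross3 a b"
    "w \<bullet> cross3 (w + a) (w + b) = w \<bullet> cross3 a b"
    "w \<bullet> cross3 (w + a) (w + a + b) = w \<bullet> cross3 a b"
    by (simp_all add: inner_3 cross3_def algebra_simps)
  have h: "height v a b p = - (w \<bullet> cross3 a b)" by (simp add: height_def w_def inner_diff_left)
  show ?thesis unfolding rtrace_def rect_def list.map w_def[symmetric] w spin_trace_4_Im d h
    by (simp add: algebra_simps)
qed

lemma norm_sum_pos:
  assumes "a \<noteq> 0"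
  shows "norm (v - p) + norm (v + a - p) + norm (v + a + b - p) + norm (v + b - p) > (0::real)"
proof -
  have "norm (v - p) + norm (v + a - p) \<noteq> 0"
  proof
    assume "norm (v - p) + norm (v + a - p) = 0"
    then have "norm (v - p) = 0 \<and> norm (v + a - p) = 0"
      by (simp only: add_nonneg_eq_0_iff[OF norm_ge_zero norm_ge_zero])
    then show False using assms by (metis add_cancel_right_right eq_iff_diff_eq_0 norm_eq_zero)
  qed
  then have "norm (v - p) + norm (v + a - p) > 0" by (simp add: order_neq_le_trans)
  then show ?thesis by (simp add: add_pos_nonneg)
qed

lemma rtrace_Im_sign:
  assumes "a \<noteq> 0"
  shows "Im (rtrace v a b p) < 0 \<longleftrightarrow> height v a b p > 0" "Im (rtrace v a b p) > 0 \<longleftrightarrow> height v a b p < 0"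
    "Im (rtrace v a b p) = 0 \<longleftrightarrow> height v a b p = 0"
  using norm_sum_pos[OF assms, of v p b] unfolding rtrace_Im
  by (auto simp: mult_less_0_iff zero_less_mult_iff)

lemma plane_coords:
  fixes a b :: "real^3"
  assumes ab: "a \<bullet> b = 0" "a \<noteq> 0" "b \<noteq> 0" and h: "x \<bullet> cross3 a b = 0"
  shows "x = ((x \<bullet> a) / (a \<bullet> a)) *\<^sub>R a + ((x \<bullet> b) / (b \<bullet> b)) *\<^sub>R b"
proof -
  define y where "y = x - (((x \<bullet> a) / (a \<bullet> a)) *\<^sub>R a + ((x \<bullet> b) / (b \<bullet> b)) *\<^sub>R b)"
  have y: "y \<bullet> a = 0" "y \<bullet> b = 0" "y \<bullet> cross3 a b = 0"
    using ab h by (simp_all add: y_def inner_diff_left inner_add_left inner_commute[of b a] dot_cross_self)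
  have "(norm (cross3 a b))\<^sup>2 = (norm a * norm b)\<^sup>2" using norm_cross_dot[of a b] ab by simp
  then have "cross3 a b \<noteq> 0" using ab by auto
  have "norm (cross3 (cross3 a b) y) ^ 2 = (norm (cross3 a b) * norm y)^2 - (cross3 a b \<bullet> y)^2"
    using norm_cross_dot[of "cross3 a b" y] by (simp add: algebra_simps)
  moreover have "cross3 (cross3 a b) y = 0"
    using Lagrange[of y a b] y cross_skew[of "cross3 a b" y] by (simp add: inner_commute)
  ultimately have "norm (cross3 a b) * norm y = 0" using y by (simp add: inner_commute)
  then have "y = 0" using \<open>cross3 a b \<noteq> 0\<close> by simp
  then show ?thesis by (simp add: y_def)
qed

lemma sign_constant:
  fixes f :: "real \<Rightarrow> real"
  assumes "continuous_on {0..1} f" "\<And>t. t \<in> {0..1} \<Longrightarrow> f t \<noteq> 0"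
  shows "f 0 > 0 \<longleftrightarrow> f 1 > 0"
proof -
  have c: "connected (f ` {0..1})" using assms(1) by (intro connected_continuous_image) auto
  have m: "f 0 \<in> f ` {0..1}" "f 1 \<in> f ` {0..1}" by auto
  have n: "0 \<notin> f ` {0..1}" using assms(2) by (metis imageE)
  have "\<not> (f 0 \<le> 0 \<and> 0 \<le> f 1)" "\<not> (f 1 \<le> 0 \<and> 0 \<le> f 0)"
    using connectedD_interval[OF c m, of 0] connectedD_interval[OF c m(2,1), of 0] n by auto
  then show ?thesis by linarith
qed

text \<open>In the plane of the rectangle the trace is real, and off the boundary it is nonzero. So
  its sign does not change while \<open>p\<close> moves to the centre through the interior; there
  its value is \<open>-16 * A * B\<close>.\<close>

lemma rtrace_inside:
  assumes ab: "a \<bullet> b = 0" "a \<noteq> 0" "b \<noteq> 0" and h: "height v a b p = 0" and i: "inside_rect v a b p"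
  shows "Re (rtrace v a b p) < 0"
proof -
  define \<xi> \<zeta> where "\<xi> = ((p - v) \<bullet> a) / (a \<bullet> a)" and "\<zeta> = ((p - v) \<bullet> b) / (b \<bullet> b)"
  have xz: "0 < \<xi>" "\<xi> < 1" "0 < \<zeta>" "\<zeta> < 1" using i ab by (auto simp: \<xi>_def \<zeta>_def inside_rect_def field_simps)
  have p: "p = v + \<xi> *\<^sub>R a + \<zeta> *\<^sub>R b"
    using plane_coords[OF ab, of "p - v"] h by (simp add: height_def \<xi>_def \<zeta>_def algebra_simps)
  define q where "q t = v + ((1 - t) * \<xi> + t / 2) *\<^sub>R a + ((1 - t) * \<zeta> + t / 2) *\<^sub>R b" for t :: real
  let ?f = "\<lambda>t. - Re (rtrace v a b (q t))"
  have c: "continuous_on {0..1} ?f" unfolding rtrace_def q_def by (intro continuous_intros continuous_on_spin_trace) auto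
  have "?f t \<noteq> 0" if t: "t \<in> {0..1}" for t
  proof -
    define x y where "x = (1 - t) * \<xi> + t / 2" and "y = (1 - t) * \<zeta> + t / 2"
    have xy: "0 < x" "x < 1" "0 < y" "y < 1"
    proof -
      have m: "0 < (1 - t) * r + t / 2 \<and> (1 - t) * r + t / 2 < 1" if r: "0 < r" "r < 1" for r :: real
      proof (cases "t = 1")
        case False
        then have t': "0 < 1 - t" "0 \<le> t" using t by auto
        then have "0 < (1 - t) * r" using r by simp
        moreover have "(1 - t) * r < (1 - t) * 1" using t'(1) r by (intro mult_strict_left_mono) auto
        then have "(1 - t) * r + t / 2 < 1 - t / 2" by (simp add: algebra_simps)
        ultimately show ?thesis using t' by (simp add: add_pos_nonneg)
      qed auto
      show "0 < x" "x < 1" "0 < y" "y < 1"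
        using m[of \<xi>] m[of \<zeta>] xz by (simp_all add: x_def y_def)
    qed
    have q: "q t = v + x *\<^sub>R a + y *\<^sub>R b" by (simp add: q_def x_def y_def)
    have "height v a b (q t) = 0"
      unfolding q height_def by (simp add: inner_add_left dot_cross_self)
    then have im: "Im (rtrace v a b (q t)) = 0" by (simp add: rtrace_Im)
    have "q t \<notin> csegs (cyc (rect v a b))"
    proof
      assume "q t \<in> csegs (cyc (rect v a b))"
      then have "\<exists>s. 0 \<le> s \<and> s \<le> 1 \<and> (q t = v + s *\<^sub>R a \<or> q t = v + a + s *\<^sub>R b \<or> q t = v + b + (1 - s) *\<^sub>R a \<or> q t = v + (1 - s) *\<^sub>R b)"
        by (auto simp: rect_def closed_segment_def algebra_simps)
      then obtain s where "q t = v + s *\<^sub>R a \<or> q t = v + a + s *\<^sub>R b \<or> q t = v + b + (1 - s) *\<^sub>R a \<or> q t = v + (1 - s) *\<^sub>R b" by blast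
      then have "(q t - v) \<bullet> b = 0 \<or> (q t - v) \<bullet> a = a \<bullet> a \<or> (q t - v) \<bullet> b = b \<bullet> b \<or> (q t - v) \<bullet> a = 0"
        using ab by (auto simp: inner_add_left inner_commute[of b a])
      then show False unfolding q using ab xy by (auto simp: inner_add_left inner_commute[of b a])
    qed
    then have "rtrace v a b (q t) \<noteq> 0" unfolding rtrace_def by (intro spin_trace_nonzero) (auto simp: rect_def)
    then show ?thesis using im by (simp add: complex_eq_iff)
  qed
  then have "?f 0 > 0 \<longleftrightarrow> ?f 1 > 0" using sign_constant[OF c] by blast
  moreover have "Re (rtrace v a b (q 1)) < 0"
  proof -
    define A B where "A = (a \<bullet> a) / 4" and "B = (b \<bullet> b) / 4"
    have AB: "A > 0" "B > 0" using ab by (simp_all add: A_def B_def)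
    let ?u = "(1/2) *\<^sub>R (a + b)" and ?w = "(1/2) *\<^sub>R (a - b)"
    have e: "map (\<lambda>u. u - q 1) (rect v a b) = [- ?u, ?w, ?u, - ?w]"
      by (simp add: rect_def q_def vec_eq_iff field_simps)
    have i: "?u \<bullet> ?u = A + B" "?w \<bullet> ?w = A + B" "?u \<bullet> ?w = A - B"
      using ab by (simp_all add: A_def B_def inner_add_left inner_add_right inner_diff_left inner_diff_right inner_commute[of b a] field_simps)
    have n: "norm ?u = sqrt (A + B)" "norm ?w = sqrt (A + B)" unfolding norm_eq_sqrt_inner i by simp_all
    define R where "R = sqrt (A + B)"
    have R: "R * R = A + B" using AB by (simp add: R_def)
    have "Re (rtrace v a b (q 1)) = 2 * (R*R*R*R + R*R*(- (A-B)) + R*R*(-(A+B)) + R*R*(A-B)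
       + R*R*(A-B) + R*R*(-(A+B)) + R*R*(-(A-B)) + (-(A-B))*(-(A-B)) - (-(A+B))*(-(A+B)) + (A-B)*(A-B))"
      unfolding rtrace_def e spin_trace_4_Re norm_minus_cancel n R_def[symmetric] inner_minus_left inner_minus_right
        inner_commute[of ?w ?u] i by simp
    also have "\<dots> = -16 * A * B" using R by algebra
    finally show ?thesis using AB by simp
  qed
  moreover have "q 0 = p" by (simp add: q_def p)
  ultimately show ?thesis by simp
qed

text \<open>Beyond one of the sides, some \<open>n\<close> among \<open>a\<close>, \<open>b\<close>
  and their negatives has a positive inner product with all four vertices seen from
  \<open>p\<close>. Contracting these to \<open>n\<close> keeps them in the plane and in an open
  half plane, so the trace stays real and nonzero; in the end it is positive.\<close>

lemma rtrace_outside: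
  assumes ab: "a \<bullet> b = 0" "a \<noteq> 0" "b \<noteq> 0" and h: "height v a b p = 0" and o: "outside_rect v a b p"
  shows "Re (rtrace v a b p) > 0"
proof -
  define w where "w = v - p"
  have wh: "w \<bullet> cross3 a b = 0" using h by (simp add: height_def w_def inner_diff_left)
  obtain n where n: "n = a \<or> n = -a \<or> n = b \<or> n = -b"
    and pos: "w \<bullet> n > 0" "(w + a) \<bullet> n > 0" "(w + a + b) \<bullet> n > 0" "(w + b) \<bullet> n > 0"
  proof -
    have pos: "a \<bullet> a > 0" "b \<bullet> b > 0" using ab by simp_all
    have wv: "(p - v) \<bullet> x = - (w \<bullet> x)" for x by (simp add: w_def inner_diff_left)
    from o consider "w \<bullet> a > 0" | "w \<bullet> a + a \<bullet> a < 0" | "w \<bullet> b > 0" | "w \<bullet> b + b \<bullet> b < 0"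
      unfolding outside_rect_def wv by linarith
    then show ?thesis
    proof cases
      case 1 show ?thesis by (rule that[of a]) (use 1 pos ab in \<open>simp_all add: inner_add_left inner_commute[of b a] del: inner_gt_zero_iff\<close>)
    next
      case 2 show ?thesis by (rule that[of "-a"]) (use 2 pos ab in \<open>simp_all add: inner_add_left inner_commute[of b a] del: inner_gt_zero_iff\<close>)
    next
      case 3 show ?thesis by (rule that[of b]) (use 3 pos ab in \<open>simp_all add: inner_add_left inner_commute[of b a] del: inner_gt_zero_iff\<close>)
    next
      case 4 show ?thesis by (rule that[of "-b"]) (use 4 pos ab in \<open>simp_all add: inner_add_left inner_commute[of b a] del: inner_gt_zero_iff\<close>)
    qed
  qed
  have nn: "n \<noteq> 0" "n \<bullet> n > 0" using n ab by auto
  define W where "W x t = (1 - t) *\<^sub>R x + t *\<^sub>R n" for x and t :: real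
  let ?L = "[w, w + a, w + a + b, w + b]"
  let ?f = "\<lambda>t. Re (spin_trace (map (\<lambda>x. W x t) ?L))"
  have c: "continuous_on {0..1} ?f" unfolding W_def by (intro continuous_intros continuous_on_spin_trace)
  have lp: "x \<in> span {a, b}" if "x \<in> set ?L" for x
  proof -
    have "w \<in> span {a, b}"
      by (subst plane_coords[OF ab wh]) (intro span_add span_scale span_base, auto)
    moreover have "a \<in> span {a, b}" "b \<in> span {a, b}" by (auto intro: span_base)
    ultimately have "w \<in> span {a, b}" "w + a \<in> span {a, b}" "w + a + b \<in> span {a, b}" "w + b \<in> span {a, b}"
      by (simp_all add: span_add)
    then have "set ?L \<subseteq> span {a, b}" by simp
    then show ?thesis using that by (rule subsetD)
  qed
  have np: "n \<in> span {a, b}" using n by (auto intro: span_base span_neg)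
  have pl: "x \<bullet> cross3 y z = 0" if "x \<in> span {a, b}" "y \<in> span {a, b}" "z \<in> span {a, b}" for x y z
  proof -
    have ex: "\<exists>k l. u = k *\<^sub>R a + l *\<^sub>R b" if u: "u \<in> span {a, b}" for u
    proof -
      obtain k where "u - k *\<^sub>R a \<in> span {b}" using u unfolding span_insert by blast
      then obtain l where "u - k *\<^sub>R a = l *\<^sub>R b" unfolding span_singleton by blast
      then have "u = k *\<^sub>R a + l *\<^sub>R b" by (simp add: algebra_simps)
      then show ?thesis by blast
    qed
    note xyz = that
    obtain x1 x2 y1 y2 z1 z2 where e: "x = x1 *\<^sub>R a + x2 *\<^sub>R b" "y = y1 *\<^sub>R a + y2 *\<^sub>R b" "z = z1 *\<^sub>R a + z2 *\<^sub>R b"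
      using ex[OF xyz(1)] ex[OF xyz(2)] ex[OF xyz(3)] by metis
    show ?thesis unfolding e by (simp add: inner_3 cross3_def algebra_simps)
  qed
  have "?f t \<noteq> 0" if t: "t \<in> {0..1}" for t
  proof -
    have Wp: "W x t \<bullet> n > 0" if "x \<bullet> n > 0" for x
      using that t nn unfolding W_def inner_add_left inner_scaleR_left
      by (cases "t = 0") (auto intro!: add_nonneg_pos)
    have seg: "0 \<notin> closed_segment x y" if "x \<bullet> n > 0" "y \<bullet> n > 0" for x y
    proof
      assume "0 \<in> closed_segment x y"
      then obtain s where s: "0 \<le> s" "s \<le> 1" "0 = (1 - s) *\<^sub>R x + s *\<^sub>R y" by (auto simp: closed_segment_def)
      have "0 = ((1 - s) *\<^sub>R x + s *\<^sub>R y) \<bullet> n" using s(3) by simp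
      also have "\<dots> = (1 - s) * (x \<bullet> n) + s * (y \<bullet> n)" by (simp add: inner_add_left)
      also have "\<dots> > 0" using s that by (cases "s = 0") (auto intro!: add_nonneg_pos)
      finally show False by simp
    qed
    have "spin_trace (map (\<lambda>x. W x t) ?L) \<noteq> 0"
      using spin_trace_nonzero[of "map (\<lambda>x. W x t) ?L" 0] pos Wp seg by simp
    moreover have "Im (spin_trace (map (\<lambda>x. W x t) ?L)) = 0"
    proof -
      have "W x t \<in> span {a, b}" if "x \<in> set ?L" for x
        unfolding W_def using lp[OF that] np by (intro span_add span_scale)
      then have "W w t \<in> span {a, b}" "W (w + a) t \<in> span {a, b}" "W (w + a + b) t \<in> span {a, b}" "W (w + b) t \<in> span {a, b}"
        by simp_all
      then show ?thesis by (simp only: list.map spin_trace_4_Im pl) simp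
    qed
    ultimately show ?thesis by (simp add: complex_eq_iff)
  qed
  then have "?f 0 > 0 \<longleftrightarrow> ?f 1 > 0" using sign_constant[OF c] by blast
  moreover have "?f 1 > 0" using nn
    by (simp add: W_def spin_trace_4_Re power2_norm_eq_inner[symmetric] power2_eq_square add_pos_pos)
  moreover have "rtrace v a b p = spin_trace (map (\<lambda>x. W x 0) ?L)"
    by (simp add: rtrace_def rect_def W_def w_def algebra_simps)
  ultimately show ?thesis by simp
qed

section \<open>Counting crossings along a path\<close>

definition above :: "real^3 \<Rightarrow> real^3 \<Rightarrow> real^3 \<Rightarrow> real^3 \<Rightarrow> int" where
  "above v a b p = (if height v a b p > 0 then 1 else 0)"

text \<open>Testing the initial point is enough: a transversal edge that changes the side projects
  entirely into the interior or entirely into the exterior of the rectangle.\<close>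

definition cross_edge :: "real^3 \<Rightarrow> real^3 \<Rightarrow> real^3 \<Rightarrow> real^3 \<Rightarrow> real^3 \<Rightarrow> int" where
  "cross_edge v a b p q = (if inside_rect v a b p then above v a b q - above v a b p else 0)"

text \<open>The three cases in which one branch of the logarithm serves for the trace along the
  whole edge.\<close>

definition transversal :: "real^3 \<Rightarrow> real^3 \<Rightarrow> real^3 \<Rightarrow> real^3 \<Rightarrow> real^3 \<Rightarrow> bool" where
  "transversal v a b p q \<longleftrightarrow> height v a b p \<noteq> 0 \<and> height v a b q \<noteq> 0 \<and>
    (height v a b p * height v a b q > 0 \<or> (\<forall>x\<in>closed_segment p q. inside_rect v a b x) \<or>
     (\<forall>x\<in>closed_segment p q. outside_rect v a b x))"

lemma winding_number_log:
  assumes "path g" "path_image g \<subseteq> S" "continuous_on S l" "\<And>z. z \<in> S \<Longrightarrow> exp (l z) = z"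
  shows "winding_number g 0 = (l (pathfinish g) - l (pathstart g)) / (2 * of_real pi * \<i>)"
proof -
  have p: "path (l \<circ> g)" using assms by (meson path_continuous_image continuous_on_subset)
  have "winding_number g 0 = winding_number (exp \<circ> (l \<circ> g)) 0"
  proof (rule winding_number_cong)
    fix t :: real assume "0 \<le> t" "t \<le> 1"
    then have "g t \<in> S" using assms(2) by (force simp: path_image_def)
    then show "g t = (exp \<circ> (l \<circ> g)) t" using assms(4) by simp
  qed
  also have "\<dots> = (pathfinish (l \<circ> g) - pathstart (l \<circ> g)) / (2 * of_real pi * \<i>)"
    by (rule winding_number_compose_exp[OF p])
  finally show ?thesis by (simp add: pathfinish_compose pathstart_compose)
qed

lemma height_linear: "x = (1 - t) *\<^sub>R p + t *\<^sub>R q \<Longrightarrow> height v a b x = (1 - t) * height v a b p + t * height v a b q"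
proof -
  assume x: "x = (1 - t) *\<^sub>R p + t *\<^sub>R q"
  show "height v a b x = (1 - t) * height v a b p + t * height v a b q"
    unfolding x height_def by (simp add: inner_diff_left inner_add_left algebra_simps)
qed

text \<open>On edges that keep their side or stay outside, the trace avoids the nonpositive reals
  and \<open>Ln\<close> is continuous along it. On inside edges it avoids the nonnegative reals, and
  the branch \<open>Ln (-z) + \<i> * of_real pi\<close> is used. Returning to \<open>Ln\<close>
  shifts the value at each end by a whole period according to \<open>above\<close>, and the
  difference of the shifts is \<open>cross_edge\<close>.\<close>

lemma rtrace_edge:
  assumes ab: "a \<bullet> b = 0" "a \<noteq> 0" "b \<noteq> 0" and t: "transversal v a b p q"
  shows "winding_number (rtrace v a b \<circ> linepath p q) 0 =
      (Ln (rtrace v a b q) - Ln (rtrace v a b p)) / (2 * of_real pi * \<i>) + of_int (cross_edge v a b p q)"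
    and "0 \<notin> path_image (rtrace v a b \<circ> linepath p q)"
proof -
  let ?G = "rtrace v a b" and ?h = "height v a b"
  let ?g = "?G \<circ> linepath p q"
  have hp: "?h p \<noteq> 0" "?h q \<noteq> 0" using t by (auto simp: transversal_def)
  have pg: "path ?g" unfolding rtrace_def o_def by (rule path_spin_trace) simp
  have im: "path_image ?g = ?G ` closed_segment p q" by (simp add: path_image_compose)
  have ends: "pathstart ?g = ?G p" "pathfinish ?g = ?G q" by (simp_all add: pathstart_compose pathfinish_compose)
  have z0: "(0::complex) \<in> \<real>\<^sub>\<le>\<^sub>0" by (simp add: complex_nonpos_Reals_iff)
  have eL: "exp (Ln z) = z" if "z \<notin> \<real>\<^sub>\<le>\<^sub>0" for z :: complex
    using that by (cases "z = 0") (auto simp: exp_Ln)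
  have slit: "winding_number ?g 0 = (Ln (?G q) - Ln (?G p)) / (2 * of_real pi * \<i>)"
    if "\<And>x. x \<in> closed_segment p q \<Longrightarrow> ?G x \<notin> \<real>\<^sub>\<le>\<^sub>0"
  proof -
    have "winding_number ?g 0 = (Ln (pathfinish ?g) - Ln (pathstart ?g)) / (2 * of_real pi * \<i>)"
      by (rule winding_number_log[OF pg, where S = "- \<real>\<^sub>\<le>\<^sub>0"])
         (use that im in \<open>auto intro!: continuous_intros simp: eL\<close>)
    then show ?thesis by (simp add: ends)
  qed
  consider (level) "?h p * ?h q > 0" | (out) "\<forall>x\<in>closed_segment p q. outside_rect v a b x"
    | (ins) "\<forall>x\<in>closed_segment p q. inside_rect v a b x"
    using t by (auto simp: transversal_def)
  then have "winding_number ?g 0 = (Ln (?G q) - Ln (?G p)) / (2 * of_real pi * \<i>) + of_int (cross_edge v a b p q)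
    \<and> 0 \<notin> path_image ?g"
  proof cases
    case level
    have hx: "Im (?G x) \<noteq> 0" if x: "x \<in> closed_segment p q" for x
    proof -
      obtain s where s: "0 \<le> s" "s \<le> 1" "x = (1 - s) *\<^sub>R p + s *\<^sub>R q" using x by (auto simp: closed_segment_def)
      have "?h x = (1 - s) * ?h p + s * ?h q" by (rule height_linear[OF s(3)])
      also have "\<dots> \<noteq> 0"
      proof (cases "?h p > 0")
        case True
        then have "?h q > 0" using level by (simp add: zero_less_mult_iff)
        then have "(1 - s) * ?h p + s * ?h q > 0" using True s by (cases "s = 0") (auto intro!: add_nonneg_pos)
        then show ?thesis by simp
      next
        case False
        then have "?h p < 0" "?h q < 0" using level by (auto simp: zero_less_mult_iff)
        then have "0 \<le> (1 - s) * (- ?h p)" "0 \<le> s * (- ?h q)" "s \<noteq> 0 \<Longrightarrow> 0 < s * (- ?h q)"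
          using s by (auto simp: mult_nonneg_nonpos mult_pos_neg)
        then show ?thesis using \<open>?h p < 0\<close> by (cases "s = 0") auto
      qed
      finally show ?thesis using rtrace_Im_sign(3)[OF ab(2)] by blast
    qed
    then have nz: "0 \<notin> path_image ?g" unfolding im by force
    have "above v a b q = above v a b p" using level by (auto simp: above_def zero_less_mult_iff)
    then have "cross_edge v a b p q = 0" by (simp add: cross_edge_def)
    moreover have "?G x \<notin> \<real>\<^sub>\<le>\<^sub>0" if "x \<in> closed_segment p q" for x
      using hx[OF that] by (auto simp: complex_nonpos_Reals_iff)
    ultimately show ?thesis
      using slit nz by simp
  next
    case out
    have hx: "?G x \<notin> \<real>\<^sub>\<le>\<^sub>0" if x: "x \<in> closed_segment p q" for x
    proof (cases "?h x = 0")
      case True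
      then have "Re (?G x) > 0" using rtrace_outside[OF ab] out x by blast
      then show ?thesis by (auto simp: complex_nonpos_Reals_iff)
    next
      case False
      then show ?thesis using rtrace_Im_sign(3)[OF ab(2)] by (auto simp: complex_nonpos_Reals_iff)
    qed
    then have nz: "0 \<notin> path_image ?g" unfolding im using z0 by (metis imageE)
    have "outside_rect v a b p" using out by simp
    then have "\<not> inside_rect v a b p" by (auto simp: inside_rect_def outside_rect_def)
    then have "cross_edge v a b p q = 0" by (simp add: cross_edge_def)
    then show ?thesis
      using slit hx nz by simp
  next
    case ins
    have hx: "- ?G x \<notin> \<real>\<^sub>\<le>\<^sub>0" if x: "x \<in> closed_segment p q" for x
    proof (cases "?h x = 0")
      case True
      then have "Re (?G x) < 0" using rtrace_inside[OF ab] ins x by blast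
      then show ?thesis by (auto simp: complex_nonpos_Reals_iff)
    next
      case False
      then show ?thesis using rtrace_Im_sign(3)[OF ab(2)] by (auto simp: complex_nonpos_Reals_iff)
    qed
    then have nz: "0 \<notin> path_image ?g" unfolding im using z0 by (metis imageE minus_zero)
    have "winding_number ?g 0 = ((\<lambda>z. Ln (-z) + \<i> * of_real pi) (pathfinish ?g) - (\<lambda>z. Ln (-z) + \<i> * of_real pi) (pathstart ?g)) / (2 * of_real pi * \<i>)"
      by (rule winding_number_log[OF pg, where S = "{z. - z \<notin> \<real>\<^sub>\<le>\<^sub>0}"])
         (use hx im in \<open>auto intro!: continuous_intros simp: exp_add eL\<close>)
    also have "\<dots> = (Ln (- ?G q) - Ln (- ?G p)) / (2 * of_real pi * \<i>)" by (simp add: ends)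
    finally have wn: "winding_number ?g 0 = (Ln (- ?G q) - Ln (- ?G p)) / (2 * of_real pi * \<i>)" .
    have L: "Ln (- ?G x) = Ln (?G x) + \<i> * of_real pi * (2 * of_int (above v a b x) - 1)" if "?h x \<noteq> 0" for x
    proof -
      have nz: "?G x \<noteq> 0" using that rtrace_Im_sign(3)[OF ab(2), of v b x] by auto
      show ?thesis
      proof (cases "?h x > 0")
        case True
        then have "Im (?G x) < 0" using rtrace_Im_sign(1)[OF ab(2)] by blast
        then show ?thesis using True nz by (simp add: Ln_minus above_def algebra_simps)
      next
        case False
        then have "Im (?G x) > 0" using rtrace_Im_sign(2)[OF ab(2)] that by (metis linorder_neqE_linordered_idom)
        then show ?thesis using False nz by (simp add: Ln_minus above_def algebra_simps)
      qed
    qed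
    have "inside_rect v a b p" using ins by auto
    then have ce: "cross_edge v a b p q = above v a b q - above v a b p" by (simp add: cross_edge_def)
    show ?thesis
      using nz unfolding wn L[OF hp(1)] L[OF hp(2)] ce by (simp add: field_simps)
  qed
then show "winding_number ?g 0 = (Ln (?G q) - Ln (?G p)) / (2 * of_real pi * \<i>) + of_int (cross_edge v a b p q)" "0 \<notin> path_image ?g" by blast+
qed


fun cross_list :: "real^3 \<Rightarrow> real^3 \<Rightarrow> real^3 \<Rightarrow> (real^3) list \<Rightarrow> int" where
  "cross_list v a b (p # q # ps) = cross_edge v a b p q + cross_list v a b (q # ps)"
| "cross_list v a b ps = 0"

text \<open>The logarithms telescope along the vertices, so that for a closed polygon only the
  crossing numbers remain.\<close>

lemma rtrace_path:
  assumes ab: "a \<bullet> b = 0" "a \<noteq> 0" "b \<noteq> 0" and "length ps \<ge> 2" "successively (transversal v a b) ps"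
  shows "winding_number (rtrace v a b \<circ> ppath ps) 0 =
      (Ln (rtrace v a b (last ps)) - Ln (rtrace v a b (hd ps))) / (2 * of_real pi * \<i>) + of_int (cross_list v a b ps)
    \<and> 0 \<notin> path_image (rtrace v a b \<circ> ppath ps)"
  using assms(4,5)
proof (induction ps rule: ppath.induct)
  case (1 u x w ws)
  let ?G = "rtrace v a b"
  have path: "path (?G \<circ> g)" if "path g" for g
    unfolding rtrace_def o_def using that by (rule path_spin_trace)
  have t: "transversal v a b u x" using 1(3) by simp
  note e = rtrace_edge[OF ab t]
  have S: "2 \<le> length (x # w # ws)" "successively (transversal v a b) (x # w # ws)" using 1(3) by simp_all
  note IH0 = 1(1)[OF S, unfolded list.sel]
  note IH = conjunct1[OF IH0] conjunct2[OF IH0]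
  have j: "?G \<circ> ppath (u # x # w # ws) = (?G \<circ> linepath u x) +++ (?G \<circ> ppath (x # w # ws))"
    by (simp add: path_compose_join)
  have fs: "pathfinish (?G \<circ> linepath u x) = pathstart (?G \<circ> ppath (x # w # ws))"
    by (simp add: pathstart_compose pathfinish_compose)
  define X where "X = winding_number (?G \<circ> ppath (u # x # w # ws)) 0"
  have "X = winding_number (?G \<circ> linepath u x) 0 + winding_number (?G \<circ> ppath (x # w # ws)) 0"
    unfolding X_def j by (rule winding_number_join[OF path[OF path_linepath] e(2) path[OF path_ppath] IH(2) fs])
  also have "\<dots> = (Ln (?G x) - Ln (?G u)) / (2 * of_real pi * \<i>) + of_int (cross_edge v a b u x) +
      ((Ln (?G (last (x # w # ws))) - Ln (?G x)) / (2 * of_real pi * \<i>) + of_int (cross_list v a b (x # w # ws)))"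
    by (simp only: e(1) IH(1))
  also have "\<dots> = (Ln (?G (last (u # x # w # ws))) - Ln (?G (hd (u # x # w # ws)))) / (2 * of_real pi * \<i>) +
      of_int (cross_list v a b (u # x # w # ws))"
    by (simp add: diff_divide_distrib)
  finally have "X = \<dots>" .
  moreover have "0 \<notin> path_image (?G \<circ> ppath (u # x # w # ws))"
    unfolding j path_image_join[OF fs] using e(2) IH(2) by (metis UnE)
  ultimately show ?case unfolding X_def by (rule conjI)
next
  case (2 u x)
  then show ?case using rtrace_edge[OF ab, of v u x] by (simp add: o_def)
qed auto

lemma spin_link_rect:
  assumes ab: "a \<bullet> b = 0" "a \<noteq> 0" "b \<noteq> 0" and ps: "ps \<noteq> []" "successively (transversal v a b) (cyc ps)"
  shows "spin_link (rect v a b) (ppath (cyc ps)) = of_int (cross_list v a b (cyc ps))"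
    and "0 \<notin> path_image (rtrace v a b \<circ> ppath (cyc ps))"
proof -
  have l: "length (cyc ps) \<ge> 2" using ps(1) by (cases ps) auto
  have "spin_link (rect v a b) (ppath (cyc ps)) = winding_number (rtrace v a b \<circ> ppath (cyc ps)) 0"
    by (simp add: spin_link_def rtrace_def o_def)
  then show "spin_link (rect v a b) (ppath (cyc ps)) = of_int (cross_list v a b (cyc ps))"
    using rtrace_path[OF ab l ps(2)] ps(1) by simp
  show "0 \<notin> path_image (rtrace v a b \<circ> ppath (cyc ps))"
    using rtrace_path[OF ab l ps(2)] by simp
qed

lemma winding_number_mult:
  assumes "path f" "path g" "0 \<notin> path_image f" "0 \<notin> path_image g"
  shows "winding_number (\<lambda>t. f t * g t) 0 = winding_number f 0 + winding_number g 0"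
proof -
  have "\<exists>p. path p \<and> (\<forall>t\<in>{0..1}. h t = exp (p t))" if "path h" "0 \<notin> path_image h" for h :: "real \<Rightarrow> complex"
  proof -
    have "\<And>t. t \<in> {0..1} \<Longrightarrow> h t \<noteq> 0" using that(2) by (force simp: path_image_def)
    note nz = this
    have "contractible {0..1::real}" by (simp add: convex_imp_contractible)
    then show ?thesis
      using continuous_logarithm_on_contractible[OF that(1)[unfolded path_def] _ nz] unfolding path_def by metis
  qed
  then obtain p q where pq: "path p" "path q" "\<And>t. t \<in> {0..1} \<Longrightarrow> f t = exp (p t)" "\<And>t. t \<in> {0..1} \<Longrightarrow> g t = exp (q t)"
    using assms by metis
  have 1: "winding_number f 0 = winding_number (exp \<circ> p) 0" "winding_number g 0 = winding_number (exp \<circ> q) 0"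
    by (rule winding_number_cong; simp add: pq)+
  have 2: "winding_number (\<lambda>t. f t * g t) 0 = winding_number (exp \<circ> (\<lambda>t. p t + q t)) 0"
    by (rule winding_number_cong) (simp add: pq exp_add)
  have "path (\<lambda>t. p t + q t)" using pq(1,2) unfolding path_def by (intro continuous_intros)
  then show ?thesis unfolding 1 2 using pq(1,2)
    by (simp add: winding_number_compose_exp pathfinish_def pathstart_def add_divide_distrib diff_divide_distrib)
qed

lemma spin_link_decompose:
  assumes b: "path b" "pathfinish b = pathstart b"
    and pm: "\<And>t. t \<in> {0..1} \<Longrightarrow> pos_mult (spin_trace (map (\<lambda>v. v - b t) vs))
       (spin_trace (map (\<lambda>v. v - b t) us) * spin_trace (map (\<lambda>v. v - b t) ws))"
    and nz: "\<And>t. t \<in> {0..1} \<Longrightarrow> spin_trace (map (\<lambda>v. v - b t) us) \<noteq> 0" "\<And>t. t \<in> {0..1} \<Longrightarrow> spin_trace (map (\<lambda>v. v - b t) ws) \<noteq> 0"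
  shows "spin_link vs b = spin_link us b + spin_link ws b"
proof -
  let ?F = "\<lambda>vs t. spin_trace (map (\<lambda>v. v - b t) vs)"
  have p: "path (?F vs)" for vs by (rule path_spin_trace[OF b(1)])
  have l: "pathfinish (?F vs) = pathstart (?F vs)" for vs using b(2) by (simp add: pathfinish_def pathstart_def)
  have "spin_link vs b = winding_number (\<lambda>t. ?F us t * ?F ws t) 0"
    unfolding spin_link_def
  proof (rule winding_number_pos_mult)
    show "path (\<lambda>t. ?F us t * ?F ws t)" using p unfolding path_def by (intro continuous_intros)
    show "pathfinish (\<lambda>t. ?F us t * ?F ws t) = pathstart (\<lambda>t. ?F us t * ?F ws t)"
      using l by (simp add: pathfinish_def pathstart_def)
  qed (use p l pm nz in auto)
  also have "\<dots> = spin_link us b + spin_link ws b"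
    unfolding spin_link_def by (rule winding_number_mult) (use p nz in \<open>auto simp: path_image_def\<close>)
  finally show ?thesis .
qed

section \<open>Lattice polygons in general position\<close>

lemma nth_cyc:
  assumes "i < length vs"
  shows "cyc vs ! i = vs ! i" "cyc vs ! Suc i = vs ! (Suc i mod length vs)"
proof -
  show "cyc vs ! i = vs ! i" using assms by (simp add: nth_append)
  have "vs \<noteq> []" using assms by auto
  then have "vs ! 0 = hd vs" by (simp add: hd_conv_nth)
  then show "cyc vs ! Suc i = vs ! (Suc i mod length vs)"
    using assms by (cases "Suc i = length vs") (auto simp: nth_append)
qed

definition bt :: "real \<Rightarrow> real \<Rightarrow> real \<Rightarrow> bool" where
  "bt u v x \<longleftrightarrow> u \<le> x \<and> x \<le> v \<or> v \<le> x \<and> x \<le> u"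

lemma in_axis_segment:
  fixes p q x :: "real^3"
  assumes "\<And>j. j \<noteq> D \<Longrightarrow> x $ j = p $ j" "\<And>j. j \<noteq> D \<Longrightarrow> q $ j = p $ j" "bt (p $ D) (q $ D) (x $ D)"
  shows "x \<in> closed_segment p q"
proof -
  have "x $ D \<in> closed_segment (p $ D) (q $ D)"
    using assms(3) by (auto simp: bt_def closed_segment_eq_real_ivl)
  then obtain u where u: "0 \<le> u" "u \<le> 1" "x $ D = (1 - u) * p $ D + u * q $ D"
    by (auto simp: closed_segment_def)
  have "x = (1 - u) *\<^sub>R p + u *\<^sub>R q"
  proof (simp add: vec_eq_iff, intro allI)
    fix j show "x $ j = (1 - u) * p $ j + u * q $ j"
      using u(3) assms(1,2)[of j] by (cases "j = D") (auto simp: algebra_simps)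
  qed
  then show ?thesis using u unfolding closed_segment_def by blast
qed

lemma axis_segmentD:
  fixes p q x :: "real^3"
  assumes "x \<in> closed_segment p q" "\<And>j. j \<noteq> D \<Longrightarrow> q $ j = p $ j"
  shows "j \<noteq> D \<Longrightarrow> x $ j = p $ j" "bt (p $ D) (q $ D) (x $ D)"
proof -
  obtain u where u: "0 \<le> u" "u \<le> 1" "x = (1 - u) *\<^sub>R p + u *\<^sub>R q"
    using assms(1) by (auto simp: closed_segment_def)
  show "x $ j = p $ j" if "j \<noteq> D" unfolding u(3) using assms(2)[OF that] by (simp add: algebra_simps)
  have "x $ D \<in> closed_segment (p $ D) (q $ D)"
    using u unfolding closed_segment_def by auto
  then show "bt (p $ D) (q $ D) (x $ D)" by (auto simp: bt_def closed_segment_eq_real_ivl split: if_splits)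
qed

text \<open>\<open>d i\<close> is the axis of edge \<open>i\<close>. That consecutive axes differ
  expresses the absence of straight angles and of edges folded back.\<close>

definition lcyc :: "(real^3) list \<Rightarrow> (nat \<Rightarrow> 3) \<Rightarrow> bool" where
  "lcyc vs d \<longleftrightarrow> length vs \<ge> 3 \<and> distinct vs \<and> (\<forall>i<length vs. \<forall>j. vs ! i $ j \<in> \<int>) \<and>
    (\<forall>i<length vs. \<forall>j. vs ! (Suc i mod length vs) $ j = vs ! i $ j \<longleftrightarrow> j \<noteq> d i) \<and>
    (\<forall>i<length vs. d (Suc i mod length vs) \<noteq> d i)"

lemma small_not_int:
  fixes x y :: real
  assumes "x \<in> \<int>" "0 < \<bar>y\<bar>" "\<bar>y\<bar> < 1"
  shows "x + y \<notin> \<int>"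
proof
  assume "x + y \<in> \<int>"
  then have "y \<in> \<int>" using Ints_diff[OF _ assms(1)] by fastforce
  then show False using assms(2,3) by (metis Ints_nonzero_abs_less1 abs_0_eq order_less_irrefl)
qed

text \<open>If two coordinates changed along the edge, a point close to \<open>p\<close> would have
  two coordinates that are not integers.\<close>

lemma lattice_edge_axis:
  fixes p q :: "real^3"
  assumes i: "\<And>j. p $ j \<in> \<int>" and s: "closed_segment p q \<subseteq> cubic_lattice" and pq: "p \<noteq> q"
  shows "\<exists>d. \<forall>j. q $ j = p $ j \<longleftrightarrow> j \<noteq> d"
proof -
  obtain d where d: "q $ d \<noteq> p $ d" using pq by (metis vec_eq_iff)
  have "q $ j = p $ j" if j: "j \<noteq> d" for j
  proof (rule ccontr)
    assume ne: "q $ j \<noteq> p $ j"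
    define a b where "a = q $ d - p $ d" and "b = q $ j - p $ j"
    \<comment> \<open>So small that both increments are less than 1 in absolute value.\<close>
    define t where "t = 1 / (2 * (\<bar>a\<bar> + \<bar>b\<bar> + 1))"
    have ab: "a \<noteq> 0" "b \<noteq> 0" using d ne by (auto simp: a_def b_def)
    have t: "0 < t" "t \<le> 1" by (auto simp: t_def field_simps intro: add_nonneg_pos)
    have ta: "\<bar>t * a\<bar> < 1" "\<bar>t * b\<bar> < 1"
      by (auto simp: t_def abs_mult field_simps)
    define x where "x = (1 - t) *\<^sub>R p + t *\<^sub>R q"
    have "x \<in> closed_segment p q" using t by (auto simp: x_def closed_segment_def)
    then have "x \<in> cubic_lattice" using s by (rule subsetD[rotated])
    then obtain k where k: "\<And>l. l \<noteq> k \<Longrightarrow> x $ l \<in> \<int>" by (auto simp: cubic_lattice_def)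
    have "x $ d = p $ d + t * a" "x $ j = p $ j + t * b" by (simp_all add: x_def a_def b_def algebra_simps)
    then have "x $ d \<notin> \<int>" "x $ j \<notin> \<int>"
      using small_not_int[OF i, of "t * a" d] small_not_int[OF i, of "t * b" j] ta ab t by auto
    then show False using k j by metis
  qed
  then show ?thesis using d by metis
qed

text \<open>If consecutive edges had the same axis, one of the three vertices would lie between the
  other two: the middle one against \<open>reduced\<close>, an outer one against simplicity.\<close>

lemma obtain_lcyc:
  assumes sp: "simple_polygon vs" and r: "reduced vs" and i: "set vs \<subseteq> integer_points" and c: "polygon vs \<subseteq> cubic_lattice"
  obtains d where "lcyc vs d"
proof -
  let ?n = "length vs"
  have n: "?n \<ge> 3" and dis: "distinct vs" and
    e: "\<And>i j. i < ?n \<Longrightarrow> j < ?n \<Longrightarrow> i \<noteq> j \<Longrightarrow> edge vs i \<inter> edge vs j = edge_ends vs i \<inter> edge_ends vs j"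
    using sp by (auto simp: simple_polygon_def)
  have n0: "?n > 0" using n by linarith
  have lt: "Suc i mod ?n < ?n" for i using n0 by simp
  have int: "vs ! i $ j \<in> \<int>" if "i < ?n" for i j
  proof -
    have "vs ! i \<in> integer_points" using i that by (meson nth_mem subsetD)
    then show ?thesis by (simp add: integer_points_def)
  qed
  have "\<exists>d. \<forall>j. vs ! (Suc i mod ?n) $ j = vs ! i $ j \<longleftrightarrow> j \<noteq> d" if "i < ?n" for i
  proof (rule lattice_edge_axis)
    show "closed_segment (vs ! i) (vs ! (Suc i mod ?n)) \<subseteq> cubic_lattice"
      using c that by (auto simp: polygon_def edge_def)
  qed (use int that edge_line_segment(2)[OF sp that] in auto)
  then obtain d where d: "\<And>i j. i < ?n \<Longrightarrow> vs ! (Suc i mod ?n) $ j = vs ! i $ j \<longleftrightarrow> j \<noteq> d i" by metis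
  have "d (Suc i mod ?n) \<noteq> d i" if i: "i < ?n" for i
  proof
    let ?i' = "Suc i mod ?n"
    assume eq: "d ?i' = d i"
    define p q s where "p = vs ! i" and "q = vs ! ?i'" and "s = vs ! (Suc ?i' mod ?n)"
    have s': "s = vs ! (Suc (Suc i) mod ?n)" by (simp add: s_def mod_Suc_eq)
    have pq: "q $ j = p $ j \<longleftrightarrow> j \<noteq> d i" for j using d[OF i] by (simp add: p_def q_def)
    have qs: "s $ j = q $ j \<longleftrightarrow> j \<noteq> d i" for j using d[OF lt, of i j] eq by (simp add: s_def q_def)
    have pq': "q $ j = p $ j" and qs': "s $ j = q $ j" if "j \<noteq> d i" for j using that pq qs by blast+
    have ii: "i \<noteq> ?i'" using edge_line_segment(2)[OF sp i] by metis
    have E: "edge vs i = closed_segment p q" "edge vs ?i' = closed_segment q s"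
      "edge_ends vs i = {p, q}" "edge_ends vs ?i' = {q, s}"
      by (simp_all add: edge_def edge_ends_def p_def q_def s_def)
    have I: "closed_segment p q \<inter> closed_segment q s = {p, q} \<inter> {q, s}"
      using e[OF i lt ii] E by simp
    have ps: "p \<noteq> s"
    proof -
      have "i \<noteq> Suc (Suc i) mod ?n" using i n by (auto simp: mod_Suc split: if_splits)
      then show ?thesis unfolding p_def s' using dis i n0 by (simp add: nth_eq_iff_index_eq)
    qed
    have "bt (p $ d i) (s $ d i) (q $ d i) \<or> bt (q $ d i) (s $ d i) (p $ d i) \<or> bt (p $ d i) (q $ d i) (s $ d i)"
      by (auto simp: bt_def)
    then show False
    proof (elim disjE)
      assume "bt (p $ d i) (s $ d i) (q $ d i)"
      then have "q \<in> closed_segment p s" by (intro in_axis_segment[where D = "d i"]) (simp_all add: pq' qs')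
      moreover have "q \<notin> closed_segment p s" using r i unfolding reduced_def p_def q_def s' by simp
      ultimately show False by simp
    next
      assume "bt (q $ d i) (s $ d i) (p $ d i)"
      then have "p \<in> closed_segment q s" by (intro in_axis_segment[where D = "d i"]) (simp_all add: pq' qs')
      then have "p \<in> {q, s}" using I by auto
      then show False using ps pq[of "d i"] by auto
    next
      assume "bt (p $ d i) (q $ d i) (s $ d i)"
      then have "s \<in> closed_segment p q" by (intro in_axis_segment[where D = "d i"]) (simp_all add: pq' qs')
      then have "s \<in> {p, q}" using I by auto
      then show False using ps qs[of "d i"] by auto
    qed
  qed
  then have "lcyc vs d" using n dis int d by (auto simp: lcyc_def)
  then show ?thesis by (rule that)
qed

text \<open>Shifting one polygon along the diagonal makes its vertices half-integral, so that they
  avoid all lattice planes of the other one.\<close>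

definition half :: "real^3" where "half = (\<chi> i. 1/2)"

definition shifted :: "(real^3) list \<Rightarrow> (real^3) list" where
  "shifted ws = map (\<lambda>x. x + half) ws"

lemma ppath_shift: "xs \<noteq> [] \<Longrightarrow> ppath (map (\<lambda>x. x + c) xs) s = ppath xs s + c"
proof (induction xs arbitrary: s rule: ppath.induct)
  case (1 u v w ws)
  have "linepath (u + c) (v + c) t = linepath u v t + c" for t by (simp add: linepath_def algebra_simps)
  then show ?case using 1 by (simp add: joinpaths_def)
next
  case (2 u v) then show ?case by (simp add: linepath_def algebra_simps)
qed auto

text \<open>A point of the cubic lattice has at most one coordinate that is not an integer. If a
  moved point \<open>x + u *\<^sub>R half\<close> met the other polygon, some coordinate would be
  integral both before and after, although it has changed by \<open>u / 2\<close>, which lies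
  strictly between 0 and 1.\<close>

lemma spin_link_shifted:
  assumes vs: "vs \<noteq> []" "csegs (cyc vs) \<subseteq> cubic_lattice" and ws: "ws \<noteq> []" "csegs (cyc ws) \<subseteq> cubic_lattice"
    and d: "csegs (cyc vs) \<inter> csegs (cyc ws) = {}"
  shows "spin_link vs (ppath (cyc ws)) = spin_link vs (ppath (cyc (shifted ws)))"
proof (rule spin_link_loop_homotopic[OF vs(1)])
  have cs: "cyc (shifted ws) = map (\<lambda>x. x + half) (cyc ws)" using ws(1) by (simp add: shifted_def hd_map)
  have sw: "shifted ws \<noteq> []" using ws(1) by (simp add: shifted_def)
  show "homotopic_loops (- csegs (cyc vs)) (ppath (cyc ws)) (ppath (cyc (shifted ws)))"
  proof (rule homotopic_loops_linear)
    fix t :: real assume t: "t \<in> {0..1}"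
    show "closed_segment (ppath (cyc ws) t) (ppath (cyc (shifted ws)) t) \<subseteq> - csegs (cyc vs)"
    proof
      fix y assume y: "y \<in> closed_segment (ppath (cyc ws) t) (ppath (cyc (shifted ws)) t)"
      define x where "x = ppath (cyc ws) t"
      have x: "x \<in> csegs (cyc ws)" using t path_image_cyc[OF ws(1)] by (auto simp: x_def path_image_def)
      have "ppath (cyc (shifted ws)) t = x + half" unfolding cs x_def by (rule ppath_shift) simp
      then obtain u where u: "0 \<le> u" "u \<le> 1" "y = (1 - u) *\<^sub>R x + u *\<^sub>R (x + half)"
        using y unfolding x_def closed_segment_def by auto
      then have yx: "y = x + u *\<^sub>R half" by (simp add: algebra_simps)
      show "y \<in> - csegs (cyc vs)"
      proof
        assume yv: "y \<in> csegs (cyc vs)"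
        show False
        proof (cases "u = 0")
          case True then show False using yx x yv d by auto
        next
          case False
          obtain i k where ik: "\<And>j. j \<noteq> i \<Longrightarrow> x $ j \<in> \<int>" "\<And>j. j \<noteq> k \<Longrightarrow> y $ j \<in> \<int>"
            using x yv vs(2) ws(2) unfolding cubic_lattice_def by blast
          have "(1::3) \<noteq> 2" "(1::3) \<noteq> 3" "(2::3) \<noteq> 3" by simp_all
          then obtain j :: 3 where "j \<noteq> i" "j \<noteq> k" by metis
          then have "x $ j \<in> \<int>" "x $ j + u / 2 \<in> \<int>" using ik(1)[of j] ik(2)[of j] yx by (simp_all add: half_def)
          then show False using small_not_int[of "x $ j" "u / 2"] u(1,2) False by auto
        qed
      qed
    qed
  qed (use ws(1) sw in simp_all)
qed simp

lemma cross_list_sum: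
  "cross_list v a b xs = (\<Sum>i<length xs - 1. cross_edge v a b (xs ! i) (xs ! Suc i))"
proof (induction xs rule: cross_list.induct)
  case (1 v a b p q ps)
  have "(\<Sum>i<length (p # q # ps) - 1. cross_edge v a b ((p # q # ps) ! i) ((p # q # ps) ! Suc i)) =
      cross_edge v a b p q + (\<Sum>i<length (q # ps) - 1. cross_edge v a b ((q # ps) ! i) ((q # ps) ! Suc i))"
    by (simp add: sum.lessThan_Suc_shift del: sum.lessThan_Suc)
  then show ?case using 1 by simp
qed auto

definition crossing :: "real^3 \<Rightarrow> real^3 \<Rightarrow> real^3 \<Rightarrow> (real^3) list \<Rightarrow> int" where
  "crossing v a b ps = (\<Sum>i<length ps. cross_edge v a b (ps ! i) (ps ! (Suc i mod length ps)))"

lemma cross_list_cyc: "cross_list v a b (cyc ps) = crossing v a b ps"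
  unfolding cross_list_sum crossing_def by (rule sum.cong) (simp, metis lessThan_iff diff_Suc_1 length_append_singleton nth_cyc)

definition ax :: "3 \<Rightarrow> real \<Rightarrow> real^3" where "ax d \<alpha> = \<alpha> *\<^sub>R axis d 1"

lemma ax_nth [simp]: "ax d \<alpha> $ j = (if j = d then \<alpha> else 0)"
  by (simp add: ax_def axis_def)

lemma inner_ax [simp]: "x \<bullet> ax d \<alpha> = \<alpha> * x $ d"
  by (simp add: ax_def inner_axis)

lemma ax_0 [simp]: "ax d \<alpha> = 0 \<longleftrightarrow> \<alpha> = 0"
  by (auto simp: vec_eq_iff split: if_splits)

lemma third_axis: "(d::3) \<noteq> e \<Longrightarrow> \<exists>f. f \<noteq> d \<and> f \<noteq> e \<and> (\<forall>j. j = d \<or> j = e \<or> j = f)"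
proof -
  assume "d \<noteq> e"
  moreover have "(1::3) \<noteq> 2" "(1::3) \<noteq> 3" "(2::3) \<noteq> 3" by simp_all
  ultimately show ?thesis using exhaust_3 by metis
qed

lemma height_ax:
  assumes "d \<noteq> e" "f \<noteq> d" "f \<noteq> e"
  obtains s where "s = 1 \<or> s = -1" "\<And>v \<alpha> \<beta> p. height v (ax d \<alpha>) (ax e \<beta>) p = s * \<alpha> * \<beta> * (p $ f - v $ f)"
proof -
  have "cross3 (axis d 1) (axis e 1) = axis f 1 \<or> cross3 (axis d 1) (axis e 1) = - axis f 1"
    using assms exhaust_3[of d] exhaust_3[of e] exhaust_3[of f]
    by (elim disjE) (simp_all add: cross_basis)
  then obtain s :: real where s: "s = 1 \<or> s = -1" "cross3 (axis d 1) (axis e 1) = s *\<^sub>R axis f 1"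
    by (metis scaleR_minus1_left scaleR_one)
  have "height v (ax d \<alpha>) (ax e \<beta>) p = s * \<alpha> * \<beta> * (p $ f - v $ f)" for v \<alpha> \<beta> p
    unfolding height_def ax_def by (simp add: cross_mult_left cross_mult_right s(2) inner_axis)
  then show ?thesis using s(1) that by blast
qed

text \<open>For nonzero \<open>\<alpha>\<close> of either sign: \<open>x\<close> lies strictly
  between \<open>u\<close> and \<open>u + \<alpha>\<close>.\<close>

definition sbt :: "real \<Rightarrow> real \<Rightarrow> real \<Rightarrow> bool" where
  "sbt u \<alpha> x \<longleftrightarrow> 0 < \<alpha> * (x - u) \<and> \<alpha> * (x - u) < \<alpha> * \<alpha>"

lemma inside_rect_ax: "d \<noteq> e \<Longrightarrow> inside_rect v (ax d \<alpha>) (ax e \<beta>) p \<longleftrightarrow> sbt (v $ d) \<alpha> (p $ d) \<and> sbt (v $ e) \<beta> (p $ e)"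
  by (auto simp: inside_rect_def sbt_def)

lemma half_int_neq: "x - 1/2 \<in> \<int> \<Longrightarrow> y \<in> \<int> \<Longrightarrow> x \<noteq> (y::real)"
proof
  assume "x - 1/2 \<in> \<int>" "y \<in> \<int>" "x = y"
  then show False using small_not_int[of y "-1/2"] by auto
qed

text \<open>Half-integral coordinates never equal those of the plane or of the sides of an integral
  rectangle. Only an edge along the normal axis \<open>f\<close> changes its height, and it projects
  to a single point of the plane.\<close>

lemma transversal_shifted:
  fixes v :: "real^3"
  assumes ws: "lcyc ws dw" and v: "\<And>j. v $ j \<in> \<int>" and ab: "\<alpha> \<in> \<int>" "\<beta> \<in> \<int>" "\<alpha> \<noteq> 0" "\<beta> \<noteq> 0" and de: "d \<noteq> e"
    and i: "i < length ws"
  shows "transversal v (ax d \<alpha>) (ax e \<beta>) (shifted ws ! i) (shifted ws ! (Suc i mod length ws))"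
    and "above v (ax d \<alpha>) (ax e \<beta>) (shifted ws ! i) \<noteq> above v (ax d \<alpha>) (ax e \<beta>) (shifted ws ! (Suc i mod length ws))
      \<Longrightarrow> dw i \<noteq> d \<and> dw i \<noteq> e"
proof -
  obtain f where f: "f \<noteq> d" "f \<noteq> e" "\<And>j. j = d \<or> j = e \<or> j = f" using third_axis[OF de] by blast
  obtain s where s: "s = 1 \<or> s = -1" and h: "\<And>v \<alpha> \<beta> p. height v (ax d \<alpha>) (ax e \<beta>) p = s * \<alpha> * \<beta> * (p $ f - v $ f)"
    using height_ax[OF de f(1,2)] by blast
  let ?n = "length ws"
  define p q where "p = shifted ws ! i" and "q = shifted ws ! (Suc i mod ?n)"
  have n: "?n > 0" using i by auto
  then have lt: "Suc i mod ?n < ?n" by simp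
  have pc: "p $ j - 1/2 \<in> \<int>" "q $ j - 1/2 \<in> \<int>" for j
    using ws i lt by (auto simp: p_def q_def shifted_def half_def lcyc_def)
  have pq: "q $ j = p $ j \<longleftrightarrow> j \<noteq> dw i" for j
    using ws i lt by (auto simp: p_def q_def shifted_def half_def lcyc_def)
  have h0: "height v (ax d \<alpha>) (ax e \<beta>) p \<noteq> 0" "height v (ax d \<alpha>) (ax e \<beta>) q \<noteq> 0"
    using s ab half_int_neq[OF pc(1)[of f] v[of f]] half_int_neq[OF pc(2)[of f] v[of f]] by (auto simp: h)
  have eq: "height v (ax d \<alpha>) (ax e \<beta>) q = height v (ax d \<alpha>) (ax e \<beta>) p" if "dw i \<noteq> f"
    using pq[of f] that by (auto simp: h)
  show "dw i \<noteq> d \<and> dw i \<noteq> e" if "above v (ax d \<alpha>) (ax e \<beta>) (shifted ws ! i) \<noteq> above v (ax d \<alpha>) (ax e \<beta>) (shifted ws ! (Suc i mod ?n))"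
    using that eq f unfolding p_def[symmetric] q_def[symmetric] above_def by metis
  have "height v (ax d \<alpha>) (ax e \<beta>) p * height v (ax d \<alpha>) (ax e \<beta>) q > 0 \<or>
     (\<forall>x\<in>closed_segment p q. inside_rect v (ax d \<alpha>) (ax e \<beta>) x) \<or>
     (\<forall>x\<in>closed_segment p q. outside_rect v (ax d \<alpha>) (ax e \<beta>) x)"
  proof (cases "dw i = f")
    case False
    then show ?thesis using eq h0 by (auto simp: zero_less_mult_iff)
  next
    case True
    have co: "x $ d = p $ d" "x $ e = p $ e" if "x \<in> closed_segment p q" for x
      using axis_segmentD(1)[OF that, of f] pq True f by auto
    have ne: "\<alpha> * (p $ d - v $ d) \<noteq> 0" "\<alpha> * (p $ d - v $ d) \<noteq> \<alpha> * \<alpha>" "\<beta> * (p $ e - v $ e) \<noteq> 0" "\<beta> * (p $ e - v $ e) \<noteq> \<beta> * \<beta>"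
      using half_int_neq[OF pc(1) v, of d] half_int_neq[OF pc(1) Ints_add[OF v ab(1)], of d d]
        half_int_neq[OF pc(1) v, of e] half_int_neq[OF pc(1) Ints_add[OF v ab(2)], of e e] ab by auto
    define A B where "A = \<alpha> * (p $ d - v $ d)" and "B = \<beta> * (p $ e - v $ e)"
    have ins: "inside_rect v (ax d \<alpha>) (ax e \<beta>) x \<longleftrightarrow> 0 < A \<and> A < \<alpha> * \<alpha> \<and> 0 < B \<and> B < \<beta> * \<beta>"
      and out: "outside_rect v (ax d \<alpha>) (ax e \<beta>) x \<longleftrightarrow> A < 0 \<or> \<alpha> * \<alpha> < A \<or> B < 0 \<or> \<beta> * \<beta> < B"
      if "x \<in> closed_segment p q" for x
      using co[OF that] by (simp_all add: inside_rect_def outside_rect_def A_def B_def)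
    show ?thesis
    proof (cases "0 < A \<and> A < \<alpha> * \<alpha> \<and> 0 < B \<and> B < \<beta> * \<beta>")
      case True then show ?thesis using ins by simp
    next
      case False
      then have "A < 0 \<or> \<alpha> * \<alpha> < A \<or> B < 0 \<or> \<beta> * \<beta> < B"
        using ne unfolding A_def[symmetric] B_def[symmetric] by linarith
      then show ?thesis using out by simp
    qed
  qed
  then show "transversal v (ax d \<alpha>) (ax e \<beta>) (shifted ws ! i) (shifted ws ! (Suc i mod ?n))"
    using h0 unfolding p_def q_def by (simp add: transversal_def)
qed

lemma spin_link_rect_shifted:
  fixes v :: "real^3"
  assumes ws: "lcyc ws dw" and v: "\<And>j. v $ j \<in> \<int>" and ab: "\<alpha> \<in> \<int>" "\<beta> \<in> \<int>" "\<alpha> \<noteq> 0" "\<beta> \<noteq> 0" and de: "d \<noteq> e"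
  shows "spin_link (rect v (ax d \<alpha>) (ax e \<beta>)) (ppath (cyc (shifted ws))) = of_int (crossing v (ax d \<alpha>) (ax e \<beta>) (shifted ws))"
    and "t \<in> {0..1} \<Longrightarrow> spin_trace (map (\<lambda>u. u - ppath (cyc (shifted ws)) t) (rect v (ax d \<alpha>) (ax e \<beta>))) \<noteq> 0"
proof -
  have l: "length (shifted ws) = length ws" by (simp add: shifted_def)
  have ne: "shifted ws \<noteq> []" using ws by (auto simp: lcyc_def shifted_def)
  have o: "ax d \<alpha> \<bullet> ax e \<beta> = 0" "ax d \<alpha> \<noteq> 0" "ax e \<beta> \<noteq> 0" using ab de by auto
  have t: "successively (transversal v (ax d \<alpha>) (ax e \<beta>)) (cyc (shifted ws))"
    unfolding successively_conv_nth
  proof (intro allI impI)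
    fix i assume "Suc i < length (cyc (shifted ws))"
    then have i: "i < length ws" using l by simp
    show "transversal v (ax d \<alpha>) (ax e \<beta>) (cyc (shifted ws) ! i) (cyc (shifted ws) ! Suc i)"
      using transversal_shifted(1)[OF ws v ab de i] nth_cyc[of i "shifted ws"] i l by simp
  qed
  show "spin_link (rect v (ax d \<alpha>) (ax e \<beta>)) (ppath (cyc (shifted ws))) = of_int (crossing v (ax d \<alpha>) (ax e \<beta>) (shifted ws))"
    using spin_link_rect(1)[OF o ne t] by (simp add: cross_list_cyc)
  show "spin_trace (map (\<lambda>u. u - ppath (cyc (shifted ws)) t) (rect v (ax d \<alpha>) (ax e \<beta>))) \<noteq> 0" if "t \<in> {0..1}"
    using spin_link_rect(2)[OF o ne t] that unfolding path_image_def rtrace_def by force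
qed

text \<open>The changes of level inside and those outside cancel around the cycle, so each part is
  at most half of their total number. Consecutive edges do not both change the level, so at most
  half of the edges do. The sum in the middle is kept for the case of equality.\<close>

lemma cyclic_sum_bounds:
  fixes s :: "nat \<Rightarrow> int" and n :: nat and I :: "nat \<Rightarrow> bool"
  defines "\<delta> \<equiv> \<lambda>i. s (Suc i mod n) - s i"
  assumes n: "n > 0" and adj: "\<And>i. i < n \<Longrightarrow> \<bar>\<delta> i\<bar> + \<bar>\<delta> (Suc i mod n)\<bar> \<le> 1"
  defines "X \<equiv> (\<Sum>i<n. if I i then \<delta> i else 0)"
  shows "4 * \<bar>X\<bar> \<le> (\<Sum>i<n. \<bar>\<delta> i\<bar> + \<bar>\<delta> (Suc i mod n)\<bar>)" "(\<Sum>i<n. \<bar>\<delta> i\<bar> + \<bar>\<delta> (Suc i mod n)\<bar>) \<le> int n"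
proof -
  have re: "(\<Sum>i<n. g (Suc i mod n)) = (\<Sum>i<n. g i)" for g :: "nat \<Rightarrow> int"
    using sum.reindex_bij_betw[OF bij_Suc_mod[OF n], of g] by simp
  let ?Y = "\<Sum>i<n. if I i then 0 else \<delta> i"
  have "X + ?Y = (\<Sum>i<n. \<delta> i)" unfolding X_def by (simp add: sum.distrib[symmetric] if_distrib cong: if_cong)

  also have "\<dots> = 0" unfolding \<delta>_def by (simp add: sum_subtractf re)
  finally have XY: "\<bar>X\<bar> = \<bar>?Y\<bar>" by linarith
  have "\<bar>X\<bar> + \<bar>?Y\<bar> \<le> (\<Sum>i<n. \<bar>if I i then \<delta> i else 0\<bar>) + (\<Sum>i<n. \<bar>if I i then 0 else \<delta> i\<bar>)"
    unfolding X_def by (intro add_mono sum_abs)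
  also have "\<dots> = (\<Sum>i<n. \<bar>\<delta> i\<bar>)" unfolding sum.distrib[symmetric] by (rule sum.cong) auto
  finally have "2 * \<bar>X\<bar> \<le> (\<Sum>i<n. \<bar>\<delta> i\<bar>)" using XY by linarith
  moreover have "(\<Sum>i<n. \<bar>\<delta> i\<bar> + \<bar>\<delta> (Suc i mod n)\<bar>) = 2 * (\<Sum>i<n. \<bar>\<delta> i\<bar>)"
    using re[of "\<lambda>i. \<bar>\<delta> i\<bar>"] by (simp add: sum.distrib)
  ultimately show "4 * \<bar>X\<bar> \<le> (\<Sum>i<n. \<bar>\<delta> i\<bar> + \<bar>\<delta> (Suc i mod n)\<bar>)" by linarith
  have "(\<Sum>i<n. \<bar>\<delta> i\<bar> + \<bar>\<delta> (Suc i mod n)\<bar>) \<le> (\<Sum>i<n. 1)" by (rule sum_mono) (use adj in auto)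
  then show "(\<Sum>i<n. \<bar>\<delta> i\<bar> + \<bar>\<delta> (Suc i mod n)\<bar>) \<le> int n" by simp
qed

locale rect_crossing =
  fixes ws :: "(real^3) list" and dw :: "nat \<Rightarrow> 3" and v :: "real^3" and d e :: 3 and \<alpha> \<beta> :: real
  assumes ws: "lcyc ws dw" and v: "\<And>j. v $ j \<in> \<int>"
    and ab: "\<alpha> \<in> \<int>" "\<beta> \<in> \<int>" "\<alpha> \<noteq> 0" "\<beta> \<noteq> 0" and de: "d \<noteq> e"
begin

abbreviation "n \<equiv> length ws"
abbreviation "s i \<equiv> above v (ax d \<alpha>) (ax e \<beta>) (shifted ws ! i)"
abbreviation "ins i \<equiv> inside_rect v (ax d \<alpha>) (ax e \<beta>) (shifted ws ! i)"

lemma n_pos: "n > 0" "n \<ge> 3"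
  using ws by (auto simp: lcyc_def)

lemma lt: "Suc i mod n < n"
  using n_pos by simp

lemma s01: "s i = 0 \<or> s i = 1"
  by (simp add: above_def)

lemma s_change: "i < n \<Longrightarrow> s (Suc i mod n) \<noteq> s i \<Longrightarrow> dw i \<noteq> d \<and> dw i \<noteq> e"
  using transversal_shifted(2)[OF ws v ab de] by metis

text \<open>Both edges would have to run along the normal axis of the rectangle.\<close>

lemma s_adjacent:
  assumes i: "i < n"
  shows "\<bar>s (Suc i mod n) - s i\<bar> + \<bar>s (Suc (Suc i mod n) mod n) - s (Suc i mod n)\<bar> \<le> 1"
proof (rule ccontr)
  assume "\<not> ?thesis"
  then have c: "s (Suc i mod n) \<noteq> s i" "s (Suc (Suc i mod n) mod n) \<noteq> s (Suc i mod n)"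
    using s01[of i] s01[of "Suc i mod n"] s01[of "Suc (Suc i mod n) mod n"] by auto
  obtain f where f: "\<And>j. j = d \<or> j = e \<or> j = f" using third_axis[OF de] by blast
  have "dw i = f" "dw (Suc i mod n) = f" using s_change[OF i c(1)] s_change[OF lt c(2)] f by metis+
  then show False using ws i by (auto simp: lcyc_def)
qed

lemma crossing_eq: "crossing v (ax d \<alpha>) (ax e \<beta>) (shifted ws) = (\<Sum>i<n. if ins i then s (Suc i mod n) - s i else 0)"
proof -
  have l: "length (shifted ws) = n" by (simp add: shifted_def)
  show ?thesis unfolding crossing_def cross_edge_def l ..
qed

lemma sum_small:
  assumes "n < 8"
  shows "\<bar>\<Sum>i<n. if I i then s (Suc i mod n) - s i else 0\<bar> \<le> 1"
  using cyclic_sum_bounds(1)[where s = s and n = n and I = I, OF n_pos(1) s_adjacent]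
    cyclic_sum_bounds(2)[where s = s and n = n, OF n_pos(1) s_adjacent] assms by linarith

lemma crossing_small: "n < 8 \<Longrightarrow> \<bar>crossing v (ax d \<alpha>) (ax e \<beta>) (shifted ws)\<bar> \<le> 1"
  unfolding crossing_eq by (rule sum_small)

end

section \<open>Eight edges against a rectangle\<close>

lemma simple_nonadjacent:
  assumes "simple_polygon vs" "i < length vs" "j < length vs" "i \<noteq> j" "j \<noteq> Suc i mod length vs" "i \<noteq> Suc j mod length vs"
  shows "edge vs i \<inter> edge vs j = {}"
proof -
  have d: "distinct vs" and n: "length vs \<ge> 3" and "edge vs i \<inter> edge vs j = edge_ends vs i \<inter> edge_ends vs j"
    using assms by (auto simp: simple_polygon_def)
  moreover have n0: "length vs > 0" using n by linarith
  then have lt: "Suc k mod length vs < length vs" for k by simp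
  have "vs ! i \<noteq> vs ! j" "vs ! j \<noteq> vs ! (Suc i mod length vs)" "vs ! i \<noteq> vs ! (Suc j mod length vs)"
    using assms d lt by (simp_all add: nth_eq_iff_index_eq)
  moreover have "Suc i mod length vs \<noteq> Suc j mod length vs"
    using assms(2-4) bij_Suc_mod[OF n0] unfolding bij_betw_def inj_on_def by blast
  then have "vs ! (Suc i mod length vs) \<noteq> vs ! (Suc j mod length vs)"
    using d lt by (simp add: nth_eq_iff_index_eq)
  ultimately show ?thesis by (auto simp: edge_ends_def)
qed

lemma cross_point:
  fixes p q p' q' :: "real^3"
  assumes gf: "g \<noteq> f" and pq: "\<And>j. j \<noteq> g \<Longrightarrow> q $ j = p $ j" and pq': "\<And>j. j \<noteq> f \<Longrightarrow> q' $ j = p' $ j"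
    and h: "\<And>j. j \<noteq> g \<Longrightarrow> j \<noteq> f \<Longrightarrow> p $ j = p' $ j"
    and b: "bt (p $ g) (q $ g) (p' $ g)" "bt (p' $ f) (q' $ f) (p $ f)"
  shows "closed_segment p q \<inter> closed_segment p' q' \<noteq> {}"
proof -
  define x :: "real^3" where "x = (\<chi> j. if j = g then p' $ g else p $ j)"
  have "x \<in> closed_segment p q" by (rule in_axis_segment[where D = g]) (use pq b in \<open>auto simp: x_def\<close>)
  moreover have "x \<in> closed_segment p' q'"
    by (rule in_axis_segment[where D = f]) (use pq' b h gf in \<open>auto simp: x_def\<close>)
  ultimately show ?thesis by blast
qed

text \<open>Four level changes alternate in sign; a partial sum of modulus 2 takes both of one sign
  and none of the other.\<close>

lemma two_of_four:
  fixes x y :: int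
  assumes "\<bar>y - x\<bar> = 1"
    "\<bar>(if A then y - x else 0) + (if B then x - y else 0) + (if C then y - x else 0) + (if D then x - y else 0)\<bar> \<ge> 2"
  shows "A \<and> C \<and> \<not> B \<and> \<not> D \<or> B \<and> D \<and> \<not> A \<and> \<not> C"
  using assms by (cases A; cases B; cases C; cases D) auto

text \<open>Seen in the vertical plane through the line of the four columns, a polygon which passes up through the
  interval at \<open>a\<close> and \<open>c\<close> and down outside of it at \<open>b\<close> and \<open>d\<close> has to cross itself.\<close>

lemma four_columns:
  assumes up: "b1 < t1" "b1 < t2" "b2 < t1" "b2 < t2"
    and I: "r0 < a" "a < r1" "r0 < c" "c < r1" and O: "b < r0 \<or> r1 < b" "d < r0 \<or> r1 < d"
    and H: "\<not> (bt a b c \<and> bt b1 t2 t1)" "\<not> (bt b c a \<and> bt b2 t1 b1)" "\<not> (bt c d a \<and> bt b2 t1 t2)"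
      "\<not> (bt d a c \<and> bt b1 t2 b2)" "\<not> (bt a b d \<and> bt t2 b2 t1)" "\<not> (bt b c d \<and> bt t2 b2 b1)"
      "\<not> (bt c d b \<and> bt t1 b1 t2)" "\<not> (bt d a b \<and> bt t1 b1 b2)"
  shows False
proof -
  \<comment> \<open>The polygon runs through the columns in the order \<open>a\<close>,
    \<open>b\<close>, \<open>c\<close>, \<open>d\<close>. The horizontal edge from \<open>a\<close>
    to \<open>b\<close> has height \<open>t1\<close>, that from \<open>b\<close> to \<open>c\<close>
    height \<open>b1\<close>, that from \<open>c\<close> to \<open>d\<close> height
    \<open>t2\<close>, that from \<open>d\<close> to \<open>a\<close> height \<open>b2\<close>. As
    all bottoms are below all tops, missing a column means passing beyond its nearer end.\<close>
  have h: "\<not> bt a b c \<or> t2 < t1" "\<not> bt b c a \<or> b1 < b2" "\<not> bt c d a \<or> t1 < t2" "\<not> bt d a c \<or> b2 < b1"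
    "\<not> bt a b d \<or> t2 < t1" "\<not> bt b c d \<or> b1 < b2" "\<not> bt c d b \<or> t1 < t2" "\<not> bt d a b \<or> b2 < b1"
  proof -
    have 1: "t' < t" if "b' < t" "b' < t'" "\<not> bt b' t' t" for b' t t' using that by (auto simp: bt_def)
    have 2: "t' < t" if "b' < t" "b' < t'" "\<not> bt t' b' t" for b' t t' using that by (auto simp: bt_def)
    have 3: "b < b'" if "b < t'" "b' < t'" "\<not> bt b' t' b" for b b' t' using that by (auto simp: bt_def)
    have 4: "b < b'" if "b < t'" "b' < t'" "\<not> bt t' b' b" for b b' t' using that by (auto simp: bt_def)
    show "\<not> bt a b c \<or> t2 < t1" "\<not> bt b c a \<or> b1 < b2" "\<not> bt c d a \<or> t1 < t2" "\<not> bt d a c \<or> b2 < b1"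
      "\<not> bt a b d \<or> t2 < t1" "\<not> bt b c d \<or> b1 < b2" "\<not> bt c d b \<or> t1 < t2" "\<not> bt d a b \<or> b2 < b1"
      using H 1[OF up(1,2)] 3[OF up(1,3)] 1[OF up(4,3)] 3[OF up(4,2)] 2[OF up(3,4)] 4[OF up(2,4)] 2[OF up(2,1)] 4[OF up(3,1)]
      by blast+
  qed
  from O show False
  proof (elim disjE)
    assume o: "b < r0" "d < r0"
    show False using h I o unfolding bt_def
      by (cases "a \<le> c"; cases "b \<le> d") auto
  next
    assume o: "b < r0" "r1 < d"
    show False using h I o unfolding bt_def by (cases "a \<le> c") auto
  next
    assume o: "r1 < b" "d < r0"
    show False using h I o unfolding bt_def by (cases "a \<le> c") auto
  next
    assume o: "r1 < b" "r1 < d"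
    show False using h I o unfolding bt_def
      by (cases "a \<le> c"; cases "b \<le> d") auto
  qed
qed

text \<open>A value of modulus 2 is the case of equality: every second edge is a column that changes
  the level, and the columns lie alternately inside and outside. If the edges between the columns
  used both horizontal axes, two columns would overlap on one line. So all columns lie in one plane,
  and \<open>four_columns\<close> applies.\<close>

lemma (in rect_crossing) crossing_eight:
  assumes sp: "simple_polygon ws" and n8: "n = 8"
  shows "\<bar>crossing v (ax d \<alpha>) (ax e \<beta>) (shifted ws)\<bar> \<le> 1"
proof (rule ccontr)
  let ?\<delta> = "\<lambda>i. s (Suc i mod n) - s i"
  assume big: "\<not> ?thesis"
  let ?X = "\<Sum>i<n. if ins i then ?\<delta> i else 0"
  have "4 * \<bar>?X\<bar> \<le> (\<Sum>i<n. \<bar>?\<delta> i\<bar> + \<bar>?\<delta> (Suc i mod n)\<bar>)"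
    by (rule cyclic_sum_bounds(1)[where s = s and n = n and I = ins, OF n_pos(1) s_adjacent])
  then have "(\<Sum>i<n. \<bar>?\<delta> i\<bar> + \<bar>?\<delta> (Suc i mod n)\<bar>) \<ge> 8" using big unfolding crossing_eq by linarith
  then have S0: "(\<Sum>i<n. 1 - (\<bar>?\<delta> i\<bar> + \<bar>?\<delta> (Suc i mod n)\<bar>)) \<le> 0" unfolding sum_subtractf using n8 by simp
  \<comment> \<open>Equality in every term: of two consecutive edges exactly one changes the
    level.\<close>
  have all1: "\<bar>?\<delta> i\<bar> + \<bar>?\<delta> (Suc i mod n)\<bar> = 1" if i: "i < n" for i
  proof (rule ccontr)
    assume "\<not> ?thesis"
    then have "0 < (\<Sum>i<n. 1 - (\<bar>?\<delta> i\<bar> + \<bar>?\<delta> (Suc i mod n)\<bar>))"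
      using i s_adjacent by (intro sum_pos2[of _ i]) (auto simp: order_neq_le_trans)
    then show False using S0 by linarith
  qed
  have X: "\<bar>?X\<bar> \<ge> 2" using big unfolding crossing_eq by linarith
  have m8: "Suc 0 mod 8 = 1" "Suc 1 mod 8 = 2" "Suc 2 mod 8 = 3" "Suc 3 mod 8 = 4" "Suc 4 mod 8 = 5" "Suc 5 mod 8 = 6"
    "Suc 6 mod 8 = 7" "Suc 7 mod 8 = 0" by simp_all
  have l8: "(0::nat) < 8" "(1::nat) < 8" "(2::nat) < 8" "(3::nat) < 8" "(4::nat) < 8" "(5::nat) < 8" "(6::nat) < 8" by simp_all
  have ex: "?X = (if ins 0 then s 1 - s 0 else 0) + (if ins 1 then s 2 - s 1 else 0) + (if ins 2 then s 3 - s 2 else 0)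
     + (if ins 3 then s 4 - s 3 else 0) + (if ins 4 then s 5 - s 4 else 0) + (if ins 5 then s 6 - s 5 else 0)
     + (if ins 6 then s 7 - s 6 else 0) + (if ins 7 then s 0 - s 7 else 0)"
  proof -
    have sum8: "(\<Sum>i<8. g i) = g 0 + g 1 + g 2 + g 3 + g 4 + g 5 + g 6 + g 7" for g :: "nat \<Rightarrow> int"
      by (simp add: eval_nat_numeral)
    show ?thesis unfolding n8 sum8 m8 by (simp split del: if_split)
  qed
  note q8 = all1[unfolded n8]
  note a8 = q8[OF l8(1), unfolded m8] q8[OF l8(2), unfolded m8] q8[OF l8(3), unfolded m8] q8[OF l8(4), unfolded m8]
    q8[OF l8(5), unfolded m8] q8[OF l8(6), unfolded m8] q8[OF l8(7), unfolded m8]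
  have step: "y \<noteq> x \<and> z = y \<or> y = x \<and> z \<noteq> y" if "\<bar>y - x\<bar> + \<bar>z - y\<bar> = 1" for x y z :: int
    using that by linarith
  have two: "s i = s j" if "s i \<noteq> s l" "s j \<noteq> s l" for i j l
    using that s01[of i] s01[of j] s01[of l] by linarith
  \<comment> \<open>\<open>k\<close> marks the start of the alternating pattern: the edges
    \<open>k\<close> and \<open>k + 4\<close> are columns inside the rectangle, \<open>k + 2\<close>
    and \<open>k + 6\<close> columns outside of it. From here on vertices are numbered from
    \<open>k\<close>.\<close>
  have "\<exists>k<4. ins k \<and> ins (k + 4) \<and> \<not> ins (k + 2) \<and> \<not> ins ((k + 6) mod 8) \<and> s (Suc k) \<noteq> s k \<and> s ((k+2)) = s (Suc k)
     \<and> s ((k+3)) \<noteq> s (Suc k) \<and> s ((k+4)) \<noteq> s (Suc k) \<and> s ((k+5) mod 8) = s (Suc k) \<and> s ((k+6) mod 8) = s (Suc k) \<and> s ((k+7) mod 8) = s k"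
  proof (cases "s 1 = s 0")
    case False
    have eqs: "s 2 = s 1" "s 3 = s 0" "s 4 = s 0" "s 5 = s 1" "s 6 = s 1" "s 7 = s 0"
    proof -
      have a: "s 2 = s 1" using step[OF a8(1)] False by simp
      have b: "s 3 \<noteq> s 2" using step[OF a8(2)] a by simp
      have c: "s 4 = s 3" using step[OF a8(3)] b by simp
      have d: "s 5 \<noteq> s 4" using step[OF a8(4)] c by simp
      have e: "s 6 = s 5" using step[OF a8(5)] d by simp
      have f: "s 7 \<noteq> s 6" using step[OF a8(6)] e by simp
      have g: "s 3 = s 0" by (rule two[of 3 1]) (use a b False in auto)
      have h: "s 5 = s 1" by (rule two[of 5 3]) (use a b c d in auto)
      have i: "s 7 = s 0" by (rule two[of 7 1]) (use e f h False in auto)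
      show "s 2 = s 1" "s 3 = s 0" "s 4 = s 0" "s 5 = s 1" "s 6 = s 1" "s 7 = s 0"
        using a b c d e f g h i by simp_all
    qed
    have "ins 0 \<and> ins 4 \<and> \<not> ins 2 \<and> \<not> ins 6 \<or> ins 2 \<and> ins 6 \<and> \<not> ins 0 \<and> \<not> ins 4"
    proof (rule two_of_four)
      show "\<bar>s 1 - s 0\<bar> = 1" using False s01[of 0] s01[of 1] by linarith
      have "?X = (if ins 0 then s 1 - s 0 else 0) + (if ins 2 then s 0 - s 1 else 0) + (if ins 4 then s 1 - s 0 else 0)
          + (if ins 6 then s 0 - s 1 else 0)"
        unfolding ex eqs by simp
      then show "2 \<le> \<bar>(if ins 0 then s 1 - s 0 else 0) + (if ins 2 then s 0 - s 1 else 0) + (if ins 4 then s 1 - s 0 else 0)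
          + (if ins 6 then s 0 - s 1 else 0)\<bar>" using X by (simp only:)
    qed
    then show ?thesis
    proof
      assume "ins 0 \<and> ins 4 \<and> \<not> ins 2 \<and> \<not> ins 6"
      then show ?thesis using eqs False by (intro exI[of _ 0], unfold add_0) simp
    next
      assume "ins 2 \<and> ins 6 \<and> \<not> ins 0 \<and> \<not> ins 4"
      then show ?thesis using eqs False by (intro exI[of _ 2]) simp
    qed
  next
    case True
    have eqs: "s 2 \<noteq> s 1" "s 3 = s 2" "s 4 = s 1" "s 5 = s 1" "s 6 = s 2" "s 7 = s 2" "s 0 = s 1"
    proof -
      have a: "s 2 \<noteq> s 1" using step[OF a8(1)] True by simp
      have b: "s 3 = s 2" using step[OF a8(2)] a by simp
      have c: "s 4 \<noteq> s 3" using step[OF a8(3)] b by simp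
      have d: "s 5 = s 4" using step[OF a8(4)] c by simp
      have e: "s 6 \<noteq> s 5" using step[OF a8(5)] d by simp
      have f: "s 7 = s 6" using step[OF a8(6)] e by simp
      have g: "s 4 = s 1" by (rule two[of 4 2]) (use a b c in auto)
      have h: "s 6 = s 2" by (rule two[of 6 1]) (use a d e g in auto)
      show "s 2 \<noteq> s 1" "s 3 = s 2" "s 4 = s 1" "s 5 = s 1" "s 6 = s 2" "s 7 = s 2" "s 0 = s 1"
        using a b c d e f g h True by simp_all
    qed
    have "ins 1 \<and> ins 5 \<and> \<not> ins 3 \<and> \<not> ins 7 \<or> ins 3 \<and> ins 7 \<and> \<not> ins 1 \<and> \<not> ins 5"
    proof (rule two_of_four)
      show "\<bar>s 2 - s 1\<bar> = 1" using eqs(1) s01[of 1] s01[of 2] by linarith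
      have "?X = (if ins 1 then s 2 - s 1 else 0) + (if ins 3 then s 1 - s 2 else 0) + (if ins 5 then s 2 - s 1 else 0)
          + (if ins 7 then s 1 - s 2 else 0)"
        unfolding ex eqs(2-) by simp
      then show "2 \<le> \<bar>(if ins 1 then s 2 - s 1 else 0) + (if ins 3 then s 1 - s 2 else 0) + (if ins 5 then s 2 - s 1 else 0)
          + (if ins 7 then s 1 - s 2 else 0)\<bar>" using X by (simp only:)
    qed
    then show ?thesis
    proof
      assume "ins 1 \<and> ins 5 \<and> \<not> ins 3 \<and> \<not> ins 7"
      then show ?thesis using eqs by (intro exI[of _ 1]) (simp add: Suc_1 del: One_nat_def)
    next
      assume "ins 3 \<and> ins 7 \<and> \<not> ins 1 \<and> \<not> ins 5"
      then show ?thesis using eqs by (intro exI[of _ 3]) simp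
    qed
  qed
  then obtain k where k: "k < 4" "ins k" "ins (k + 4)" "\<not> ins (k + 2)" "\<not> ins ((k + 6) mod 8)"
    and sk: "s (Suc k) \<noteq> s k" "s (k+2) = s (Suc k)" "s (k+3) \<noteq> s (Suc k)" "s (k+4) \<noteq> s (Suc k)"
      "s ((k+5) mod 8) = s (Suc k)" "s ((k+6) mod 8) = s (Suc k)" "s ((k+7) mod 8) = s k" by blast
  obtain f where f: "f \<noteq> d" "f \<noteq> e" "\<And>j. j = d \<or> j = e \<or> j = f" using third_axis[OF de] by blast
  define V where "V j = ws ! ((k + j) mod 8)" for j
  define D where "D j = dw ((k + j) mod 8)" for j
  have V8: "V 8 = V 0" by (simp add: V_def)
  have Sm: "Suc ((k + j) mod 8) mod 8 = (k + Suc j) mod 8" for j by (simp add: mod_Suc_eq)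
  have VD: "V (Suc j) $ i = V j $ i \<longleftrightarrow> i \<noteq> D j" for i j
    using ws n8 Sm[of j] unfolding lcyc_def V_def D_def by (metis mod_less_divisor zero_less_numeral)
  have VDe: "V (Suc j) $ i = V j $ i" if "i \<noteq> D j" for i j using VD that by blast
  have Dn: "D (Suc j) \<noteq> D j" for j
    using ws n8 Sm[of j] unfolding lcyc_def D_def by (metis mod_less_divisor zero_less_numeral)
  have disj: "closed_segment (V j) (V (Suc j)) \<inter> closed_segment (V l) (V (Suc l)) = {}"
    if jl: "Suc j < l" "l < 8" "\<not> (j = 0 \<and> l = 7)" for j l
  proof -
    have e: "edge ws ((k + j) mod 8) = closed_segment (V j) (V (Suc j))" for j
      unfolding edge_def V_def n8 Sm ..
    have "(k + j) mod 8 \<noteq> (k + l) mod 8" "(k + l) mod 8 \<noteq> (k + Suc j) mod 8" "(k + j) mod 8 \<noteq> (k + Suc l) mod 8"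
    proof -
      have md: "(k + a) mod 8 = (if k + a < 8 then k + a else k + a - 8)" if "a \<le> 8" for a
        using that k(1) by (simp add: mod_if)
      show "(k + j) mod 8 \<noteq> (k + l) mod 8" "(k + l) mod 8 \<noteq> (k + Suc j) mod 8" "(k + j) mod 8 \<noteq> (k + Suc l) mod 8"
        using jl k(1) md[of j] md[of l] md[of "Suc j"] md[of "Suc l"] by (auto split: if_splits)
    qed
    then show ?thesis
      using simple_nonadjacent[OF sp, of "(k + j) mod 8" "(k + l) mod 8"] unfolding n8 Sm e by simp
  qed
  have km: "(k + j) mod 8 = k + j" if "j \<le> 4" for j using k(1) that by simp
  have shV: "shifted ws ! ((k + j) mod 8) = V j + half" for j
    unfolding V_def shifted_def using n8 by simp
  have shs: "s ((k + j) mod 8) = above v (ax d \<alpha>) (ax e \<beta>) (V j + half)" for j using shV by simp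
  have shi: "ins ((k + j) mod 8) \<longleftrightarrow> inside_rect v (ax d \<alpha>) (ax e \<beta>) (V j + half)" for j using shV by simp
  define z where "z j = V j $ f" for j
  obtain sg where sg: "sg = 1 \<or> sg = -1" and h: "\<And>v \<alpha> \<beta> p. height v (ax d \<alpha>) (ax e \<beta>) p = sg * \<alpha> * \<beta> * (p $ f - v $ f)"
    using height_ax[OF de f(1,2)] by blast
  define w where "w = sg * \<alpha> * \<beta>"
  have w0: "w \<noteq> 0" using sg ab by (auto simp: w_def)
  have ab_s: "above v (ax d \<alpha>) (ax e \<beta>) (V j + half) = (if w * (z j + 1/2 - v $ f) > 0 then 1 else 0)" for j
    by (simp add: above_def h z_def half_def w_def)
  have sV: "s k = above v (ax d \<alpha>) (ax e \<beta>) (V 0 + half)" "s (Suc k) = above v (ax d \<alpha>) (ax e \<beta>) (V 1 + half)"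
    "s (k + 2) = above v (ax d \<alpha>) (ax e \<beta>) (V 2 + half)" "s (k + 3) = above v (ax d \<alpha>) (ax e \<beta>) (V 3 + half)"
    "s (k + 4) = above v (ax d \<alpha>) (ax e \<beta>) (V 4 + half)"
    using shs[of 0] shs[of 1] shs[of 2] shs[of 3] shs[of 4] k(1) by simp_all
  note sab = sk[unfolded shs sV, unfolded ab_s]
  have Dch: "D j = f" if "above v (ax d \<alpha>) (ax e \<beta>) (V (Suc j) + half) \<noteq> above v (ax d \<alpha>) (ax e \<beta>) (V j + half)" for j
  proof -
    have "z (Suc j) \<noteq> z j" using that unfolding ab_s by auto
    then show ?thesis using VD[of j f] by (auto simp: z_def)
  qed
  have De: "D 0 = f" "D 2 = f" "D 4 = f" "D 6 = f"
  proof -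
    show "D 0 = f" by (rule Dch) (use sab(1) in \<open>simp add: ab_s\<close>)
    show "D 2 = f" by (rule Dch) (use sab(2,3) in \<open>simp add: ab_s\<close>)
    show "D 4 = f" by (rule Dch) (use sab(4,5) in \<open>simp add: ab_s\<close>)
    show "D 6 = f" by (rule Dch) (use sab(1,6,7) in \<open>simp add: ab_s\<close>)
  qed
  have Do: "D 1 \<noteq> f" "D 3 \<noteq> f" "D 5 \<noteq> f" "D 7 \<noteq> f"
    using Dn[of 0] Dn[of 2] Dn[of 4] Dn[of 6] De by (simp_all add: eval_nat_numeral)
  have zz: "z 2 = z 1" "z 4 = z 3" "z 6 = z 5" "z 0 = z 7"
    using VDe[of f 1] VDe[of f 3] VDe[of f 5] VDe[of f 7] Do V8 by (auto simp: z_def eval_nat_numeral)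
  have cc: "V 1 $ j = V 0 $ j" "V 3 $ j = V 2 $ j" "V 5 $ j = V 4 $ j" "V 7 $ j = V 6 $ j" if "j \<noteq> f" for j
    using VDe[of j 0] VDe[of j 2] VDe[of j 4] VDe[of j 6] De that by (simp_all add: eval_nat_numeral)
  \<comment> \<open>The heights after the columns 0 and 4 are on one side of the plane of the
    rectangle, those after the columns 2 and 6 on the other; the sign of \<open>w\<close> decides
    which side is up.\<close>
  have side: "(z 3 < z 1 \<and> z 3 < z 5 \<and> z 7 < z 1 \<and> z 7 < z 5) \<or> (z 1 < z 3 \<and> z 5 < z 3 \<and> z 1 < z 7 \<and> z 5 < z 7)"
  proof -
    define y where "y j = w * (z j + 1/2 - v $ f)" for j
    have "(y 1 > 0 \<longleftrightarrow> y 5 > 0) \<and> (y 3 > 0 \<longleftrightarrow> y 7 > 0) \<and> (y 1 > 0 \<longleftrightarrow> \<not> y 3 > 0)"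
    proof -
      have ifeq: "((if P then 1 else 0 :: int) = (if Q then 1 else 0)) = (P = Q)" for P Q by simp
      have r: "b \<noteq> a \<Longrightarrow> d \<noteq> b \<Longrightarrow> f = b \<Longrightarrow> h = a \<Longrightarrow> (b \<longleftrightarrow> f) \<and> (d \<longleftrightarrow> h) \<and> (b \<longleftrightarrow> \<not> d)" for a b d f h
        by blast
      note t = sab[unfolded ifeq]
      show ?thesis unfolding y_def by (rule r[OF t(1) t(3) t(5) t(7)])
    qed
    then consider "y 1 > 0 \<and> y 5 > 0 \<and> \<not> y 3 > 0 \<and> \<not> y 7 > 0" | "\<not> y 1 > 0 \<and> \<not> y 5 > 0 \<and> y 3 > 0 \<and> y 7 > 0"
      by metis
    then have yy: "(y 3 < y 1 \<and> y 3 < y 5 \<and> y 7 < y 1 \<and> y 7 < y 5) \<or> (y 1 < y 3 \<and> y 5 < y 3 \<and> y 1 < y 7 \<and> y 5 < y 7)"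
      by cases linarith+
    have "y i < y j \<longleftrightarrow> (if w > 0 then z i < z j else z j < z i)" for i j
      using w0 by (simp add: y_def mult_less_cancel_left)
    then show ?thesis using yy by (cases "w > 0") (simp_all add: disj_commute)
  qed
  define Ig where "Ig g j = (if g = d then sbt (v $ d) \<alpha> (V j $ d + 1/2) else sbt (v $ e) \<beta> (V j $ e + 1/2))" for g j
  have insI: "inside_rect v (ax d \<alpha>) (ax e \<beta>) (V j + half) \<longleftrightarrow> Ig d j \<and> Ig e j" for j
    using de by (auto simp: inside_rect_ax Ig_def half_def)
  have In: "Ig d 0" "Ig e 0" "Ig d 4" "Ig e 4" "\<not> (Ig d 2 \<and> Ig e 2)" "\<not> (Ig d 6 \<and> Ig e 6)"
    using k(2-5) shi[of 0] shi[of 4] shi[of 2] shi[of 6] km[of 0] km[of 4] km[of 2] insI by simp_all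
  have Igeq: "Ig g i = Ig g j" if "V i $ g = V j $ g" "g = d \<or> g = e" for g i j
    using that de by (auto simp: Ig_def)
  \<comment> \<open>If the connecting edges before and after an outside column had different axes,
    each horizontal coordinate of that column would agree with one of the two inside columns, and it
    would be inside as well.\<close>
  have st: "D (Suc j) = D (Suc (Suc (Suc j)))"
    if j: "Ig d j" "Ig e j" "\<not> (Ig d (j+2) \<and> Ig e (j+2))" "Ig d (j+4)" "Ig e (j+4)"
      and c: "\<And>i. i \<noteq> f \<Longrightarrow> V (Suc j) $ i = V j $ i" "\<And>i. i \<noteq> f \<Longrightarrow> V (j + 3) $ i = V (j + 2) $ i" for j
  proof (rule ccontr)
    assume ne: "D (Suc j) \<noteq> D (Suc (Suc (Suc j)))"
    have 1: "V (j+2) $ i = V j $ i" if "i \<noteq> D (Suc j)" "i \<noteq> f" for i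
      using VDe[of i "Suc j"] c(1) that by simp
    have 2: "V (j+4) $ i = V (j+2) $ i" if "i \<noteq> D (Suc (Suc (Suc j)))" "i \<noteq> f" for i
      using VDe[of i "Suc (Suc (Suc j))"] c(2) that by (simp add: eval_nat_numeral)
    have "Ig i (j+2)" if "i = d \<or> i = e" for i
    proof (cases "i = D (Suc j)")
      case True
      then have "V (j+4) $ i = V (j+2) $ i" using 2 ne that f by metis
      then show ?thesis using Igeq[OF _ that] j that by metis
    next
      case False
      then have "V (j+2) $ i = V j $ i" using 1 that f by metis
      then show ?thesis using Igeq[OF _ that] j that by metis
    qed
    then show False using j(3) by blast
  qed
  have D13: "D 1 = D 3" using st[of 0] In cc by (simp add: eval_nat_numeral)
  have Ig8: "Ig g 8 = Ig g 0" for g using V8 by (simp add: Ig_def)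
  have D57: "D 5 = D 7" using st[of 4] In cc Ig8 by (simp add: eval_nat_numeral)
  show False
  proof (cases "D 1 = D 5")
    case False
    \<comment> \<open>Along the axis of \<open>D 1\<close> nothing changes from vertex 4 back to
      vertex 0, along the other horizontal axis nothing changes from 0 to 4. So the columns 0 and 4
      lie on one line.\<close>
    have "V 4 $ j = V 0 $ j" if "j \<noteq> f" for j
    proof (cases "j = D 1")
      case True
      then have "V 6 $ j = V 5 $ j" "V 8 $ j = V 7 $ j" using VDe[of j 5] VDe[of j 7] False D57 by (simp_all add: eval_nat_numeral)
      then show ?thesis using cc[OF that] V8 by simp
    next
      case False
      then have "V 2 $ j = V 1 $ j" "V 4 $ j = V 3 $ j" using VDe[of j 1] VDe[of j 3] D13 by (simp_all add: eval_nat_numeral)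
      then show ?thesis using cc[OF that] by simp
    qed
    note AC = this
    \<comment> \<open>The height intervals of the two columns overlap, since both reach across the
      plane of the rectangle.\<close>
    have "bt (z 0) (z 1) (z 4) \<or> bt (z 4) (z 5) (z 0)"
      using side zz unfolding bt_def by linarith
    then have "V 4 \<in> closed_segment (V 0) (V 1) \<or> V 0 \<in> closed_segment (V 4) (V 5)"
      using in_axis_segment[of f "V 4" "V 0" "V 1"] in_axis_segment[of f "V 0" "V 4" "V 5"] AC cc by (auto simp: z_def)
    then show False using disj[of 0 4] by (auto simp: eval_nat_numeral)
  next
    case True
    \<comment> \<open>All connecting edges have the same axis, so the polygon lies in the plane of
      \<open>g\<close> and \<open>f\<close>.\<close>
    define g where "g = D 1"
    have Dg: "D 1 = g" "D 3 = g" "D 5 = g" "D 7 = g" using True D13 D57 by (simp_all add: g_def)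
    have gf: "g \<noteq> f" using Do g_def by simp
    obtain g' where g': "g' \<noteq> g" "g' \<noteq> f" "\<And>j. j = g \<or> j = g' \<or> j = f" "(g = d \<and> g' = e) \<or> (g = e \<and> g' = d)"
      using f gf de by metis
    have hh: "V 2 $ j = V 1 $ j" "V 4 $ j = V 3 $ j" "V 6 $ j = V 5 $ j" "V 0 $ j = V 7 $ j" if "j \<noteq> g" for j
      using VDe[of j 1] VDe[of j 3] VDe[of j 5] VDe[of j 7] Dg that V8 by (simp_all add: eval_nat_numeral)
    have G': "V j $ g' = V 0 $ g'" if "j \<in> {0,1,2,3,4,5,6,7}" for j
      using that hh[OF g'(1)] cc[OF g'(2)] by auto
    define x where "x j = V j $ g" for j
    have xx: "x 1 = x 0" "x 3 = x 2" "x 5 = x 4" "x 7 = x 6" using cc[OF gf] by (simp_all add: x_def)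
    have cp: "\<not> (bt (x j) (x j') (x l) \<and> bt (z l) (z l') (z j))"
      if jl: "closed_segment (V j) (V j') \<inter> closed_segment (V l) (V l') = {}"
        "j \<in> {0,1,2,3,4,5,6,7}" "l \<in> {0,1,2,3,4,5,6,7}"
        "\<And>i. i \<noteq> g \<Longrightarrow> V j' $ i = V j $ i" "\<And>i. i \<noteq> f \<Longrightarrow> V l' $ i = V l $ i" for j j' l l'
    proof
      assume b: "bt (x j) (x j') (x l) \<and> bt (z l) (z l') (z j)"
      have "V j $ i = V l $ i" if "i \<noteq> g" "i \<noteq> f" for i
        using that g'(3)[of i] G'[OF jl(2)] G'[OF jl(3)] by auto
      then have "closed_segment (V j) (V j') \<inter> closed_segment (V l) (V l') \<noteq> {}"
        by (intro cross_point[OF gf]) (use jl(4,5) b in \<open>auto simp: x_def z_def\<close>)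
      then show False using jl(1) by simp
    qed
    have dd: "closed_segment (V 1) (V 2) \<inter> closed_segment (V 4) (V 5) = {}"
      "closed_segment (V 3) (V 4) \<inter> closed_segment (V 0) (V 1) = {}"
      "closed_segment (V 5) (V 6) \<inter> closed_segment (V 0) (V 1) = {}"
      "closed_segment (V 7) (V 0) \<inter> closed_segment (V 4) (V 5) = {}"
      "closed_segment (V 1) (V 2) \<inter> closed_segment (V 6) (V 7) = {}"
      "closed_segment (V 3) (V 4) \<inter> closed_segment (V 6) (V 7) = {}"
      "closed_segment (V 5) (V 6) \<inter> closed_segment (V 2) (V 3) = {}"
      "closed_segment (V 7) (V 0) \<inter> closed_segment (V 2) (V 3) = {}"
      using disj[of 1 4] disj[of 0 3] disj[of 0 5] disj[of 4 7] disj[of 1 6] disj[of 3 6] disj[of 2 5] disj[of 2 7] V8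
      by (simp_all add: eval_nat_numeral Int_commute)
    have H: "\<not> (bt (x 0) (x 2) (x 4) \<and> bt (z 3) (z 5) (z 1))" "\<not> (bt (x 2) (x 4) (x 0) \<and> bt (z 7) (z 1) (z 3))"
      "\<not> (bt (x 4) (x 6) (x 0) \<and> bt (z 7) (z 1) (z 5))" "\<not> (bt (x 6) (x 0) (x 4) \<and> bt (z 3) (z 5) (z 7))"
      "\<not> (bt (x 0) (x 2) (x 6) \<and> bt (z 5) (z 7) (z 1))" "\<not> (bt (x 2) (x 4) (x 6) \<and> bt (z 5) (z 7) (z 3))"
      "\<not> (bt (x 4) (x 6) (x 2) \<and> bt (z 1) (z 3) (z 5))" "\<not> (bt (x 6) (x 0) (x 2) \<and> bt (z 1) (z 3) (z 7))"
      using cp[OF dd(1)] cp[OF dd(2)] cp[OF dd(3)] cp[OF dd(4)] cp[OF dd(5)] cp[OF dd(6)] cp[OF dd(7)] cp[OF dd(8)]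
        hh cc xx zz by simp_all
    obtain u \<gamma> where u\<gamma>: "\<And>j. Ig g j \<longleftrightarrow> sbt u \<gamma> (x j + 1/2)" "u \<in> \<int>" "\<gamma> \<in> \<int>" "\<gamma> \<noteq> 0"
      using g'(4) v ab de unfolding Ig_def x_def by metis
    have IgO: "\<not> Ig g 2" "\<not> Ig g 6"
    proof -
      have "Ig g' 2" "Ig g' 6" using Igeq[of 2 g' 0] Igeq[of 6 g' 0] G'[of 2] G'[of 6] In g'(4) by auto
      then show "\<not> Ig g 2" "\<not> Ig g 6" using In(5,6) g'(4) by auto
    qed
    have IgI: "Ig g 0" "Ig g 4" using In g'(4) by auto
    \<comment> \<open>The window is tested at the shifted points; subtracting 1/2 returns to the
      lattice coordinates.\<close>
    define r0 r1 where "r0 = min u (u + \<gamma>) - 1/2" and "r1 = max u (u + \<gamma>) - 1/2"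
    have sb: "sbt u \<gamma> (y + 1/2) \<longleftrightarrow> r0 < y \<and> y < r1" for y
    proof (cases "\<gamma> > 0")
      case True
      then show ?thesis by (auto simp: sbt_def r0_def r1_def zero_less_mult_iff)
    next
      case False
      then have "\<gamma> < 0" using u\<gamma>(4) by simp
      then show ?thesis by (auto simp: sbt_def r0_def r1_def zero_less_mult_iff mult_less_cancel_left)
    qed
    have xi: "x j \<in> \<int>" for j
      using ws n8 unfolding x_def V_def lcyc_def by simp
    have nb: "x j \<noteq> r0" "x j \<noteq> r1" for j
    proof -
      have m: "min u (u + \<gamma>) \<in> \<int>" "max u (u + \<gamma>) \<in> \<int>" using u\<gamma> by (auto simp: min_def max_def)
      show "x j \<noteq> r0" "x j \<noteq> r1"
        using half_int_neq[of "x j + 1/2" "min u (u + \<gamma>)"] half_int_neq[of "x j + 1/2" "max u (u + \<gamma>)"] xi[of j] m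
        by (auto simp: r0_def r1_def)
    qed
    have I: "r0 < x 0" "x 0 < r1" "r0 < x 4" "x 4 < r1" using IgI u\<gamma>(1) sb by auto
    have O: "x 2 < r0 \<or> r1 < x 2" "x 6 < r0 \<or> r1 < x 6" using IgO u\<gamma>(1) sb nb by (metis linorder_neqE_linordered_idom)+
    from side show False
    proof (elim disjE conjE)
      assume "z 3 < z 1" "z 3 < z 5" "z 7 < z 1" "z 7 < z 5"
      then show False by (rule four_columns[OF _ _ _ _ I O H])
    next
      assume a: "z 1 < z 3" "z 5 < z 3" "z 1 < z 7" "z 5 < z 7"
      \<comment> \<open>Reflecting the heights exchanges tops and bottoms and reduces this case to
        the other one.\<close>
      have nbt: "bt (- p) (- q) (- r) = bt p q r" for p q r by (auto simp: bt_def)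
      show False
        by (rule four_columns[of "- z 3" "- z 1" "- z 5" "- z 7", OF _ _ _ _ I O]) (use a H in \<open>simp_all add: nbt\<close>)
    qed
  qed
qed

section \<open>Polygons with four or six sticks\<close>

lemma Suc_mod_3: "Suc 0 mod 3 = 1" "Suc 1 mod 3 = 2" "Suc 2 mod 3 = 0" by simp_all
lemma Suc_mod_4: "Suc 0 mod 4 = 1" "Suc 1 mod 4 = 2" "Suc 2 mod 4 = 3" "Suc 3 mod 4 = 0" by simp_all
lemma Suc_mod_5: "Suc 0 mod 5 = 1" "Suc 1 mod 5 = 2" "Suc 2 mod 5 = 3" "Suc 3 mod 5 = 4" "Suc 4 mod 5 = 0" by simp_all
lemma Suc_mod_6: "Suc 0 mod 6 = 1" "Suc 1 mod 6 = 2" "Suc 2 mod 6 = 3" "Suc 3 mod 6 = 4" "Suc 4 mod 6 = 5" "Suc 5 mod 6 = 0" by simp_all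
lemma below_3: "(0::nat) < 3" "(1::nat) < 3" "(2::nat) < 3" by simp_all
lemma below_4: "(0::nat) < 4" "(1::nat) < 4" "(2::nat) < 4" "(3::nat) < 4" by simp_all
lemma below_5: "(0::nat) < 5" "(1::nat) < 5" "(2::nat) < 5" "(3::nat) < 5" "(4::nat) < 5" by simp_all
lemma below_6: "(0::nat) < 6" "(1::nat) < 6" "(2::nat) < 6" "(3::nat) < 6" "(4::nat) < 6" "(5::nat) < 6" by simp_all

lemma cyclic_zero_sum:
  fixes c :: "nat \<Rightarrow> real"
  assumes "n > 0"
  shows "(\<Sum>i<n. c (Suc i mod n) - c i) = 0"
  using sum.reindex_bij_betw[OF bij_Suc_mod[OF assms], of c] by (simp add: sum_subtractf)

text \<open>The changes of one coordinate around a closed polygon sum to 0, so a nonzero change is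
  not the only one.\<close>

lemma lcyc_axis_repeats:
  assumes vs: "lcyc vs d" and i: "i < length vs"
  shows "\<exists>k<length vs. k \<noteq> i \<and> d k = d i"
proof (rule ccontr)
  let ?n = "length vs"
  assume no: "\<not> ?thesis"
  let ?c = "\<lambda>k. vs ! k $ d i"
  have st: "?c (Suc k mod ?n) = ?c k \<longleftrightarrow> d i \<noteq> d k" if "k < ?n" for k
    using vs that by (auto simp: lcyc_def)
  have "(\<Sum>k<?n. ?c (Suc k mod ?n) - ?c k) = (\<Sum>k\<in>{i}. ?c (Suc k mod ?n) - ?c k)"
  proof (rule sum.mono_neutral_right)
    show "\<forall>k\<in>{..<?n} - {i}. ?c (Suc k mod ?n) - ?c k = 0" using no st by (metis DiffE insertCI lessThan_iff right_minus_eq)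
  qed (use i in auto)
  moreover have "?n > 0" using i by auto
  ultimately have "?c (Suc i mod ?n) - ?c i = 0" using cyclic_zero_sum[of ?n ?c] by simp
  then show False using st[OF i] by simp
qed

lemma lcyc_step:
  assumes vs: "lcyc vs d" and i: "i < length vs"
  shows "vs ! (Suc i mod length vs) = vs ! i + ax (d i) (vs ! (Suc i mod length vs) $ d i - vs ! i $ d i)"
  using vs i by (auto simp: vec_eq_iff lcyc_def)

text \<open>Each axis in use occurs at least twice and never on consecutive edges. In a cycle of
  three this is impossible; in a cycle of five each axis would occur exactly twice, and five is
  odd.\<close>

lemma lcyc_length:
  assumes vs: "lcyc vs d"
  shows "length vs \<noteq> 3" "length vs \<noteq> 5"
proof -
  have ad: "d (Suc i mod length vs) \<noteq> d i" if "i < length vs" for i using vs that by (auto simp: lcyc_def)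
  have re: "\<exists>k<length vs. k \<noteq> i \<and> d k = d i" if "i < length vs" for i using lcyc_axis_repeats[OF vs that] .
  show "length vs \<noteq> 3"
  proof
    assume n: "length vs = 3"
    have "d 1 \<noteq> d 0" "d 2 \<noteq> d 1" "d 0 \<noteq> d 2" 
      using ad[unfolded n, OF below_3(1)] ad[unfolded n, OF below_3(2)] ad[unfolded n, OF below_3(3)] unfolding Suc_mod_3 by blast+
    moreover have "d 1 = d 0 \<or> d 2 = d 0" using re[of 0] unfolding n by (auto simp: less_Suc_eq eval_nat_numeral)
    ultimately show False by metis
  qed
  show "length vs \<noteq> 5"
  proof
    assume n: "length vs = 5"
    have a: "d 1 \<noteq> d 0" "d 2 \<noteq> d 1" "d 3 \<noteq> d 2" "d 4 \<noteq> d 3" "d 0 \<noteq> d 4"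
      using ad[unfolded n, OF below_5(1)] ad[unfolded n, OF below_5(2)] ad[unfolded n, OF below_5(3)] ad[unfolded n, OF below_5(4)] ad[unfolded n, OF below_5(5)]
      unfolding Suc_mod_5 by blast+
    have e: "\<exists>k\<in>{0,1,2,3,4}. k \<noteq> i \<and> d k = d i" if "i < 5" for i
      using re[of i] that unfolding n by (auto simp: less_Suc_eq eval_nat_numeral)
    have "d 2 = d 0 \<or> d 3 = d 0" "d 3 = d 1 \<or> d 4 = d 1" "d 4 = d 2 \<or> d 0 = d 2" "d 0 = d 3 \<or> d 1 = d 3" "d 1 = d 4 \<or> d 2 = d 4"
      using e[of 0] e[of 1] e[of 2] e[of 3] e[of 4] a by auto
    then show False using a by metis
  qed
qed

section \<open>Cutting hexagons into rectangles\<close>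

lemma spin_trace_rotate: "spin_trace (ws @ [a]) = spin_trace (a # ws)"
proof (cases "ws = []")
  case False
  then show ?thesis
    using hchain_join[of ws "[a]"] hchain_join[of "[a]" ws] by (simp add: spin_trace_alt mult_ac)
qed simp

lemma spin_link_rotate: "spin_link (us @ [u]) b = spin_link (u # us) b"
  unfolding spin_link_def map_append list.map spin_trace_rotate ..

lemma list_4: "length vs = 4 \<Longrightarrow> vs = [vs ! 0, vs ! 1, vs ! 2, vs ! 3]"
  by (cases vs; cases "tl vs"; cases "tl (tl vs)"; cases "tl (tl (tl vs))") (auto simp: eval_nat_numeral)

lemma list_6: "length vs = 6 \<Longrightarrow> vs = [vs ! 0, vs ! 1, vs ! 2, vs ! 3, vs ! 4, vs ! 5]"
  by (cases vs; cases "tl vs"; cases "tl (tl vs)"; cases "tl (tl (tl vs))"; cases "tl (tl (tl (tl vs)))";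
      cases "tl (tl (tl (tl (tl vs))))") (auto simp: eval_nat_numeral)

lemma lcyc_rect:
  assumes vs: "lcyc vs d" and n: "length vs = 4"
  obtains \<alpha> \<beta> where "vs = rect (vs ! 0) (ax (d 0) \<alpha>) (ax (d 1) \<beta>)" "\<alpha> \<in> \<int>" "\<beta> \<in> \<int>" "\<alpha> \<noteq> 0" "\<beta> \<noteq> 0" "d 0 \<noteq> d 1"
proof -
  have a: "d 1 \<noteq> d 0" "d 2 \<noteq> d 1" "d 3 \<noteq> d 2" "d 0 \<noteq> d 3"
  proof -
    have ad: "d (Suc i mod 4) \<noteq> d i" if "i < 4" for i using vs that n by (auto simp: lcyc_def)
    show "d 1 \<noteq> d 0" "d 2 \<noteq> d 1" "d 3 \<noteq> d 2" "d 0 \<noteq> d 3"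
      using ad[OF below_4(1)] ad[OF below_4(2)] ad[OF below_4(3)] ad[OF below_4(4)] unfolding Suc_mod_4 by blast+
  qed
  have e: "\<exists>k\<in>{0,1,2,3}. k \<noteq> i \<and> d k = d i" if "i < 4" for i
    using lcyc_axis_repeats[OF vs, of i] that unfolding n by (auto simp: less_Suc_eq eval_nat_numeral)
  have d: "d 2 = d 0" "d 3 = d 1" using e[of 0] e[of 1] a by auto
  have st: "vs ! (Suc i mod 4) $ j = vs ! i $ j \<longleftrightarrow> j \<noteq> d i" if "i < 4" for i j
    using vs that n by (auto simp: lcyc_def)
  have s: "vs ! 1 $ j = vs ! 0 $ j \<longleftrightarrow> j \<noteq> d 0" "vs ! 2 $ j = vs ! 1 $ j \<longleftrightarrow> j \<noteq> d 1"
    "vs ! 3 $ j = vs ! 2 $ j \<longleftrightarrow> j \<noteq> d 0" "vs ! 0 $ j = vs ! 3 $ j \<longleftrightarrow> j \<noteq> d 1" for j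
    using st[OF below_4(1), of j] st[OF below_4(2), of j] st[OF below_4(3), of j] st[OF below_4(4), of j] unfolding Suc_mod_4 d by blast+
  define \<alpha> \<beta> where "\<alpha> = vs ! 1 $ d 0 - vs ! 0 $ d 0" and "\<beta> = vs ! 2 $ d 1 - vs ! 1 $ d 1"
  have int: "vs ! i $ j \<in> \<int>" if "i < 4" for i j using vs that n by (auto simp: lcyc_def)
  have v: "vs ! 1 = vs ! 0 + ax (d 0) \<alpha>" "vs ! 2 = vs ! 0 + ax (d 0) \<alpha> + ax (d 1) \<beta>" "vs ! 3 = vs ! 0 + ax (d 1) \<beta>"
  proof -
    show 1: "vs ! 1 = vs ! 0 + ax (d 0) \<alpha>" using s(1) by (simp add: vec_eq_iff \<alpha>_def)
    have 2: "vs ! 2 = vs ! 1 + ax (d 1) \<beta>" using s(2) by (simp add: vec_eq_iff \<beta>_def)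
    then show "vs ! 2 = vs ! 0 + ax (d 0) \<alpha> + ax (d 1) \<beta>" using 1 by simp
    show "vs ! 3 = vs ! 0 + ax (d 1) \<beta>"
      unfolding vec_eq_iff
    proof
      fix j show "vs ! 3 $ j = (vs ! 0 + ax (d 1) \<beta>) $ j"
        using s(4)[of j] s(3)[of j] 1 2 a(1) by (cases "j = d 1") auto
    qed
  qed
  have "vs = rect (vs ! 0) (ax (d 0) \<alpha>) (ax (d 1) \<beta>)"
    using list_4[OF n] v by (simp add: rect_def)
  moreover have "\<alpha> \<noteq> 0" "\<beta> \<noteq> 0" using s(1)[of "d 0"] s(2)[of "d 1"] by (auto simp: \<alpha>_def \<beta>_def)
  moreover have "\<alpha> \<in> \<int>" "\<beta> \<in> \<int>" using int by (auto simp: \<alpha>_def \<beta>_def)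
  ultimately show ?thesis using that a(1) by metis
qed

text \<open>A cut that is passed once in each direction contributes a squared modulus, so it
  disappears from the trace up to a positive factor.\<close>

lemma pos_mult_herm_sq: "herm (spinor u) (spinor v) \<noteq> 0 \<Longrightarrow> pos_mult (herm (spinor u) (spinor v) * herm (spinor v) (spinor u)) 1"
  unfolding herm_commute[of "spinor v" "spinor u"] pos_mult_def complex_norm_square[symmetric]
  by (intro exI[of _ "(cmod (herm (spinor u) (spinor v)))\<^sup>2"]) auto

lemma herm_spinor_segment: "herm (spinor u) (spinor v) \<noteq> 0 \<Longrightarrow> 0 \<notin> closed_segment u v"
proof
  assume nz: "herm (spinor u) (spinor v) \<noteq> 0" and "0 \<in> closed_segment u v"
  then obtain t where t: "0 \<le> t" "t \<le> 1" "(1 - t) *\<^sub>R u + t *\<^sub>R v = 0" by (auto simp: closed_segment_def)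
  have "norm u * norm v + u \<bullet> v = 0"
  proof (cases "t = 0")
    case True then show ?thesis using t by simp
  next
    case False
    then have v: "v = - ((1 - t) / t) *\<^sub>R u"
    proof -
      have "t *\<^sub>R v = - ((1 - t) *\<^sub>R u)" using t(3) by (simp add: eq_neg_iff_add_eq_0 add.commute)
      then have "(1 / t) *\<^sub>R (t *\<^sub>R v) = (1 / t) *\<^sub>R (- ((1 - t) *\<^sub>R u))" by simp
      then show ?thesis using False by simp
    qed
    have "\<bar>(1 - t) / t\<bar> = (1 - t) / t" using t False by simp
    then show ?thesis unfolding v by (simp add: power2_norm_eq_inner[symmetric] power2_eq_square)
  qed
  then show False using nz herm_spinor_sq[of u v] by simp
qed

text \<open>The hexagon bounds two rectangles glued along the segment from \<open>v + y\<close> to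
  \<open>v + x + y\<close>.\<close>

lemma spin_link_bent:
  assumes b: "path b" "pathfinish b = pathstart b"
    and nz: "\<And>t. t \<in> {0..1} \<Longrightarrow> spin_trace (map (\<lambda>u. u - b t) (rect v x y)) \<noteq> 0"
      "\<And>t. t \<in> {0..1} \<Longrightarrow> spin_trace (map (\<lambda>u. u - b t) (rect (v + y) x z)) \<noteq> 0"
  shows "spin_link [v, v + x, v + x + y, v + x + y + z, v + y + z, v + y] b = spin_link (rect v x y) b + spin_link (rect (v + y) x z) b"
    and "\<And>t. t \<in> {0..1} \<Longrightarrow> spin_trace (map (\<lambda>u. u - b t) [v, v + x, v + x + y, v + x + y + z, v + y + z, v + y]) \<noteq> 0"
proof -
  let ?h = "[v, v + x, v + x + y, v + x + y + z, v + y + z, v + y]"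
  have pm: "pos_mult (spin_trace (map (\<lambda>u. u - b t) (rect v x y)) * spin_trace (map (\<lambda>u. u - b t) (rect (v + y) x z)))
       (spin_trace (map (\<lambda>u. u - b t) ?h))" if t: "t \<in> {0..1}" for t
  proof -
    have e: "v + y + x = v + x + y" by simp
    let ?s = "\<lambda>u. spinor (u - b t)"
    have "herm (?s (v + x + y)) (?s (v + y)) \<noteq> 0" using nz(1)[OF t] by (auto simp: spin_trace_hchain rect_def)
    from pos_mult_mult[OF pos_mult_refl[of "spin_trace (map (\<lambda>u. u - b t) ?h)"] pos_mult_herm_sq[OF this]]
    show ?thesis by (simp add: spin_trace_hchain rect_def e mult_ac)
  qed
  show "spin_link ?h b = spin_link (rect v x y) b + spin_link (rect (v + y) x z) b"
    by (rule spin_link_decompose[OF b pos_mult_sym[OF pm] nz])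
  show "spin_trace (map (\<lambda>u. u - b t) ?h) \<noteq> 0" if t: "t \<in> {0..1}" for t
  proof
    assume "spin_trace (map (\<lambda>u. u - b t) ?h) = 0"
    then have "spin_trace (map (\<lambda>u. u - b t) (rect v x y)) * spin_trace (map (\<lambda>u. u - b t) (rect (v + y) x z)) = 0"
      using pm[OF t] unfolding pos_mult_def by auto
    then show False using nz[OF t] by simp
  qed
qed

text \<open>This hexagon on the edges of a box is a Petrie polygon: it omits two opposite corners
  and bounds the three faces that meet at the omitted corner \<open>v + y\<close>.\<close>

lemma spin_link_petrie:
  assumes b: "path b" "pathfinish b = pathstart b"
    and nz: "\<And>t. t \<in> {0..1} \<Longrightarrow> spin_trace (map (\<lambda>u. u - b t) (rect v x y)) \<noteq> 0"
      "\<And>t. t \<in> {0..1} \<Longrightarrow> spin_trace (map (\<lambda>u. u - b t) (rect (v + y) x z)) \<noteq> 0"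
      "\<And>t. t \<in> {0..1} \<Longrightarrow> spin_trace (map (\<lambda>u. u - b t) (rect v y z)) \<noteq> 0"
  shows "spin_link [v, v + x, v + x + y, v + x + y + z, v + y + z, v + z] b =
     spin_link (rect v x y) b + spin_link (rect (v + y) x z) b + spin_link (rect v y z) b"
proof -
  let ?h = "[v, v + x, v + x + y, v + x + y + z, v + y + z, v + y]"
  let ?p = "[v, v + x, v + x + y, v + x + y + z, v + y + z, v + z]"
  note bent = spin_link_bent[OF b nz(1,2)]
  have "pos_mult (spin_trace (map (\<lambda>u. u - b t) ?h) * spin_trace (map (\<lambda>u. u - b t) (rect v y z)))
       (spin_trace (map (\<lambda>u. u - b t) ?p))" if t: "t \<in> {0..1}" for t
  proof -
    let ?s = "\<lambda>u. spinor (u - b t)"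
    have "herm (?s v) (?s (v + y)) \<noteq> 0" "herm (?s (v + y)) (?s (v + y + z)) \<noteq> 0"
      using nz(3)[OF t] by (auto simp: spin_trace_hchain rect_def)
    from pos_mult_mult[OF pos_mult_refl[of "spin_trace (map (\<lambda>u. u - b t) ?p)"]
        pos_mult_mult[OF pos_mult_herm_sq[OF this(1)] pos_mult_herm_sq[OF this(2)]]]
    show ?thesis by (simp add: spin_trace_hchain rect_def mult_ac)
  qed
  from spin_link_decompose[OF b pos_mult_sym[OF this] bent(2) nz(3)]
  show ?thesis by (simp only: bent(1))
qed

text \<open>An L-shaped hexagon with its notch at \<open>v3\<close>, cut along the prolongation of
  the edge from \<open>v2\<close> to \<open>v3\<close> up to the point \<open>w\<close> of the edge
  from \<open>v5\<close> to \<open>v0\<close>. The segment between \<open>w\<close> and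
  \<open>v3\<close> is passed in both directions; the other changes are subdivisions of
  edges.\<close>

lemma spin_link_notched:
  assumes b: "path b" "pathfinish b = pathstart b"
    and nz: "\<And>t. t \<in> {0..1} \<Longrightarrow> spin_trace (map (\<lambda>u. u - b t) [v0, v1, v2, w]) \<noteq> 0"
      "\<And>t. t \<in> {0..1} \<Longrightarrow> spin_trace (map (\<lambda>u. u - b t) [w, v3, v4, v5]) \<noteq> 0"
    and seg: "v3 \<in> closed_segment v2 w" "w \<in> closed_segment v5 v0"
  shows "spin_link [v0, v1, v2, v3, v4, v5] b = spin_link [v0, v1, v2, w] b + spin_link [w, v3, v4, v5] b"
proof (rule spin_link_decompose[OF b _ nz])
  fix t :: real assume t: "t \<in> {0..1}"
  let ?H = "\<lambda>x y. herm (spinor (x - b t)) (spinor (y - b t))"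
  have n1: "?H v2 w \<noteq> 0" "?H w v0 \<noteq> 0" using nz(1)[OF t] by (auto simp: spin_trace_hchain)
  have n2: "?H w v3 \<noteq> 0" "?H v5 w \<noteq> 0" using nz(2)[OF t] by (auto simp: spin_trace_hchain)
  have sh: "x - b t \<in> closed_segment (y - b t) (z - b t) \<longleftrightarrow> x \<in> closed_segment y z" for x y z
    using closed_segment_translation_eq[of "- b t" x y z] by simp
  have a1: "pos_mult (?H v2 v3 * ?H v3 w) (?H v2 w)"
    by (rule hchain_subdivide) (use seg sh herm_spinor_segment[OF n1(1)] in auto)
  have "0 \<notin> closed_segment (v5 - b t) (v0 - b t)"
  proof
    assume "0 \<in> closed_segment (v5 - b t) (v0 - b t)"
    then have "0 \<in> closed_segment (v5 - b t) (w - b t) \<union> closed_segment (w - b t) (v0 - b t)"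
      using Un_closed_segment[of "w - b t" "v5 - b t" "v0 - b t"] seg(2) sh by simp
    then show False using herm_spinor_segment[OF n1(2)] herm_spinor_segment[OF n2(2)] by blast
  qed
  then have a2: "pos_mult (?H v5 w * ?H w v0) (?H v5 v0)"
    by (intro hchain_subdivide) (use seg sh in auto)
  have a3: "pos_mult (?H w v3 * ?H v3 w) 1" by (rule pos_mult_herm_sq[OF n2(1)])
  let ?c = "?H v0 v1 * ?H v1 v2 * ?H v3 v4 * ?H v4 v5"
  have "pos_mult (?c * ((?H v2 w * ?H w v3) * (?H v5 w * ?H w v0))) (?c * (?H v2 v3 * 1 * ?H v5 v0))"
  proof (rule pos_mult_mult[OF pos_mult_refl pos_mult_mult[OF _ a2]])
    have "pos_mult (?H v2 w * ?H w v3) (?H v2 v3 * ?H v3 w * ?H w v3)"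
      by (intro pos_mult_mult pos_mult_refl pos_mult_sym[OF a1])
    also have "?H v2 v3 * ?H v3 w * ?H w v3 = ?H v2 v3 * (?H w v3 * ?H v3 w)" by (simp add: mult_ac)
    finally have "pos_mult (?H v2 w * ?H w v3) (?H v2 v3 * (?H w v3 * ?H v3 w))" .
    then show "pos_mult (?H v2 w * ?H w v3) (?H v2 v3 * 1)"
      by (rule pos_mult_trans) (intro pos_mult_mult pos_mult_refl a3)
  qed
  from pos_mult_sym[OF this]
  show "pos_mult (spin_trace (map (\<lambda>v. v - b t) [v0, v1, v2, v3, v4, v5]))
      (spin_trace (map (\<lambda>v. v - b t) [v0, v1, v2, w]) * spin_trace (map (\<lambda>v. v - b t) [w, v3, v4, v5]))"
    by (simp add: spin_trace_hchain mult_ac)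
qed

section \<open>Hexagons on a box and the faces at a corner\<close>

lemma cyclic_closed:
  fixes n :: nat
  assumes i: "i \<in> S" "S \<subseteq> {..<n}" and c: "\<And>i. i \<in> S \<Longrightarrow> Suc i mod n \<in> S"
  shows "S = {..<n}"
proof -
  have m: "(i + m) mod n \<in> S" for m
  proof (induction m)
    case 0 then show ?case using i by auto
  next
    case (Suc m) then show ?case using c[OF Suc] by (simp add: mod_Suc_eq)
  qed
  have "j \<in> S" if "j < n" for j
  proof -
    have "i < n" using i by auto
    then have "(i + (j + n - i)) mod n = j" using that by simp
    then show ?thesis using m[of "j + n - i"] by simp
  qed
  then show ?thesis using i(2) by auto
qed

text \<open>A box has the corner \<open>w\<close> and the signed edge lengths \<open>e\<close>. The
  condition is that \<open>p\<close> projects along the axis \<open>k\<close> into the face at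
  \<open>w\<close> perpendicular to \<open>k\<close>.\<close>

definition window :: "real^3 \<Rightarrow> real^3 \<Rightarrow> 3 \<Rightarrow> real^3 \<Rightarrow> bool" where
  "window w e k p \<longleftrightarrow> (\<forall>j. j \<noteq> k \<longrightarrow> sbt (w $ j) (e $ j) (p $ j))"

definition boxside :: "real^3 \<Rightarrow> real^3 \<Rightarrow> 3 \<Rightarrow> real^3 \<Rightarrow> int" where
  "boxside w e k p = (if e $ k * (p $ k - w $ k) > 0 then 1 else 0)"

text \<open>Passages of a closed hexagon into the box through this face, minus passages out of
  it.\<close>

definition face_crossing :: "real^3 \<Rightarrow> real^3 \<Rightarrow> 3 \<Rightarrow> (nat \<Rightarrow> real^3) \<Rightarrow> int" where
  "face_crossing w e k Q = (\<Sum>i<6. if window w e k (Q i) then boxside w e k (Q (Suc i mod 6)) - boxside w e k (Q i) else 0)"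

text \<open>The set \<open>{i1, i2}\<close> expresses that each axis belongs to one or two edges.
  Together with the closing up this makes the hexagon run along the edges of a box.\<close>

definition boxcycle :: "(nat \<Rightarrow> real^3) \<Rightarrow> (nat \<Rightarrow> 3) \<Rightarrow> bool" where
  "boxcycle Q D \<longleftrightarrow> (\<forall>i<6. \<forall>j. Q (Suc i mod 6) $ j = Q i $ j \<longleftrightarrow> j \<noteq> D i) \<and> (\<forall>i<6. D (Suc i mod 6) \<noteq> D i) \<and>
     inj_on Q {..<6} \<and> (\<forall>j. \<exists>i1 i2. {i. i < 6 \<and> D i = j} = {i1, i2})"

text \<open>A value of the coordinate different from those at the starts of the edges along
  \<open>j\<close> would never be left, and so would be kept around the whole cycle.\<close>

lemma boxcycle_two_values:
  fixes Q :: "nat \<Rightarrow> real^3"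
  assumes "boxcycle Q D"
  shows "\<exists>A B. \<forall>i<6. Q i $ j = A \<or> Q i $ j = B"
proof -
  obtain i1 i2 where i12: "{i. i < 6 \<and> D i = j} = {i1, i2}" using assms unfolding boxcycle_def by blast
  have "Q i $ j = Q i1 $ j \<or> Q i $ j = Q i2 $ j" if i: "i < 6" for i
  proof (rule ccontr)
    assume no: "\<not> ?thesis"
    let ?S = "{k. k < 6 \<and> Q k $ j = Q i $ j}"
    have "?S = {..<6}"
    proof (rule cyclic_closed)
      show "i \<in> ?S" using i by simp
      fix k assume k: "k \<in> ?S"
      then have "k \<notin> {i1, i2}" using no by auto
      then have "D k \<noteq> j" using i12 k by auto
      then have "Q (Suc k mod 6) $ j = Q k $ j"
        using k assms unfolding boxcycle_def by (metis (no_types, lifting) mem_Collect_eq)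
      then show "Suc k mod 6 \<in> ?S" using k by simp
    qed auto
    moreover have "i1 < 6" using i12 by blast
    ultimately have "i1 \<in> ?S" by blast
    then show False using no by simp
  qed
  then show ?thesis by blast
qed

text \<open>Let the hexagon leave through face \<open>j\<close> along edge \<open>i\<close> and
  through face \<open>k\<close> along edge \<open>i'\<close>. As coordinates take two values only,
  the starts of these edges differ exactly along the third axis \<open>l\<close>. The edge before
  \<open>i\<close> is not along \<open>j\<close>. If it is along \<open>l\<close>, it starts where
  \<open>i'\<close> starts, so it is \<open>i'\<close>, which has another axis. If it is along
  \<open>k\<close>, it enters through face \<open>k\<close> and cancels the exit, as there are no
  further edges along \<open>k\<close>.\<close>

lemma adjacent_faces_out:
  fixes Q :: "nat \<Rightarrow> real^3"
  assumes Q: "boxcycle Q D" and jk: "j \<noteq> k"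
  shows "\<not> (face_crossing w e j Q < 0 \<and> face_crossing w e k Q < 0)"
proof
  assume neg: "face_crossing w e j Q < 0 \<and> face_crossing w e k Q < 0"
  have st: "Q (Suc i mod 6) $ l = Q i $ l \<longleftrightarrow> l \<noteq> D i" if "i < 6" for i l using Q that by (auto simp: boxcycle_def)
  have ex: "\<exists>i<6. window w e m (Q i) \<and> boxside w e m (Q i) = 1 \<and> boxside w e m (Q (Suc i mod 6)) = 0"
    if "face_crossing w e m Q < 0" for m
  proof (rule ccontr)
    assume "\<not> ?thesis"
    note no = this
    have "\<forall>i<6. window w e m (Q i) \<longrightarrow> boxside w e m (Q (Suc i mod 6)) - boxside w e m (Q i) \<ge> 0"
    proof (intro allI impI)
      fix i :: nat assume "i < 6" "window w e m (Q i)"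
      then have "\<not> (boxside w e m (Q i) = 1 \<and> boxside w e m (Q (Suc i mod 6)) = 0)" using no by blast
      moreover have "boxside w e m p = 0 \<or> boxside w e m p = 1" for p by (simp add: boxside_def)
      ultimately show "boxside w e m (Q (Suc i mod 6)) - boxside w e m (Q i) \<ge> 0" by (metis diff_ge_0_iff_ge order_refl zero_le_one)
    qed
    then have "face_crossing w e m Q \<ge> 0" unfolding face_crossing_def by (intro sum_nonneg) auto
    then show False using that by simp
  qed
  have side: "boxside w e m (Q i) = 1" if "window w e m' (Q i)" "m \<noteq> m'" for m m' i
    using that by (auto simp: window_def sbt_def boxside_def)
  have dir: "D i = m" if "i < 6" "boxside w e m (Q i) \<noteq> boxside w e m (Q (Suc i mod 6))" for i m
    using st[of i m] that by (auto simp: boxside_def)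
  have bse: "boxside w e m p = boxside w e m q" if "p $ m = q $ m" for p q :: "real^3" and m using that by (simp add: boxside_def)
  obtain i where i: "i < 6" "window w e j (Q i)" "boxside w e j (Q i) = 1" "boxside w e j (Q (Suc i mod 6)) = 0"
    using ex neg by blast
  obtain i' where i': "i' < 6" "window w e k (Q i')" "boxside w e k (Q i') = 1" "boxside w e k (Q (Suc i' mod 6)) = 0"
    using ex neg by blast
  have Di: "D i = j" "D i' = k" using dir[of i j] dir[of i' k] i i' by auto
  obtain l where l: "l \<noteq> j" "l \<noteq> k" "\<And>m. m = j \<or> m = k \<or> m = l" using third_axis[OF jk] by blast
  have lt: "Suc m mod 6 < (6::nat)" for m by simp
  have two: "(Q a :: real^3) $ m = (Q b :: real^3) $ m" if "a < 6" "b < 6" "c < 6" "(Q a :: real^3) $ m \<noteq> Q c $ m" "(Q b :: real^3) $ m \<noteq> Q c $ m" for a b c :: nat and m :: 3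
  proof -
    obtain A B :: real where "\<forall>i<6. Q i $ m = A \<or> Q i $ m = B" using boxcycle_two_values[OF Q] by blast
    then show ?thesis using that by metis
  qed
  \<comment> \<open>Both starts are on the inner side of face \<open>j\<close>, unlike the end of
    edge \<open>i\<close>; so they share the other one of the two values.\<close>
  have pj: "Q i' $ j = Q i $ j"
  proof (rule two[OF i'(1) i(1) lt[of i]])
    have "boxside w e j (Q i') = 1" by (rule side[OF i'(2) jk])
    then show "Q i' $ j \<noteq> Q (Suc i mod 6) $ j" using bse[of "Q i'" j "Q (Suc i mod 6)"] i(4) by auto
    show "Q i $ j \<noteq> Q (Suc i mod 6) $ j" using st[OF i(1), of j] Di by auto
  qed
  have pk: "Q i $ k = Q i' $ k"
  proof (rule two[OF i(1) i'(1) lt[of i']])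
    have "boxside w e k (Q i) = 1" by (rule side[OF i(2)]) (use jk in auto)
    then show "Q i $ k \<noteq> Q (Suc i' mod 6) $ k" using bse[of "Q i" k "Q (Suc i' mod 6)"] i'(4) by auto
    show "Q i' $ k \<noteq> Q (Suc i' mod 6) $ k" using st[OF i'(1), of k] Di by auto
  qed
  have inj: "a = b" if "a < 6" "b < 6" "Q a = Q b" for a b
    using Q that by (auto simp: boxcycle_def inj_on_def)
  have pl: "Q i $ l \<noteq> Q i' $ l"
  proof
    assume "Q i $ l = Q i' $ l"
    then have "Q i $ m = Q i' $ m" for m using l(3)[of m] pj pk by (elim disjE) simp_all
    then have "Q i = Q i'" by (simp add: vec_eq_iff)
    then have "i = i'" using inj i(1) i'(1) by blast
    then show False using Di jk by simp
  qed
  \<comment> \<open>The predecessor of \<open>i\<close>, since 5 is -1 modulo 6.\<close>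
  define h where "h = (i + 5) mod 6"
  have h: "h < 6" "Suc h mod 6 = i" using i(1) by (simp_all add: h_def mod_Suc_eq)
  have Dh: "D h \<noteq> j" using Q h Di(1) by (auto simp: boxcycle_def)
  show False
  proof (cases "D h = k")
    case True
    have hc: "Q h $ m = Q i $ m" if "m \<noteq> k" for m using st[OF h(1), of m] h(2) True that by simp
    have "Q h $ k \<noteq> Q i $ k" using st[OF h(1), of k] h(2) True by simp
    then have hk: "Q h $ k = Q (Suc i' mod 6) $ k"
      using two[OF h(1) lt[of i'] i(1), of k] pk st[OF i'(1), of k] Di by auto
    have hi': "h \<noteq> i'" using \<open>Q h $ k \<noteq> Q i $ k\<close> pk by auto
    \<comment> \<open>Along \<open>j\<close> the edge \<open>h\<close> agrees with
      \<open>i'\<close>, along \<open>l\<close> with \<open>i\<close>; each of these coordinates is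
      within the bounds of face \<open>k\<close>.\<close>
    have wh: "window w e k (Q h)" unfolding window_def
    proof (intro allI impI)
      fix m assume m: "m \<noteq> k"
      then have "m = j \<or> m = l" using l(3) by blast
      then show "sbt (w $ m) (e $ m) (Q h $ m)"
        using hc[OF m] i(2) i'(2) pj l jk unfolding window_def by metis
    qed
    have bh: "boxside w e k (Q h) = 0" "boxside w e k (Q (Suc h mod 6)) = 1"
      using bse[OF hk] i'(4) bse[OF pk] i'(3) h(2) by simp_all
    obtain i1 i2 where i12: "{m. m < 6 \<and> D m = k} = {i1, i2}" using Q unfolding boxcycle_def by blast
    moreover have "h \<in> {m. m < 6 \<and> D m = k}" "i' \<in> {m. m < 6 \<and> D m = k}" using h(1) True i'(1) Di(2) by simp_all
    ultimately have "h \<in> {i1, i2}" "i' \<in> {i1, i2}" by metis+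
    then have "{i1, i2} = {h, i'}" using hi' by auto
    with i12 have set: "{m. m < 6 \<and> D m = k} = {h, i'}" by (rule trans)
    have "face_crossing w e k Q = (\<Sum>i\<in>{h, i'}. if window w e k (Q i) then boxside w e k (Q (Suc i mod 6)) - boxside w e k (Q i) else 0)"
      unfolding face_crossing_def
    proof (rule sum.mono_neutral_right)
      show "\<forall>m\<in>{..<6} - {h, i'}. (if window w e k (Q m) then boxside w e k (Q (Suc m mod 6)) - boxside w e k (Q m) else 0) = 0"
      proof
        fix m assume m: "m \<in> {..<6} - {h, i'}"
        then have "D m \<noteq> k" using set by blast
        then have "boxside w e k (Q m) = boxside w e k (Q (Suc m mod 6))" using dir[of m k] m by blast
        then show "(if window w e k (Q m) then boxside w e k (Q (Suc m mod 6)) - boxside w e k (Q m) else 0) = 0" by simp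
      qed
    qed (use h i' in auto)
    also have "\<dots> = 0" using hi' wh bh i' by simp
    finally show False using neg by simp
  next
    case False
    then have Dl: "D h = l" using Dh l(3) by blast
    have hc: "Q h $ m = Q i $ m" if "m \<noteq> l" for m using st[OF h(1), of m] h(2) Dl that by simp
    have "Q h $ l \<noteq> Q i $ l" using st[OF h(1), of l] h(2) Dl by simp
    then have "Q h $ l = Q i' $ l" using two[OF h(1) i'(1) i(1), of l] pl by auto
    have "Q h $ m = Q i' $ m" for m
      using l(3)[of m]
    proof (elim disjE)
      assume "m = j" then show ?thesis using hc[of j] pj l by simp
    next
      assume "m = k" then show ?thesis using hc[of k] pk l by simp
    next
      assume "m = l" then show ?thesis using \<open>Q h $ l = Q i' $ l\<close> by simp
    qed
    then have "Q h = Q i'" by (simp add: vec_eq_iff)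
    then have "h = i'" using inj h(1) i'(1) by blast
    then show False using Dl Di l by simp
  qed
qed

lemma less_6: "(i::nat) < 6 \<longleftrightarrow> i = 0 \<or> i = 1 \<or> i = 2 \<or> i = 3 \<or> i = 4 \<or> i = 5"
  by auto

text \<open>Reversal turns exits into entries, so the case of two exits also settles that of two
  entries. Edge \<open>i\<close> of the reversed cycle is edge \<open>5 - i\<close> of the original
  one.\<close>

lemma boxcycle_reverse:
  fixes Q :: "nat \<Rightarrow> real^3"
  assumes Q: "boxcycle Q D"
  shows "boxcycle (\<lambda>i. Q ((6 - i) mod 6)) (\<lambda>i. D (5 - i))"
    and "face_crossing w e k (\<lambda>i. Q ((6 - i) mod 6)) = - face_crossing w e k Q"
proof -
  have st: "Q (Suc i mod 6) $ l = Q i $ l \<longleftrightarrow> l \<noteq> D i" if "i < 6" for i l using Q that by (auto simp: boxcycle_def)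
  have s6: "Q 1 $ l = Q 0 $ l \<longleftrightarrow> l \<noteq> D 0" "Q 2 $ l = Q 1 $ l \<longleftrightarrow> l \<noteq> D 1" "Q 3 $ l = Q 2 $ l \<longleftrightarrow> l \<noteq> D 2"
    "Q 4 $ l = Q 3 $ l \<longleftrightarrow> l \<noteq> D 3" "Q 5 $ l = Q 4 $ l \<longleftrightarrow> l \<noteq> D 4" "Q 0 $ l = Q 5 $ l \<longleftrightarrow> l \<noteq> D 5" for l
    using st[OF below_6(1), of l] st[OF below_6(2), of l] st[OF below_6(3), of l] st[OF below_6(4), of l] st[OF below_6(5), of l] st[OF below_6(6), of l]
    unfolding Suc_mod_6 by blast+
  have ad: "D (Suc i mod 6) \<noteq> D i" if "i < 6" for i using Q that by (auto simp: boxcycle_def)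
  have a6: "D 1 \<noteq> D 0" "D 2 \<noteq> D 1" "D 3 \<noteq> D 2" "D 4 \<noteq> D 3" "D 5 \<noteq> D 4" "D 0 \<noteq> D 5"
    using ad[OF below_6(1)] ad[OF below_6(2)] ad[OF below_6(3)] ad[OF below_6(4)] ad[OF below_6(5)] ad[OF below_6(6)] unfolding Suc_mod_6 by blast+
  have inj: "inj_on Q {..<6}" using Q by (simp add: boxcycle_def)
  have m: "(6 - 0) mod 6 = (0::nat)" "(6 - 1) mod 6 = (5::nat)" "(6 - 2) mod 6 = (4::nat)" "(6 - 3) mod 6 = (3::nat)"
    "(6 - 4) mod 6 = (2::nat)" "(6 - 5) mod 6 = (1::nat)" "Suc 0 mod 6 = 1" "Suc 1 mod 6 = 2" "Suc 2 mod 6 = 3"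
    "Suc 3 mod 6 = 4" "Suc 4 mod 6 = 5" "Suc 5 mod 6 = 0" by simp_all
  have n5: "5 - 0 = (5::nat)" "5 - 1 = (4::nat)" "5 - 2 = (3::nat)" "5 - 3 = (2::nat)" "5 - 4 = (1::nat)" "5 - 5 = (0::nat)"
    by simp_all
  show "boxcycle (\<lambda>i. Q ((6 - i) mod 6)) (\<lambda>i. D (5 - i))"
    unfolding boxcycle_def
  proof (intro conjI allI impI)
    fix i :: nat and l assume "i < 6"
    then show "Q ((6 - Suc i mod 6) mod 6) $ l = Q ((6 - i) mod 6) $ l \<longleftrightarrow> l \<noteq> D (5 - i)"
      using s6[of l] unfolding less_6 by (elim disjE) (simp_all only: m n5, metis+)
  next
    fix i :: nat assume "i < 6"
    then show "D (5 - Suc i mod 6) \<noteq> D (5 - i)"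
    proof -
      consider "i = 0" | "i = 1" | "i = 2" | "i = 3" | "i = 4" | "i = 5" using \<open>i < 6\<close> unfolding less_6 by blast
      then show ?thesis
      proof cases
        case 1 show ?thesis unfolding 1 m n5 using a6 by metis
      next
        case 2 show ?thesis unfolding 2 m n5 using a6 by metis
      next
        case 3 show ?thesis unfolding 3 m n5 using a6 by metis
      next
        case 4 show ?thesis unfolding 4 m n5 using a6 by metis
      next
        case 5 show ?thesis unfolding 5 m n5 using a6 by metis
      next
        case 6 show ?thesis unfolding 6 m n5 using a6 by metis
      qed
    qed
  next
    have "inj_on (\<lambda>i. (6 - i) mod 6) {..<6::nat}" by (auto simp: inj_on_def less_6)
    moreover have "(\<lambda>i. (6 - i) mod 6) ` {..<6::nat} \<subseteq> {..<6}" by auto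
    ultimately have "inj_on (Q \<circ> (\<lambda>i. (6 - i) mod 6)) {..<6}" using inj by (meson comp_inj_on inj_on_subset)
    then show "inj_on (\<lambda>i. Q ((6 - i) mod 6)) {..<6}" by (simp add: o_def)
  next
    fix j obtain i1 i2 where i12: "{i. i < 6 \<and> D i = j} = {i1, i2}" using Q unfolding boxcycle_def by blast
    have "{i. i < 6 \<and> D (5 - i) = j} = (\<lambda>i. 5 - i) ` {i. i < 6 \<and> D i = j}"
    proof (intro set_eqI iffI)
      fix x assume "x \<in> {i. i < 6 \<and> D (5 - i) = j}"
      then show "x \<in> (\<lambda>i. 5 - i) ` {i. i < 6 \<and> D i = j}" by (intro image_eqI[of _ _ "5 - x"]) auto
    qed auto
    then show "\<exists>i1 i2. {i. i < 6 \<and> D (5 - i) = j} = {i1, i2}" unfolding i12 by auto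
  qed
  have sum6: "(\<Sum>i<6. g i) = g 0 + g 1 + g 2 + g 3 + g 4 + g 5" for g :: "nat \<Rightarrow> int" by (simp add: eval_nat_numeral)
  let ?b = "\<lambda>i. boxside w e k (Q i)" and ?w = "\<lambda>i. window w e k (Q i)"
  have sym: "(if ?w a then ?b b - ?b a else 0) = - (if ?w b then ?b a - ?b b else 0)"
    if "\<And>l. Q a $ l = Q b $ l \<longleftrightarrow> l \<noteq> D'" for a b D'
  proof (cases "D' = k")
    case True
    then have "Q a $ l = Q b $ l" if "l \<noteq> k" for l using \<open>\<And>l. Q a $ l = Q b $ l \<longleftrightarrow> l \<noteq> D'\<close> that by simp
    then have "?w a \<longleftrightarrow> ?w b" unfolding window_def by simp
    then show ?thesis by simp
  next
    case False
    then have "?b a = ?b b" using that[of k] by (auto simp: boxside_def)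
    then show ?thesis by simp
  qed
  show "face_crossing w e k (\<lambda>i. Q ((6 - i) mod 6)) = - face_crossing w e k Q"
    unfolding face_crossing_def sum6 m
    using sym[OF s6(1)] sym[OF s6(2)] sym[OF s6(3)] sym[OF s6(4)] sym[OF s6(5)] sym[OF s6(6)] by (simp split del: if_split)
qed

lemma adjacent_faces:
  fixes Q :: "nat \<Rightarrow> real^3"
  assumes Q: "boxcycle Q D" and jk: "j \<noteq> k"
  shows "\<not> (face_crossing w e j Q < 0 \<and> face_crossing w e k Q < 0)" "\<not> (face_crossing w e j Q > 0 \<and> face_crossing w e k Q > 0)"
  using adjacent_faces_out[OF Q jk] adjacent_faces_out[OF boxcycle_reverse(1)[OF Q] jk] boxcycle_reverse(2)[OF Q] by auto

text \<open>The Levi-Civita symbol of the three axes.\<close>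

definition orient :: "3 \<Rightarrow> 3 \<Rightarrow> 3 \<Rightarrow> real" where
  "orient d e f = cross3 (axis d 1) (axis e 1) $ f"

lemma orient:
  assumes "d \<noteq> e" "f \<noteq> d" "f \<noteq> e"
  shows "orient d e f = 1 \<or> orient d e f = -1" "orient d f e = - orient d e f" "orient e f d = orient d e f"
    "cross3 (axis d 1) (axis e 1) = orient d e f *\<^sub>R axis f 1"
proof -
  have "cross3 (axis d 1) (axis e 1) = axis f 1 \<and> cross3 (axis d 1) (axis f 1) = - axis e 1 \<and> cross3 (axis e 1) (axis f 1) = axis d 1 \<or>
      cross3 (axis d 1) (axis e 1) = - axis f 1 \<and> cross3 (axis d 1) (axis f 1) = axis e 1 \<and> cross3 (axis e 1) (axis f 1) = - axis d 1"
    using assms exhaust_3[of d] exhaust_3[of e] exhaust_3[of f] by (elim disjE) (simp_all add: cross_basis)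
  then have "orient d e f = 1 \<and> orient d f e = - 1 \<and> orient e f d = 1 \<and> cross3 (axis d 1) (axis e 1) = axis f 1 \<or>
      orient d e f = - 1 \<and> orient d f e = 1 \<and> orient e f d = - 1 \<and> cross3 (axis d 1) (axis e 1) = - axis f 1"
    by (elim disjE) (simp_all add: orient_def)
  then show "orient d e f = 1 \<or> orient d e f = -1" "orient d f e = - orient d e f" "orient e f d = orient d e f"
    "cross3 (axis d 1) (axis e 1) = orient d e f *\<^sub>R axis f 1"
    by (elim disjE; simp)+
qed

lemma sign_product:
  fixes a e t :: real
  assumes "a \<noteq> 0" "e \<noteq> 0" "t \<noteq> 0"
  shows "a * t > 0 \<longleftrightarrow> (if a * e > 0 then e * t > 0 else \<not> e * t > 0)"
  using assms by (cases "a > 0"; cases "e > 0"; cases "t > 0"; simp add: zero_less_mult_iff mult_less_0_iff)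

text \<open>Nonzero terms have pairwise opposite signs, so there are at most two of them, and two
  cancel.\<close>

lemma signs_sum:
  fixes a b c :: int
  assumes "\<bar>a\<bar> \<le> 1" "\<bar>b\<bar> \<le> 1" "\<bar>c\<bar> \<le> 1" "\<not> (a < 0 \<and> b < 0)" "\<not> (a > 0 \<and> b > 0)" "\<not> (a < 0 \<and> c < 0)" "\<not> (a > 0 \<and> c > 0)"
    "\<not> (b < 0 \<and> c < 0)" "\<not> (b > 0 \<and> c > 0)"
  shows "\<bar>a + b\<bar> \<le> 1" "\<bar>a + b + c\<bar> \<le> 1"
proof -
  have "a = -1 \<or> a = 0 \<or> a = 1" "b = -1 \<or> b = 0 \<or> b = 1" "c = -1 \<or> c = 0 \<or> c = 1" using assms(1-3) by linarith+
  then show "\<bar>a + b\<bar> \<le> 1" "\<bar>a + b + c\<bar> \<le> 1" using assms(4-) by (elim disjE; simp)+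
qed

lemma height_orient:
  assumes "d \<noteq> e" "f \<noteq> d" "f \<noteq> e"
  shows "height v (ax d \<alpha>) (ax e \<beta>) p = orient d e f * \<alpha> * \<beta> * (p $ f - v $ f)"
  unfolding height_def ax_def by (simp add: cross_mult_left cross_mult_right orient(4)[OF assms] inner_axis)

lemma sbt_flip: "sbt (u + a) (- a) x \<longleftrightarrow> sbt u a x"
  by (auto simp: sbt_def algebra_simps)

lemma shifted_nth: "i < length ws \<Longrightarrow> shifted ws ! i $ j = ws ! i $ j + 1/2"
  by (simp add: shifted_def half_def)

lemma shifted_neq:
  assumes "lcyc ws dw" "i < length ws" "u \<in> \<int>"
  shows "shifted ws ! i $ j \<noteq> u"
proof (rule half_int_neq[OF _ assms(3)])
  show "shifted ws ! i $ j - 1/2 \<in> \<int>" using assms by (simp add: shifted_nth lcyc_def)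
qed

context rect_crossing
begin

text \<open>The same rectangle as a face of a box. A side may be measured from either end, which
  does not affect the window, and the sign compares the normal vector of the rectangle with the
  direction into the box.\<close>

lemma crossing_face:
  fixes w E :: "real^3"
  assumes n6: "n = 6" and f: "f \<noteq> d" "f \<noteq> e"
    and w: "w $ d = v $ d \<and> E $ d = \<alpha> \<or> w $ d = v $ d + \<alpha> \<and> E $ d = - \<alpha>"
      "w $ e = v $ e \<and> E $ e = \<beta> \<or> w $ e = v $ e + \<beta> \<and> E $ e = - \<beta>" "w $ f = v $ f" and E: "E $ f \<noteq> 0"
  shows "crossing v (ax d \<alpha>) (ax e \<beta>) (shifted ws) = (if orient d e f * \<alpha> * \<beta> * E $ f > 0 then 1 else - 1) * face_crossing w E f (\<lambda>i. shifted ws ! i)"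
proof -
  let ?Q = "\<lambda>i. shifted ws ! i" and ?o = "orient d e f * \<alpha> * \<beta>"
  have ax3: "j = d \<or> j = e \<or> j = f" for j
    using third_axis[OF de] f by metis
  have win: "window w E f p \<longleftrightarrow> inside_rect v (ax d \<alpha>) (ax e \<beta>) p" for p
  proof -
    have 1: "sbt (w $ d) (E $ d) (p $ d) \<longleftrightarrow> sbt (v $ d) \<alpha> (p $ d)" using w(1) sbt_flip by auto
    have 2: "sbt (w $ e) (E $ e) (p $ e) \<longleftrightarrow> sbt (v $ e) \<beta> (p $ e)" using w(2) sbt_flip by auto
    have "window w E f p \<longleftrightarrow> sbt (w $ d) (E $ d) (p $ d) \<and> sbt (w $ e) (E $ e) (p $ e)"
      unfolding window_def
    proof (intro iffI allI impI)
      fix j assume "sbt (w $ d) (E $ d) (p $ d) \<and> sbt (w $ e) (E $ e) (p $ e)" "j \<noteq> f"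
      then show "sbt (w $ j) (E $ j) (p $ j)" using ax3[of j] by (elim disjE) simp_all
    qed (use f[symmetric] in blast)
    then show ?thesis unfolding inside_rect_ax[OF de] 1 2 .
  qed
  have o: "?o \<noteq> 0" using orient(1)[OF de f] ab by auto
  have ab': "above v (ax d \<alpha>) (ax e \<beta>) p = (if ?o * E $ f > 0 then boxside w E f p else 1 - boxside w E f p)"
    if "p $ f \<noteq> v $ f" for p
  proof -
    have h: "height v (ax d \<alpha>) (ax e \<beta>) p = ?o * (p $ f - w $ f)"
      using height_orient[OF de f] w(3) by simp
    have "p $ f - w $ f \<noteq> 0" using that w(3) by simp
    then show ?thesis using sign_product[OF o E] unfolding above_def boxside_def h by simp
  qed
  have "?Q i $ f \<noteq> v $ f" if "i < 6" for i using shifted_neq[OF ws _ v] n6 that by simp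
  note ab'' = ab'[OF this]
  show ?thesis
    unfolding crossing_eq face_crossing_def n6 sum_distrib_left
  proof (rule sum.cong[OF refl])
    fix i assume "i \<in> {..<6::nat}"
    then have i: "i < 6" "Suc i mod 6 < 6" by auto
    show "(if ins i then s (Suc i mod 6) - s i else 0) = (if ?o * E $ f > 0 then 1 else - 1) *
       (if window w E f (?Q i) then boxside w E f (?Q (Suc i mod 6)) - boxside w E f (?Q i) else 0)"
      unfolding win ab''[OF i(1)] ab''[OF i(2)] by auto
  qed
qed

end

lemma rect_crossingI:
  assumes "lcyc ws dw" "\<And>j. (v::real^3) $ j \<in> \<int>" "\<alpha> \<in> \<int>" "\<beta> \<in> \<int>" "\<alpha> \<noteq> 0" "\<beta> \<noteq> 0" "d \<noteq> e"
  shows "rect_crossing ws dw v d e \<alpha> \<beta>"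
  using assms by unfold_locales

text \<open>The three rectangles are the faces at the corner \<open>v + ax y \<beta>\<close> of a
  box with signed edges \<open>\<alpha>\<close>, \<open>- \<beta>\<close>, \<open>\<gamma>\<close>,
  and all normal vectors compare with it by the same sign \<open>\<tau>\<close>. By
  \<open>adjacent_faces\<close> no two of the crossing numbers have the same nonzero sign.\<close>

lemma three_faces:
  fixes v :: "real^3"
  assumes ws: "lcyc ws dw" "length ws = 6" "boxcycle (\<lambda>i. shifted ws ! i) dw" and v: "\<And>j. v $ j \<in> \<int>"
    and abc: "\<alpha> \<in> \<int>" "\<beta> \<in> \<int>" "\<gamma> \<in> \<int>" "\<alpha> \<noteq> 0" "\<beta> \<noteq> 0" "\<gamma> \<noteq> 0" and xyz: "x \<noteq> y" "z \<noteq> x" "z \<noteq> y"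
  defines "X1 \<equiv> crossing v (ax x \<alpha>) (ax y \<beta>) (shifted ws)"
    and "X2 \<equiv> crossing (v + ax y \<beta>) (ax x \<alpha>) (ax z \<gamma>) (shifted ws)"
    and "X3 \<equiv> crossing v (ax y \<beta>) (ax z \<gamma>) (shifted ws)"
  shows "\<bar>X1 + X2\<bar> \<le> 1" "\<bar>X1 + X2 + X3\<bar> \<le> 1"
proof -
  let ?v' = "v + ax y \<beta>"
  have v': "?v' $ j \<in> \<int>" for j using v abc by simp
  define E :: "real^3" where "E = (\<chi> j. if j = x then \<alpha> else if j = y then - \<beta> else \<gamma>)"
  have E: "E $ x = \<alpha>" "E $ y = - \<beta>" "E $ z = \<gamma>" using xyz by (simp_all add: E_def)
  interpret R1: rect_crossing ws dw v x y \<alpha> \<beta> by (rule rect_crossingI) (use ws v abc xyz in auto)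
  interpret R2: rect_crossing ws dw "v + ax y \<beta>" x z \<alpha> \<gamma> by (rule rect_crossingI) (use ws(1) v' abc xyz in auto)
  interpret R3: rect_crossing ws dw v y z \<beta> \<gamma> by (rule rect_crossingI) (use ws v abc xyz in auto)
  let ?F = "\<lambda>f. face_crossing ?v' E f (\<lambda>i. shifted ws ! i)"
  define \<tau> :: int where "\<tau> = (if orient x y z * \<alpha> * \<beta> * \<gamma> > 0 then 1 else - 1)"
  have o: "orient x z y * \<alpha> * \<gamma> * - \<beta> = orient x y z * \<alpha> * \<beta> * \<gamma>" "orient y z x * \<beta> * \<gamma> * \<alpha> = orient x y z * \<alpha> * \<beta> * \<gamma>"
    using orient[OF xyz] by simp_all
  have 1: "X1 = \<tau> * ?F z"
    unfolding X1_def \<tau>_def using R1.crossing_face[OF ws(2) xyz(2,3), of ?v' E] E xyz abc by simp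
  have 2: "X2 = \<tau> * ?F y"
    unfolding X2_def \<tau>_def o(1)[symmetric]
    using R2.crossing_face[OF ws(2) xyz(1)[symmetric] xyz(3)[symmetric], of ?v' E] E xyz abc by simp
  have 3: "X3 = \<tau> * ?F x"
    unfolding X3_def \<tau>_def o(2)[symmetric]
    using R3.crossing_face[OF ws(2) xyz(1) xyz(2)[symmetric], of ?v' E] E xyz abc by simp
  have t: "\<tau> = 1 \<or> \<tau> = -1" by (simp add: \<tau>_def)
  have b: "\<bar>X1\<bar> \<le> 1" "\<bar>X2\<bar> \<le> 1" "\<bar>X3\<bar> \<le> 1"
    unfolding X1_def X2_def X3_def using R1.crossing_small R2.crossing_small R3.crossing_small ws(2) by simp_all
  note aj = adjacent_faces[OF ws(3), where w = ?v' and e = E]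
  have "?F z = \<tau> * X1" "?F y = \<tau> * X2" "?F x = \<tau> * X3" using t 1 2 3 by (elim disjE; simp)+
  then have bF: "\<bar>?F z\<bar> \<le> 1" "\<bar>?F y\<bar> \<le> 1" "\<bar>?F x\<bar> \<le> 1" using t b by (elim disjE; simp)+
  have nn: "\<not> (?F z < 0 \<and> ?F y < 0)" "\<not> (?F z > 0 \<and> ?F y > 0)" "\<not> (?F z < 0 \<and> ?F x < 0)" "\<not> (?F z > 0 \<and> ?F x > 0)"
    "\<not> (?F y < 0 \<and> ?F x < 0)" "\<not> (?F y > 0 \<and> ?F x > 0)"
    using aj[OF xyz(3)] aj[OF xyz(2)] aj[OF xyz(1)] by blast+
  note S = signs_sum[OF bF nn]
  have "X1 + X2 = \<tau> * (?F z + ?F y)" "X1 + X2 + X3 = \<tau> * (?F z + ?F y + ?F x)" using 1 2 3 by (simp_all add: distrib_left)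
  then show "\<bar>X1 + X2\<bar> \<le> 1" "\<bar>X1 + X2 + X3\<bar> \<le> 1" using S t by (simp_all add: abs_mult) (elim disjE; simp)+
qed

section \<open>Hexagons in space\<close>

lemma spin_link_rotate_list: "spin_link (rotate k vs) b = spin_link vs b"
proof (induction k)
  case (Suc k)
  have "spin_link (rotate1 us) b = spin_link us b" for us by (cases us) (auto simp: spin_link_rotate)
  then show ?case using Suc by simp
qed simp

lemma lcyc_rotate:
  assumes "lcyc vs d"
  shows "lcyc (rotate k vs) (\<lambda>i. d ((k + i) mod length vs))"
proof -
  let ?n = "length vs"
  have n: "?n \<ge> 3" using assms by (simp add: lcyc_def)
  then have n0: "?n > 0" by linarith
  have m: "(k + Suc i mod ?n) mod ?n = Suc ((k + i) mod ?n) mod ?n" for i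
    by (simp add: mod_simps)
  have lt: "(k + i) mod ?n < ?n" "Suc i mod ?n < ?n" for i using n0 by simp_all
  show ?thesis
    unfolding lcyc_def length_rotate
  proof (intro conjI allI impI)
    fix i j assume i: "i < ?n"
    show "rotate k vs ! i $ j \<in> \<int>" using assms i lt by (simp add: nth_rotate lcyc_def)
    show "rotate k vs ! (Suc i mod ?n) $ j = rotate k vs ! i $ j \<longleftrightarrow> j \<noteq> d ((k + i) mod ?n)"
      unfolding nth_rotate[OF i] nth_rotate[OF lt(2)] m using assms lt by (simp add: lcyc_def)
  next
    fix i assume i: "i < ?n"
    show "d ((k + Suc i mod ?n) mod ?n) \<noteq> d ((k + i) mod ?n)" unfolding m using assms lt by (simp add: lcyc_def)
  qed (use assms n in \<open>auto simp: lcyc_def\<close>)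
qed

text \<open>Up to names the cyclic patterns of axes are xyxyxy (planar), xyzxyz (Petrie polygon) and
  xyzxzy (two rectangles with a common edge); the last one appears in three rotations.\<close>

lemma lcyc_axes_6:
  assumes vs: "lcyc vs d" and n: "length vs = 6"
  shows "d 1 \<noteq> d 0 \<and> d 2 \<noteq> d 1 \<and> d 3 \<noteq> d 2 \<and> d 4 \<noteq> d 3 \<and> d 5 \<noteq> d 4 \<and> d 0 \<noteq> d 5" (is ?a)
    and "d 0 = d 2 \<and> d 2 = d 4 \<and> d 1 = d 3 \<and> d 3 = d 5 \<or> d 0 = d 3 \<and> d 1 = d 4 \<and> d 2 = d 5 \<and> d 0 \<noteq> d 2 \<or>
      d 0 = d 3 \<and> d 1 = d 5 \<and> d 2 = d 4 \<or> d 1 = d 4 \<and> d 2 = d 0 \<and> d 3 = d 5 \<or> d 2 = d 5 \<and> d 3 = d 1 \<and> d 4 = d 0" (is ?b)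
proof -
  have ad: "d (Suc i mod 6) \<noteq> d i" if "i < 6" for i using vs that n by (auto simp: lcyc_def)
  show a: ?a using ad[OF below_6(1)] ad[OF below_6(2)] ad[OF below_6(3)] ad[OF below_6(4)] ad[OF below_6(5)] ad[OF below_6(6)] unfolding Suc_mod_6 by blast
  have e: "\<exists>k\<in>{0,1,2,3,4,5}. k \<noteq> i \<and> d k = d i" if "i < 6" for i
    using lcyc_axis_repeats[OF vs, of i] that unfolding n by (auto simp: less_Suc_eq eval_nat_numeral)
  have r: "d 2 = d 0 \<or> d 3 = d 0 \<or> d 4 = d 0" "d 3 = d 1 \<or> d 4 = d 1 \<or> d 5 = d 1" "d 4 = d 2 \<or> d 5 = d 2 \<or> d 0 = d 2"
    "d 5 = d 3 \<or> d 0 = d 3 \<or> d 1 = d 3" "d 0 = d 4 \<or> d 1 = d 4 \<or> d 2 = d 4" "d 1 = d 5 \<or> d 2 = d 5 \<or> d 3 = d 5"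
    using a e[OF below_6(1)] e[OF below_6(2)] e[OF below_6(3)] e[OF below_6(4)] e[OF below_6(5)] e[OF below_6(6)] by (metis insert_iff empty_iff)+
  show ?b using r a by metis
qed

definition planar6 :: "(nat \<Rightarrow> 3) \<Rightarrow> bool" where
  "planar6 d \<longleftrightarrow> d 0 = d 2 \<and> d 2 = d 4 \<and> d 1 = d 3 \<and> d 3 = d 5"

text \<open>Each non-planar pattern of \<open>lcyc_axes_6\<close> uses every axis twice.\<close>

lemma boxcycle_shifted:
  assumes ws: "lcyc ws d" and n: "length ws = 6" and np: "\<not> planar6 d"
  shows "boxcycle (\<lambda>i. shifted ws ! i) d"
  unfolding boxcycle_def
proof (intro conjI allI impI)
  fix i :: nat and j assume "i < 6"
  then have "i < length ws" "Suc i mod 6 < length ws" using n by simp_all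
  then show "shifted ws ! (Suc i mod 6) $ j = shifted ws ! i $ j \<longleftrightarrow> j \<noteq> d i"
    using ws n by (simp add: shifted_nth lcyc_def)
next
  fix i :: nat assume "i < 6" then show "d (Suc i mod 6) \<noteq> d i" using ws n by (auto simp: lcyc_def)
next
  have "distinct (shifted ws)" using ws by (auto simp: lcyc_def shifted_def distinct_map inj_on_def)
  moreover have "length (shifted ws) = 6" using n by (simp add: shifted_def)
  ultimately show "inj_on (\<lambda>i. shifted ws ! i) {..<6}" by (simp add: inj_on_def nth_eq_iff_index_eq)
next
  fix j
  have fib: "\<exists>i1 i2. {i. i < 6 \<and> d i = j} = {i1, i2}"
    if d: "d a1 = d a2" "d b1 = d b2" "d c1 = d c2" "d a1 \<noteq> d b1" "d c1 \<noteq> d a1" "d c1 \<noteq> d b1"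
      and perm: "{..<6} = {a1, a2, b1, b2, c1, c2}" for a1 a2 b1 b2 c1 c2 :: nat
  proof -
    have ax3: "j = d a1 \<or> j = d b1 \<or> j = d c1" using third_axis[OF d(4)] d(5,6) by metis
    have "{i. i < 6 \<and> d i = j} = {i \<in> {..<6}. d i = j}" by auto
    also have "\<dots> = {i \<in> {a1, a2, b1, b2, c1, c2}. d i = j}" unfolding perm ..
    finally show ?thesis using ax3
    proof (elim disjE)
      assume "{i. i < 6 \<and> d i = j} = {i \<in> {a1, a2, b1, b2, c1, c2}. d i = j}" "j = d a1"
      moreover from this have "d a1 = j" "d a2 = j" "d b1 \<noteq> j" "d b2 \<noteq> j" "d c1 \<noteq> j" "d c2 \<noteq> j" using d by metis+
      then have "{i \<in> {a1, a2, b1, b2, c1, c2}. d i = j} = {a1, a2}" by blast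
      ultimately have "{i. i < 6 \<and> d i = j} = {a1, a2}" by simp
      then show ?thesis by blast
    next
      assume "{i. i < 6 \<and> d i = j} = {i \<in> {a1, a2, b1, b2, c1, c2}. d i = j}" "j = d b1"
      moreover from this have "d b1 = j" "d b2 = j" "d a1 \<noteq> j" "d a2 \<noteq> j" "d c1 \<noteq> j" "d c2 \<noteq> j" using d by metis+
      then have "{i \<in> {a1, a2, b1, b2, c1, c2}. d i = j} = {b1, b2}" by blast
      ultimately have "{i. i < 6 \<and> d i = j} = {b1, b2}" by simp
      then show ?thesis by blast
    next
      assume "{i. i < 6 \<and> d i = j} = {i \<in> {a1, a2, b1, b2, c1, c2}. d i = j}" "j = d c1"
      moreover from this have "d c1 = j" "d c2 = j" "d a1 \<noteq> j" "d a2 \<noteq> j" "d b1 \<noteq> j" "d b2 \<noteq> j" using d by metis+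
      then have "{i \<in> {a1, a2, b1, b2, c1, c2}. d i = j} = {c1, c2}" by blast
      ultimately have "{i. i < 6 \<and> d i = j} = {c1, c2}" by simp
      then show ?thesis by blast
    qed
  qed
  note a = lcyc_axes_6(1)[OF ws n]
  consider "d 0 = d 3" "d 1 = d 4" "d 2 = d 5" "d 0 \<noteq> d 2" | "d 0 = d 3" "d 1 = d 5" "d 2 = d 4"
    | "d 1 = d 4" "d 2 = d 0" "d 3 = d 5" | "d 2 = d 5" "d 3 = d 1" "d 4 = d 0"
    using lcyc_axes_6(2)[OF ws n] np unfolding planar6_def by metis
  then show "\<exists>i1 i2. {i. i < 6 \<and> d i = j} = {i1, i2}"
  proof cases
    case 1 show ?thesis by (rule fib[of 0 3 1 4 2 5]) (use 1 a in auto)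
  next
    case 2
    have "d 0 \<noteq> d 2" using 2 a by metis
    then show ?thesis using 2 a by (intro fib[of 0 3 1 5 2 4]) auto
  next
    case 3
    have "d 3 \<noteq> d 1" using 3 a by metis
    then show ?thesis using 3 a by (intro fib[of 1 4 2 0 3 5]) auto
  next
    case 4
    have "d 4 \<noteq> d 2" using 4 a by metis
    then show ?thesis using 4 a by (intro fib[of 2 5 3 1 4 0]) auto
  qed
qed

text \<open>The pattern xyzxzy is cut into two and xyzxyz into three rectangles at a common corner,
  and \<open>three_faces\<close> bounds the sum of their crossing numbers.\<close>

lemma spin_link_box_hexagon:
  assumes vs: "lcyc vs d" and n: "length vs = 6" and np: "\<not> planar6 d"
    and ws: "lcyc ws dw" "length ws = 6" "boxcycle (\<lambda>i. shifted ws ! i) dw"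
  shows "cmod (spin_link vs (ppath (cyc (shifted ws)))) \<le> 1"
proof -
  let ?b = "ppath (cyc (shifted ws))"
  have ne: "shifted ws \<noteq> []" using ws(2) by (auto simp: shifted_def)
  have b: "path ?b" "pathfinish ?b = pathstart ?b" using ne by (simp_all add: pathfinish_cyc)
  have main: "cmod (spin_link us ?b) \<le> 1"
    if us: "lcyc us c" "length us = 6" and t: "c 0 = c 3 \<and> (c 1 = c 4 \<and> c 2 = c 5 \<and> c 0 \<noteq> c 2 \<or> c 1 = c 5 \<and> c 2 = c 4)" for us :: "(real^3) list" and c
  proof -
    note a = lcyc_axes_6(1)[OF us]
    have st: "us ! (Suc i mod 6) = us ! i + ax (c i) (us ! (Suc i mod 6) $ c i - us ! i $ c i)" if "i < 6" for i
      using lcyc_step[OF us(1)] us(2) that by simp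
    have nz: "us ! (Suc i mod 6) $ c i \<noteq> us ! i $ c i" if "i < 6" for i
      using us that by (auto simp: lcyc_def)
    have int: "us ! i $ j \<in> \<int>" if "i < 6" for i j using us that by (auto simp: lcyc_def)
    define x y z v where "x = c 0" and "y = c 1" and "z = c 2" and "v = us ! 0"
    define \<alpha> \<beta> \<gamma> where "\<alpha> = us ! 1 $ x - us ! 0 $ x" and "\<beta> = us ! 2 $ y - us ! 1 $ y" and "\<gamma> = us ! 3 $ z - us ! 2 $ z"
    have xyz: "x \<noteq> y" "z \<noteq> x" "z \<noteq> y" using a t unfolding x_def y_def z_def by metis+
    have abc: "\<alpha> \<in> \<int>" "\<beta> \<in> \<int>" "\<gamma> \<in> \<int>" "\<alpha> \<noteq> 0" "\<beta> \<noteq> 0" "\<gamma> \<noteq> 0"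
      using int[OF below_6(1)] int[OF below_6(2)] int[OF below_6(3)] int[OF below_6(4)] nz[OF below_6(1)] nz[OF below_6(2)] nz[OF below_6(3)]
      unfolding \<alpha>_def \<beta>_def \<gamma>_def x_def y_def z_def Suc_mod_6 by simp_all
    have v: "v $ j \<in> \<int>" for j using int[OF below_6(1)] by (simp add: v_def)
    have u1: "us ! 1 = v + ax x \<alpha>" using st[OF below_6(1)] unfolding Suc_mod_6 v_def x_def \<alpha>_def by simp
    have u2: "us ! 2 = v + ax x \<alpha> + ax y \<beta>" using st[OF below_6(2)] unfolding Suc_mod_6 y_def[symmetric] \<beta>_def[symmetric] unfolding u1 .
    have u3: "us ! 3 = v + ax x \<alpha> + ax y \<beta> + ax z \<gamma>" using st[OF below_6(3)] unfolding Suc_mod_6 z_def[symmetric] \<gamma>_def[symmetric] unfolding u2 .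
    have v': "(v + ax y \<beta>) $ j \<in> \<int>" for j using v abc by simp
    note L1 = spin_link_rect_shifted[OF ws(1) v abc(1,2,4,5) xyz(1)]
    note L2 = spin_link_rect_shifted[OF ws(1) v' abc(1,3,4,6) xyz(2)[symmetric]]
    note L3 = spin_link_rect_shifted[OF ws(1) v abc(2,3,5,6) xyz(3)[symmetric]]
    note T = three_faces[OF ws v abc xyz]
    have e0: "c 3 = x" using t by (simp add: x_def)
    obtain \<alpha>' where u4: "us ! 4 = us ! 3 + ax x \<alpha>'" using st[OF below_6(4)] unfolding Suc_mod_6 e0 by blast
    show ?thesis
    proof (cases "c 1 = c 5 \<and> c 2 = c 4")
      case True
      then have e: "c 4 = z" "c 5 = y" unfolding y_def z_def by metis+
      obtain \<gamma>' where u5: "us ! 5 = us ! 4 + ax z \<gamma>'" using st[OF below_6(5)] unfolding Suc_mod_6 e by blast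
      obtain \<beta>' where u0: "us ! 0 = us ! 5 + ax y \<beta>'" using st[OF below_6(6)] unfolding Suc_mod_6 e by blast
      have eq: "v = v + ax x \<alpha> + ax y \<beta> + ax z \<gamma> + ax x \<alpha>' + ax z \<gamma>' + ax y \<beta>'"
        using u0 unfolding u5 u4 u3 v_def[symmetric] .
      have p: "\<alpha>' = - \<alpha>" "\<beta>' = - \<beta>" "\<gamma>' = - \<gamma>"
        using arg_cong[OF eq, of "\<lambda>u. u $ x"] arg_cong[OF eq, of "\<lambda>u. u $ y"] arg_cong[OF eq, of "\<lambda>u. u $ z"] xyz by simp_all
      have u45: "us ! 4 = v + ax y \<beta> + ax z \<gamma>" "us ! 5 = v + ax y \<beta>"
        unfolding u5 u4 u3 p by (simp_all add: vec_eq_iff)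
      have "us = [v, v + ax x \<alpha>, v + ax x \<alpha> + ax y \<beta>, v + ax x \<alpha> + ax y \<beta> + ax z \<gamma>, v + ax y \<beta> + ax z \<gamma>, v + ax y \<beta>]"
        using list_6[OF us(2)] unfolding u1 u2 u3 u45 v_def[symmetric] .
      then have "spin_link us ?b = of_int (crossing v (ax x \<alpha>) (ax y \<beta>) (shifted ws) + crossing (v + ax y \<beta>) (ax x \<alpha>) (ax z \<gamma>) (shifted ws))"
        using spin_link_bent(1)[OF b L1(2) L2(2)] L1(1) L2(1) by simp
      then show ?thesis using T(1) by (simp only: norm_of_int of_int_le_1_iff flip: of_int_abs)
    next
      case False
      then have e: "c 4 = y" "c 5 = z" unfolding y_def z_def using False t by metis+
      obtain \<beta>' where u5: "us ! 5 = us ! 4 + ax y \<beta>'" using st[OF below_6(5)] unfolding Suc_mod_6 e by blast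
      obtain \<gamma>' where u0: "us ! 0 = us ! 5 + ax z \<gamma>'" using st[OF below_6(6)] unfolding Suc_mod_6 e by blast
      have eq: "v = v + ax x \<alpha> + ax y \<beta> + ax z \<gamma> + ax x \<alpha>' + ax y \<beta>' + ax z \<gamma>'"
        using u0 unfolding u5 u4 u3 v_def[symmetric] .
      have p: "\<alpha>' = - \<alpha>" "\<beta>' = - \<beta>" "\<gamma>' = - \<gamma>"
        using arg_cong[OF eq, of "\<lambda>u. u $ x"] arg_cong[OF eq, of "\<lambda>u. u $ y"] arg_cong[OF eq, of "\<lambda>u. u $ z"] xyz by simp_all
      have u45: "us ! 4 = v + ax y \<beta> + ax z \<gamma>" "us ! 5 = v + ax z \<gamma>"
        unfolding u5 u4 u3 p by (simp_all add: vec_eq_iff)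
      have "us = [v, v + ax x \<alpha>, v + ax x \<alpha> + ax y \<beta>, v + ax x \<alpha> + ax y \<beta> + ax z \<gamma>, v + ax y \<beta> + ax z \<gamma>, v + ax z \<gamma>]"
        using list_6[OF us(2)] unfolding u1 u2 u3 u45 v_def[symmetric] .
      then have "spin_link us ?b = of_int (crossing v (ax x \<alpha>) (ax y \<beta>) (shifted ws) + crossing (v + ax y \<beta>) (ax x \<alpha>) (ax z \<gamma>) (shifted ws)
         + crossing v (ax y \<beta>) (ax z \<gamma>) (shifted ws))"
        using spin_link_petrie[OF b L1(2) L2(2) L3(2)] L1(1) L2(1) L3(1) by simp
      then show ?thesis using T(2) by (simp only: norm_of_int of_int_le_1_iff flip: of_int_abs)
    qed
  qed
  \<comment> \<open>Rotating the vertex list brings the axes into one of the two patterns of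
    \<open>main\<close>.\<close>
  have rot: "cmod (spin_link vs ?b) \<le> 1"
    if "d (k mod 6) = d ((k + 3) mod 6) \<and> (d ((k + 1) mod 6) = d ((k + 4) mod 6) \<and> d ((k + 2) mod 6) = d ((k + 5) mod 6)
       \<and> d (k mod 6) \<noteq> d ((k + 2) mod 6) \<or> d ((k + 1) mod 6) = d ((k + 5) mod 6) \<and> d ((k + 2) mod 6) = d ((k + 4) mod 6))" for k
    using main[OF lcyc_rotate[OF vs, of k], unfolded length_rotate n add_0_right spin_link_rotate_list, OF refl that] .
  have r6: "0 mod 6 = (0::nat)" "(0 + 1) mod 6 = (1::nat)" "(0 + 2) mod 6 = (2::nat)" "(0 + 3) mod 6 = (3::nat)" "(0 + 4) mod 6 = (4::nat)"
    "(0 + 5) mod 6 = (5::nat)" "1 mod 6 = (1::nat)" "(1 + 1) mod 6 = (2::nat)" "(1 + 2) mod 6 = (3::nat)" "(1 + 3) mod 6 = (4::nat)"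
    "(1 + 4) mod 6 = (5::nat)" "(1 + 5) mod 6 = (0::nat)" "2 mod 6 = (2::nat)" "(2 + 1) mod 6 = (3::nat)" "(2 + 2) mod 6 = (4::nat)"
    "(2 + 3) mod 6 = (5::nat)" "(2 + 4) mod 6 = (0::nat)" "(2 + 5) mod 6 = (1::nat)" by simp_all
  consider "d 0 = d 3" "d 1 = d 4" "d 2 = d 5" "d 0 \<noteq> d 2" | "d 0 = d 3" "d 1 = d 5" "d 2 = d 4"
    | "d 1 = d 4" "d 2 = d 0" "d 3 = d 5" | "d 2 = d 5" "d 3 = d 1" "d 4 = d 0"
    using lcyc_axes_6(2)[OF vs n] np unfolding planar6_def by metis
  then show ?thesis
  proof cases
    case 1 then show ?thesis by (intro rot[of 0], unfold r6) blast
  next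
    case 2 then show ?thesis by (intro rot[of 0], unfold r6) blast
  next
    case 3 then show ?thesis by (intro rot[of 1], unfold r6) metis
  next
    case 4 then show ?thesis by (intro rot[of 2], unfold r6) metis
  qed
qed

section \<open>Planar hexagons\<close>

definition elen :: "(real^3) list \<Rightarrow> (nat \<Rightarrow> 3) \<Rightarrow> nat \<Rightarrow> real" where
  "elen us c i = us ! (Suc i mod length us) $ c i - us ! i $ c i"

lemma elen_rotate:
  assumes "length us = 6" "i < 6"
  shows "elen (rotate k us) (\<lambda>i. c ((k + i) mod 6)) i = elen us c ((k + i) mod 6)"
proof -
  have m: "(k + Suc i mod 6) mod 6 = Suc ((k + i) mod 6) mod 6" by (simp add: mod_simps)
  have lt: "i < length us" "Suc i mod 6 < length us" using assms by simp_all
  show ?thesis unfolding elen_def length_rotate assms(1) nth_rotate[OF lt(1)] nth_rotate[OF lt(2)] m by (simp add: assms(1))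
qed

text \<open>The closing up determines the edges 0 and 5 from the other four. The vertices 3 to 5 are
  written relative to \<open>v + ax (c 1) q1\<close>, where \<open>planar_notched\<close> makes its
  cut.\<close>

lemma planar_coordinates:
  assumes us: "lcyc us c" "length us = 6" "planar6 c"
  defines "v \<equiv> us ! 0" and "p0 \<equiv> elen us c 0" and "q1 \<equiv> elen us c 1" and "p2 \<equiv> elen us c 2" and "q3 \<equiv> elen us c 3"
    and "p4 \<equiv> elen us c 4" and "q5 \<equiv> elen us c 5"
  shows "c 0 \<noteq> c 1" "p0 = - (p2 + p4)" "q5 = - (q1 + q3)"
    "us ! 1 = v + ax (c 0) p0" "us ! 2 = v + ax (c 0) p0 + ax (c 1) q1"
    "us ! 3 = v + ax (c 1) q1 + ax (c 0) (- p4)" "us ! 4 = v + ax (c 1) q1 + ax (c 0) (- p4) + ax (c 1) q3"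
    "us ! 5 = v + ax (c 1) q1 + ax (c 1) q3"
    "p0 \<noteq> 0" "q1 \<noteq> 0" "p2 \<noteq> 0" "q3 \<noteq> 0" "p4 \<noteq> 0" "q5 \<noteq> 0"
    "p0 \<in> \<int>" "q1 \<in> \<int>" "q3 \<in> \<int>" "p4 \<in> \<int>" "\<And>j. (v::real^3) $ j \<in> \<int>"
proof -
  have c: "c 2 = c 0" "c 4 = c 0" "c 3 = c 1" "c 5 = c 1" using us(3) by (simp_all add: planar6_def)
  show xy: "c 0 \<noteq> c 1" using lcyc_axes_6(1)[OF us(1,2)] by metis
  have st: "us ! (Suc i mod 6) = us ! i + ax (c i) (elen us c i)" if "i < 6" for i
    using lcyc_step[OF us(1)] us(2) that by (simp add: elen_def)
  have nz: "elen us c i \<noteq> 0" if "i < 6" for i using us that by (auto simp: lcyc_def elen_def)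
  have int: "us ! i $ j \<in> \<int>" if "i < 6" for i j using us that by (auto simp: lcyc_def)
  have inte: "elen us c i \<in> \<int>" if "i < 6" for i using int[OF that] int[of "Suc i mod 6"] us(2) by (simp add: elen_def)
  note s = st[OF below_6(1), unfolded Suc_mod_6 c, folded v_def p0_def] st[OF below_6(2), unfolded Suc_mod_6 c, folded q1_def] st[OF below_6(3), unfolded Suc_mod_6 c, folded p2_def]
     st[OF below_6(4), unfolded Suc_mod_6 c, folded q3_def] st[OF below_6(5), unfolded Suc_mod_6 c, folded p4_def] st[OF below_6(6), unfolded Suc_mod_6 c, folded v_def q5_def]
  show "p0 \<noteq> 0" "q1 \<noteq> 0" "p2 \<noteq> 0" "q3 \<noteq> 0" "p4 \<noteq> 0" "q5 \<noteq> 0"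
    unfolding p0_def q1_def p2_def q3_def p4_def q5_def using nz by simp_all
  show "p0 \<in> \<int>" "q1 \<in> \<int>" "q3 \<in> \<int>" "p4 \<in> \<int>" "\<And>j. (v::real^3) $ j \<in> \<int>"
    unfolding p0_def q1_def p2_def q3_def p4_def q5_def v_def using inte int by simp_all
  have eq: "v = v + ax (c 0) p0 + ax (c 1) q1 + ax (c 0) p2 + ax (c 1) q3 + ax (c 0) p4 + ax (c 1) q5"
    using s(6)[unfolded s(5), unfolded s(4), unfolded s(3), unfolded s(2), unfolded s(1)] .
  show p: "p0 = - (p2 + p4)" "q5 = - (q1 + q3)"
    using arg_cong[OF eq, of "\<lambda>u. u $ c 0"] arg_cong[OF eq, of "\<lambda>u. u $ c 1"] xy by simp_all
  show 1: "us ! 1 = v + ax (c 0) p0" by (rule s(1))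
  show 2: "us ! 2 = v + ax (c 0) p0 + ax (c 1) q1" using s(2) unfolding 1 .
  have 3: "us ! 3 = v + ax (c 0) p0 + ax (c 1) q1 + ax (c 0) p2" using s(3) unfolding 2 .
  have 4: "us ! 4 = v + ax (c 0) p0 + ax (c 1) q1 + ax (c 0) p2 + ax (c 1) q3" using s(4) unfolding 3 .
  have 5: "us ! 5 = v + ax (c 0) p0 + ax (c 1) q1 + ax (c 0) p2 + ax (c 1) q3 + ax (c 0) p4" using s(5) unfolding 4 .
  show "us ! 3 = v + ax (c 1) q1 + ax (c 0) (- p4)" "us ! 4 = v + ax (c 1) q1 + ax (c 0) (- p4) + ax (c 1) q3"
    "us ! 5 = v + ax (c 1) q1 + ax (c 1) q3"
    unfolding 3 4 5 p by (simp_all add: vec_eq_iff)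
qed

text \<open>Edges 2 and 4 have the same sense, as do edges 1 and 3, so the adjacent edges 0 and 5
  are the long ones and the hexagon is L-shaped. Its two rectangles lie in one plane, have the same
  orientation and disjoint windows; so the two crossing numbers form one sum over the union of the
  windows, to which \<open>sum_small\<close> applies.\<close>

lemma planar_notched:
  assumes us: "lcyc us c" "length us = 6" "planar6 c" and ws: "lcyc ws dw" "length ws < 8"
    and pq: "elen us c 2 * elen us c 4 > 0" "elen us c 1 * elen us c 3 > 0"
  shows "cmod (spin_link us (ppath (cyc (shifted ws)))) \<le> 1"
proof -
  let ?b = "ppath (cyc (shifted ws))"
  have ne: "shifted ws \<noteq> []" using ws(1) by (auto simp: shifted_def lcyc_def)
  have b: "path ?b" "pathfinish ?b = pathstart ?b" using ne by (simp_all add: pathfinish_cyc)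
  define v p0 q1 p2 q3 p4 x y where "v = us ! 0" and "p0 = elen us c 0" and "q1 = elen us c 1" and "p2 = elen us c 2"
    and "q3 = elen us c 3" and "p4 = elen us c 4" and "x = c 0" and "y = c 1"
  note P = planar_coordinates[OF us, folded v_def p0_def q1_def p2_def q3_def p4_def x_def y_def]
  note pq' = pq[folded p2_def q1_def q3_def p4_def]
  define w where "w = v + ax y q1"
  have w: "w $ j \<in> \<int>" for j using P by (simp add: w_def)
  note L1 = spin_link_rect_shifted[OF ws(1) P(19,15,16,9,10,1)]
  have p4_neg: "- p4 \<in> \<int>" "- p4 \<noteq> 0" using P by simp_all
  note L2 = spin_link_rect_shifted[OF ws(1) w p4_neg(1) P(17) p4_neg(2) P(12,1)]
  have us_eq: "us = [v, v + ax x p0, v + ax x p0 + ax y q1, w + ax x (- p4), w + ax x (- p4) + ax y q3, w + ax y q3]"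
    using list_6[OF us(2)] unfolding P(4-8) v_def[symmetric] w_def .
  have sg: "w + ax x (- p4) \<in> closed_segment (v + ax x p0 + ax y q1) w" 
  proof (rule in_axis_segment[where D = x])
    show "bt ((v + ax x p0 + ax y q1) $ x) (w $ x) ((w + ax x (- p4)) $ x)"
      using P(1,2) pq'(1) by (auto simp: w_def bt_def zero_less_mult_iff)
  qed (use P(1) in \<open>auto simp: w_def\<close>)
  have sg2: "w \<in> closed_segment (w + ax y q3) v"
  proof (rule in_axis_segment[where D = y])
    show "bt ((w + ax y q3) $ y) (v $ y) (w $ y)"
      using P(1,2) pq'(2) by (auto simp: w_def bt_def zero_less_mult_iff)
  qed (use P(1) in \<open>auto simp: w_def\<close>)
  have spin_link: "spin_link us ?b = of_int (crossing v (ax x p0) (ax y q1) (shifted ws) + crossing w (ax x (- p4)) (ax y q3) (shifted ws))"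
  proof -
    have "spin_link us ?b = spin_link [v, v + ax x p0, v + ax x p0 + ax y q1, w] ?b + spin_link [w, w + ax x (- p4), w + ax x (- p4) + ax y q3, w + ax y q3] ?b"
      unfolding us_eq
    proof (rule spin_link_notched[OF b _ _ sg sg2])
      fix t :: real assume t: "t \<in> {0..1}"
      show "spin_trace (map (\<lambda>u. u - ?b t) [v, v + ax x p0, v + ax x p0 + ax y q1, w]) \<noteq> 0"
        using L1(2)[OF t] unfolding rect_def w_def .
      show "spin_trace (map (\<lambda>u. u - ?b t) [w, w + ax x (- p4), w + ax x (- p4) + ax y q3, w + ax y q3]) \<noteq> 0"
        using L2(2)[OF t] unfolding rect_def .
    qed
    then show ?thesis using L1(1) L2(1) unfolding rect_def w_def of_int_add by simp
  qed
  interpret R1: rect_crossing ws dw v x y p0 q1 by (rule rect_crossingI) (use ws P in auto)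
  interpret R2: rect_crossing ws dw w x y "- p4" q3 by (rule rect_crossingI) (use ws P w in auto)
  obtain f where f: "f \<noteq> x" "f \<noteq> y" using third_axis[OF P(1)] by blast
  have wf: "w $ f = v $ f" using f by (simp add: w_def)
  have same: "R2.s i = R1.s i" for i
  proof -
    have "p0 * (- p4) = p2 * p4 + p4 * p4" unfolding P(2) by (simp add: algebra_simps)
    then have "p0 * (- p4) > 0" using pq'(1) by (simp add: add_pos_nonneg)
    then have "p0 / (- p4) > 0" by (simp only: zero_less_mult_iff zero_less_divide_iff)
    moreover have "q1 / q3 > 0" using pq'(2) by (simp only: zero_less_mult_iff zero_less_divide_iff)
    \<comment> \<open>The two normal vectors differ by a positive factor, so both rectangles have
      the same upper side.\<close>
    ultimately have k: "(p0 / (- p4)) * (q1 / q3) > 0" by (rule mult_pos_pos)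
    have "height v (ax x p0) (ax y q1) p = (p0 / (- p4)) * (q1 / q3) * height w (ax x (- p4)) (ax y q3) p" for p
      unfolding height_orient[OF P(1) f] wf using P(12,13) by (simp add: field_simps)
    then show ?thesis unfolding above_def using zero_less_mult_pos[OF _ k] mult_pos_pos[OF k] by auto
  qed
  \<comment> \<open>Along \<open>y\<close> the first window ends at \<open>w\<close>, where the
    second one begins.\<close>
  have dis: "\<not> (R1.ins i \<and> R2.ins i)" for i
  proof
    assume "R1.ins i \<and> R2.ins i"
    then have "sbt (v $ y) q1 (shifted ws ! i $ y)" "sbt (w $ y) q3 (shifted ws ! i $ y)"
      unfolding inside_rect_ax[OF P(1)] by blast+
    then have a: "q1 * (shifted ws ! i $ y - v $ y - q1) < 0" "q3 * (shifted ws ! i $ y - v $ y - q1) > 0"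
      by (simp_all add: sbt_def w_def algebra_simps)
    show False using a pq'(2) by (auto simp: zero_less_mult_iff mult_less_0_iff)
  qed
  have "crossing v (ax x p0) (ax y q1) (shifted ws) + crossing w (ax x (- p4)) (ax y q3) (shifted ws)
     = (\<Sum>i<length ws. if R1.ins i \<or> R2.ins i then R1.s (Suc i mod length ws) - R1.s i else 0)"
    unfolding R1.crossing_eq R2.crossing_eq same sum.distrib[symmetric]
    by (rule sum.cong) (use dis in auto)
  also have "\<bar>\<dots>\<bar> \<le> 1" by (rule R1.sum_small[OF ws(2)])
  finally show ?thesis unfolding spin_link by (simp only: norm_of_int of_int_le_1_iff flip: of_int_abs)
qed

text \<open>Here the long edges are the opposite edges 0 and 3, which cross each other.\<close>

lemma planar_long_edges:
  assumes us: "lcyc us c" "length us = 6" "planar6 c" "simple_polygon us"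
    and pq: "elen us c 2 * elen us c 4 > 0" "elen us c 1 * elen us c 5 > 0"
  shows False
proof -
  note P = planar_coordinates[OF us(1-3)]
  have "edge us 0 \<inter> edge us 3 \<noteq> {}"
    unfolding edge_def us(2) Suc_mod_6
  proof (rule cross_point[OF P(1)])
    show "bt (us ! 0 $ c 0) (us ! 1 $ c 0) (us ! 3 $ c 0)" unfolding P(4,6)
      using P(1,2) pq(1) by (auto simp: bt_def zero_less_mult_iff)
    show "bt (us ! 3 $ c 1) (us ! 4 $ c 1) (us ! 0 $ c 1)" unfolding P(7,6)
      using P(1,3) pq(2) by (auto simp: bt_def zero_less_mult_iff)
  qed (use P(1) in \<open>auto simp: P(4-8) simp del: One_nat_def\<close>)
  moreover have "edge us 0 \<inter> edge us 3 = {}"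
    by (rule simple_nonadjacent[OF us(4)]) (simp_all add: us(2))
  ultimately show False by simp
qed

text \<open>On each axis three signed lengths sum to 0, so two of them have the same sign and the
  third edge is long. The long edges of the two axes are adjacent or opposite; rotating the vertex
  list reduces the nine combinations to \<open>planar_notched\<close> and
  \<open>planar_long_edges\<close>.\<close>

lemma spin_link_planar_hexagon:
  assumes vs: "lcyc vs d" "length vs = 6" "planar6 d" "simple_polygon vs" and ws: "lcyc ws dw" "length ws < 8"
  shows "cmod (spin_link vs (ppath (cyc (shifted ws)))) \<le> 1"
proof -
  let ?l = "elen vs d"
  have par: "d i = (if even i then d 0 else d 1)" if "i < 6" for i
    using that vs(3) unfolding less_6 planar6_def by (elim disjE) simp_all
  have pl: "planar6 (\<lambda>i. d ((k + i) mod 6))" if "k < 6" for k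
  proof -
    have "d (m mod 6) = (if even m then d 0 else d 1)" for m
      using par[of "m mod 6"] dvd_mod_iff[of 2 6 m] by simp
    then show ?thesis unfolding planar6_def by simp
  qed
  have lc: "lcyc (rotate k vs) (\<lambda>i. d ((k + i) mod 6))" for k using lcyc_rotate[OF vs(1)] vs(2) by simp
  have good: ?thesis if "k < 6" "?l ((k + 2) mod 6) * ?l ((k + 4) mod 6) > 0" "?l ((k + 1) mod 6) * ?l ((k + 3) mod 6) > 0" for k
    using planar_notched[OF lc _ pl[OF that(1)] ws] that elen_rotate[OF vs(2), where c = d] by (simp add: vs(2) spin_link_rotate_list)
  have bad: False if "k < 6" "?l ((k + 2) mod 6) * ?l ((k + 4) mod 6) > 0" "?l ((k + 1) mod 6) * ?l ((k + 5) mod 6) > 0" for k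
    using planar_long_edges[OF lc[of k] _ pl[OF that(1)]] simple_polygon_rotate[OF vs(4)] that elen_rotate[OF vs(2), where c = d]
    by (simp add: vs(2))
  note P = planar_coordinates[OF vs(1-3)]
  have two: "b * c > 0 \<or> c * a > 0 \<or> a * b > 0" if "a = - (b + c)" "a \<noteq> 0" "b \<noteq> 0" "c \<noteq> 0" for a b c :: real
    using that by (cases "b > 0"; cases "c > 0"; cases "a > 0"; simp add: zero_less_mult_iff mult_less_0_iff)
  have x: "?l 2 * ?l 4 > 0 \<or> ?l 4 * ?l 0 > 0 \<or> ?l 0 * ?l 2 > 0" using two[OF P(2) P(9,11,13)] .
  have y: "?l 1 * ?l 3 > 0 \<or> ?l 3 * ?l 5 > 0 \<or> ?l 5 * ?l 1 > 0" using two[OF P(3) P(14,10,12)] .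
  have c: "a * b = b * a" for a b :: real by simp
  from x y show ?thesis
  proof (elim disjE)
    assume "?l 2 * ?l 4 > 0" "?l 1 * ?l 3 > 0" then show ?thesis by (intro good[of 0]) (simp_all add: mult.commute del: One_nat_def add_2_eq_Suc add_2_eq_Suc')
  next
    assume "?l 2 * ?l 4 > 0" "?l 3 * ?l 5 > 0" then show ?thesis by (intro good[of 1]) (simp_all add: mult.commute del: One_nat_def add_2_eq_Suc add_2_eq_Suc')
  next
    assume "?l 2 * ?l 4 > 0" "?l 5 * ?l 1 > 0" then show ?thesis using bad[of 0] by (simp add: mult.commute del: One_nat_def add_2_eq_Suc add_2_eq_Suc')
  next
    assume "?l 4 * ?l 0 > 0" "?l 1 * ?l 3 > 0" then show ?thesis using bad[of 2] by (simp add: mult.commute del: One_nat_def add_2_eq_Suc add_2_eq_Suc')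
  next
    assume "?l 4 * ?l 0 > 0" "?l 3 * ?l 5 > 0" then show ?thesis by (intro good[of 2]) (simp_all add: mult.commute del: One_nat_def add_2_eq_Suc add_2_eq_Suc')
  next
    assume "?l 4 * ?l 0 > 0" "?l 5 * ?l 1 > 0" then show ?thesis by (intro good[of 3]) (simp_all add: mult.commute del: One_nat_def add_2_eq_Suc add_2_eq_Suc')
  next
    assume "?l 0 * ?l 2 > 0" "?l 1 * ?l 3 > 0" then show ?thesis by (intro good[of 5]) (simp_all add: mult.commute del: One_nat_def add_2_eq_Suc add_2_eq_Suc')
  next
    assume "?l 0 * ?l 2 > 0" "?l 3 * ?l 5 > 0" then show ?thesis using bad[of 4] by (simp add: mult.commute del: One_nat_def add_2_eq_Suc add_2_eq_Suc')
  next
    assume "?l 0 * ?l 2 > 0" "?l 5 * ?l 1 > 0" then show ?thesis by (intro good[of 4]) (simp_all add: mult.commute del: One_nat_def add_2_eq_Suc add_2_eq_Suc')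
  qed
qed

lemma spin_link_rectangle:
  assumes vs: "lcyc vs d" "length vs = 4" and ws: "lcyc ws dw" "simple_polygon ws" "length ws \<le> 8"
  shows "cmod (spin_link vs (ppath (cyc (shifted ws)))) \<le> 1"
proof -
  obtain \<alpha> \<beta> where r: "vs = rect (vs ! 0) (ax (d 0) \<alpha>) (ax (d 1) \<beta>)" and ab: "\<alpha> \<in> \<int>" "\<beta> \<in> \<int>" "\<alpha> \<noteq> 0" "\<beta> \<noteq> 0" "d 0 \<noteq> d 1"
    using lcyc_rect[OF vs] by blast
  have v: "vs ! 0 $ j \<in> \<int>" for j using vs by (auto simp: lcyc_def)
  note n8 = ws(3) and sp = ws(2)
  interpret rect_crossing ws dw "vs ! 0" "d 0" "d 1" \<alpha> \<beta> by (rule rect_crossingI) (use ws v ab in auto)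
  have "\<bar>crossing (vs ! 0) (ax (d 0) \<alpha>) (ax (d 1) \<beta>) (shifted ws)\<bar> \<le> 1"
    using crossing_small crossing_eight[OF sp] n8 by linarith
  moreover have "spin_link vs (ppath (cyc (shifted ws))) = of_int (crossing (vs ! 0) (ax (d 0) \<alpha>) (ax (d 1) \<beta>) (shifted ws))"
    by (subst r) (rule spin_link_rect_shifted(1)[OF ws v ab de])
  ultimately show ?thesis by (simp only: norm_of_int of_int_le_1_iff flip: of_int_abs)
qed

text \<open>Neither polygon has three or five edges, so twelve allow only four with at most eight,
  or six with six. The polygon that is cut into rectangles has to be the first argument, hence the
  disjunction.\<close>

lemma spin_link_lattice_bound:
  assumes vs: "simple_polygon vs" "lcyc vs d" "polygon vs \<subseteq> cubic_lattice"
    and ws: "simple_polygon ws" "lcyc ws dw" "polygon ws \<subseteq> cubic_lattice"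
    and dj: "polygon vs \<inter> polygon ws = {}" and n: "length vs + length ws \<le> 12"
  shows "cmod (spin_link vs (ppath (cyc ws))) \<le> 1 \<or> cmod (spin_link ws (ppath (cyc vs))) \<le> 1"
proof -
  have ne: "vs \<noteq> []" "ws \<noteq> []" using vs ws by (auto simp: lcyc_def)
  have c: "csegs (cyc vs) \<subseteq> cubic_lattice" "csegs (cyc ws) \<subseteq> cubic_lattice" "csegs (cyc vs) \<inter> csegs (cyc ws) = {}"
    using vs ws dj polygon_csegs[OF ne(1)] polygon_csegs[OF ne(2)] by simp_all
  have 1: "spin_link vs (ppath (cyc ws)) = spin_link vs (ppath (cyc (shifted ws)))" by (rule spin_link_shifted) (use ne c in auto)
  have 2: "spin_link ws (ppath (cyc vs)) = spin_link ws (ppath (cyc (shifted vs)))" by (rule spin_link_shifted) (use ne c in auto)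
  have "length vs \<ge> 3" "length ws \<ge> 3" using vs ws by (auto simp: lcyc_def)
  then have l: "length vs \<ge> 4" "length ws \<ge> 4" "length vs \<noteq> 5" "length ws \<noteq> 5" 
    using lcyc_length[OF vs(2)] lcyc_length[OF ws(2)] by linarith+
  then consider "length vs = 4" "length ws \<le> 8" | "length ws = 4" "length vs \<le> 8" | "length vs = 6" "length ws = 6"
    using n by linarith
  then show ?thesis
  proof cases
    case 1 then show ?thesis using spin_link_rectangle[OF vs(2) _ ws(2,1)] \<open>spin_link vs _ = _\<close> by simp
  next
    case 2 then show ?thesis using spin_link_rectangle[OF ws(2) _ vs(2,1)] \<open>spin_link ws _ = _\<close> by simp
  next
    case 3
    then have "length vs < 8" "length ws < 8" by simp_all
    show ?thesis
    proof (cases "planar6 d \<or> planar6 dw")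
      case True then show ?thesis
        using spin_link_planar_hexagon[OF vs(2) 3(1) _ vs(1) ws(2)] spin_link_planar_hexagon[OF ws(2) 3(2) _ ws(1) vs(2)] 1 2 3 by auto
    next
      case False
      then show ?thesis using spin_link_box_hexagon[OF vs(2) 3(1) _ ws(2) 3(2) boxcycle_shifted[OF ws(2) 3(2)]] 1 by auto
    qed
  qed
qed

section \<open>Isotopies of space\<close>

definition isotopy :: "(real^3 \<Rightarrow> real^3) \<Rightarrow> bool" where
  "isotopy f \<longleftrightarrow> homotopic_with_canon (\<lambda>h. \<exists>g. homeomorphism UNIV UNIV h g) UNIV UNIV id f"

lemma isotopyI:
  fixes H :: "real \<Rightarrow> real^3 \<Rightarrow> real^3"
  assumes cont: "continuous_on ({0..1} \<times> UNIV) (\<lambda>(t, x). H t x)"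
    and inv: "\<And>t. t \<in> {0..1} \<Longrightarrow> homeomorphism UNIV UNIV (H t) (G t)"
    and H: "\<And>x. H 0 x = x" "\<And>x. H 1 x = f x"
  shows "isotopy f"
  unfolding isotopy_def homotopic_with_def
proof (intro exI conjI ballI allI)
  have e: "prod_topology (top_of_set {0..1::real}) euclidean = top_of_set ({0..1} \<times> (UNIV :: (real^3) set))"
    using subtopology_Times[of euclidean "euclidean :: (real^3) topology" "{0..1::real}" UNIV] by (simp add: euclidean_product_topology)
  show "continuous_map (prod_topology (top_of_set {0..1}) (top_of_set UNIV)) (top_of_set UNIV) (\<lambda>(t, x). H t x)"
    unfolding subtopology_UNIV e continuous_map_iff_continuous by (rule cont)
  show "(case (0, x) of (t, x) \<Rightarrow> H t x) = id x" for x using H by simp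
  show "(case (1, x) of (t, x) \<Rightarrow> H t x) = f x" for x using H by simp
  show "homeomorphism UNIV UNIV (\<lambda>x. case (t, x) of (t, x) \<Rightarrow> H t x) (G t)" if "t \<in> {0..1}" for t
    using inv[OF that] by simp
qed

lemma isotopyE:
  assumes "isotopy f"
  obtains H :: "real \<Rightarrow> real^3 \<Rightarrow> real^3" where "continuous_on ({0..1} \<times> UNIV) (\<lambda>(t, x). H t x)" "\<And>t. t \<in> {0..1} \<Longrightarrow> \<exists>g. homeomorphism UNIV UNIV (H t) g"
    "\<And>x. H 0 x = x" "\<And>x. H 1 x = f x"
proof -
  have e: "prod_topology (top_of_set {0..1::real}) euclidean = top_of_set ({0..1} \<times> (UNIV :: (real^3) set))"
    using subtopology_Times[of euclidean "euclidean :: (real^3) topology" "{0..1::real}" UNIV] by (simp add: euclidean_product_topology)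
  show ?thesis
    using assms unfolding isotopy_def homotopic_with_def subtopology_UNIV e continuous_map_iff_continuous
  proof (elim exE conjE)
    fix h :: "real \<times> (real^3) \<Rightarrow> real^3"
    assume h: "continuous_on ({0..1} \<times> UNIV) h" "\<forall>x. h (0, x) = id x" "\<forall>x. h (1, x) = f x"
      "\<forall>t\<in>{0..1}. \<exists>g. homeomorphism UNIV UNIV (\<lambda>x. h (t, x)) g"
    show ?thesis using that[of "\<lambda>t x. h (t, x)"] h by simp
  qed
qed

lemma isotopy_homeomorphism:
  assumes "isotopy f"
  obtains g where "homeomorphism UNIV UNIV f g"
  using assms homotopic_with_imp_property unfolding isotopy_def by blast

lemma homeomorphism_UNIV_comp:
  "\<exists>g. homeomorphism UNIV UNIV f g \<Longrightarrow> \<exists>g. homeomorphism UNIV UNIV h g \<Longrightarrow> \<exists>g. homeomorphism UNIV UNIV (h \<circ> f) g"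
  using homeomorphism_compose by blast

lemma isotopy_comp:
  assumes f: "isotopy f" and g: "isotopy g"
  shows "isotopy (g \<circ> f)"
proof -
  obtain g' where g': "homeomorphism UNIV UNIV g g'" using isotopy_homeomorphism[OF g] .
  have "homotopic_with_canon (\<lambda>h. \<exists>g. homeomorphism UNIV UNIV h g) UNIV UNIV (g \<circ> id) (g \<circ> f)"
  proof (rule homotopic_with_compose_continuous_map_left[OF f[unfolded isotopy_def]])
    show "continuous_map (top_of_set UNIV) (top_of_set UNIV) g" using g' by (simp add: homeomorphism_def)
    show "\<exists>k. homeomorphism UNIV UNIV (g \<circ> j) k" if "\<exists>k. homeomorphism UNIV UNIV j k" for j
      using homeomorphism_UNIV_comp[OF that] g' by blast
  qed
  then show ?thesis using g unfolding isotopy_def by (simp add: homotopic_with_trans)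
qed

text \<open>Composing the isotopy of \<open>f\<close> with the fixed map \<open>g\<close> leads from
  \<open>g\<close> to the identity.\<close>

lemma isotopy_inverse:
  assumes f: "isotopy f" and g: "homeomorphism UNIV UNIV f g"
  shows "isotopy g"
proof -
  have g': "homeomorphism UNIV UNIV g f" using g by (rule homeomorphism_symD)
  have "homotopic_with_canon (\<lambda>h. \<exists>g. homeomorphism UNIV UNIV h g) UNIV UNIV (g \<circ> id) (g \<circ> f)"
  proof (rule homotopic_with_compose_continuous_map_left[OF f[unfolded isotopy_def]])
    show "continuous_map (top_of_set UNIV) (top_of_set UNIV) g" using g' by (simp add: homeomorphism_def)
    show "\<exists>k. homeomorphism UNIV UNIV (g \<circ> j) k" if "\<exists>k. homeomorphism UNIV UNIV j k" for j
      using homeomorphism_UNIV_comp[OF that] g' by blast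
  qed
  moreover have "g \<circ> f = id" using g by (auto simp: homeomorphism_def)
  ultimately show ?thesis unfolding isotopy_def by (simp add: homotopic_with_symD)
qed

text \<open>Keeps track of the order of the components, because the arguments of
  \<open>spin_link\<close> play different roles.\<close>

definition same_pair :: "(real^3) set \<Rightarrow> (real^3) set \<Rightarrow> (real^3) set \<Rightarrow> (real^3) set \<Rightarrow> bool" where
  "same_pair A B A' B' \<longleftrightarrow> (\<exists>f. isotopy f \<and> f ` A = A' \<and> f ` B = B')"

lemma same_pair_trans: "same_pair A B A' B' \<Longrightarrow> same_pair A' B' A'' B'' \<Longrightarrow> same_pair A B A'' B''"
  unfolding same_pair_def
proof (elim exE conjE)
  fix f g assume "isotopy f" "f ` A = A'" "f ` B = B'" "isotopy g" "g ` A' = A''" "g ` B' = B''"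
  then show "\<exists>f. isotopy f \<and> f ` A = A'' \<and> f ` B = B''"
    by (intro exI[of _ "g \<circ> f"] conjI isotopy_comp) (metis image_comp)+
qed

lemma same_pair_sym:
  assumes "same_pair A B A' B'" shows "same_pair A' B' A B"
proof -
  obtain f where f: "isotopy f" "f ` A = A'" "f ` B = B'" using assms unfolding same_pair_def by blast
  obtain g where g: "homeomorphism UNIV UNIV f g" using isotopy_homeomorphism[OF f(1)] .
  then have "g (f x) = x" for x by (simp add: homeomorphism_def)
  then have "g ` A' = A" "g ` B' = B" using f(2,3) by (auto simp: image_image)
  then show ?thesis unfolding same_pair_def using isotopy_inverse[OF f(1) g] by blast
qed

text \<open>As \<open>\<phi>\<close> is constant along \<open>u\<close>, every intermediate map is
  undone by subtracting the same displacement.\<close>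

lemma isotopy_shear:
  fixes \<phi> :: "real^3 \<Rightarrow> real"
  assumes c: "continuous_on UNIV \<phi>" and u: "\<And>x t. \<phi> (x + t *\<^sub>R u) = \<phi> x"
  shows "isotopy (\<lambda>x. x + \<phi> x *\<^sub>R u)"
proof (rule isotopyI[where H = "\<lambda>t x. x + (t * \<phi> x) *\<^sub>R u" and G = "\<lambda>t x. x + (- t * \<phi> x) *\<^sub>R u"])
  show "continuous_on ({0..1} \<times> UNIV) (\<lambda>(t, x). x + (t * \<phi> x) *\<^sub>R u)"
    unfolding case_prod_unfold by (intro continuous_intros continuous_on_compose2[OF c]) auto
  fix t :: real
  have u': "\<phi> (x - t *\<^sub>R u) = \<phi> x" for x t using u[of x "- t"] by simp
  have c': "continuous_on UNIV (\<lambda>x. x + (s * \<phi> x) *\<^sub>R u)" for s by (intro continuous_intros c)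
  show "homeomorphism UNIV UNIV (\<lambda>x. x + (t * \<phi> x) *\<^sub>R u) (\<lambda>x. x + (- t * \<phi> x) *\<^sub>R u)"
    by (rule homeomorphismI) (use c'[of t] c'[of "- t"] u u' in auto)
qed auto

section \<open>Moves along vertical lines and along horizontal rays\<close>

definition pt :: "complex \<Rightarrow> real \<Rightarrow> real^3" where
  "pt w z = ax 1 (Re w) + ax 2 (Im w) + ax 3 z"

definition wp :: "real^3 \<Rightarrow> complex" where
  "wp p = of_real (p $ 1) + \<i> * of_real (p $ 2)"

lemma pt_nth [simp]: "pt w z $ 1 = Re w" "pt w z $ 2 = Im w" "pt w z $ 3 = z"
  by (simp_all add: pt_def)

lemma Re_Im_wp [simp]: "Re (wp p) = p $ 1" "Im (wp p) = p $ 2"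
  by (simp_all add: wp_def)

lemma wp_pt [simp]: "wp (pt w z) = w"
  by (simp add: complex_eq_iff)

lemma vec3_eq_iff: "(p :: real^3) = q \<longleftrightarrow> p $ 1 = q $ 1 \<and> p $ 2 = q $ 2 \<and> p $ 3 = q $ 3"
  by (simp add: vec_eq_iff forall_3)

lemma pt_wp [simp]: "pt (wp p) (p $ 3) = p"
  by (simp add: vec3_eq_iff)

lemma continuous_on_pt [continuous_intros]:
  "continuous_on S f \<Longrightarrow> continuous_on S g \<Longrightarrow> continuous_on S (\<lambda>x. pt (f x) (g x))"
  unfolding pt_def ax_def by (intro continuous_intros)

lemma continuous_on_wp [continuous_intros]: "continuous_on S f \<Longrightarrow> continuous_on S (\<lambda>x. wp (f x))"
  unfolding wp_def by (intro continuous_intros)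

lemma isotopy_vertical:
  assumes D: "continuous_on UNIV D" and B: "continuous_on UNIV B"
  shows "isotopy (\<lambda>p. pt (wp p) (exp (D (wp p)) * p $ 3 + B (wp p)))"
proof (rule isotopyI[where H = "\<lambda>t p. pt (wp p) (exp (t * D (wp p)) * p $ 3 + t * B (wp p))"
      and G = "\<lambda>t p. pt (wp p) ((p $ 3 - t * B (wp p)) * exp (- t * D (wp p)))"])
  show "continuous_on ({0..1} \<times> UNIV) (\<lambda>(t, p). pt (wp p) (exp (t * D (wp p)) * p $ 3 + t * B (wp p)))"
    unfolding case_prod_unfold
    by (intro continuous_intros continuous_on_compose2[OF D] continuous_on_compose2[OF B]) auto
  fix t :: real
  show "homeomorphism UNIV UNIV (\<lambda>p. pt (wp p) (exp (t * D (wp p)) * p $ 3 + t * B (wp p)))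
     (\<lambda>p. pt (wp p) ((p $ 3 - t * B (wp p)) * exp (- t * D (wp p))))"
  proof (rule homeomorphismI)
    show "continuous_on UNIV (\<lambda>p. pt (wp p) (exp (t * D (wp p)) * p $ 3 + t * B (wp p)))"
      "continuous_on UNIV (\<lambda>p. pt (wp p) ((p $ 3 - t * B (wp p)) * exp (- t * D (wp p))))"
      by (intro continuous_intros continuous_on_compose2[OF D] continuous_on_compose2[OF B]; simp)+
  qed (auto simp: vec3_eq_iff exp_minus field_simps)
qed simp_all

text \<open>In the logarithm of the radius this is the affine map with slope \<open>\<alpha>\<close>
  and shift \<open>\<beta>\<close>. Since \<open>sgn 0 = 0\<close>, the origin is fixed.\<close>

definition radpt :: "real \<Rightarrow> real \<Rightarrow> complex \<Rightarrow> complex" where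
  "radpt \<alpha> \<beta> w = sgn w * of_real (cmod w powr \<alpha> * exp \<beta>)"

lemma norm_radpt: "cmod (radpt \<alpha> \<beta> w) = cmod w powr \<alpha> * exp \<beta>"
  by (cases "w = 0") (simp_all add: radpt_def norm_mult norm_sgn)

lemma sgn_radpt [simp]: "sgn (radpt \<alpha> \<beta> w) = sgn w"
proof (cases "w = 0")
  case False
  then have "cmod w powr \<alpha> * exp \<beta> > 0" by simp
  then have "sgn (complex_of_real (cmod w powr \<alpha> * exp \<beta>)) = 1" by (simp only: sgn_of_real sgn_pos of_real_1)
  then show ?thesis by (simp only: radpt_def sgn_mult sgn_sgn mult_1_right)
qed (simp add: radpt_def)

lemma radpt_radpt:
  assumes "\<alpha> * \<alpha>' = 1" "\<beta> * \<alpha>' + \<beta>' = 0"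
  shows "radpt \<alpha>' \<beta>' (radpt \<alpha> \<beta> w) = w"
proof (cases "w = 0")
  case False
  have "cmod (radpt \<alpha> \<beta> w) powr \<alpha>' * exp \<beta>' = cmod w"
    unfolding norm_radpt using False assms
    by (simp add: powr_mult powr_powr powr_def[of "exp \<beta>"] mult.commute[of \<alpha>'] mult.assoc exp_add[symmetric])
  then have "radpt \<alpha>' \<beta>' (radpt \<alpha> \<beta> w) = sgn w * of_real (cmod w)"
    unfolding radpt_def[of \<alpha>' \<beta>'] by (simp only: sgn_radpt)
  then show ?thesis by (simp add: sgn_eq)
qed (simp add: radpt_def)

text \<open>The coefficients may depend on the direction of \<open>w\<close> and so have no limit at
  its zeros. The bounds on them give \<open>cmod w powr c * exp C\<close> as a majorant near a zero,
  which is enough for continuity there.\<close>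

lemma continuous_on_radpt:
  fixes X :: "'a::metric_space set" and w :: "'a \<Rightarrow> complex"
  assumes w: "continuous_on X w" and \<alpha>: "continuous_on {x \<in> X. w x \<noteq> 0} \<alpha>" and \<beta>: "continuous_on {x \<in> X. w x \<noteq> 0} \<beta>"
    and bd: "\<And>x. x \<in> X \<Longrightarrow> c \<le> \<alpha> x" "c > 0" "\<And>x. x \<in> X \<Longrightarrow> \<beta> x \<le> C"
  shows "continuous_on X (\<lambda>x. radpt (\<alpha> x) (\<beta> x) (w x))"
  unfolding continuous_on_def
proof
  let ?f = "\<lambda>x. radpt (\<alpha> x) (\<beta> x) (w x)" and ?Y = "{x \<in> X. w x \<noteq> 0}"
  fix x0 assume x0: "x0 \<in> X"
  show "(?f \<longlongrightarrow> ?f x0) (at x0 within X)"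
  proof (cases "w x0 = 0")
    case False
    have "openin (top_of_set X) (X \<inter> w -` (- {0}))"
      by (rule continuous_openin_preimage_gen[OF w]) auto
    moreover have Y: "X \<inter> w -` (- {0}) = ?Y" by auto
    ultimately obtain U where U: "open U" "?Y = X \<inter> U" unfolding openin_open by auto
    have "at x0 within X = at x0 within ?Y"
      by (rule at_within_nhd[of _ U]) (use x0 False U in auto)
    moreover have "continuous_on ?Y ?f"
      unfolding radpt_def sgn_div_norm by (intro continuous_intros \<alpha> \<beta> continuous_on_subset[OF w]) auto
    ultimately show ?thesis using x0 False by (auto simp: continuous_on_def)
  next
    case True
    have w0: "((\<lambda>x. cmod (w x)) \<longlongrightarrow> 0) (at x0 within X)"
      using w x0 True unfolding continuous_on_def by (metis norm_zero tendsto_norm)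
    have "((\<lambda>x. cmod (w x) powr c * exp C) \<longlongrightarrow> 0 powr c * exp C) (at x0 within X)"
      by (intro tendsto_mult tendsto_powr' w0 tendsto_const) (use bd in auto)
    then have lim: "((\<lambda>x. cmod (w x) powr c * exp C) \<longlongrightarrow> 0) (at x0 within X)" by simp
    have small: "\<forall>\<^sub>F x in at x0 within X. cmod (w x) < 1" using w0 by (rule order_tendstoD) simp
    have inX: "\<forall>\<^sub>F x in at x0 within X. x \<in> X" by (simp add: eventually_at_filter)
    have "\<forall>\<^sub>F x in at x0 within X. norm (?f x) \<le> cmod (w x) powr c * exp C"
      using small inX
    proof eventually_elim
      fix x assume x: "cmod (w x) < 1" "x \<in> X"
      have "cmod (w x) powr \<alpha> x \<le> cmod (w x) powr c" using x bd(1) by (intro powr_mono') auto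
      then show "norm (?f x) \<le> cmod (w x) powr c * exp C"
        unfolding norm_radpt using bd(3)[OF x(2)] by (intro mult_mono) auto
    qed
    then have "(?f \<longlongrightarrow> 0) (at x0 within X)" using lim by (rule Lim_null_comparison)
    then show ?thesis using True by (simp add: radpt_def)
  qed
qed

lemma isotopy_radial:
  fixes D B :: "complex \<times> real \<Rightarrow> real"
  assumes D: "continuous_on UNIV D" "\<And>q. \<bar>D q\<bar> \<le> C" and B: "continuous_on UNIV B" "\<And>q. \<bar>B q\<bar> \<le> C"
  shows "isotopy (\<lambda>p. pt (radpt (exp (D (sgn (wp p), p $ 3))) (B (sgn (wp p), p $ 3)) (wp p)) (p $ 3))"
proof -
  let ?q = "\<lambda>p :: real^3. (sgn (wp p), p $ 3)"
  let ?H = "\<lambda>t p. pt (radpt (exp (t * D (?q p))) (t * B (?q p)) (wp p)) (p $ 3)"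
  let ?G = "\<lambda>t p. pt (radpt (exp (- (t * D (?q p)))) (- (t * B (?q p) * exp (- (t * D (?q p))))) (wp p)) (p $ 3)"
  have sg: "continuous_on {x \<in> X. wp (g x) \<noteq> 0} (\<lambda>x. ?q (g x))" if "continuous_on X g" for X :: "'a::metric_space set" and g
    unfolding sgn_div_norm by (intro continuous_intros continuous_on_subset[OF that]) auto
  have q: "?q (pt (radpt a b (wp p)) (p $ 3)) = ?q p" for a b p by simp
  show ?thesis
  proof (rule isotopyI[where H = ?H and G = ?G])
    have qs: "continuous_on {x \<in> {0..1} \<times> UNIV. wp (snd x) \<noteq> 0} (\<lambda>x :: real \<times> (real^3). ?q (snd x))"
      by (rule sg) (intro continuous_intros)
    have "continuous_on ({0..1} \<times> UNIV) (\<lambda>x :: real \<times> (real^3). radpt (exp (fst x * D (?q (snd x)))) (fst x * B (?q (snd x))) (wp (snd x)))"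
    proof (rule continuous_on_radpt[where c = "exp (- C)" and C = C])
      show "continuous_on {x \<in> {0..1} \<times> UNIV. wp (snd x) \<noteq> 0} (\<lambda>x. exp (fst x * D (?q (snd x))))"
        "continuous_on {x \<in> {0..1} \<times> UNIV. wp (snd x) \<noteq> 0} (\<lambda>x. fst x * B (?q (snd x)))"
        by (intro continuous_intros continuous_on_compose2[OF D(1) qs] continuous_on_compose2[OF B(1) qs]; simp)+
      fix x :: "real \<times> (real^3)" assume "x \<in> {0..1} \<times> UNIV"
      then have x: "0 \<le> fst x" "fst x \<le> 1" by auto
      have le: "\<bar>fst x * y\<bar> \<le> C" if "\<bar>y\<bar> \<le> C" for y
      proof -
        have "\<bar>fst x * y\<bar> \<le> 1 * \<bar>y\<bar>" unfolding abs_mult using x by (intro mult_right_mono) auto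
        then show ?thesis using that by simp
      qed
      show "exp (- C) \<le> exp (fst x * D (?q (snd x)))" using le[OF D(2), of "?q (snd x)"] by (simp add: abs_le_iff)
      show "fst x * B (?q (snd x)) \<le> C" using le[OF B(2), of "?q (snd x)"] by (simp add: abs_le_iff)
    qed (auto intro!: continuous_intros)
    then show "continuous_on ({0..1} \<times> UNIV) (\<lambda>(t, x). ?H t x)"
      unfolding case_prod_unfold by (intro continuous_intros)
  next
    fix t :: real assume t: "t \<in> {0..1}"
    have le: "\<bar>t * y\<bar> \<le> C" if "\<bar>y\<bar> \<le> C" for y
    proof -
      have "\<bar>t * y\<bar> \<le> 1 * \<bar>y\<bar>" unfolding abs_mult using t by (intro mult_right_mono) auto
      then show ?thesis using that by simp
    qed
    have qs: "continuous_on {x \<in> UNIV. wp x \<noteq> 0} (\<lambda>x. ?q x)" by (rule sg[OF continuous_on_id])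
    show "homeomorphism UNIV UNIV (?H t) (?G t)"
    proof (rule homeomorphismI)
      have "continuous_on UNIV (\<lambda>x. radpt (exp (t * D (?q x))) (t * B (?q x)) (wp x))"
      proof (rule continuous_on_radpt[where c = "exp (- C)" and C = C])
        show "continuous_on {x \<in> UNIV. wp x \<noteq> 0} (\<lambda>x. exp (t * D (?q x)))" "continuous_on {x \<in> UNIV. wp x \<noteq> 0} (\<lambda>x. t * B (?q x))"
          by (intro continuous_intros continuous_on_compose2[OF D(1) qs] continuous_on_compose2[OF B(1) qs]; simp)+
        show "exp (- C) \<le> exp (t * D (?q x))" for x using le[OF D(2), of "?q x"] by (simp add: abs_le_iff)
        show "t * B (?q x) \<le> C" for x using le[OF B(2), of "?q x"] by (simp add: abs_le_iff)
      qed (auto intro!: continuous_intros)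
      then show "continuous_on UNIV (?H t)" by (intro continuous_intros)
      have "continuous_on UNIV (\<lambda>x. radpt (exp (- (t * D (?q x)))) (- (t * B (?q x) * exp (- (t * D (?q x))))) (wp x))"
      \<comment> \<open>The inverse of an affine map with slope \<open>exp E\<close> and shift
        \<open>B\<close> has the shift \<open>- B * exp (- E)\<close>, hence the larger
        bound.\<close>
      proof (rule continuous_on_radpt[where c = "exp (- C)" and C = "C * exp C"])
        show "continuous_on {x \<in> UNIV. wp x \<noteq> 0} (\<lambda>x. exp (- (t * D (?q x))))"
          "continuous_on {x \<in> UNIV. wp x \<noteq> 0} (\<lambda>x. - (t * B (?q x) * exp (- (t * D (?q x)))))"
          by (intro continuous_intros continuous_on_compose2[OF D(1) qs] continuous_on_compose2[OF B(1) qs]; simp)+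
        show "exp (- C) \<le> exp (- (t * D (?q x)))" for x using le[OF D(2), of "?q x"] by (simp add: abs_le_iff)
        fix x
        have "- (t * B (?q x) * exp (- (t * D (?q x)))) \<le> \<bar>t * B (?q x)\<bar> * exp (- (t * D (?q x)))"
          using mult_right_mono[OF abs_ge_minus_self[of "t * B (?q x)"] exp_ge_zero[of "- (t * D (?q x))"]]
          by (simp only: mult_minus_left)
        also have "\<dots> \<le> C * exp C" using le[OF B(2), of "?q x"] le[OF D(2), of "?q x"] by (intro mult_mono) (auto simp: abs_le_iff)
        finally show "- (t * B (?q x) * exp (- (t * D (?q x)))) \<le> C * exp C" .
      qed (auto intro!: continuous_intros)
      then show "continuous_on UNIV (?G t)" by (intro continuous_intros)
      show "?G t (?H t x) = x" for x
        unfolding q by (simp add: radpt_radpt exp_minus)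
      show "?H t (?G t x) = x" for x
        unfolding q by (simp add: radpt_radpt exp_minus)
    qed auto
  qed (auto simp: radpt_def sgn_eq vec3_eq_iff)
qed

text \<open>Two strands lie over the compact sets \<open>E1\<close> and \<open>E2\<close> of fibres,
  and one increasing affine map on each fibre is to move them to their new positions. The slope is
  forced only where both strands occur. There it is positive by \<open>ord\<close>, and as this set
  is finite, its logarithm extends by Tietze's theorem. Then the shift is determined over
  \<open>E1 \<union> E2\<close>, consistently over the intersection, and is extended in the same
  way.\<close>

lemma fiber_functions:
  fixes E1 E2 :: "'a::{metric_space,second_countable_topology} set"
  assumes E: "compact E1" "compact E2" and fin: "finite (E1 \<inter> E2)"
    and y: "continuous_on E1 y1" "continuous_on E2 y2" "continuous_on E1 y1'" "continuous_on E2 y2'"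
    and ord: "\<And>q. q \<in> E1 \<inter> E2 \<Longrightarrow> (y1' q - y2' q) * (y1 q - y2 q) > (0::real)"
  obtains D B and C :: real where "continuous_on UNIV D" "continuous_on UNIV B" "\<And>q. \<bar>D q\<bar> \<le> C" "\<And>q. \<bar>B q\<bar> \<le> C"
    "\<And>q. q \<in> E1 \<Longrightarrow> y1' q = exp (D q) * y1 q + B q" "\<And>q. q \<in> E2 \<Longrightarrow> y2' q = exp (D q) * y2 q + B q"
proof -
  have cl: "closed E1" "closed E2" "closed (E1 \<inter> E2)" "closed (E1 \<union> E2)" using E by (auto simp: compact_imp_closed)
  let ?d = "\<lambda>q. ln ((y1' q - y2' q) / (y1 q - y2 q))"
  have "bounded (?d ` (E1 \<inter> E2))" using fin by (intro finite_imp_bounded) simp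
  then obtain C0 where "\<And>q. q \<in> E1 \<inter> E2 \<Longrightarrow> \<bar>?d q\<bar> \<le> C0" unfolding bounded_iff by auto
  \<comment> \<open>The maximum with 0 provides a nonnegative bound also when the intersection is
    empty.\<close>
  then have "\<And>q. q \<in> E1 \<inter> E2 \<Longrightarrow> \<bar>?d q\<bar> \<le> max C0 0" "0 \<le> max C0 0" by (simp_all add: le_max_iff_disj)
  then obtain C1 where C1: "\<And>q. q \<in> E1 \<inter> E2 \<Longrightarrow> \<bar>?d q\<bar> \<le> C1" "0 \<le> C1" by blast
  obtain D where D: "continuous_on UNIV D" "\<And>q. q \<in> E1 \<inter> E2 \<Longrightarrow> D q = ?d q" "\<And>q. \<bar>D q\<bar> \<le> C1"
    using Tietze[of "E1 \<inter> E2" ?d UNIV C1] C1 cl continuous_on_finite[OF fin] by auto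
  define b where "b q = (if q \<in> E1 then y1' q - exp (D q) * y1 q else y2' q - exp (D q) * y2 q)" for q
  have agree: "y1' q - exp (D q) * y1 q = y2' q - exp (D q) * y2 q" if "q \<in> E1 \<inter> E2" for q
  proof -
    have pos: "(y1' q - y2' q) / (y1 q - y2 q) > 0" and nz: "y1 q - y2 q \<noteq> 0"
      using ord[OF that] by (auto simp: zero_less_mult_iff zero_less_divide_iff)
    have "exp (D q) * (y1 q - y2 q) = y1' q - y2' q" using D(2)[OF that] pos nz by simp
    then show ?thesis by (simp add: algebra_simps)
  qed
  have "continuous_on (E1 \<union> E2) (\<lambda>q. if q \<in> E1 then y1' q - exp (D q) * y1 q else y2' q - exp (D q) * y2 q)"
    by (rule continuous_on_cases)
      (use cl agree in \<open>auto intro!: continuous_intros y continuous_on_subset[OF D(1)]\<close>)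
  then have bc: "continuous_on (E1 \<union> E2) b" unfolding b_def .
  then have "bounded (b ` (E1 \<union> E2))" using E by (intro compact_imp_bounded compact_continuous_image) auto
  then obtain C2 where C2: "\<And>q. q \<in> E1 \<union> E2 \<Longrightarrow> \<bar>b q\<bar> \<le> C2" unfolding bounded_iff by auto
  obtain B where B: "continuous_on UNIV B" "\<And>q. q \<in> E1 \<union> E2 \<Longrightarrow> B q = b q" "\<And>q. \<bar>B q\<bar> \<le> max C2 0"
    using Tietze[of "E1 \<union> E2" b UNIV "max C2 0"] C2 cl bc by (auto simp: le_max_iff_disj)
  show ?thesis
  proof (rule that[OF D(1) B(1)])
    show "\<bar>D q\<bar> \<le> max C1 (max C2 0)" "\<bar>B q\<bar> \<le> max C1 (max C2 0)" for q using D(3)[of q] B(3)[of q] by auto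
    show "y1' q = exp (D q) * y1 q + B q" if "q \<in> E1" for q using that B(2)[of q] by (simp add: b_def)
    show "y2' q = exp (D q) * y2 q + B q" if "q \<in> E2" for q
      using that B(2)[of q] agree[of q] by (cases "q \<in> E1") (auto simp: b_def)
  qed
qed

section \<open>Curves that are star-shaped about the vertical axis\<close>

definition circ :: "complex set" where "circ = sphere 0 1"

definition star_curve :: "(complex \<Rightarrow> real) \<Rightarrow> (complex \<Rightarrow> real) \<Rightarrow> (real^3) set" where
  "star_curve \<rho> \<eta> = (\<lambda>s. pt (of_real (\<rho> s) * s) (\<eta> s)) ` circ"

definition radial :: "(complex \<Rightarrow> real) \<Rightarrow> (complex \<Rightarrow> real) \<Rightarrow> bool" where
  "radial \<rho> \<eta> \<longleftrightarrow> continuous_on circ \<rho> \<and> continuous_on circ \<eta> \<and> (\<forall>s\<in>circ. \<rho> s > 0)"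

lemma sgn_circ: "s \<in> circ \<Longrightarrow> sgn s = s" "s \<in> circ \<Longrightarrow> cmod s = 1" "s \<in> circ \<Longrightarrow> s \<noteq> 0"
  by (auto simp: circ_def sgn_div_norm)

lemma sgn_scaled_circ: "s \<in> circ \<Longrightarrow> r > 0 \<Longrightarrow> sgn (of_real r * s) = s" "s \<in> circ \<Longrightarrow> r > 0 \<Longrightarrow> cmod (of_real r * s) = r"
  by (simp_all add: sgn_mult sgn_of_real sgn_circ norm_mult)

text \<open>First the radii are changed, which needs the two curves to be separated where their heights agree;
  then the heights are changed, which needs them to be separated where their new radii agree.\<close>

lemma star_curves_isotopic:
  assumes A: "radial \<rho>1 \<eta>1" "radial \<rho>2 \<eta>2" and B: "radial \<sigma>1 \<zeta>1" "radial \<sigma>2 \<zeta>2"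
    and a: "finite {s \<in> circ. \<eta>1 s = \<eta>2 s}" "\<And>s. s \<in> circ \<Longrightarrow> \<eta>1 s = \<eta>2 s \<Longrightarrow> (\<sigma>1 s - \<sigma>2 s) * (\<rho>1 s - \<rho>2 s) > 0"
    and b: "finite {s \<in> circ. \<sigma>1 s = \<sigma>2 s}" "\<And>s. s \<in> circ \<Longrightarrow> \<sigma>1 s = \<sigma>2 s \<Longrightarrow> (\<zeta>1 s - \<zeta>2 s) * (\<eta>1 s - \<eta>2 s) > 0"
  shows "same_pair (star_curve \<rho>1 \<eta>1) (star_curve \<rho>2 \<eta>2) (star_curve \<sigma>1 \<zeta>1) (star_curve \<sigma>2 \<zeta>2)"
proof (rule same_pair_trans)
  have cc: "compact circ" by (simp add: circ_def)
  show "same_pair (star_curve \<rho>1 \<eta>1) (star_curve \<rho>2 \<eta>2) (star_curve \<sigma>1 \<eta>1) (star_curve \<sigma>2 \<eta>2)"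
  proof -
    \<comment> \<open>The fibres of the radial move are horizontal rays, indexed by direction and
      height.\<close>
    let ?E = "\<lambda>\<eta>. (\<lambda>s. (s, \<eta> s)) ` circ"
    have cE: "compact (?E \<eta>)" if "continuous_on circ \<eta>" for \<eta> :: "complex \<Rightarrow> real"
      using cc that by (intro compact_continuous_image continuous_intros)
    have cf: "continuous_on (?E \<eta>) (\<lambda>q. ln (f (fst q)))" if "continuous_on circ f" "\<forall>s\<in>circ. f s > 0" for f \<eta> :: "complex \<Rightarrow> real"
      by (intro continuous_on_ln continuous_on_compose2[OF that(1)] continuous_intros) (use that in fastforce)+
    have fin: "finite (?E \<eta>1 \<inter> ?E \<eta>2)"
      by (rule finite_subset[OF _ finite_imageI[OF a(1), of "\<lambda>s. (s, \<eta>1 s)"]]) auto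
    have ord: "(ln (\<sigma>1 (fst q)) - ln (\<sigma>2 (fst q))) * (ln (\<rho>1 (fst q)) - ln (\<rho>2 (fst q))) > 0" if "q \<in> ?E \<eta>1 \<inter> ?E \<eta>2" for q
    proof -
      obtain s s' where ss: "s \<in> circ" "q = (s, \<eta>1 s)" "q = (s', \<eta>2 s')" using \<open>q \<in> _\<close> by blast
      have "(s, \<eta>1 s) = (s', \<eta>2 s')" using ss(2,3) by metis
      then have s: "s \<in> circ" "fst q = s" "\<eta>1 s = \<eta>2 s" using ss(1,2) by auto
      have "\<sigma>1 s > 0" "\<sigma>2 s > 0" "\<rho>1 s > 0" "\<rho>2 s > 0" using A B s(1) by (auto simp: radial_def)
      then show ?thesis using a(2)[OF s(1,3)] s(2) by (auto simp: zero_less_mult_iff)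
    qed
    obtain D K and C :: real where DK: "continuous_on UNIV D" "continuous_on UNIV K" "\<And>q. \<bar>D q\<bar> \<le> C" "\<And>q. \<bar>K q\<bar> \<le> C"
      and e: "\<And>q. q \<in> ?E \<eta>1 \<Longrightarrow> ln (\<sigma>1 (fst q)) = exp (D q) * ln (\<rho>1 (fst q)) + K q"
       "\<And>q. q \<in> ?E \<eta>2 \<Longrightarrow> ln (\<sigma>2 (fst q)) = exp (D q) * ln (\<rho>2 (fst q)) + K q"
      by (rule fiber_functions[of "?E \<eta>1" "?E \<eta>2" "\<lambda>q. ln (\<rho>1 (fst q))" "\<lambda>q. ln (\<rho>2 (fst q))" "\<lambda>q. ln (\<sigma>1 (fst q))" "\<lambda>q. ln (\<sigma>2 (fst q))",
          OF cE cE fin cf cf cf cf ord]) (use A B in \<open>auto simp: radial_def\<close>)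
    let ?f = "\<lambda>p. pt (radpt (exp (D (sgn (wp p), p $ 3))) (K (sgn (wp p), p $ 3)) (wp p)) (p $ 3)"
    have im: "?f ` star_curve \<rho> \<eta> = star_curve \<sigma> \<eta>"
      if "radial \<rho> \<eta>" "radial \<sigma> \<zeta>" "\<And>q. q \<in> ?E \<eta> \<Longrightarrow> ln (\<sigma> (fst q)) = exp (D q) * ln (\<rho> (fst q)) + K q" for \<rho> \<sigma> \<eta> \<zeta>
      unfolding star_curve_def image_image
    proof (rule image_cong[OF refl])
      fix s assume s: "s \<in> circ"
      have pos: "\<rho> s > 0" "\<sigma> s > 0" using that s by (auto simp: radial_def)
      have "ln (\<sigma> s) = exp (D (s, \<eta> s)) * ln (\<rho> s) + K (s, \<eta> s)" using that(3)[of "(s, \<eta> s)"] s by simp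
      then have "\<sigma> s = exp (exp (D (s, \<eta> s)) * ln (\<rho> s) + K (s, \<eta> s))" using pos by (metis exp_ln)
      then have "\<rho> s powr exp (D (s, \<eta> s)) * exp (K (s, \<eta> s)) = \<sigma> s" using pos by (simp add: powr_def exp_add)
      then have "radpt (exp (D (s, \<eta> s))) (K (s, \<eta> s)) (of_real (\<rho> s) * s) = of_real (\<sigma> s) * s"
        unfolding radpt_def sgn_scaled_circ[OF s pos(1)] by (simp only: mult.commute)
      then show "?f (pt (of_real (\<rho> s) * s) (\<eta> s)) = pt (of_real (\<sigma> s) * s) (\<eta> s)"
        by (simp add: sgn_scaled_circ[OF s pos(1)])
    qed
    show ?thesis unfolding same_pair_def
      using isotopy_radial[OF DK(1,3,2,4)] im[OF A(1) B(1) e(1)] im[OF A(2) B(2) e(2)] by blast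
  qed
  show "same_pair (star_curve \<sigma>1 \<eta>1) (star_curve \<sigma>2 \<eta>2) (star_curve \<sigma>1 \<zeta>1) (star_curve \<sigma>2 \<zeta>2)"
  proof -
    \<comment> \<open>The fibres of the vertical move are vertical lines, indexed by their points in
      the plane.\<close>
    let ?E = "\<lambda>\<sigma>. (\<lambda>s. complex_of_real (\<sigma> s) * s) ` circ"
    have cE: "compact (?E \<sigma>)" if "continuous_on circ \<sigma>" for \<sigma> :: "complex \<Rightarrow> real"
      using cc that by (intro compact_continuous_image continuous_intros)
    have cf: "continuous_on (?E \<sigma>) (\<lambda>q. f (sgn q))" if "continuous_on circ f" "\<forall>s\<in>circ. \<sigma> s > 0" for f \<sigma> :: "complex \<Rightarrow> real"
    proof (rule continuous_on_compose2[OF that(1)])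
      show "continuous_on (?E \<sigma>) sgn" unfolding sgn_div_norm using that(2) by (intro continuous_intros) (auto simp: sgn_circ dest: bspec)
      show "sgn ` ?E \<sigma> \<subseteq> circ" using that(2) by (auto simp: sgn_scaled_circ)
    qed
    have pos: "\<forall>s\<in>circ. \<sigma>1 s > 0" "\<forall>s\<in>circ. \<sigma>2 s > 0" using B by (auto simp: radial_def)
    have both: "\<exists>s\<in>circ. q = of_real (\<sigma>1 s) * s \<and> \<sigma>1 s = \<sigma>2 s" if "q \<in> ?E \<sigma>1 \<inter> ?E \<sigma>2" for q
    proof -
      obtain s s' where s: "s \<in> circ" "q = of_real (\<sigma>1 s) * s" "s' \<in> circ" "q = of_real (\<sigma>2 s') * s'" using \<open>q \<in> _\<close> by auto
      then have "s = s'" using sgn_scaled_circ(1)[of s "\<sigma>1 s"] sgn_scaled_circ(1)[of s' "\<sigma>2 s'"] pos by metis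
      moreover have "\<sigma>1 s = \<sigma>2 s'" using s sgn_scaled_circ(2)[of s "\<sigma>1 s"] sgn_scaled_circ(2)[of s' "\<sigma>2 s'"] pos by metis
      ultimately show ?thesis using s by (intro bexI[of _ s]) simp_all
    qed
    have fin: "finite (?E \<sigma>1 \<inter> ?E \<sigma>2)"
      by (rule finite_subset[OF _ finite_imageI[OF b(1), of "\<lambda>s. of_real (\<sigma>1 s) * s"]]) (use both in blast)
    have ord: "(\<zeta>1 (sgn q) - \<zeta>2 (sgn q)) * (\<eta>1 (sgn q) - \<eta>2 (sgn q)) > 0" if "q \<in> ?E \<sigma>1 \<inter> ?E \<sigma>2" for q
    proof -
      obtain s where "s \<in> circ" "q = of_real (\<sigma>1 s) * s" "\<sigma>1 s = \<sigma>2 s" using both[OF \<open>q \<in> _\<close>] by blast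
      then show ?thesis using b(2)[of s] pos by (simp add: sgn_scaled_circ)
    qed
    obtain D K and C :: real where DK: "continuous_on UNIV D" "continuous_on UNIV K"
      and e: "\<And>q. q \<in> ?E \<sigma>1 \<Longrightarrow> \<zeta>1 (sgn q) = exp (D q) * \<eta>1 (sgn q) + K q"
       "\<And>q. q \<in> ?E \<sigma>2 \<Longrightarrow> \<zeta>2 (sgn q) = exp (D q) * \<eta>2 (sgn q) + K q"
      by (rule fiber_functions[of "?E \<sigma>1" "?E \<sigma>2" "\<lambda>q. \<eta>1 (sgn q)" "\<lambda>q. \<eta>2 (sgn q)" "\<lambda>q. \<zeta>1 (sgn q)" "\<lambda>q. \<zeta>2 (sgn q)",
          OF cE cE fin cf cf cf cf ord]) (use A B in \<open>auto simp: radial_def\<close>)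
    let ?f = "\<lambda>p. pt (wp p) (exp (D (wp p)) * p $ 3 + K (wp p))"
    have im: "?f ` star_curve \<sigma> \<eta> = star_curve \<sigma> \<zeta>"
      if "\<forall>s\<in>circ. \<sigma> s > 0" "\<And>q. q \<in> ?E \<sigma> \<Longrightarrow> \<zeta> (sgn q) = exp (D q) * \<eta> (sgn q) + K q" for \<sigma> \<eta> \<zeta>
      unfolding star_curve_def image_image
    proof (rule image_cong[OF refl])
      fix s assume s: "s \<in> circ"
      then have "\<zeta> s = exp (D (of_real (\<sigma> s) * s)) * \<eta> s + K (of_real (\<sigma> s) * s)"
        using that(2)[of "of_real (\<sigma> s) * s"] that(1) by (auto simp: sgn_scaled_circ)
      then show "?f (pt (of_real (\<sigma> s) * s) (\<eta> s)) = pt (of_real (\<sigma> s) * s) (\<zeta> s)" by simp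
    qed
    show ?thesis unfolding same_pair_def
      using isotopy_vertical[OF DK] im[OF pos(1) e(1)] im[OF pos(2) e(2)] by blast
  qed
qed

section \<open>A conformation with thirteen sticks\<close>

text \<open>If a point \<open>c\<close> of the circle were missed, the argument would be a
  continuous real function on the loop, injective except for the common end value. By the
  intermediate value theorem it takes some value once before and once after the parameter
  1/2.\<close>

lemma injective_loop_circle:
  fixes f :: "'a::real_normed_vector \<Rightarrow> complex"
  assumes \<gamma>: "simple_path \<gamma>" "pathfinish \<gamma> = pathstart \<gamma>"
    and f: "continuous_on (path_image \<gamma>) f" "inj_on f (path_image \<gamma>)" "f ` path_image \<gamma> \<subseteq> circ"
  shows "f ` path_image \<gamma> = circ"
proof (rule ccontr)
  assume "\<not> ?thesis"
  then obtain c where c: "c \<in> circ" "c \<notin> f ` path_image \<gamma>" using f(3) by blast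
  have im: "\<gamma> t \<in> path_image \<gamma>" if "t \<in> {0..1}" for t using that by (auto simp: path_image_def)
  \<comment> \<open>Turns \<open>c\<close> to -1, so that the principal branch of the logarithm is
    continuous on the values.\<close>
  define k where "k t = - f (\<gamma> t) / c" for t
  have k1: "cmod (k t) = 1" "k t \<noteq> -1" if "t \<in> {0..1}" for t
  proof -
    have "f (\<gamma> t) \<in> circ" "f (\<gamma> t) \<noteq> c" using im[OF that] f(3) c by auto
    then show "cmod (k t) = 1" "k t \<noteq> -1" using c(1) by (auto simp: k_def norm_divide sgn_circ divide_eq_eq)
  qed
  have k2: "k t \<notin> \<real>\<^sub>\<le>\<^sub>0" if "t \<in> {0..1}" for t
  proof
    assume "k t \<in> \<real>\<^sub>\<le>\<^sub>0"
    then obtain r where "k t = of_real r" "r \<le> 0" by (auto simp: nonpos_Reals_def)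
    then show False using k1[OF that] by auto
  qed
  have cg: "continuous_on {0..1} \<gamma>" using \<gamma>(1) by (simp add: simple_path_def path_def)
  have ck: "continuous_on {0..1} k"
  proof -
    have "continuous_on {0..1} (\<lambda>t. f (\<gamma> t))"
      by (rule continuous_on_compose2[OF f(1) cg]) (auto simp: path_image_def)
    then show ?thesis unfolding k_def using c(1) by (intro continuous_intros) (auto simp: sgn_circ)
  qed
  define g where "g t = Im (Ln (k t))" for t
  have cgg: "continuous_on {0..1} g"
    unfolding g_def by (intro continuous_on_Im continuous_on_Ln' ck k2)
  have inj: "s = t \<or> s = 0 \<and> t = 1 \<or> s = 1 \<and> t = 0" if "s \<in> {0..1}" "t \<in> {0..1}" "g s = g t" for s t
  proof -
    have nz: "k s \<noteq> 0" "k t \<noteq> 0" using k1[OF that(1)] k1[OF that(2)] by auto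
    have "Re (Ln (k s)) = Re (Ln (k t))" using nz k1[OF that(1)] k1[OF that(2)] by simp
    then have "Ln (k s) = Ln (k t)" using that(3) by (simp add: complex_eq_iff g_def)
    then have "k s = k t" using nz by (metis exp_Ln)
    then have "f (\<gamma> s) = f (\<gamma> t)" using c(1) by (simp add: k_def sgn_circ)
    then have "\<gamma> s = \<gamma> t" using f(2) im[OF that(1)] im[OF that(2)] by (auto dest: inj_onD)
    then show ?thesis using \<gamma>(1) that(1,2) by (auto simp: simple_path_def loop_free_def)
  qed
  have "\<gamma> 0 = \<gamma> 1" using \<gamma>(2) by (simp add: pathstart_def pathfinish_def)
  then have g01: "g 0 = g 1" by (simp add: g_def k_def)
  have half: "g (1/2) \<noteq> g 0" using inj[of "1/2" 0] by auto
  \<comment> \<open>The second factor makes the value at 1/2 positive, whichever way the argument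
    moves.\<close>
  define h where "h t = (g t - g 0) * (g (1/2) - g 0)" for t
  have h: "h 0 = 0" "h 1 = 0" "h (1/2) > 0" using g01 half by (auto simp: h_def zero_less_mult_iff)
  have ch: "continuous_on {0..1} h" unfolding h_def by (intro continuous_intros cgg)
  obtain s where s: "0 \<le> s" "s \<le> 1/2" "h s = h (1/2) / 2"
    using IVT'[of h 0 "h (1/2) / 2" "1/2"] h continuous_on_subset[OF ch, of "{0..1/2}"] by auto
  obtain t where t: "1/2 \<le> t" "t \<le> 1" "h t = h (1/2) / 2"
    using IVT2'[of h 1 "h (1/2) / 2" "1/2"] h continuous_on_subset[OF ch, of "{1/2..1}"] by auto
  have "g s = g t" using s(3) t(3) half by (simp add: h_def)
  moreover have "s \<in> {0..1}" "t \<in> {0..1}" using s t by auto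
  ultimately have "s = t \<or> s = 0 \<and> t = 1 \<or> s = 1 \<and> t = 0" using inj by blast
  moreover have "s \<noteq> 0" using s h by auto
  moreover have "s \<noteq> 1/2"
  proof
    assume a: "s = 1/2"
    show False using s(3) h(3) unfolding a by simp
  qed
  ultimately show False using s t by auto
qed

text \<open>A positively homogeneous \<open>G\<close> that is 1 on the projection makes the loop
  meet each half plane bounded by the vertical axis at most once. So the direction is injective on
  the loop, hence onto the circle, and its inverse gives radius and height.\<close>

lemma star_curve_of_loop:
  fixes G h :: "complex \<Rightarrow> real"
  assumes \<gamma>: "simple_path \<gamma>" "pathfinish \<gamma> = pathstart \<gamma>"
    and G: "\<And>k w. k > 0 \<Longrightarrow> G (of_real k * w) = k * G w"
    and p: "\<And>p. p \<in> path_image \<gamma> \<Longrightarrow> G (wp p) = 1 \<and> p $ 3 = h (wp p)"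
  obtains \<sigma> \<zeta> where "radial \<sigma> \<zeta>" "path_image \<gamma> = star_curve \<sigma> \<zeta>" "\<And>s. s \<in> circ \<Longrightarrow> \<sigma> s * G s = 1"
proof -
  let ?A = "path_image \<gamma>" and ?f = "\<lambda>p. sgn (wp p)"
  have cA: "compact ?A" using \<gamma>(1) by (simp add: compact_path_image simple_path_imp_path)
  have G0: "G 0 = 0" using G[of 2 0] by simp
  have nz: "wp p \<noteq> 0" if "p \<in> ?A" for p using p[OF that] G0 by auto
  have Gn: "cmod (wp q) * G (sgn (wp q)) = 1" if "q \<in> ?A" for q
  proof -
    have "wp q = of_real (cmod (wp q)) * sgn (wp q)" using nz[OF that] by (simp add: sgn_eq)
    then have "G (wp q) = cmod (wp q) * G (sgn (wp q))" using G[of "cmod (wp q)" "sgn (wp q)"] nz[OF that] by (metis zero_less_norm_iff)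
    then show ?thesis using p[OF that] by simp
  qed
  have cf: "continuous_on ?A ?f"
    unfolding sgn_div_norm by (intro continuous_intros) (use nz in auto)
  have inj: "inj_on ?f ?A"
  proof (rule inj_onI)
    fix p q assume pq: "p \<in> ?A" "q \<in> ?A" "?f p = ?f q"
    have "cmod (wp p) * G (?f p) = cmod (wp q) * G (?f p)" using Gn[OF pq(1)] Gn[OF pq(2)] pq(3) by simp
    then have "cmod (wp p) = cmod (wp q)" using Gn[OF pq(1)] by (metis mult_right_cancel mult_zero_right zero_neq_one)
    then have "wp p = wp q" using pq(3) nz pq(1,2) by (simp add: sgn_eq)
    moreover then have "p $ 3 = q $ 3" using p[OF pq(1)] p[OF pq(2)] by simp
    ultimately show "p = q" by (metis pt_wp)
  qed
  have "?f ` ?A \<subseteq> circ" using nz by (auto simp: circ_def norm_sgn)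
  from injective_loop_circle[OF \<gamma> cf inj this] have im: "?f ` ?A = circ" .
  obtain g where g: "homeomorphism ?A circ ?f g" using homeomorphism_compact[OF cA cf im inj] by blast
  define \<sigma> \<zeta> where "\<sigma> s = cmod (wp (g s))" and "\<zeta> s = g s $ 3" for s
  have gA: "g s \<in> ?A" "?f (g s) = s" if "s \<in> circ" for s using g that by (auto simp: homeomorphism_def)
  have cg: "continuous_on circ g" using g by (simp add: homeomorphism_def)
  show ?thesis
  proof (rule that)
    show "radial \<sigma> \<zeta>" unfolding radial_def \<sigma>_def \<zeta>_def using gA nz by (auto intro!: continuous_intros cg)
    have "g s = pt (of_real (\<sigma> s) * s) (\<zeta> s)" if "s \<in> circ" for s
    proof -
      have "of_real (\<sigma> s) * s = wp (g s)" using gA[OF that] nz by (simp add: \<sigma>_def sgn_eq) (metis gA(2)[OF that] nz sgn_eq mult.commute nonzero_eq_divide_eq norm_eq_zero of_real_eq_0_iff)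
      then show ?thesis by (simp add: \<zeta>_def)
    qed
    moreover have "?A = g ` circ" using g by (auto simp: homeomorphism_def)
    ultimately show "?A = star_curve \<sigma> \<zeta>" by (simp add: star_curve_def)
    show "\<sigma> s * G s = 1" if "s \<in> circ" for s using Gn[OF gA(1)[OF that]] gA(2)[OF that] by (simp add: \<sigma>_def)
  qed
qed

lemma segment_bounds:
  fixes a b p :: "real^3"
  assumes "p \<in> closed_segment a b"
  shows "min (a $ j) (b $ j) \<le> p $ j" "p $ j \<le> max (a $ j) (b $ j)"
proof -
  obtain t where t: "0 \<le> t" "t \<le> 1" "p = (1 - t) *\<^sub>R a + t *\<^sub>R b" using assms by (auto simp: closed_segment_def)
  let ?m = "min (a $ j) (b $ j)" and ?M = "max (a $ j) (b $ j)"
  have "(1 - t) * ?m + t * ?m \<le> (1 - t) * a $ j + t * b $ j" "(1 - t) * a $ j + t * b $ j \<le> (1 - t) * ?M + t * ?M"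
    using t by (intro add_mono mult_left_mono; simp)+
  moreover have "p $ j = (1 - t) * a $ j + t * b $ j" using t(3) by simp
  moreover have "(1 - t) * m + t * m = m" for m by (simp add: algebra_simps)
  ultimately show "?m \<le> p $ j" "p $ j \<le> ?M" by simp_all
qed

lemma lcyc_reduced:
  assumes "lcyc vs d" shows "reduced vs"
  unfolding reduced_def
proof (intro allI impI notI)
  fix i assume i: "i < length vs"
  let ?n = "length vs"
  let ?a = "vs ! i" and ?b = "vs ! (Suc i mod ?n)" and ?c = "vs ! (Suc (Suc i) mod ?n)" and ?e = "d (Suc i mod ?n)"
  assume bet: "?b \<in> closed_segment ?a ?c"
  have n0: "?n > 0" using i by auto
  then have n: "?n > 0" "Suc i mod ?n < ?n" by simp_all
  have m: "Suc (Suc i mod ?n) mod ?n = Suc (Suc i) mod ?n" by (simp add: mod_Suc_eq)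
  have st: "?b $ j = ?a $ j \<longleftrightarrow> j \<noteq> d i" "?c $ j = ?b $ j \<longleftrightarrow> j \<noteq> ?e" and de: "?e \<noteq> d i" for j
    using assms i n m unfolding lcyc_def by metis+
  obtain t where t: "?b = (1 - t) *\<^sub>R ?a + t *\<^sub>R ?c" using bet by (auto simp: closed_segment_def)
  have "?b $ ?e = (1 - t) * ?a $ ?e + t * ?c $ ?e" using arg_cong[OF t, of "\<lambda>x. x $ ?e"] by simp
  moreover have "?b $ ?e = ?a $ ?e" using st(1) de by blast
  moreover have "t * (C - B) = 0" if "B = (1 - t) * A + t * C" "B = A" for A B C :: real
    using that by (auto simp: algebra_simps)
  ultimately have "t * (?c $ ?e - ?b $ ?e) = 0" by blast
  moreover have "?c $ ?e \<noteq> ?b $ ?e" using st(2)[of ?e] by blast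
  ultimately have "t = 0" by (metis mult_eq_0_iff right_minus_eq)
  then have "?b = ?a" using t by simp
  then show False using st(1)[of "d i"] by simp
qed

lemma lcyc_lattice:
  assumes "lcyc vs d" shows "set vs \<subseteq> integer_points" "polygon vs \<subseteq> cubic_lattice"
proof -
  show "set vs \<subseteq> integer_points" using assms by (auto simp: lcyc_def integer_points_def in_set_conv_nth)
  show "polygon vs \<subseteq> cubic_lattice"
  proof
    fix p assume "p \<in> polygon vs"
    then obtain i where i: "i < length vs" "p \<in> edge vs i" by (auto simp: polygon_def)
    have st: "vs ! (Suc i mod length vs) $ j = vs ! i $ j" if "j \<noteq> d i" for j using assms i that by (auto simp: lcyc_def)
    have "p $ j \<in> \<int>" if "j \<noteq> d i" for j
      using axis_segmentD(1)[OF i(2)[unfolded edge_def], of "d i" j] st that assms i(1) by (auto simp: lcyc_def)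
    then show "p \<in> cubic_lattice" by (auto simp: cubic_lattice_def)
  qed
qed

section \<open>The conformation and its linking number\<close>

definition link_P :: "(real^3) list" where
  "link_P = [pt (Complex (-17) (-11)) 0, pt (Complex 27 (-11)) 0, pt (Complex 27 15) 0, pt (Complex (-17) 15) 0]"

text \<open>The edges 0 and 4 rise through the rectangle \<open>link_P\<close>, and the edges 2 and
  6 descend outside of it, whence the linking number has modulus 2. With these lengths the
  projections of the polygons meet, after \<open>tilt\<close>, only at (27, -9), (27, 9), (9, 15)
  and (-15, 15).\<close>

definition link_Q :: "(real^3) list" where
  "link_Q = [pt (Complex (-14) 8) (-1), pt (Complex (-14) 8) 2, pt (Complex 30 8) 2, pt (Complex 30 8) (-1), pt (Complex 8 8) (-1),
     pt (Complex 8 8) 1, pt (Complex 8 20) 1, pt (Complex 8 20) (-1), pt (Complex (-14) 20) (-1)]"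

lemma pt_eq_iff [simp]: "pt w z = pt w' z' \<longleftrightarrow> w = w' \<and> z = z'"
  by (auto simp: vec3_eq_iff complex_eq_iff)

definition box_P :: "nat \<Rightarrow> real \<Rightarrow> real \<Rightarrow> real \<Rightarrow> bool" where
  "box_P i x y z \<longleftrightarrow> z = 0 \<and> -17 \<le> x \<and> x \<le> 27 \<and> -11 \<le> y \<and> y \<le> 15 \<and>
    (i = 0 \<and> y = -11 \<or> i = 1 \<and> x = 27 \<or> i = 2 \<and> y = 15 \<or> i = 3 \<and> x = -17)"

lemma link_P_edge:
  fixes p :: "real^3"
  assumes "p \<in> edge link_P i" "i < 4"
  shows "box_P i (p $ 1) (p $ 2) (p $ 3)"
proof -
  have "i = 0 \<or> i = 1 \<or> i = 2 \<or> i = 3" using assms(2) by auto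
  then show ?thesis
    using segment_bounds[OF assms(1)[unfolded edge_def], of 1] segment_bounds[OF assms(1)[unfolded edge_def], of 2]
      segment_bounds[OF assms(1)[unfolded edge_def], of 3]
    by (elim disjE) (simp_all add: link_P_def box_P_def)
qed

definition box_Q :: "nat \<Rightarrow> real \<Rightarrow> real \<Rightarrow> real \<Rightarrow> bool" where
  "box_Q i x y z \<longleftrightarrow> i = 0 \<and> x = -14 \<and> y = 8 \<and> -1 \<le> z \<and> z \<le> 2 \<or>
    i = 1 \<and> -14 \<le> x \<and> x \<le> 30 \<and> y = 8 \<and> z = 2 \<or>
    i = 2 \<and> x = 30 \<and> y = 8 \<and> -1 \<le> z \<and> z \<le> 2 \<or>
    i = 3 \<and> 8 \<le> x \<and> x \<le> 30 \<and> y = 8 \<and> z = -1 \<or>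
    i = 4 \<and> x = 8 \<and> y = 8 \<and> -1 \<le> z \<and> z \<le> 1 \<or>
    i = 5 \<and> x = 8 \<and> 8 \<le> y \<and> y \<le> 20 \<and> z = 1 \<or>
    i = 6 \<and> x = 8 \<and> y = 20 \<and> -1 \<le> z \<and> z \<le> 1 \<or>
    i = 7 \<and> -14 \<le> x \<and> x \<le> 8 \<and> y = 20 \<and> z = -1 \<or>
    i = 8 \<and> x = -14 \<and> 8 \<le> y \<and> y \<le> 20 \<and> z = -1"

lemma link_Q_edge:
  fixes p :: "real^3"
  assumes "p \<in> edge link_Q i" "i < 9"
  shows "box_Q i (p $ 1) (p $ 2) (p $ 3)"
proof -
  have "i = 0 \<or> i = 1 \<or> i = 2 \<or> i = 3 \<or> i = 4 \<or> i = 5 \<or> i = 6 \<or> i = 7 \<or> i = 8" using assms(2) by auto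
  then show ?thesis
    using segment_bounds[OF assms(1)[unfolded edge_def], of 1] segment_bounds[OF assms(1)[unfolded edge_def], of 2]
      segment_bounds[OF assms(1)[unfolded edge_def], of 3]
    by (elim disjE) (simp_all add: link_Q_def box_Q_def)
qed

definition dir_P :: "nat \<Rightarrow> 3" where "dir_P i = [1, 2, 1, 2] ! i"
definition dir_Q :: "nat \<Rightarrow> 3" where "dir_Q i = [3, 1, 3, 1, 3, 2, 3, 1, 2] ! i"

lemma less_4: "(i::nat) < 4 \<longleftrightarrow> i = 0 \<or> i = 1 \<or> i = 2 \<or> i = 3"
  and less_9: "(i::nat) < 9 \<longleftrightarrow> i = 0 \<or> i = 1 \<or> i = 2 \<or> i = 3 \<or> i = 4 \<or> i = 5 \<or> i = 6 \<or> i = 7 \<or> i = 8"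
  by auto

lemma lcyc_link: "lcyc link_P dir_P" "lcyc link_Q dir_Q"
proof -
  have l: "length link_P = 4" "length link_Q = 9" by (simp_all add: link_P_def link_Q_def)
  show "lcyc link_P dir_P"
    unfolding lcyc_def l
  proof (intro conjI allI impI)
    show "distinct link_P" by (simp add: link_P_def)
    fix i :: nat and j :: 3 assume "i < 4"
    then show "link_P ! i $ j \<in> \<int>" "link_P ! (Suc i mod 4) $ j = link_P ! i $ j \<longleftrightarrow> j \<noteq> dir_P i"
      unfolding less_4 using exhaust_3[of j] by (elim disjE; simp add: link_P_def dir_P_def)+
  next
    fix i :: nat assume "i < 4"
    then show "dir_P (Suc i mod 4) \<noteq> dir_P i" unfolding less_4 by (elim disjE) (simp_all add: dir_P_def)
  qed simp
  show "lcyc link_Q dir_Q"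
    unfolding lcyc_def l
  proof (intro conjI allI impI)
    show "distinct link_Q" by (simp add: link_Q_def)
    fix i :: nat and j :: 3 assume "i < 9"
    then show "link_Q ! i $ j \<in> \<int>" "link_Q ! (Suc i mod 9) $ j = link_Q ! i $ j \<longleftrightarrow> j \<noteq> dir_Q i"
      unfolding less_9 using exhaust_3[of j] by (elim disjE; simp add: link_Q_def dir_Q_def)+
  next
    fix i :: nat assume "i < 9"
    then show "dir_Q (Suc i mod 9) \<noteq> dir_Q i" unfolding less_9 by (elim disjE) (simp_all add: dir_Q_def)
  qed simp
qed

lemma simple_polygonI:
  assumes "length vs \<ge> 3" "distinct vs"
    and "\<And>i j p. i < j \<Longrightarrow> j < length vs \<Longrightarrow> p \<in> edge vs i \<Longrightarrow> p \<in> edge vs j \<Longrightarrow> p \<in> edge_ends vs i \<inter> edge_ends vs j"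
  shows "simple_polygon vs"
proof -
  have "edge_ends vs i \<subseteq> edge vs i" for i by (auto simp: edge_ends_def edge_def)
  then have h: "edge vs i \<inter> edge vs j = edge_ends vs i \<inter> edge_ends vs j" if "i < j" "j < length vs" for i j
    using assms(3)[OF that] by blast
  then have "edge vs i \<inter> edge vs j = edge_ends vs i \<inter> edge_ends vs j" if "i < length vs" "j < length vs" "i \<noteq> j" for i j
    using that h[of i j] h[of j i] by (cases "i < j") (simp_all add: Int_commute)
  then show ?thesis using assms(1,2) by (simp add: simple_polygon_def)
qed

lemma simple_link: "simple_polygon link_P" "simple_polygon link_Q"
proof -
  have l: "length link_P = 4" "length link_Q = 9" by (simp_all add: link_P_def link_Q_def)
  show "simple_polygon link_P"
  proof (rule simple_polygonI)
    fix i j p assume ij: "i < j" "j < length link_P" and p: "p \<in> edge link_P i" "p \<in> edge link_P j"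
    have "i < 4" "j < 4" using ij l by auto
    then show "p \<in> edge_ends link_P i \<inter> edge_ends link_P j"
      using link_P_edge[OF p(1) \<open>i < 4\<close>] link_P_edge[OF p(2) \<open>j < 4\<close>] ij(1) unfolding box_P_def
      by (elim conjE disjE; simp add: edge_ends_def link_P_def vec3_eq_iff)
  qed (use lcyc_link in \<open>simp_all add: l lcyc_def\<close>)
  show "simple_polygon link_Q"
  proof (rule simple_polygonI)
    fix i j p assume ij: "i < j" "j < length link_Q" and p: "p \<in> edge link_Q i" "p \<in> edge link_Q j"
    have "i < 9" "j < 9" using ij l by auto
    then show "p \<in> edge_ends link_Q i \<inter> edge_ends link_Q j"
      using link_Q_edge[OF p(1) \<open>i < 9\<close>] link_Q_edge[OF p(2) \<open>j < 9\<close>] ij(1) unfolding box_Q_def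
      by (elim conjE disjE; simp add: edge_ends_def link_Q_def vec3_eq_iff)
  qed (use lcyc_link in \<open>simp_all add: l lcyc_def\<close>)
qed

lemma disjoint_link: "polygon link_P \<inter> polygon link_Q = {}"
proof -
  have "False" if p: "p \<in> edge link_P i" "p \<in> edge link_Q j" and ij: "i < 4" "j < 9" for p i j
    using link_P_edge[OF p(1) ij(1)] link_Q_edge[OF p(2) ij(2)] unfolding box_P_def box_Q_def by (elim conjE disjE) simp_all
  moreover have l: "length link_P = 4" "length link_Q = 9" by (simp_all add: link_P_def link_Q_def)
  ultimately show ?thesis unfolding polygon_def l by fastforce
qed

lemma spin_link_link: "cmod (spin_link link_P (ppath (cyc link_Q))) = 2"
proof -
  have ne: "link_P \<noteq> []" "link_Q \<noteq> []" by (simp_all add: link_P_def link_Q_def)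
  have n9: "length link_Q = 9" by (simp add: link_Q_def)
  let ?v = "pt (Complex (-17) (-11)) 0"
  have r: "link_P = rect ?v (ax 1 44) (ax 2 26)" by (simp add: link_P_def rect_def vec3_eq_iff)
  have v: "?v $ j \<in> \<int>" for j using exhaust_3[of j] by auto
  have ax12: "(1::3) \<noteq> 2" "(3::3) \<noteq> 1" "(3::3) \<noteq> 2" by simp_all
  interpret rect_crossing link_Q dir_Q ?v 1 2 44 26 by (rule rect_crossingI) (use lcyc_link v in auto)
  have 1: "spin_link link_P (ppath (cyc link_Q)) = spin_link link_P (ppath (cyc (shifted link_Q)))"
    by (rule spin_link_shifted) (use ne lcyc_lattice(2)[OF lcyc_link(1)] lcyc_lattice(2)[OF lcyc_link(2)] disjoint_link in \<open>simp_all add: polygon_csegs\<close>)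
  have 2: "\<dots> = of_int (crossing ?v (ax 1 44) (ax 2 26) (shifted link_Q))"
    unfolding r by (rule spin_link_rect_shifted(1)[OF lcyc_link(2) v]) simp_all
  have sum9: "(\<Sum>i<9. g i) = g 0 + g 1 + g 2 + g 3 + g 4 + g 5 + g 6 + g 7 + g 8" for g :: "nat \<Rightarrow> int" by (simp add: eval_nat_numeral)
  have sn: "shifted link_Q = map (\<lambda>x. x + half) link_Q" by (simp add: shifted_def)
  have "\<bar>crossing ?v (ax 1 44) (ax 2 26) (shifted link_Q)\<bar> = 2"
    unfolding crossing_eq unfolding n9 sum9 inside_rect_ax[OF ax12(1)] above_def height_orient[OF ax12] sn
    using orient(1)[OF ax12] by (elim disjE) (simp_all add: link_Q_def half_def sbt_def)
  then show ?thesis unfolding 1 2 norm_of_int by (metis of_int_abs of_int_numeral)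
qed

text \<open>After tilting, both polygons are star-shaped about the vertical axis. The gauges are positively homogeneous
  functions which are \<open>1\<close> on the horizontal projections; with the level of the tilted second polygon they certify this.
  The pieces of \<open>gauge_Q\<close> are the edges in counterclockwise order, starting from the right.\<close>

definition gauge_P :: "real \<Rightarrow> real \<Rightarrow> real" where
  "gauge_P x y = max (max (x / 27) (- x / 17)) (max (y / 15) (- y / 11))"

definition gauge_Q :: "real \<Rightarrow> real \<Rightarrow> real" where
  "gauge_Q x y = (if y \<le> 0 \<or> 0 \<le> 9 * x - 30 * y \<or> 0 \<le> - 9 * x - 14 * y then max (max (- x / 14) (x / 30)) (- y / 9)
     else if 0 \<le> 9 * x - 12 * y then y / 9
     else if 0 \<le> 7 * x - 9 * y then (3 * y - 2 * x) / 3
     else if 0 \<le> 7 * x - 8 * y then y / 7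
     else if 0 \<le> 9 * x - 8 * y then x / 8
     else if 0 \<le> 15 * x - 9 * y then (6 * x - y) / 39
     else if 0 \<le> 21 * x - 9 * y then x / 9
     else if 0 \<le> 19 * x - 7 * y then (y - x) / 12
     else if 0 \<le> 21 * x + 14 * y then (2 * x + 21 * y) / 413
     else if 0 \<le> 21 * x + 15 * y then y / 21
     else if 0 \<le> 15 * x + 15 * y then - x / 15
     else - (6 * x + y) / 75)"

definition level_Q :: "real \<Rightarrow> real \<Rightarrow> real" where
  "level_Q x y = (if y \<le> 0 \<or> 0 \<le> 9 * x - 30 * y \<or> 0 \<le> - 9 * x - 14 * y then (if 7 \<le> y then 8 - y else (23 - y) / 16)
     else if 0 \<le> 7 * x - 8 * y then - 1
     else if 0 \<le> 9 * x - 8 * y then y - 8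
     else if 0 \<le> 21 * x - 9 * y then 1
     else if 0 \<le> 19 * x - 7 * y then x - 8
     else - 1)"

section \<open>Gauge and level along the tilted second polygon\<close>

lemma gauge_P_scale: "k > 0 \<Longrightarrow> gauge_P (k * x) (k * y) = k * gauge_P x y"
  by (simp add: gauge_P_def max_mult_distrib_left)

lemma gauge_Q_scale:
  assumes k: "k > 0"
  shows "gauge_Q (k * x) (k * y) = k * gauge_Q x y"
proof -
  have 1: "0 \<le> a * (k * x) - b * (k * y) \<longleftrightarrow> 0 \<le> a * x - b * y" for a b
  proof -
    have "a * (k * x) - b * (k * y) = k * (a * x - b * y)" by (simp add: algebra_simps)
    then show ?thesis using k by (simp add: zero_le_mult_iff)
  qed
  have 2: "0 \<le> a * (k * x) + b * (k * y) \<longleftrightarrow> 0 \<le> a * x + b * y" for a b using 1[of a "- b"] by simp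
  have 3: "k * y \<le> 0 \<longleftrightarrow> y \<le> 0" using k by (simp add: mult_le_0_iff)
  have 4: "max (max (- (k * x) / 14) (k * x / 30)) (- (k * y) / 9) = k * max (max (- x / 14) (x / 30)) (- y / 9)"
    using k by (simp add: max_mult_distrib_left)
  show ?thesis unfolding gauge_Q_def 1 2 3 4 by (simp add: field_simps split del: if_split cong: if_cong) (simp add: algebra_simps)
qed

text \<open>Besides gauge and level this records the four crossings with the first polygon, with the
  height of the second polygon there; the first one has height 0.\<close>

definition on_Q :: "real \<Rightarrow> real \<Rightarrow> real \<Rightarrow> bool" where
  "on_Q x y z \<longleftrightarrow> gauge_Q x y = 1 \<and> level_Q x y = z \<and> (gauge_P x y = 1 \<longrightarrow>
     x = 27 \<and> y = -9 \<and> z = 2 \<or> x = 27 \<and> y = 9 \<and> z = -1 \<or> x = 9 \<and> y = 15 \<and> z = 1 \<or> x = -15 \<and> y = 15 \<and> z = -1)"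

lemma gauge_P_eq_1: "gauge_P x y = 1 \<Longrightarrow> x \<le> 27 \<and> -17 \<le> x \<and> y \<le> 15 \<and> -11 \<le> y \<and> (x = 27 \<or> x = -17 \<or> y = 15 \<or> y = -11)"
  unfolding gauge_P_def by (auto simp: max_def split: if_splits)

lemma on_QI:
  assumes "gauge_Q x y = 1" "level_Q x y = z"
    and "x \<le> 27 \<Longrightarrow> -17 \<le> x \<Longrightarrow> y \<le> 15 \<Longrightarrow> -11 \<le> y \<Longrightarrow> x = 27 \<or> x = -17 \<or> y = 15 \<or> y = -11 \<Longrightarrow>
      x = 27 \<and> y = -9 \<and> z = 2 \<or> x = 27 \<and> y = 9 \<and> z = -1 \<or> x = 9 \<and> y = 15 \<and> z = 1 \<or> x = -15 \<and> y = 15 \<and> z = -1"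
  shows "on_Q x y z"
  unfolding on_Q_def using assms gauge_P_eq_1[of x y] by blast

lemma on_Q_left_1: "-1 \<le> z \<Longrightarrow> z \<le> 1 \<Longrightarrow> on_Q (-14) (8 - z) z"
  by (rule on_QI; simp add: gauge_Q_def level_Q_def max_def; (linarith)?)

lemma on_Q_left_2: "1 \<le> z \<Longrightarrow> z \<le> 2 \<Longrightarrow> on_Q (-14) (23 - 16 * z) z"
  by (rule on_QI; simp add: gauge_Q_def level_Q_def max_def; (linarith)?)

lemma on_Q_right_1: "-1 \<le> z \<Longrightarrow> z \<le> 1 \<Longrightarrow> on_Q 30 (8 - z) z"
  by (rule on_QI; simp add: gauge_Q_def level_Q_def max_def; (linarith)?)

lemma on_Q_right_2: "1 \<le> z \<Longrightarrow> z \<le> 2 \<Longrightarrow> on_Q 30 (23 - 16 * z) z"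
  by (rule on_QI; simp add: gauge_Q_def level_Q_def max_def; (linarith)?)

lemma on_Q_bottom_1: "-14 \<le> x \<Longrightarrow> x \<le> 30 \<Longrightarrow> on_Q x (-9) 2"
  by (rule on_QI; simp add: gauge_Q_def level_Q_def max_def; (linarith)?)

text \<open>At an end point on the boundary of two pieces of \<open>gauge_Q\<close> the earlier
  piece applies, hence the separate case.\<close>

lemma on_Q_fold_1: "12 \<le> x \<Longrightarrow> x \<le> 30 \<Longrightarrow> on_Q x 9 (-1)"
  by (rule on_QI; cases "x = 30"; simp add: gauge_Q_def level_Q_def max_def; (linarith)?)

text \<open>The parameter \<open>t\<close> of the edge keeps the coefficients of its points
  integral.\<close>

lemma on_Q_fold_2_aux: "0 \<le> t \<Longrightarrow> t \<le> 1 \<Longrightarrow> on_Q (9 + 3 * t) (7 + 2 * t) (-1)"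
  by (rule on_QI; cases "t = 1"; simp add: gauge_Q_def level_Q_def max_def; (linarith)?)

lemma on_Q_fold_2:
  assumes "9 \<le> x" "x \<le> 12"
  shows "on_Q x (8 - (21 - 2 * x) / 3) (-1)"
proof -
  have "9 + 3 * ((x - 9) / 3) = x" "7 + 2 * ((x - 9) / 3) = 8 - (21 - 2 * x) / 3" by (simp_all add: field_simps)
  moreover have "0 \<le> (x - 9) / 3" "(x - 9) / 3 \<le> 1" using assms by (simp_all add: field_simps)
  ultimately show ?thesis using on_Q_fold_2_aux[of "(x - 9) / 3"] by (simp only:)
qed

lemma on_Q_fold_3: "8 \<le> x \<Longrightarrow> x \<le> 9 \<Longrightarrow> on_Q x 7 (-1)"
  by (rule on_QI; cases "x = 9"; simp add: gauge_Q_def level_Q_def max_def; (linarith)?)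

lemma on_Q_rise_1: "-1 \<le> z \<Longrightarrow> z \<le> 1 \<Longrightarrow> on_Q 8 (8 + z) z"
  by (rule on_QI; cases "z = -1"; simp add: gauge_Q_def level_Q_def max_def; (linarith)?)

lemma on_Q_rise_2_aux: "0 \<le> t \<Longrightarrow> t \<le> 1 \<Longrightarrow> on_Q (8 + t) (9 + 6 * t) 1"
  by (rule on_QI; cases "t = 0"; simp add: gauge_Q_def level_Q_def max_def; (linarith)?)

lemma on_Q_rise_2:
  assumes "8 \<le> y" "y \<le> 14"
  shows "on_Q (8 + (y - 8) / 6) (y + 1) 1"
proof -
  have "8 + ((y - 8) / 6) = 8 + (y - 8) / 6" "9 + 6 * ((y - 8) / 6) = y + 1" by (simp_all add: field_simps)
  moreover have "0 \<le> (y - 8) / 6" "(y - 8) / 6 \<le> 1" using assms by (simp_all add: field_simps)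
  ultimately show ?thesis using on_Q_rise_2_aux[of "(y - 8) / 6"] by (simp only:)
qed

lemma on_Q_rise_3: "14 \<le> y \<Longrightarrow> y \<le> 20 \<Longrightarrow> on_Q 9 (y + 1) 1"
  by (rule on_QI; cases "y = 14"; simp add: gauge_Q_def level_Q_def max_def; (linarith)?)

lemma on_Q_rise_4: "-1 \<le> z \<Longrightarrow> z \<le> 1 \<Longrightarrow> on_Q (8 + z) (20 + z) z"
  by (rule on_QI; cases "z = 1"; simp add: gauge_Q_def level_Q_def max_def; (linarith)?)

lemma on_Q_top_1: "-15 \<le> x \<Longrightarrow> x \<le> -14 \<Longrightarrow> on_Q x 21 (-1)"
  by (rule on_QI; cases "x = -14"; simp add: gauge_Q_def level_Q_def max_def; (linarith)?)

lemma on_Q_top_2_aux: "0 \<le> t \<Longrightarrow> t \<le> 1 \<Longrightarrow> on_Q (7 - 21 * t) (19 + 2 * t) (-1)"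
  by (rule on_QI; cases "t = 0"; simp add: gauge_Q_def level_Q_def max_def; (linarith)?)

lemma on_Q_top_2:
  assumes "-14 \<le> x" "x \<le> 7"
  shows "on_Q x (20 - (2 * x + 7) / 21) (-1)"
proof -
  have "7 - 21 * ((7 - x) / 21) = x" "19 + 2 * ((7 - x) / 21) = 20 - (2 * x + 7) / 21" by (simp_all add: field_simps)
  moreover have "0 \<le> (7 - x) / 21" "(7 - x) / 21 \<le> 1" using assms by (simp_all add: field_simps)
  ultimately show ?thesis using on_Q_top_2_aux[of "(7 - x) / 21"] by (simp only:)
qed

lemma on_Q_top_3_aux: "0 \<le> t \<Longrightarrow> t \<le> 1 \<Longrightarrow> on_Q (-14 - t) (9 + 6 * t) (-1)"
  by (rule on_QI; cases "t = 1"; cases "t = 0"; simp add: gauge_Q_def level_Q_def max_def; (linarith)?)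

lemma on_Q_top_3:
  assumes "8 \<le> y" "y \<le> 14"
  shows "on_Q (-14 - (y - 8) / 6) (y + 1) (-1)"
proof -
  have "-14 - ((y - 8) / 6) = -14 - (y - 8) / 6" "9 + 6 * ((y - 8) / 6) = y + 1" by (simp_all add: field_simps)
  moreover have "0 \<le> (y - 8) / 6" "(y - 8) / 6 \<le> 1" using assms by (simp_all add: field_simps)
  ultimately show ?thesis using on_Q_top_3_aux[of "(y - 8) / 6"] by (simp only:)
qed

lemma on_Q_top_4: "14 \<le> y \<Longrightarrow> y \<le> 20 \<Longrightarrow> on_Q (-15) (y + 1) (-1)"
  by (rule on_QI; cases "y = 20"; simp add: gauge_Q_def level_Q_def max_def; (linarith)?)

text \<open>A ramp that is 0 at \<open>y = 8\<close> and 1 from \<open>y = 14\<close> on: only the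
  sticks near \<open>y = 20\<close> are moved along \<open>x\<close>, and the vertical stick there
  is opened up in this direction.\<close>

definition tiltx :: "real \<Rightarrow> real" where "tiltx y = max 0 (min 1 ((y - 8) / 6))"

text \<open>The value is -1 up to -14, rises to 1 at 7, stays 1 up to 9, falls to -1 at 12 and stays
  there. So the vertical sticks over \<open>x = -14\<close> and \<open>x = 30\<close> open towards
  negative \<open>y\<close> with growing height, those over \<open>x = 8\<close> towards positive
  \<open>y\<close>.\<close>

definition tilty :: "real \<Rightarrow> real" where "tilty x = max (-1) (min 1 (min ((2 * x + 7) / 21) ((21 - 2 * x) / 3)))"

text \<open>Proportional to the height up to 1. The further term makes the displacement at height 2
  equal to -17 for all \<open>x\<close>, so the top stick moves as a whole from \<open>y = 8\<close>
  to \<open>y = -9\<close>.\<close>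

definition lean :: "real \<Rightarrow> real \<Rightarrow> real" where "lean x z = z * tilty x - max 0 (z - 1) * (2 * tilty x + 17)"

text \<open>The vertical sticks of the second polygon are opened up so that it projects to a curve without double points.\<close>

definition tilt :: "real^3 \<Rightarrow> real^3" where
  "tilt = (\<lambda>p. p + lean (p $ 1) (p $ 3) *\<^sub>R axis 2 1) \<circ> (\<lambda>p. p + (p $ 3 * tiltx (p $ 2)) *\<^sub>R axis 1 1)"

lemma axis_nth3: "axis k (1::real) $ (j::3) = (if j = k then 1 else 0)"
  by (simp add: axis_def)

lemma tilt_nth: "tilt p $ 1 = p $ 1 + p $ 3 * tiltx (p $ 2)" "tilt p $ 2 = p $ 2 + lean (p $ 1 + p $ 3 * tiltx (p $ 2)) (p $ 3)"
    "tilt p $ 3 = p $ 3"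
  by (simp_all add: tilt_def axis_nth3)

lemma isotopy_tilt: "isotopy tilt"
  unfolding tilt_def
proof (intro isotopy_comp isotopy_shear)
  show "continuous_on UNIV (\<lambda>p::real^3. p $ 3 * tiltx (p $ 2))" unfolding tiltx_def by (intro continuous_intros) auto
  show "continuous_on UNIV (\<lambda>p::real^3. lean (p $ 1) (p $ 3))" unfolding lean_def tilty_def by (intro continuous_intros) auto
qed (simp_all add: axis_nth3)

lemma tilt_Q:
  fixes p :: "real^3"
  assumes "p \<in> polygon link_Q"
  shows "on_Q (tilt p $ 1) (tilt p $ 2) (tilt p $ 3)"
proof -
  have len: "length link_Q = 9" by (simp add: link_Q_def)
  obtain i where i: "i < 9" "p \<in> edge link_Q i" using assms unfolding polygon_def len by blast
  obtain x y z where xyz: "p $ 1 = x" "p $ 2 = y" "p $ 3 = z" by blast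
  have m: "tilty x = -1" if "x \<le> -14 \<or> 12 \<le> x" for x using that by (auto simp: tilty_def)
  have tilty_1: "tilty x = 1" if "7 \<le> x" "x \<le> 9" for x using that by (auto simp: tilty_def)
  have tilty_2: "tilty x = (21 - 2 * x) / 3" if "9 \<le> x" "x \<le> 12" for x using that by (auto simp: tilty_def)
  have tilty_3: "tilty x = (2 * x + 7) / 21" if "-14 \<le> x" "x \<le> 7" for x using that by (auto simp: tilty_def)
  have t: "tiltx 8 = 0" "tiltx 20 = 1" by (simp_all add: tiltx_def)
  have t1: "tiltx y = (y - 8) / 6" if "8 \<le> y" "y \<le> 14" for y using that by (auto simp: tiltx_def)
  have t2: "tiltx y = 1" if "14 \<le> y" for y using that by (auto simp: tiltx_def)
  have l: "lean x z = z * tilty x" if "z \<le> 1" for x z using that by (simp add: lean_def)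
  have l2: "lean x z = z * tilty x - (z - 1) * (2 * tilty x + 17)" if "1 \<le> z" for x z using that by (simp add: lean_def)
  have r: "tilt p $ 1 = x + z * tiltx y" "tilt p $ 2 = y + lean (x + z * tiltx y) z" "tilt p $ 3 = z" by (simp_all add: tilt_nth xyz)
  have vert: "on_Q x (y + lean x z) z" if "x = -14 \<or> x = 30" "y = 8" "-1 \<le> z" "z \<le> 2"
  proof (cases "z \<le> 1")
    case True
    then have "y + lean x z = 8 - z" using l[of z x] m[of x] that by auto
    then show ?thesis using on_Q_left_1[of z] on_Q_right_1[of z] True that by auto
  next
    case False
    then have "lean x z = z * - 1 - (z - 1) * (2 * - 1 + 17)" using l2[of z x] m[of x] that by auto
    then have "y + lean x z = 23 - 16 * z" using that by (simp add: algebra_simps)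
    then show ?thesis using on_Q_left_2[of z] on_Q_right_2[of z] False that by auto
  qed
  show ?thesis
    unfolding r using link_Q_edge[OF i(2,1)] unfolding xyz box_Q_def
  proof (elim disjE conjE)
    assume "x = -14" "y = 8" "-1 \<le> z" "z \<le> 2" then show "on_Q (x + z * tiltx y) (y + lean (x + z * tiltx y) z) z" using vert t by simp
  next
    assume "x = 30" "y = 8" "-1 \<le> z" "z \<le> 2" then show "on_Q (x + z * tiltx y) (y + lean (x + z * tiltx y) z) z" using vert t by simp
  next
    assume a: "-14 \<le> x" "x \<le> 30" "y = 8" "z = 2"
    have e: "y + lean x z = -9" using l2[of z x] a by (simp add: algebra_simps)
    have X: "x + z * tiltx y = x" using a t by simp
    show "on_Q (x + z * tiltx y) (y + lean (x + z * tiltx y) z) z" unfolding X e using on_Q_bottom_1[of x] a by simp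
  next
    assume a: "8 \<le> x" "x \<le> 30" "y = 8" "z = -1"
    have "lean x z = - tilty x" using l[of z x] a by simp
    then have "on_Q x (y + lean x z) z" using on_Q_fold_1[of x] on_Q_fold_2[of x] on_Q_fold_3[of x] m[of x] tilty_1[of x] tilty_2[of x] a
      by (cases "x \<le> 9"; cases "x \<le> 12") (simp_all add: algebra_simps)
    then show "on_Q (x + z * tiltx y) (y + lean (x + z * tiltx y) z) z" using a t by simp
  next
    assume a: "x = 8" "y = 8" "-1 \<le> z" "z \<le> 1"
    then have "y + lean x z = 8 + z" using l[of z x] tilty_1[of x] by simp
    then show "on_Q (x + z * tiltx y) (y + lean (x + z * tiltx y) z) z" using a t on_Q_rise_1[of z] by simp
  next
    assume a: "x = 8" "8 \<le> y" "y \<le> 20" "z = 1"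
    have "0 \<le> tiltx y" "tiltx y \<le> 1" by (simp_all add: tiltx_def)
    then have L: "lean (x + z * tiltx y) z = 1" using l[of z] tilty_1 a by simp
    show "on_Q (x + z * tiltx y) (y + lean (x + z * tiltx y) z) z"
    proof (cases "y \<le> 14")
      case True
      have X: "x + z * tiltx y = 8 + (y - 8) / 6" unfolding t1[OF a(2) True] a(1,4) by simp
      show ?thesis unfolding L unfolding X unfolding a(4) by (rule on_Q_rise_2[OF a(2) True])
    next
      case False
      then have X: "x + z * tiltx y = 9" using t2[of y] a by simp
      show ?thesis unfolding L unfolding X unfolding a(4) by (rule on_Q_rise_3) (use False a in auto)
    qed
  next
    assume a: "x = 8" "y = 20" "-1 \<le> z" "z \<le> 1"
    then have "lean (x + z * tiltx y) z = z" using l[of z] tilty_1[of "8 + z"] t by simp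
    then show "on_Q (x + z * tiltx y) (y + lean (x + z * tiltx y) z) z" using a t on_Q_rise_4[of z] by simp
  next
    assume a: "-14 \<le> x" "x \<le> 8" "y = 20" "z = -1"
    have e: "x + z * tiltx y = x - 1" using a t by simp
    have "lean (x - 1) z = - tilty (x - 1)" using l[of z] a by simp
    then have "on_Q (x - 1) (y + lean (x - 1) z) z" using on_Q_top_1[of "x - 1"] on_Q_top_2[of "x - 1"] m[of "x - 1"] tilty_3[of "x - 1"] a
      by (cases "x - 1 \<le> -14") simp_all
    then show "on_Q (x + z * tiltx y) (y + lean (x + z * tiltx y) z) z" unfolding e .
  next
    assume a: "x = -14" "8 \<le> y" "y \<le> 20" "z = -1"
    have "0 \<le> tiltx y" by (simp add: tiltx_def)
    then have L: "lean (x + z * tiltx y) z = 1" using l[of z] m a by simp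
    show "on_Q (x + z * tiltx y) (y + lean (x + z * tiltx y) z) z"
    proof (cases "y \<le> 14")
      case True
      have X: "x + z * tiltx y = -14 - (y - 8) / 6" unfolding t1[OF a(2) True] a(1,4) by linarith
      show ?thesis unfolding L unfolding X unfolding a(4) by (rule on_Q_top_3[OF a(2) True])
    next
      case False
      then have X: "x + z * tiltx y = -15" using t2[of y] a by simp
      show ?thesis unfolding L unfolding X unfolding a(4) by (rule on_Q_top_4) (use False a in auto)
    qed
  qed
qed

lemma tilt_P:
  fixes p :: "real^3"
  assumes "p \<in> polygon link_P"
  shows "tilt p = p" "gauge_P (p $ 1) (p $ 2) = 1" "p $ 3 = 0"
proof -
  have len: "length link_P = 4" by (simp add: link_P_def)
  obtain i where i: "i < 4" "p \<in> edge link_P i" using assms unfolding polygon_def len by blast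
  note e = link_P_edge[OF i(2,1), unfolded box_P_def]
  show z: "p $ 3 = 0" using e by blast
  show "tilt p = p" unfolding vec3_eq_iff tilt_nth by (simp add: z lean_def)
  show "gauge_P (p $ 1) (p $ 2) = 1" using e unfolding gauge_P_def by (elim conjE disjE) (simp_all add: max_def)
qed

text \<open>Takes the rays through \<open>(3,-1)\<close>, \<open>(3,1)\<close>, \<open>(3,5)\<close>, \<open>(-1,1)\<close>, which contain the crossings of the tilted
  polygons, to the diagonals, which contain the crossings of the torus link.\<close>

definition align :: "complex \<Rightarrow> complex" where
  "align w = Complex (Re w - 2 * max 0 (- (Im w - 2 / 3 * max 0 (Re w)))) (Im w - 2 / 3 * max 0 (Re w))"

definition align3 :: "real^3 \<Rightarrow> real^3" where
  "align3 = (\<lambda>p. p + (- 2 * max 0 (- p $ 2)) *\<^sub>R axis 1 1) \<circ> (\<lambda>p. p + (- (2 / 3) * max 0 (p $ 1)) *\<^sub>R axis 2 1)"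

lemma align3_pt: "align3 (pt w z) = pt (align w) z"
  by (simp add: align3_def align_def vec3_eq_iff axis_nth3)

lemma isotopy_align3: "isotopy align3"
  unfolding align3_def
proof (intro isotopy_comp isotopy_shear)
  show "continuous_on UNIV (\<lambda>p::real^3. - 2 * max 0 (- p $ 2))" by (intro continuous_intros)
  show "continuous_on UNIV (\<lambda>p::real^3. - (2 / 3) * max 0 (p $ 1))" by (intro continuous_intros)
qed (simp_all add: axis_nth3)

lemma align_scale: "k > 0 \<Longrightarrow> align (of_real k * w) = of_real k * align w"
proof -
  assume k: "k > 0"
  have m: "max 0 (k * a) = k * max 0 a" for a using k max_mult_distrib_left[of k 0 a] by simp
  have 1: "k * Im w - 2 / 3 * (k * max 0 (Re w)) = k * (Im w - 2 / 3 * max 0 (Re w))" by (simp add: algebra_simps)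
  have 2: "- (k * a) = k * - a" for a by simp
  show "align (of_real k * w) = of_real k * align w"
    unfolding align_def complex_eq_iff by (simp only: Re_complex_of_real Im_complex_of_real times_complex.sel complex.sel mult_zero_left diff_zero add_0_right m 1 2) (simp add: algebra_simps)
qed

lemma align_nonzero: "w \<noteq> 0 \<Longrightarrow> align w \<noteq> 0"
  by (auto simp: align_def complex_eq_iff max_def split: if_splits)

lemma align_surj: "\<exists>w. align w = v"
proof -
  let ?x = "Re v + 2 * max 0 (- Im v)"
  have "align (Complex ?x (Im v + 2 / 3 * max 0 ?x)) = v" by (simp add: align_def complex_eq_iff)
  then show ?thesis by blast
qed

lemma continuous_on_align: "continuous_on S align"
proof -
  have eq: "align = (\<lambda>w. of_real (Re w - 2 * max 0 (- (Im w - 2 / 3 * max 0 (Re w)))) + \<i> * of_real (Im w - 2 / 3 * max 0 (Re w)))"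
    by (simp add: fun_eq_iff align_def complex_eq_iff)
  show ?thesis unfolding eq by (intro continuous_intros)
qed

text \<open>The rays that \<open>align\<close> takes to the coordinate axes. Over the axes the two
  torus components have equal height.\<close>

lemma align_axes:
  assumes "s \<in> circ" "Re (align s) * Im (align s) = 0"
  shows "\<exists>k>0. \<exists>d\<in>{Complex 3 2, -1, \<i>, Complex 6 1}. s = of_real k * d"
proof -
  obtain x y where s: "s = Complex x y" by (cases s)
  have s0: "x \<noteq> 0 \<or> y \<noteq> 0" using sgn_circ(3)[OF assms(1)] s by (auto simp: complex_eq_iff)
  define t where "t = y - 2 / 3 * max 0 x"
  have prod: "(x - 2 * max 0 (- t)) * t = 0" using assms(2) unfolding align_def s t_def by simp
  have "t = 0 \<or> t > 0 \<and> x = 0 \<or> t < 0 \<and> x = - 2 * t"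
    using prod by (cases t "0 :: real" rule: linorder_cases) simp_all
  then consider "y - 2 / 3 * max 0 x = 0" | "y - 2 / 3 * max 0 x > 0" "x = 0" | "y - 2 / 3 * max 0 x < 0" "x = 2 * (2 / 3 * max 0 x - y)"
    unfolding t_def by (elim disjE conjE) (blast, blast, simp add: algebra_simps)
  then show ?thesis
  proof cases
    case 1
    show ?thesis
    proof (cases "x > 0")
      case True
      then show ?thesis using 1 by (intro exI[of _ "x / 3"] conjI bexI[of _ "Complex 3 2"]) (auto simp: s complex_eq_iff)
    next
      case False
      then show ?thesis using 1 s0 by (intro exI[of _ "- x"] conjI bexI[of _ "-1"]) (auto simp: s complex_eq_iff)
    qed
  next
    case 2
    then show ?thesis by (intro exI[of _ y] conjI bexI[of _ \<i>]) (auto simp: s complex_eq_iff)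
  next
    case 3
    then have "2 * (2 / 3 * max 0 x - y) > 0" by (intro mult_pos_pos) simp_all
    then have "x > 0" by (rule ord_less_eq_trans[OF _ 3(2)[symmetric]])
    then show ?thesis using 3 by (intro exI[of _ "x / 6"] conjI bexI[of _ "Complex 6 1"]) (auto simp: s complex_eq_iff)
  qed
qed

section \<open>The torus link as a pair of star-shaped curves\<close>

lemma Re_Im_sgn_sq:
  assumes "w \<noteq> 0"
  shows "Re ((sgn w)\<^sup>2) = ((Re w)\<^sup>2 - (Im w)\<^sup>2) / (cmod w)\<^sup>2" "Im ((sgn w)\<^sup>2) = 2 * Re w * Im w / (cmod w)\<^sup>2"
proof -
  have "(sgn w)\<^sup>2 = w\<^sup>2 / of_real ((cmod w)\<^sup>2)" by (simp add: sgn_eq power_divide)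
  then show "Re ((sgn w)\<^sup>2) = ((Re w)\<^sup>2 - (Im w)\<^sup>2) / (cmod w)\<^sup>2" "Im ((sgn w)\<^sup>2) = 2 * Re w * Im w / (cmod w)\<^sup>2"
    by (simp_all only: Re_divide_of_real Im_divide_of_real) (simp_all add: power2_eq_square)
qed

text \<open>With \<open>s = cis u\<close> the square of \<open>s\<close> has the angle
  \<open>2 * u\<close>, which is the meridian angle on the first component; on the second one it is
  \<open>2 * u + pi\<close>, which changes both signs.\<close>

definition torus_1 :: "(real^3) set" where "torus_1 = star_curve (\<lambda>s. 2 + Re (s\<^sup>2)) (\<lambda>s. - Im (s\<^sup>2))"
definition torus_2 :: "(real^3) set" where "torus_2 = star_curve (\<lambda>s. 2 - Re (s\<^sup>2)) (\<lambda>s. Im (s\<^sup>2))"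

text \<open>Describes the preimage of a star-shaped curve: \<open>align\<close> stretches the ray
  through \<open>s\<close> by \<open>cmod (align s)\<close>, so the radius is divided by this
  number.\<close>

lemma align3_star_curve:
  fixes \<rho> \<eta> :: "complex \<Rightarrow> real"
  assumes "\<And>s. s \<in> circ \<Longrightarrow> \<rho> s > 0"
  shows "align3 ` star_curve (\<lambda>s. \<rho> (sgn (align s)) / cmod (align s)) (\<lambda>s. \<eta> (sgn (align s))) = star_curve \<rho> \<eta>"
proof -
  have u: "sgn (align s) \<in> circ" if "s \<in> circ" for s using align_nonzero[of s] sgn_circ(3)[OF that] by (simp add: circ_def norm_sgn)
  have e: "align3 (pt (of_real (\<rho> (sgn (align s)) / cmod (align s)) * s) (\<eta> (sgn (align s)))) = pt (of_real (\<rho> (sgn (align s))) * sgn (align s)) (\<eta> (sgn (align s)))"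
    if "s \<in> circ" for s
  proof -
    have nz: "align s \<noteq> 0" using align_nonzero sgn_circ(3)[OF that] by simp
    then have pos: "\<rho> (sgn (align s)) / cmod (align s) > 0" using assms[OF u[OF that]] by simp
    have eq: "of_real (\<rho> (sgn (align s)) / cmod (align s)) * align s = of_real (\<rho> (sgn (align s))) * sgn (align s)" by (simp add: sgn_eq)
    show ?thesis unfolding align3_pt align_scale[OF pos] eq ..
  qed
  have "(\<lambda>s. sgn (align s)) ` circ = circ"
  proof (intro equalityI subsetI)
    fix v assume v: "v \<in> circ"
    obtain w where w: "align w = v" using align_surj by blast
    have "align 0 = 0" by (simp add: align_def complex_eq_iff)
    then have nz: "w \<noteq> 0" using w v sgn_circ(3) by auto
    have "align (of_real (1 / cmod w) * w) = of_real (1 / cmod w) * v" using align_scale[of "1 / cmod w" w] nz w by simp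
    then have "sgn (align (of_real (1 / cmod w) * w)) = v" using sgn_scaled_circ(1)[OF v, of "1 / cmod w"] nz by simp
    moreover have "of_real (1 / cmod w) * w \<in> circ" using nz by (simp add: circ_def norm_divide)
    ultimately show "v \<in> (\<lambda>s. sgn (align s)) ` circ" by (rule image_eqI[OF sym])
  qed (use u in auto)
  then have "star_curve \<rho> \<eta> = (\<lambda>s. pt (of_real (\<rho> s) * s) (\<eta> s)) ` ((\<lambda>s. sgn (align s)) ` circ)"
    unfolding star_curve_def by (simp only:)
  then have "star_curve \<rho> \<eta> = (\<lambda>s. pt (of_real (\<rho> (sgn (align s))) * sgn (align s)) (\<eta> (sgn (align s)))) ` circ"
    unfolding image_image .
  moreover have "align3 ` star_curve (\<lambda>s. \<rho> (sgn (align s)) / cmod (align s)) (\<lambda>s. \<eta> (sgn (align s))) =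
      (\<lambda>s. pt (of_real (\<rho> (sgn (align s))) * sgn (align s)) (\<eta> (sgn (align s)))) ` circ"
    unfolding star_curve_def image_image by (rule image_cong[OF refl e])
  ultimately show ?thesis by (simp only:)
qed

lemma circ_power2: "s \<in> circ \<Longrightarrow> \<bar>Re (s\<^sup>2)\<bar> \<le> 1"
  using abs_Re_le_cmod[of "s\<^sup>2"] by (simp add: norm_power sgn_circ)

lemma simple_link_path:
  "simple_path (ppath (cyc link_P))" "pathfinish (ppath (cyc link_P)) = pathstart (ppath (cyc link_P))" "path_image (ppath (cyc link_P)) = polygon link_P"
  "simple_path (ppath (cyc link_Q))" "pathfinish (ppath (cyc link_Q)) = pathstart (ppath (cyc link_Q))" "path_image (ppath (cyc link_Q)) = polygon link_Q"
proof -
  have ne: "link_P \<noteq> []" "link_Q \<noteq> []" by (simp_all add: link_P_def link_Q_def)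
  show "simple_path (ppath (cyc link_P))" "simple_path (ppath (cyc link_Q))" using simple_link by (simp_all add: simple_path_cyc)
  show "pathfinish (ppath (cyc link_P)) = pathstart (ppath (cyc link_P))" "pathfinish (ppath (cyc link_Q)) = pathstart (ppath (cyc link_Q))"
    by (simp_all only: pathfinish_cyc[OF ne(1)] pathfinish_cyc[OF ne(2)])
  show "path_image (ppath (cyc link_P)) = polygon link_P" "path_image (ppath (cyc link_Q)) = polygon link_Q"
    by (simp_all only: path_image_cyc[OF ne(1)] path_image_cyc[OF ne(2)] polygon_csegs[OF ne(1)] polygon_csegs[OF ne(2)])
qed

lemma align_values:
  "align (Complex 27 (-9)) = Complex (-27) (-27)" "align (Complex 27 9) = Complex 9 (-9)" "align (Complex 9 15) = Complex 9 9"
  "align (Complex (-15) 15) = Complex (-15) 15" "align (Complex 3 2) = 3" "align (-1) = -1" "align \<i> = \<i>" "align (Complex 6 1) = Complex 0 (-3)"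
  by (simp_all add: align_def complex_eq_iff)

lemma sgn_align_scale: "k > 0 \<Longrightarrow> sgn (align (of_real k * w)) = sgn (align w)"
  by (simp add: align_scale sgn_mult sgn_of_real)

lemma on_Q_crossings:
  assumes "on_Q (Re w) (Im w) z" "gauge_P (Re w) (Im w) = 1"
  shows "(w, z) \<in> {(Complex 27 (-9), 2), (Complex 27 9, -1), (Complex 9 15, 1), (Complex (-15) 15, -1 :: real)}"
  using assms unfolding on_Q_def by (cases w) auto

text \<open>\<open>a1\<close>, \<open>e1\<close> and \<open>a2\<close>, \<open>e2\<close> are the
  radii and heights of the preimages of the torus components under \<open>align3\<close>. Over the
  rays of \<open>align_axes\<close> these have equal heights, and the radii are compared with those
  of the polygons. Over the crossings of the tilted polygons the radii of the latter agree, and the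
  heights are compared.\<close>

theorem torus_to_lattice: "same_pair torus_1 torus_2 (polygon link_P) (polygon link_Q)"
proof -
  define a1 a2 where "a1 s = (2 + Re ((sgn (align s))\<^sup>2)) / cmod (align s)" and "a2 s = (2 - Re ((sgn (align s))\<^sup>2)) / cmod (align s)" for s
  define e1 e2 where "e1 s = - Im ((sgn (align s))\<^sup>2)" and "e2 s = Im ((sgn (align s))\<^sup>2)" for s
  have pos: "2 + Re (s\<^sup>2) > 0" "2 - Re (s\<^sup>2) > 0" if "s \<in> circ" for s using circ_power2[OF that] by linarith+
  have Hnz: "align s \<noteq> 0" if "s \<in> circ" for s using align_nonzero sgn_circ(3)[OF that] by simp
  have u: "sgn (align s) \<in> circ" if "s \<in> circ" for s using Hnz[OF that] by (simp add: circ_def norm_sgn)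
  have A: "same_pair (star_curve a1 e1) (star_curve a2 e2) torus_1 torus_2"
    unfolding same_pair_def
  proof (intro exI conjI)
    show "isotopy align3" by (rule isotopy_align3)
    show "align3 ` star_curve a1 e1 = torus_1"
      unfolding torus_1_def a1_def e1_def by (rule align3_star_curve[where \<rho> = "\<lambda>s. 2 + Re (s\<^sup>2)" and \<eta> = "\<lambda>s. - Im (s\<^sup>2)"]) (rule pos)
    show "align3 ` star_curve a2 e2 = torus_2"
      unfolding torus_2_def a2_def e2_def by (rule align3_star_curve[where \<rho> = "\<lambda>s. 2 - Re (s\<^sup>2)" and \<eta> = "\<lambda>s. Im (s\<^sup>2)"]) (rule pos)
  qed
  have cs: "continuous_on circ (\<lambda>s. sgn (align s))"
    unfolding sgn_div_norm by (intro continuous_intros continuous_on_align) (use Hnz in auto)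
  have cn: "continuous_on circ (\<lambda>s. cmod (align s))" by (intro continuous_intros continuous_on_align)
  have radA: "radial a1 e1" "radial a2 e2"
    unfolding radial_def a1_def a2_def e1_def e2_def
    using Hnz pos u by (auto intro!: continuous_intros cs cn)
  obtain \<sigma>1 \<zeta>1 where P: "radial \<sigma>1 \<zeta>1" "polygon link_P = star_curve \<sigma>1 \<zeta>1" "\<And>s. s \<in> circ \<Longrightarrow> \<sigma>1 s * gauge_P (Re s) (Im s) = 1"
    using star_curve_of_loop[OF simple_link_path(1,2), of "\<lambda>w. gauge_P (Re w) (Im w)" "\<lambda>w. 0"] tilt_P(2,3) gauge_P_scale
    unfolding simple_link_path by auto
  obtain g where g: "homeomorphism UNIV UNIV tilt g" using isotopy_homeomorphism[OF isotopy_tilt] .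
  have ct: "continuous_on S tilt" for S using g continuous_on_subset unfolding homeomorphism_def by blast
  have it: "inj_on tilt S" for S using g unfolding homeomorphism_def by (metis UNIV_I inj_onI)
  have lt: "simple_path (tilt \<circ> ppath (cyc link_Q))" "pathfinish (tilt \<circ> ppath (cyc link_Q)) = pathstart (tilt \<circ> ppath (cyc link_Q))"
    using simple_link_path(4,5) by (auto intro!: simple_path_continuous_image ct it simp: pathfinish_compose pathstart_compose)
  have li: "path_image (tilt \<circ> ppath (cyc link_Q)) = tilt ` polygon link_Q"
    by (simp add: path_image_compose simple_link_path)
  have onQ: "on_Q (q $ 1) (q $ 2) (q $ 3)" if "q \<in> tilt ` polygon link_Q" for q :: "real^3" using tilt_Q that by auto
  obtain \<sigma>2 \<zeta>2 where Q: "radial \<sigma>2 \<zeta>2" "tilt ` polygon link_Q = star_curve \<sigma>2 \<zeta>2" "\<And>s. s \<in> circ \<Longrightarrow> \<sigma>2 s * gauge_Q (Re s) (Im s) = 1"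
    using star_curve_of_loop[OF lt, of "\<lambda>w. gauge_Q (Re w) (Im w)" "\<lambda>w. level_Q (Re w) (Im w)"] onQ gauge_Q_scale
    unfolding li by (auto simp: on_Q_def)
  have B: "same_pair (star_curve a1 e1) (star_curve a2 e2) (star_curve \<sigma>1 \<zeta>1) (star_curve \<sigma>2 \<zeta>2)"
  proof (rule star_curves_isotopic[OF radA P(1) Q(1)])
    have dirs: "\<exists>k>0. \<exists>d\<in>{Complex 3 2, -1, \<i>, Complex 6 1}. s = of_real k * d" if s: "s \<in> circ" "e1 s = e2 s" for s
    proof (rule align_axes[OF s(1)])
      have "Im ((sgn (align s))\<^sup>2) = 0" using s(2) by (simp add: e1_def e2_def)
      then show "Re (align s) * Im (align s) = 0" using Hnz[OF s(1)] by (simp add: Re_Im_sgn_sq)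
    qed
    show "finite {s \<in> circ. e1 s = e2 s}"
    proof (rule finite_subset)
      show "{s \<in> circ. e1 s = e2 s} \<subseteq> sgn ` {Complex 3 2, -1, \<i>, Complex 6 1}"
      proof
        fix s assume "s \<in> {s \<in> circ. e1 s = e2 s}"
        then have s: "s \<in> circ" "e1 s = e2 s" by auto
        obtain k d where kd: "k > 0" "d \<in> {Complex 3 2, -1, \<i>, Complex 6 1}" "s = of_real k * d" using dirs[OF s] by blast
        have "s = sgn s" using sgn_circ(1)[OF s(1)] by simp
        also have "\<dots> = sgn d" unfolding kd(3) using kd(1) by (simp add: sgn_mult sgn_of_real)
        finally show "s \<in> sgn ` {Complex 3 2, -1, \<i>, Complex 6 1}" using kd(2) by blast
      qed
    qed simp
    fix s assume s: "s \<in> circ" "e1 s = e2 s"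
    obtain k d where kd: "k > 0" "d \<in> {Complex 3 2, -1, \<i>, Complex 6 1}" "s = of_real k * d" using dirs[OF s] by blast
    \<comment> \<open>The radii of the polygons are the reciprocals of the gauges, and
      \<open>?r\<close> has the sign of the difference of the torus radii; so one evaluation on each
      of the four rays is enough.\<close>
    let ?p = "gauge_P (Re d) (Im d)" and ?q = "gauge_Q (Re d) (Im d)" and ?r = "(Re (align d))\<^sup>2 - (Im (align d))\<^sup>2"
    have "?p > 0 \<and> ?q > 0 \<and> (?q - ?p) * ?r > 0 \<and> (Re (align d) \<noteq> 0 \<or> Im (align d) \<noteq> 0)"
      using kd(2) by (elim insertE emptyE) (simp_all add: gauge_P_def gauge_Q_def align_values max_def)
    then have key: "?p > 0 \<and> ?q > 0 \<and> (?q - ?p) * ?r > 0 \<and> align d \<noteq> 0" by auto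
    have "\<sigma>1 s * (k * ?p) = 1" "\<sigma>2 s * (k * ?q) = 1"
      using P(3)[OF s(1)] Q(3)[OF s(1)] unfolding kd(3) by (simp_all add: gauge_P_scale[OF kd(1)] gauge_Q_scale[OF kd(1)])
    then have s12: "\<sigma>1 s = 1 / (k * ?p)" "\<sigma>2 s = 1 / (k * ?q)" using kd(1) key by (simp_all add: field_simps)
    then have 1: "\<sigma>1 s - \<sigma>2 s = (?q - ?p) * (1 / (k * ?p * ?q))"
    proof -
      have "1 / (k * p) - 1 / (k * q) = (q - p) * (1 / (k * p * q))" if "p > 0" "q > 0" for p q
        using that kd(1) by (simp add: field_simps)
      then show ?thesis unfolding s12 using key by blast
    qed
    have "a1 s - a2 s = 2 * Re ((sgn (align d))\<^sup>2) / cmod (align s)"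
      unfolding a1_def a2_def diff_divide_distrib[symmetric] kd(3) sgn_align_scale[OF kd(1)] by simp
    also have "\<dots> = ?r * (2 / ((cmod (align d))\<^sup>2 * cmod (align s)))" using key by (simp add: Re_Im_sgn_sq)
    finally have 2: "a1 s - a2 s = ?r * (2 / ((cmod (align d))\<^sup>2 * cmod (align s)))" .
    have "(\<sigma>1 s - \<sigma>2 s) * (a1 s - a2 s) = ((?q - ?p) * ?r) * ((1 / (k * ?p * ?q)) * (2 / ((cmod (align d))\<^sup>2 * cmod (align s))))"
      unfolding 1 2 by (simp only: mult_ac)
    also have "\<dots> > 0"
    proof (rule mult_pos_pos)
      show "(?q - ?p) * ?r > 0" using key by blast
      show "(1 / (k * ?p * ?q)) * (2 / ((cmod (align d))\<^sup>2 * cmod (align s))) > 0"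
        using key kd(1) Hnz[OF s(1)] by (intro mult_pos_pos divide_pos_pos) auto
    qed
    finally show "(\<sigma>1 s - \<sigma>2 s) * (a1 s - a2 s) > 0" .
  next
    let ?X = "{(Complex 27 (-9), 2), (Complex 27 9, -1), (Complex 9 15, 1), (Complex (-15) 15, -1 :: real)}"
    have cr: "(of_real (\<sigma>2 s) * s, \<zeta>2 s) \<in> ?X" if s: "s \<in> circ" "\<sigma>1 s = \<sigma>2 s" for s
    proof -
      let ?w = "of_real (\<sigma>2 s) * s"
      have "pt (of_real (\<sigma>1 s) * s) (\<zeta>1 s) \<in> polygon link_P" unfolding P(2) star_curve_def using s(1) by (rule imageI)
      then have 1: "gauge_P (Re ?w) (Im ?w) = 1" using tilt_P(2)[of "pt (of_real (\<sigma>1 s) * s) (\<zeta>1 s)"] s(2) by simp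
      have "pt ?w (\<zeta>2 s) \<in> tilt ` polygon link_Q" unfolding Q(2) star_curve_def using s(1) by (rule imageI)
      then have "on_Q (Re ?w) (Im ?w) (\<zeta>2 s)" using onQ[of "pt ?w (\<zeta>2 s)"] by simp
      then show ?thesis using on_Q_crossings 1 by blast
    qed
    have \<sigma>: "\<sigma>2 s > 0" if "s \<in> circ" for s using Q(1) that by (simp add: radial_def)
    show "finite {s \<in> circ. \<sigma>1 s = \<sigma>2 s}"
    proof (rule finite_subset)
      show "{s \<in> circ. \<sigma>1 s = \<sigma>2 s} \<subseteq> (\<lambda>x. sgn (fst x)) ` ?X"
      proof
        fix s assume "s \<in> {s \<in> circ. \<sigma>1 s = \<sigma>2 s}"
        then have s: "s \<in> circ" "\<sigma>1 s = \<sigma>2 s" by auto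
        have "s = sgn (of_real (\<sigma>2 s) * s)" using sgn_scaled_circ(1)[OF s(1) \<sigma>[OF s(1)]] by simp
        then show "s \<in> (\<lambda>x. sgn (fst x)) ` ?X" using imageI[OF cr[OF s], of "\<lambda>x. sgn (fst x)"] by simp
      qed
    qed simp
    fix s assume s: "s \<in> circ" "\<sigma>1 s = \<sigma>2 s"
    let ?w = "of_real (\<sigma>2 s) * s"
    have "pt (of_real (\<sigma>1 s) * s) (\<zeta>1 s) \<in> polygon link_P" unfolding P(2) star_curve_def using s(1) by (rule imageI)
    then have z1: "\<zeta>1 s = 0" using tilt_P(3)[of "pt (of_real (\<sigma>1 s) * s) (\<zeta>1 s)"] by simp
    obtain w where w: "?w = w" by blast
    \<comment> \<open>The first polygon has height 0 here, and the product of the real and imaginary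
      parts of \<open>align w\<close> has the sign of the height \<open>e2\<close> of the second
      torus component.\<close>
    have "\<zeta>2 s * (Re (align w) * Im (align w)) > 0"
      using cr[OF s] unfolding w by (elim insertE emptyE; elim Pair_inject) (simp_all add: align_values)
    then have key: "\<zeta>2 s * (Re (align w) * Im (align w)) > 0" "align w \<noteq> 0" by auto
    have "sgn (align s) = sgn (align w)" unfolding w[symmetric] sgn_align_scale[OF \<sigma>[OF s(1)]] ..
    then have "(\<zeta>1 s - \<zeta>2 s) * (e1 s - e2 s) = (\<zeta>2 s * (Re (align w) * Im (align w))) * (4 / (cmod (align w))\<^sup>2)"
      unfolding z1 e1_def e2_def using key(2) by (simp add: Re_Im_sgn_sq)
    also have "\<dots> > 0" by (rule mult_pos_pos[OF key(1)]) (use key(2) in simp)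
    finally show "(\<zeta>1 s - \<zeta>2 s) * (e1 s - e2 s) > 0" .
  qed
  have "tilt ` polygon link_P = polygon link_P" using tilt_P(1) by (simp cong: image_cong)
  then have "same_pair (polygon link_P) (polygon link_Q) (polygon link_P) (tilt ` polygon link_Q)"
    unfolding same_pair_def using isotopy_tilt by blast
  then show ?thesis using same_pair_sym same_pair_trans A B unfolding P(2) Q(2) by blast
qed

text \<open>Multiplying \<open>s\<close> by the imaginary unit negates its square, which exchanges
  the two parametrizations.\<close>

lemma torus_swap: "same_pair torus_1 torus_2 torus_2 torus_1"
proof -
  let ?f = "\<lambda>p. pt (\<i> * wp p) (p $ 3)"
  have iso: "isotopy ?f"
  proof (rule isotopyI[where H = "\<lambda>t p. pt (cis (t * pi / 2) * wp p) (p $ 3)" and G = "\<lambda>t p. pt (cis (- (t * pi / 2)) * wp p) (p $ 3)"])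
    show "continuous_on ({0..1} \<times> UNIV) (\<lambda>(t, p). pt (cis (t * pi / 2) * wp p) (p $ 3))"
      unfolding case_prod_unfold by (intro continuous_intros) auto
    show "homeomorphism UNIV UNIV (\<lambda>p. pt (cis (t * pi / 2) * wp p) (p $ 3)) (\<lambda>p. pt (cis (- (t * pi / 2)) * wp p) (p $ 3))" for t
    proof (rule homeomorphismI)
      show "continuous_on UNIV (\<lambda>p. pt (c * wp p) (p $ 3))" for c by (intro continuous_intros)
      then show "continuous_on UNIV (\<lambda>p. pt (cis (- (t * pi / 2)) * wp p) (p $ 3))" .
    qed (auto simp: mult.assoc[symmetric] cis_mult)
  qed auto
  have c: "(\<lambda>s. \<i> * s) ` circ = circ"
  proof (intro equalityI subsetI)
    fix s assume "s \<in> circ"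
    then show "s \<in> (\<lambda>s. \<i> * s) ` circ" by (intro image_eqI[of _ _ "- \<i> * s"]) (auto simp: circ_def norm_mult mult.assoc[symmetric])
  qed (auto simp: circ_def norm_mult)
  have sw: "?f ` star_curve (\<lambda>s. \<rho> (\<i> * s)) (\<lambda>s. \<eta> (\<i> * s)) = star_curve \<rho> \<eta>" for \<rho> \<eta> :: "complex \<Rightarrow> real"
  proof -
    have "star_curve \<rho> \<eta> = (\<lambda>s. pt (of_real (\<rho> s) * s) (\<eta> s)) ` (\<lambda>s. \<i> * s) ` circ" unfolding star_curve_def c ..
    then show ?thesis unfolding star_curve_def image_image by (simp add: mult_ac)
  qed
  have sq: "(\<i> * s)\<^sup>2 = - s\<^sup>2" for s by (simp add: power_mult_distrib)
  have "?f ` torus_1 = torus_2" "?f ` torus_2 = torus_1"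
    using sw[of "\<lambda>s. 2 - Re (s\<^sup>2)" "\<lambda>s. Im (s\<^sup>2)"] sw[of "\<lambda>s. 2 + Re (s\<^sup>2)" "\<lambda>s. - Im (s\<^sup>2)"]
    unfolding sq torus_1_def torus_2_def by simp_all
  then show ?thesis unfolding same_pair_def using iso by blast
qed

text \<open>The equation says that the meridian angle is \<open>2 * u + pi * k\<close>; the parity
  of \<open>k\<close> selects the component.\<close>

lemma link_components: "link_4_1_2 = torus_1 \<union> torus_2"
proof -
  have tp: "torus_point x v = pt (of_real (2 + cos v) * cis x) (- sin v)" for x v
    by (simp add: torus_point_def vec3_eq_iff)
  have sq: "(cis x)\<^sup>2 = cis (2 * x)" for x by (simp add: Complex.DeMoivre)
  have t1: "torus_1 = range (\<lambda>x. torus_point x (2 * x))" and t2: "torus_2 = range (\<lambda>x. torus_point x (2 * x + pi))"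
  proof -
    have circ: "circ = range cis"
    proof (intro equalityI subsetI)
      fix s assume "s \<in> circ"
      then have "s = cis (Arg s)" by (simp add: cis_Arg sgn_circ)
      then show "s \<in> range cis" by blast
    qed (auto simp: circ_def)
    show "torus_1 = range (\<lambda>x. torus_point x (2 * x))" "torus_2 = range (\<lambda>x. torus_point x (2 * x + pi))"
      unfolding torus_1_def torus_2_def star_curve_def circ image_image tp sq by simp_all
  qed
  have "torus_point x v \<in> torus_1 \<union> torus_2" if "real 2 * v - real 4 * x = 2 * pi * of_int k" for x v k
  proof (cases "even k")
    case True
    then obtain m where "k = 2 * m" by (elim evenE)
    then have v: "v = 2 * x + 2 * pi * of_int m" using that by simp
    have "cis v = cis (2 * x) * cis (2 * pi * of_int m)" unfolding v cis_mult ..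
    also have "\<dots> = cis (2 * x)" by (simp only: cis_multiple_2pi Ints_of_int mult_1_right)
    finally have "cos v = cos (2 * x)" "sin v = sin (2 * x)" by (simp_all add: complex_eq_iff)
    then have "torus_point x v = torus_point x (2 * x)" by (simp add: tp)
    then show ?thesis unfolding t1 by auto
  next
    case False
    then obtain m where "k = 2 * m + 1" by (elim oddE)
    then have v: "v = (2 * x + pi) + 2 * pi * of_int m" using that by (simp add: algebra_simps)
    have "cis v = cis (2 * x + pi) * cis (2 * pi * of_int m)" unfolding v cis_mult ..
    also have "\<dots> = cis (2 * x + pi)" by (simp only: cis_multiple_2pi Ints_of_int mult_1_right)
    finally have "cos v = cos (2 * x + pi)" "sin v = sin (2 * x + pi)" by (simp_all add: complex_eq_iff)
    then have "torus_point x v = torus_point x (2 * x + pi)" by (simp only: tp)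
    then show ?thesis unfolding t2 by auto
  qed
  moreover have "torus_1 \<subseteq> torus_link 2 4"
  proof -
    have "real 2 * (2 * x) - real 4 * x = 2 * pi * of_int 0" for x by simp
    then show ?thesis unfolding t1 torus_link_def by blast
  qed
  moreover have "torus_2 \<subseteq> torus_link 2 4"
  proof -
    have "real 2 * (2 * x + pi) - real 4 * x = 2 * pi * of_int 1" for x by simp
    then show ?thesis unfolding t2 torus_link_def by blast
  qed
  ultimately show ?thesis unfolding link_4_1_2_def torus_link_def by blast
qed

lemma spin_link_same_pair:
  assumes s: "same_pair (polygon vs) (polygon ws) (polygon vs') (polygon ws')"
    and simple: "simple_polygon vs" "simple_polygon ws" "simple_polygon vs'" "simple_polygon ws'"
    and d: "polygon vs \<inter> polygon ws = {}"
  shows "cmod (spin_link vs' (ppath (cyc ws'))) = cmod (spin_link vs (ppath (cyc ws)))"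
proof -
  obtain f where f: "isotopy f" "f ` polygon vs = polygon vs'" "f ` polygon ws = polygon ws'" using s unfolding same_pair_def by blast
  have ne: "us \<noteq> []" if "simple_polygon us" for us using that by (auto simp: simple_polygon_def)
  note n = ne[OF simple(1)] ne[OF simple(2)] ne[OF simple(3)] ne[OF simple(4)]
  show ?thesis
  proof (rule isotopyE[OF f(1)])
    fix H :: "real \<Rightarrow> real^3 \<Rightarrow> real^3"
    assume H: "continuous_on ({0..1} \<times> UNIV) (\<lambda>(t, x). H t x)" "\<And>t. t \<in> {0..1} \<Longrightarrow> \<exists>g. homeomorphism UNIV UNIV (H t) g"
      "\<And>x. H 0 x = x" "\<And>x. H 1 x = f x"
    show ?thesis
    proof (rule spin_link_isotopy_invariant[OF H(1)])
      show "inj (\<lambda>x. case (t, x) of (t, x) \<Rightarrow> H t x)" if t: "t \<in> {0..1}" for t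
      proof -
        obtain g where "homeomorphism UNIV UNIV (H t) g" using H(2)[OF t] by blast
        then have g: "g (H t x) = x" for x by (simp add: homeomorphism_def)
        show ?thesis by (rule inj_on_inverseI[of _ g]) (simp add: g)
      qed
    qed (use n simple f d H(3,4) in \<open>simp_all add: simple_path_cyc polygon_csegs[symmetric]\<close>)
  qed
qed

section \<open>The components of a conformation and the two bounds\<close>

lemma connected_in_part:
  fixes U :: "'a::topological_space set"
  assumes "finite \<B>" "\<And>B. B \<in> \<B> \<Longrightarrow> closed B" "pairwise disjnt \<B>" "connected U" "U \<subseteq> \<Union>\<B>" "P \<in> \<B>" "U \<inter> P \<noteq> {}"
  shows "U \<subseteq> P"
proof (rule ccontr)
  assume n: "\<not> U \<subseteq> P"
  let ?V = "\<Union>(\<B> - {P})"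
  have "closed ?V" using assms(1,2) by (intro closed_Union) auto
  moreover have "closed P" using assms by blast
  moreover have "U \<subseteq> P \<union> ?V" using assms(5) by blast
  moreover have "P \<inter> ?V = {}" using assms(3,6) by (auto simp: pairwise_def disjnt_def)
  moreover have "?V \<inter> U \<noteq> {}" using n assms(5) by blast
  ultimately have "\<exists>A B. closed A \<and> closed B \<and> U \<subseteq> A \<union> B \<and> A \<inter> B \<inter> U = {} \<and> A \<inter> U \<noteq> {} \<and> B \<inter> U \<noteq> {}"
    using assms(7) by (intro exI[of _ P] exI[of _ ?V] conjI) auto
  then show False by (rule notE[OF assms(4)[unfolded connected_closed]])
qed

lemma polygon_compact_connected:
  assumes "simple_polygon vs"
  shows "compact (polygon vs)" "connected (polygon vs)" "polygon vs \<noteq> {}"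
proof -
  have ne: "vs \<noteq> []" using assms by (auto simp: simple_polygon_def)
  have e: "polygon vs = path_image (ppath (cyc vs))" using path_image_cyc[OF ne] polygon_csegs[OF ne] by simp
  show "compact (polygon vs)" "connected (polygon vs)" "polygon vs \<noteq> {}"
    unfolding e by (simp_all add: compact_path_image connected_path_image)
qed

text \<open>The polygons of the link, like \<open>A\<close> and \<open>B\<close>, are compact,
  connected and disjoint. Each of \<open>A\<close> and \<open>B\<close> lies in one polygon by
  connectedness, and that polygon in turn lies in it.\<close>

lemma conformation_components:
  assumes L: "lattice_stick_conformation L" and AB: "L = A \<union> B" "A \<inter> B = {}"
    and A: "compact A" "connected A" "A \<noteq> {}" and B: "compact B" "connected B" "B \<noteq> {}"
  obtains vs ws where "simple_polygon vs" "set vs \<subseteq> integer_points" "polygon vs = A"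
    "simple_polygon ws" "set ws \<subseteq> integer_points" "polygon ws = B"
proof -
  obtain P where P: "polygonal_link P" "\<forall>vs\<in>P. set vs \<subseteq> integer_points" "L = (\<Union>vs\<in>P. polygon vs)"
    using L unfolding lattice_stick_conformation_def by blast
  have sp: "simple_polygon vs" if "vs \<in> P" for vs using P(1) that by (auto simp: polygonal_link_def)
  let ?B = "polygon ` P"
  have fin: "finite ?B" using P(1) by (simp add: polygonal_link_def)
  have cl: "closed X" if "X \<in> ?B" for X using that sp polygon_compact_connected(1) by (auto simp: compact_imp_closed)
  have pw: "pairwise disjnt ?B" using P(1) unfolding polygonal_link_def pairwise_def by auto
  have main: "\<exists>vs\<in>P. polygon vs = X" if X: "connected X" "X \<noteq> {}" "compact X" "compact Y" "X \<union> Y = L" "X \<inter> Y = {}" for X Y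
  proof -
    obtain x where x: "x \<in> X" using X(2) by blast
    then obtain vs where vs: "vs \<in> P" "x \<in> polygon vs" using X(5) P(3) by blast
    have 1: "X \<subseteq> polygon vs"
      by (rule connected_in_part[OF fin cl pw X(1)]) (use x vs X(5) P(3) in auto)
    have 2: "polygon vs \<subseteq> X"
      by (rule connected_in_part[of "{X, Y}"])
        (use X vs x sp[OF vs(1)] polygon_compact_connected P(3) in \<open>auto simp: compact_imp_closed pairwise_insert disjnt_def\<close>)
    show ?thesis using 1 2 vs by blast
  qed
  obtain vs ws where "vs \<in> P" "polygon vs = A" "ws \<in> P" "polygon ws = B"
    using main[of A B] main[of B A] AB A B by blast
  then show ?thesis using that sp P(2) by blast
qed

theorem stick_number_lower_bound:
  assumes L: "lattice_stick_conformation L" and iso: "ambient_isotopic link_4_1_2 L"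
  shows "stick_number L \<ge> 13"
proof (rule ccontr)
  assume small: "\<not> stick_number L \<ge> 13"
  obtain f where f: "isotopy f" "f ` link_4_1_2 = L" using iso unfolding ambient_isotopic_def isotopy_def by blast
  let ?P = "polygon link_P" and ?Q = "polygon link_Q"
  have "same_pair torus_1 torus_2 (f ` torus_1) (f ` torus_2)" unfolding same_pair_def using f(1) by blast
  then have PQ: "same_pair ?P ?Q (f ` torus_1) (f ` torus_2)" and QP: "same_pair ?Q ?P ?P ?Q"
  proof -
    \<comment> \<open>Since the bound concerns only one order of the components, the value 2 is
      needed for both; exchanging the torus components carries it over from the one to the
      other.\<close>
    have QP': "same_pair torus_2 torus_1 ?Q ?P" using torus_to_lattice unfolding same_pair_def by blast
    show "same_pair ?Q ?P ?P ?Q" using same_pair_trans[OF same_pair_trans[OF same_pair_sym[OF QP'] same_pair_sym[OF torus_swap]] torus_to_lattice] .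
  qed (use same_pair_trans same_pair_sym torus_to_lattice in blast)
  define A B where "A = f ` torus_1" and "B = f ` torus_2"
  obtain h where h: "isotopy h" "h ` ?P = A" "h ` ?Q = B" using PQ unfolding same_pair_def A_def B_def by blast
  obtain h' where h': "homeomorphism UNIV UNIV h h'" using isotopy_homeomorphism[OF h(1)] .
  have ch: "continuous_on S h" for S using h' continuous_on_subset unfolding homeomorphism_def by blast
  have injh: "h x = h y \<Longrightarrow> x = y" for x y using h' unfolding homeomorphism_def by (metis UNIV_I)
  have LAB: "L = A \<union> B" using f(2) by (simp add: link_components image_Un A_def B_def)
  have dAB: "A \<inter> B = {}" using disjoint_link injh unfolding h(2,3)[symmetric] by blast
  note pc = polygon_compact_connected[OF simple_link(1)] polygon_compact_connected[OF simple_link(2)]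
  have "compact A" "connected A" "A \<noteq> {}" "compact B" "connected B" "B \<noteq> {}"
    unfolding h(2,3)[symmetric] using pc by (simp_all add: compact_continuous_image connected_continuous_image ch)
  then obtain vs0 ws0 where 0: "simple_polygon vs0" "set vs0 \<subseteq> integer_points" "polygon vs0 = A"
    "simple_polygon ws0" "set ws0 \<subseteq> integer_points" "polygon ws0 = B"
    using conformation_components[OF L LAB dAB] by blast
  obtain vs where vs: "simple_polygon vs" "reduced vs" "polygon vs = A" "set vs \<subseteq> set vs0" using obtain_reduced[OF 0(1)] 0(3) by metis
  obtain ws where ws: "simple_polygon ws" "reduced ws" "polygon ws = B" "set ws \<subseteq> set ws0" using obtain_reduced[OF 0(4)] 0(6) by metis
  have cub: "polygon vs \<subseteq> cubic_lattice" "polygon ws \<subseteq> cubic_lattice"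
    using L LAB vs(3) ws(3) unfolding lattice_stick_conformation_def by auto
  obtain d where d: "lcyc vs d" using obtain_lcyc[OF vs(1,2) _ cub(1)] vs(4) 0(2) by (metis subset_trans)
  obtain e where e: "lcyc ws e" using obtain_lcyc[OF ws(1,2) _ cub(2)] ws(4) 0(5) by (metis subset_trans)
  have dis: "polygon vs \<inter> polygon ws = {}" using vs(3) ws(3) dAB by simp
  have "length vs + length ws \<le> 12"
    using stick_number_reduced[OF vs(1,2) ws(1,2) dis] small unfolding vs(3) ws(3) LAB[symmetric] by simp
  note bound = spin_link_lattice_bound[OF vs(1) d cub(1) ws(1) e cub(2) dis this]
  have sAB: "same_pair ?P ?Q (polygon vs) (polygon ws)" using PQ vs(3) ws(3) by (simp add: A_def B_def)
  then have sBA: "same_pair ?Q ?P (polygon ws) (polygon vs)" unfolding same_pair_def by blast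
  have 1: "cmod (spin_link vs (ppath (cyc ws))) = 2"
    using spin_link_same_pair[OF sAB simple_link vs(1) ws(1) disjoint_link] spin_link_link by simp
  have dl: "?Q \<inter> ?P = {}" using disjoint_link by blast
  have 2: "cmod (spin_link link_P (ppath (cyc link_Q))) = cmod (spin_link link_Q (ppath (cyc link_P)))"
    by (rule spin_link_same_pair[OF QP simple_link(2,1) simple_link dl])
  have 3: "cmod (spin_link ws (ppath (cyc vs))) = 2"
    using spin_link_same_pair[OF sBA simple_link(2,1) ws(1) vs(1) dl] spin_link_link 2 by simp
  show False using bound 1 3 by simp
qed

lemma lattice_link:
  "lattice_stick_conformation (polygon link_P \<union> polygon link_Q)" "polygon link_P \<union> polygon link_Q \<in> link_type link_4_1_2"
  "stick_number (polygon link_P \<union> polygon link_Q) = 13"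
proof -
  note lc = lcyc_link lcyc_lattice[OF lcyc_link(1)] lcyc_lattice[OF lcyc_link(2)]
  have "polygonal_link {link_P, link_Q}"
    using simple_link disjoint_link by (auto simp: polygonal_link_def pairwise_def disjnt_def)
  moreover have "\<forall>vs\<in>{link_P, link_Q}. set vs \<subseteq> integer_points" using lc by simp
  moreover have "polygon link_P \<union> polygon link_Q = (\<Union>vs\<in>{link_P, link_Q}. polygon vs)" by simp
  ultimately show "lattice_stick_conformation (polygon link_P \<union> polygon link_Q)"
    unfolding lattice_stick_conformation_def using lc by blast
  obtain f where "isotopy f" "f ` torus_1 = polygon link_P" "f ` torus_2 = polygon link_Q"
    using torus_to_lattice unfolding same_pair_def by blast
  then have "isotopy f \<and> f ` link_4_1_2 = polygon link_P \<union> polygon link_Q" by (simp add: link_components image_Un)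
  then show "polygon link_P \<union> polygon link_Q \<in> link_type link_4_1_2"
    unfolding link_type_def ambient_isotopic_def isotopy_def by blast
  show "stick_number (polygon link_P \<union> polygon link_Q) = 13"
    using stick_number_reduced[OF simple_link(1) lcyc_reduced[OF lcyc_link(1)] simple_link(2) lcyc_reduced[OF lcyc_link(2)] disjoint_link]
    by (simp add: link_P_def link_Q_def)
qed

theorem theorem6p5:
  "cubic_lattice_stick_index (link_type link_4_1_2) = 13"
proof -
  have e: "(13 :: enat) = enat 13" by (simp add: numeral_eq_enat)
  show ?thesis
    unfolding cubic_lattice_stick_index_def e
  proof (rule antisym)
    show "(INF L\<in>{L \<in> link_type link_4_1_2. lattice_stick_conformation L}. enat (stick_number L)) \<le> enat 13"
      using INF_lower[of "polygon link_P \<union> polygon link_Q" "{L \<in> link_type link_4_1_2. lattice_stick_conformation L}" "\<lambda>L. enat (stick_number L)"]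
        lattice_link by simp
    show "enat 13 \<le> (INF L\<in>{L \<in> link_type link_4_1_2. lattice_stick_conformation L}. enat (stick_number L))"
      by (rule INF_greatest) (use stick_number_lower_bound in \<open>auto simp: link_type_def\<close>)
  qed
qed

end
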